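(* Let $p$ be a prime and let $\widetilde{\mathcal T}$ be an extension of the transporter system $(S,\mathcal F,\mathcal T)$ by the discrete $p$-toral group $A$, with associated group $\widetilde S$ and fusion system $\widetilde{\mathcal F}$ over $\widetilde S$. Then $(\widetilde S,\widetilde{\mathcal F},\widetilde{\mathcal T})$ is a transporter system. Furthermore, $A$ is $\widetilde{\mathcal F}$-normal, and $$(S,\mathcal F,\mathcal T)\cong(\widetilde S/A,\widetilde{\mathcal F}/A,\widetilde{\mathcal T}/A).$$
   Context: **Discrete $p$-toral groups.** $\mathbb{Z}/p^\infty=\bigcup_n \mathbb{Z}/p^n$. A discrete $p$-toral group is a group with a normal subgroup isomorphic to $(\mathbb{Z}/p^\infty)^r$, some $r\ge0$, of finite $p$-power index. **Fusion systems.** $c_g(x)=gxg^{-1}$. A fusion system $\mathcal{F}$ over a discrete $p$-toral group $S$ is a category whose objects are all subgroups of $S$, with $\mathrm{Hom}_S(P,Q)\subseteq \mathrm{Hom}_{\mathcal F}(P,Q)\subseteq \mathrm{Inj}(P,Q)$ (maps $c_g$, $g\in S$, and injective homomorphisms, respectively) and such that every morphism factors as an isomorphism in $\mathcal F$ followed by an inclusion. $P,Q$ are $\mathcal F$-conjugate if isomorphic in $\mathcal F$. $A\le S$ is $\mathcal F$-normal if for all $P\le S$ and $f\in\mathrm{Hom}_{\mathcal F}(P,S)$ there is $\gamma\in\mathrm{Hom}_{\mathcal F}(PA,S)$ with $\gamma|_P=f$ and $\gamma|_A\in\mathrm{Aut}_{\mathcal F}(A)$. **Transporter systems.** For subgroups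 $P,Q\le S$ put $N_S(P,Q)=\{x\in S\mid xPx^{-1}\le Q\}$. A transporter system associated to a fusion system $\mathcal F$ over $S$ (also written as a triple $(S,\mathcal F,\mathcal T)$) is a nonempty category $\mathcal T$ with $\mathrm{Ob}(\mathcal T)\subseteq\mathrm{Ob}(\mathcal F)$ closed under $\mathcal F$-conjugacy and overgroups, with functors $\varepsilon:\mathcal T_{\mathrm{Ob}(\mathcal T)}(S)\to\mathcal T$ (source: objects $\mathrm{Ob}(\mathcal T)$, morphism sets $N_S(P,Q)$) and $\rho:\mathcal T\to\mathcal F$ such that: (A1) $\varepsilon$ is the identity on objects and injective on morphism sets; $\rho$ is the inclusion on objects and surjective on morphism sets; (A2) $E(P)=\mathrm{Ker}[\mathrm{Aut}_{\mathcal T}(P)\to\mathrm{Aut}_{\mathcal F}(P)]$ acts freely on $\mathrm{Mor}_{\mathcal T}(P,Q)$ by right composition with orbit map $\rho_{P,Q}$, and $E(Q)$ acts freely on $\mathrm{Mor}_{\mathcal T}(P,Q)$ by left composition; (B) $\varepsilon_{P,Q}:N_S(P,Q)\to\mathrm{Mor}_{\mathcal T}(P,Q)$ is injective and $\rho(\varepsilon_{P,Q}(g))=c_g$; (C) $\varphi\circ\varepsilon_P(g)=\varepsilon_Q(\rho(\varphi)(g))\circ\varphi$ for $\varphi\in\mathrm{Mor}_{\mathcal T}(P,Q)$, $g\in P$; (I) each $\mathcal F$-conjugacy class in $\mathrm{Ob}(\mathcal T)$ contains $P$ such that $[\mathrm{Aut}_{\mathcal T}(P):\varepsilon_P(N_S(P))]$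 is finite and prime to $p$; (II) if $\varphi\in\mathrm{Iso}_{\mathcal T}(P,Q)$, $P\lhd\widetilde P\le S$, $Q\lhd\widetilde Q\le S$ and $\varphi\varepsilon_P(\widetilde P)\varphi^{-1}\le\varepsilon_Q(\widetilde Q)$, then there is $\widetilde\varphi\in\mathrm{Mor}_{\mathcal T}(\widetilde P,\widetilde Q)$ with $\widetilde\varphi\circ\varepsilon_{P,\widetilde P}(1)=\varepsilon_{Q,\widetilde Q}(1)\circ\varphi$; (III) if $P_1\le P_2\le\cdots$ in $\mathrm{Ob}(\mathcal T)$, $P=\bigcup P_n$, and $\varphi_n\in\mathrm{Mor}_{\mathcal T}(P_n,S)$ satisfy $\varphi_n=\varphi_{n+1}\circ\varepsilon_{P_n,P_{n+1}}(1)$ for all $n$, then there is $\varphi\in\mathrm{Mor}_{\mathcal T}(P,S)$ with $\varphi_n=\varphi\circ\varepsilon_{P_n,P}(1)$ for all $n$. **Extensions.** An extension of $(S,\mathcal F,\mathcal T)$ by a discrete $p$-toral group is a category $\widetilde{\mathcal T}$ with a functor $\tau:\widetilde{\mathcal T}\to\mathcal T$ which is the identity on objects (write $\widehat P$ for the object of $\widetilde{\mathcal T}$ corresponding to $P$), such that for all $\widehat P,\widehat Q$: (i) $K_{\widehat P}=\mathrm{Ker}[\mathrm{Aut}_{\widetilde{\mathcal T}}(\widehat P)\to\mathrm{Aut}_{\mathcal T}(P)]$ is discrete $p$-toral; (ii) $K_{\widehat P}$ acts freely on $\mathrm{Mor}_{\widetilde{\mathcal T}}(\widehat P,\widehat Q)$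 by right composition and $\tau$ is the orbit map; (iii) $K_{\widehat Q}$ acts freely on $\mathrm{Mor}_{\widetilde{\mathcal T}}(\widehat P,\widehat Q)$ by left composition and $\tau$ is the orbit map. All the $K_{\widehat P}$ are then isomorphic to one group $A$. **Associated data.** $\widetilde S$ is the pull-back of $\varepsilon_S:S\to\mathrm{Aut}_{\mathcal T}(S)$ and $\tau:\mathrm{Aut}_{\widetilde{\mathcal T}}(\widehat S)\to\mathrm{Aut}_{\mathcal T}(S)$, with projections $q:\widetilde S\to S$ and $\widetilde\varepsilon_{\widetilde S}:\widetilde S\to\mathrm{Aut}_{\widetilde{\mathcal T}}(\widehat S)$; $A=\mathrm{Ker}(q)\cong K_{\widehat S}$; $\widetilde P=q^{-1}(P)$ for $P\in\mathrm{Ob}(\mathcal T)$, and $\mathrm{Ob}(\widetilde{\mathcal T})$ is identified with $\{\widetilde P\mid P\in\mathrm{Ob}(\mathcal T)\}$. Choose for each $\widetilde P$ a lift $\widetilde\iota_{\widetilde P}\in\mathrm{Mor}_{\widetilde{\mathcal T}}(\widetilde P,\widetilde S)$ of $\varepsilon_{P,S}(1)$, with $\widetilde\iota_{\widetilde S}=\mathrm{Id}$. The functor $\widetilde\varepsilon:\mathcal T_{\mathrm{Ob}(\widetilde{\mathcal T})}(\widetilde S)\to\widetilde{\mathcal T}$ sends $\widetilde x\in N_{\widetilde S}(\widetilde P,\widetilde Q)$ to the unique morphism $\widetilde\varepsilon_{\widetilde P,\widetilde Q}(\widetilde x)$ with $\widetilde\iota_{\widetilde Q}\circ\widetilde\varepsilon_{\widetilde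 P,\widetilde Q}(\widetilde x)=\widetilde\varepsilon_{\widetilde S}(\widetilde x)\circ\widetilde\iota_{\widetilde P}$. The functor $\widetilde\rho:\widetilde{\mathcal T}\to\mathrm{Groups}$ sends $\widetilde\varphi\in\mathrm{Mor}_{\widetilde{\mathcal T}}(\widetilde P,\widetilde Q)$ to the unique homomorphism $\widetilde f:\widetilde P\to\widetilde Q$ with $\widetilde\varphi\circ\widetilde\varepsilon_{\widetilde P,\widetilde P}(x)=\widetilde\varepsilon_{\widetilde Q,\widetilde Q}(\widetilde f(x))\circ\widetilde\varphi$ for all $x\in\widetilde P$. $\widetilde{\mathcal F}$ is the fusion system over $\widetilde S$ generated by the image of $\widetilde\rho$ (morphisms are composites of restrictions). The structure functors of $(\widetilde S,\widetilde{\mathcal F},\widetilde{\mathcal T})$ are $\widetilde\varepsilon$ and $\widetilde\rho$. **Quotient.** Let $\widetilde S$ be the pull-back group, $\widetilde{\mathcal F}$ the fusion system over $\widetilde S$ generated by the image of $\widetilde\rho$, and $A=\mathrm{Ker}(q)\le\widetilde S$. When $A$ is $\widetilde{\mathcal F}$-normal, $\widetilde{\mathcal F}/A$ is the fusion system over $\widetilde S/A$ whose morphisms $P/A\to Q/A$ are those induced by some $f\in\mathrm{Hom}_{\widetilde{\mathcal F}}(P,Q)$, $A\le P,Q$; and $\widetilde{\mathcal T}/A$ has objects $P/A$ for $A\le P\in\mathrm{Ob}(\widetilde{\mathcal T})$ and $\mathrm{Mor}_{\widetilde{\mathcal T}/A}(P/A,Q/A)=\mathrm{Mor}_{\widetilde{\mathcal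 T}}(P,Q)/\widetilde\varepsilon_P(A)$.
   Formalization: The isomorphism of F with the quotient of F~ by A is proved on the objects of T, and on all subgroups for the fusion system generated by F on Ob(T); for F not generated by its morphisms between objects of T the literal claim fails. *)

theory Defs
  imports
    Complex_Main
    "HOL-Computational_Algebra.Primes"
    "HOL-Algebra.Group_Action"
    "HOL-Algebra.Product_Groups"
begin

section \<open>Discrete p-toral groups\<close>

text \<open>\<open>Z/p^\<infinity>\<close>, the union of the groups \<open>Z/p^n\<close>, is realised as the union over \<open>n\<close> of the groups
  of complex \<open>p^n\<close>-th roots of unity.\<close>

definition prufer_group :: "nat \<Rightarrow> complex monoid" where
  "prufer_group p = \<lparr>carrier = (\<Union>n. {z. z ^ (p ^ n) = 1}), mult = (*), one = 1\<rparr>"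

definition discrete_p_toral :: "nat \<Rightarrow> ('a, 'b) monoid_scheme \<Rightarrow> bool" where
  "discrete_p_toral p G \<longleftrightarrow> group G \<and>
     (\<exists>N r k. normal N G
        \<and> (G\<lparr>carrier := N\<rparr>) \<cong> product_group {..<r::nat} (\<lambda>_. prufer_group p)
        \<and> finite (rcosets\<^bsub>G\<^esub> N) \<and> card (rcosets\<^bsub>G\<^esub> N) = p ^ k)"

section \<open>Categories\<close>

text \<open>A category is given by hom-sets indexed by pairs of objects. Hom-sets of different pairs may
  overlap as sets (as the sets \<open>N_S(P,Q)\<close> do), so composition carries the objects as arguments:
  \<open>Comp C P Q R g f\<close> is the composite of \<open>f : P \<rightarrow> Q\<close> and \<open>g : Q \<rightarrow> R\<close>. The values
  of the fields outside \<open>Obj\<close> and the hom-sets are irrelevant.\<close>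

record ('o, 'm) cat =
  Obj :: "'o set"
  Mor :: "'o \<Rightarrow> 'o \<Rightarrow> 'm set"
  Comp :: "'o \<Rightarrow> 'o \<Rightarrow> 'o \<Rightarrow> 'm \<Rightarrow> 'm \<Rightarrow> 'm"
  Idn :: "'o \<Rightarrow> 'm"

locale category =
  fixes C :: "('o, 'm) cat"
  assumes comp_closed: "\<lbrakk>P \<in> Obj C; Q \<in> Obj C; R \<in> Obj C; f \<in> Mor C P Q; g \<in> Mor C Q R\<rbrakk>
      \<Longrightarrow> Comp C P Q R g f \<in> Mor C P R"
    and id_closed: "P \<in> Obj C \<Longrightarrow> Idn C P \<in> Mor C P P"
    and comp_assoc: "\<lbrakk>P \<in> Obj C; Q \<in> Obj C; R \<in> Obj C; W \<in> Obj C;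
        f \<in> Mor C P Q; g \<in> Mor C Q R; h \<in> Mor C R W\<rbrakk>
      \<Longrightarrow> Comp C P Q W (Comp C Q R W h g) f = Comp C P R W h (Comp C P Q R g f)"
    and id_left: "\<lbrakk>P \<in> Obj C; Q \<in> Obj C; f \<in> Mor C P Q\<rbrakk> \<Longrightarrow> Comp C P Q Q (Idn C Q) f = f"
    and id_right: "\<lbrakk>P \<in> Obj C; Q \<in> Obj C; f \<in> Mor C P Q\<rbrakk> \<Longrightarrow> Comp C P P Q f (Idn C P) = f"

locale cat_functor = C: category C + D: category D
  for C :: "('o, 'm) cat" and D :: "('o2, 'm2) cat" +
  fixes FO :: "'o \<Rightarrow> 'o2" and FM :: "'o \<Rightarrow> 'o \<Rightarrow> 'm \<Rightarrow> 'm2"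
  assumes obj_closed: "P \<in> Obj C \<Longrightarrow> FO P \<in> Obj D"
    and mor_closed: "\<lbrakk>P \<in> Obj C; Q \<in> Obj C; f \<in> Mor C P Q\<rbrakk> \<Longrightarrow> FM P Q f \<in> Mor D (FO P) (FO Q)"
    and preserves_id: "P \<in> Obj C \<Longrightarrow> FM P P (Idn C P) = Idn D (FO P)"
    and preserves_comp: "\<lbrakk>P \<in> Obj C; Q \<in> Obj C; R \<in> Obj C; f \<in> Mor C P Q; g \<in> Mor C Q R\<rbrakk>
      \<Longrightarrow> FM P R (Comp C P Q R g f) = Comp D (FO P) (FO Q) (FO R) (FM Q R g) (FM P Q f)"

definition inverse_mors :: "('o, 'm) cat \<Rightarrow> 'o \<Rightarrow> 'o \<Rightarrow> 'm \<Rightarrow> 'm \<Rightarrow> bool" where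
  "inverse_mors C P Q f g \<longleftrightarrow> f \<in> Mor C P Q \<and> g \<in> Mor C Q P
     \<and> Comp C P Q P g f = Idn C P \<and> Comp C Q P Q f g = Idn C Q"

definition isos :: "('o, 'm) cat \<Rightarrow> 'o \<Rightarrow> 'o \<Rightarrow> 'm set" where
  "isos C P Q = {f. \<exists>g. inverse_mors C P Q f g}"

definition aut_group :: "('o, 'm) cat \<Rightarrow> 'o \<Rightarrow> 'm monoid" where
  "aut_group C P = \<lparr>carrier = isos C P P, mult = Comp C P P P, one = Idn C P\<rparr>"

definition free_right :: "('o, 'm) cat \<Rightarrow> 'o \<Rightarrow> 'o \<Rightarrow> 'm set \<Rightarrow> bool" where
  "free_right C P Q K \<longleftrightarrow>
     (\<forall>f \<in> Mor C P Q. \<forall>k \<in> K. Comp C P P Q f k = f \<longrightarrow> k = Idn C P)"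

definition free_left :: "('o, 'm) cat \<Rightarrow> 'o \<Rightarrow> 'o \<Rightarrow> 'm set \<Rightarrow> bool" where
  "free_left C P Q K \<longleftrightarrow>
     (\<forall>f \<in> Mor C P Q. \<forall>k \<in> K. Comp C P Q Q k f = f \<longrightarrow> k = Idn C Q)"

text \<open>\<open>\<pi>\<close> is the orbit map of the action of \<open>K\<close> on \<open>Mor(P,Q)\<close>, i.e. \<open>\<pi>\<close> maps \<open>Mor(P,Q)\<close> onto \<open>Y\<close>
  and its fibres are the orbits.\<close>

definition orbit_map_right ::
    "('o, 'm) cat \<Rightarrow> 'o \<Rightarrow> 'o \<Rightarrow> 'm set \<Rightarrow> ('m \<Rightarrow> 'y) \<Rightarrow> 'y set \<Rightarrow> bool" where
  "orbit_map_right C P Q K \<pi> Y \<longleftrightarrow> \<pi> ` Mor C P Q = Y \<and>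
     (\<forall>f \<in> Mor C P Q. \<forall>f' \<in> Mor C P Q. \<pi> f = \<pi> f' \<longleftrightarrow> (\<exists>k \<in> K. f' = Comp C P P Q f k))"

definition orbit_map_left ::
    "('o, 'm) cat \<Rightarrow> 'o \<Rightarrow> 'o \<Rightarrow> 'm set \<Rightarrow> ('m \<Rightarrow> 'y) \<Rightarrow> 'y set \<Rightarrow> bool" where
  "orbit_map_left C P Q K \<pi> Y \<longleftrightarrow> \<pi> ` Mor C P Q = Y \<and>
     (\<forall>f \<in> Mor C P Q. \<forall>f' \<in> Mor C P Q. \<pi> f = \<pi> f' \<longleftrightarrow> (\<exists>k \<in> K. f' = Comp C P Q Q k f))"

section \<open>Fusion systems\<close>

definition conj_by :: "('a, 'b) monoid_scheme \<Rightarrow> 'a \<Rightarrow> 'a \<Rightarrow> 'a" where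
  "conj_by G g x = g \<otimes>\<^bsub>G\<^esub> x \<otimes>\<^bsub>G\<^esub> inv\<^bsub>G\<^esub> g"

definition transporter :: "('a, 'b) monoid_scheme \<Rightarrow> 'a set \<Rightarrow> 'a set \<Rightarrow> 'a set" where
  "transporter G P Q = {x \<in> carrier G. conj_by G x ` P \<subseteq> Q}"

text \<open>Morphisms between subgroups are extensional functions on the source, so that equality of
  morphisms with given source and target is equality of functions.\<close>

type_synonym 'a hom_family = "'a set \<Rightarrow> 'a set \<Rightarrow> ('a \<Rightarrow> 'a) set"

definition conj_homs :: "('a, 'b) monoid_scheme \<Rightarrow> 'a hom_family" where
  "conj_homs G P Q = {restrict (conj_by G g) P | g. g \<in> transporter G P Q}"

definition inj_homs :: "('a, 'b) monoid_scheme \<Rightarrow> 'a hom_family" where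
  "inj_homs G P Q = {f \<in> hom (G\<lparr>carrier := P\<rparr>) (G\<lparr>carrier := Q\<rparr>). f \<in> extensional P \<and> inj_on f P}"

definition fusion_cat :: "('a, 'b) monoid_scheme \<Rightarrow> 'a hom_family \<Rightarrow> ('a set, 'a \<Rightarrow> 'a) cat" where
  "fusion_cat S F = \<lparr>Obj = {P. subgroup P S}, Mor = F,
     Comp = (\<lambda>P Q R g f. compose P g f), Idn = (\<lambda>P. \<lambda>x\<in>P. x)\<rparr>"

locale fusion_system =
  fixes p :: nat and S :: "('a, 'b) monoid_scheme" and F :: "'a hom_family"
  assumes discrete_p_toral: "discrete_p_toral p S"
    and category: "category (fusion_cat S F)"
    and conj_homs_subset: "\<lbrakk>subgroup P S; subgroup Q S\<rbrakk> \<Longrightarrow> conj_homs S P Q \<subseteq> F P Q"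
    and subset_inj_homs: "\<lbrakk>subgroup P S; subgroup Q S\<rbrakk> \<Longrightarrow> F P Q \<subseteq> inj_homs S P Q"
    and factors: "\<lbrakk>subgroup P S; subgroup Q S; f \<in> F P Q\<rbrakk>
      \<Longrightarrow> \<exists>R g. subgroup R S \<and> R \<subseteq> Q \<and> g \<in> isos (fusion_cat S F) P R
            \<and> f = compose P (\<lambda>x\<in>R. x) g"

definition fusion_conjugate ::
    "('a, 'b) monoid_scheme \<Rightarrow> 'a hom_family \<Rightarrow> 'a set \<Rightarrow> 'a set \<Rightarrow> bool" where
  "fusion_conjugate S F P Q \<longleftrightarrow> subgroup P S \<and> subgroup Q S \<and> isos (fusion_cat S F) P Q \<noteq> {}"

definition fusion_normal :: "('a, 'b) monoid_scheme \<Rightarrow> 'a hom_family \<Rightarrow> 'a set \<Rightarrow> bool" where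
  "fusion_normal S F A \<longleftrightarrow> subgroup A S \<and>
     (\<forall>P f. subgroup P S \<longrightarrow> f \<in> F P (carrier S) \<longrightarrow>
        subgroup (P <#>\<^bsub>S\<^esub> A) S \<and>
        (\<exists>\<gamma> \<in> F (P <#>\<^bsub>S\<^esub> A) (carrier S).
            restrict \<gamma> P = f \<and> restrict \<gamma> A \<in> carrier (aut_group (fusion_cat S F) A)))"

text \<open>The fusion system over \<open>G\<close> generated by a family \<open>H X Y\<close> of maps \<open>X \<rightarrow> Y\<close>
  (\<open>X, Y \<in> Obs\<close>): its morphisms are the composites of restrictions of these maps.\<close>

inductive generated_mor ::
    "('a, 'b) monoid_scheme \<Rightarrow> 'a set set \<Rightarrow> 'a hom_family \<Rightarrow> 'a set \<Rightarrow> 'a set \<Rightarrow> ('a \<Rightarrow> 'a) \<Rightarrow> bool"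
  for G :: "('a, 'b) monoid_scheme" and Obs :: "'a set set" and H :: "'a hom_family" where
  restriction: "\<lbrakk>X \<in> Obs; Y \<in> Obs; h \<in> H X Y; subgroup P G; subgroup Q G; P \<subseteq> X; Q \<subseteq> Y; h ` P \<subseteq> Q\<rbrakk>
      \<Longrightarrow> generated_mor G Obs H P Q (restrict h P)"
| composite: "\<lbrakk>generated_mor G Obs H P Q f; generated_mor G Obs H Q R g\<rbrakk>
      \<Longrightarrow> generated_mor G Obs H P R (compose P g f)"

definition generated_fusion ::
    "('a, 'b) monoid_scheme \<Rightarrow> 'a set set \<Rightarrow> 'a hom_family \<Rightarrow> 'a hom_family" where
  "generated_fusion G Obs H P Q = {f. generated_mor G Obs H P Q f}"

text \<open>The fusion system generated by the morphisms of \<open>F\<close> between subgroups in \<open>Obs\<close> is contained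
  in \<open>F\<close> and coincides with \<open>F\<close> on \<open>Obs\<close>.\<close>

lemma (in fusion_system) generated_mor_in:
  assumes "generated_mor S Obs F P Q f" and Obs: "Obs \<subseteq> {P. subgroup P S}"
  shows "subgroup P S \<and> subgroup Q S \<and> f \<in> F P Q"
  using assms(1)
proof induction
  case (restriction X Y h P Q)
  interpret C: category "fusion_cat S F" by (rule category)
  have X: "subgroup X S" and Y: "subgroup Y S" using restriction Obs by auto
  have G: "group S" using discrete_p_toral unfolding discrete_p_toral_def by blast
  have incl: "(\<lambda>x\<in>U. x) \<in> F U V" if "subgroup U S" "subgroup V S" "U \<subseteq> V" for U V
  proof -
    have sub: "x \<in> carrier S" if "x \<in> U" for x using that \<open>subgroup U S\<close> subgroup.mem_carrier by metis
    interpret G: group S by (rule G)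
    have "conj_by S \<one>\<^bsub>S\<^esub> x = x" if "x \<in> U" for x using sub[OF that] by (simp add: conj_by_def)
    then have "restrict (conj_by S \<one>\<^bsub>S\<^esub>) U = (\<lambda>x\<in>U. x)" "\<one>\<^bsub>S\<^esub> \<in> transporter S U V"
      using \<open>U \<subseteq> V\<close> by (auto simp: transporter_def restrict_def fun_eq_iff)
    then have "(\<lambda>x\<in>U. x) \<in> conj_homs S U V" unfolding conj_homs_def by (metis (mono_tags, lifting) mem_Collect_eq)
    then show ?thesis using conj_homs_subset that by blast
  qed
  have cl: "compose U b a \<in> F U W"
    if "subgroup U S" "subgroup V S" "subgroup W S" "a \<in> F U V" "b \<in> F V W" for U V W a b
    using C.comp_closed[of U V W a b] that by (simp add: fusion_cat_def)
  have "compose P h (\<lambda>x\<in>P. x) \<in> F P Y"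
    using cl[of P X Y] incl X Y restriction by blast
  moreover have "compose P h (\<lambda>x\<in>P. x) = restrict h P" by (auto simp: compose_def restrict_def)
  ultimately have r: "restrict h P \<in> F P Y" by simp
  obtain R g where R: "subgroup R S" "g \<in> isos (fusion_cat S F) P R"
      and e: "restrict h P = compose P (\<lambda>x\<in>R. x) g"
    using factors[OF _ Y r] restriction by blast
  obtain g' where g: "g \<in> F P R" "g' \<in> F R P" "compose R g g' = (\<lambda>x\<in>R. x)"
    using R(2) by (auto simp: isos_def inverse_mors_def fusion_cat_def)
  have g'P: "g' y \<in> P" if "y \<in> R" for y
    using subset_inj_homs[of R P] R g restriction that by (auto simp: inj_homs_def hom_def)
  have gR: "g x \<in> R" if "x \<in> P" for x
    using subset_inj_homs[of P R] R g restriction that by (auto simp: inj_homs_def hom_def)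
  have hg: "h x = g x" if "x \<in> P" for x
    using fun_cong[OF e, of x] that gR by (simp add: compose_def)
  have "R \<subseteq> Q"
  proof
    fix y assume y: "y \<in> R"
    have "g (g' y) = y" using fun_cong[OF g(3), of y] y by (simp add: compose_def)
    then show "y \<in> Q" using hg[OF g'P[OF y]] g'P[OF y] restriction by (metis image_subset_iff)
  qed
  then have "compose P (\<lambda>x\<in>R. x) g \<in> F P Q"
    using cl[of P R Q g "\<lambda>x\<in>R. x"] incl[of R Q] R g restriction by blast
  then show ?case using restriction e by simp
next
  case (composite P Q f R g)
  interpret C: category "fusion_cat S F" by (rule category)
  show ?case using composite C.comp_closed[of P Q R f g] by (simp add: fusion_cat_def)
qed

lemma (in fusion_system) generated_fusion_eq:
  assumes "Obs \<subseteq> {P. subgroup P S}" "P \<in> Obs" "Q \<in> Obs"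
  shows "generated_fusion S Obs F P Q = F P Q"
proof
  show "generated_fusion S Obs F P Q \<subseteq> F P Q"
    using generated_mor_in assms by (auto simp: generated_fusion_def)
  show "F P Q \<subseteq> generated_fusion S Obs F P Q"
  proof
    fix f assume f: "f \<in> F P Q"
    have "f \<in> inj_homs S P Q" using f subset_inj_homs assms by blast
    then have "f \<in> extensional P" "f ` P \<subseteq> Q" by (auto simp: inj_homs_def hom_def)
    then show "f \<in> generated_fusion S Obs F P Q"
      using generated_mor.restriction[of P Obs Q f F P S Q] assms f
      by (auto simp: generated_fusion_def extensional_restrict)
  qed
qed

section \<open>Transporter systems\<close>

definition transporter_cat :: "('a, 'b) monoid_scheme \<Rightarrow> 'a set set \<Rightarrow> ('a set, 'a) cat" where
  "transporter_cat S Obs = \<lparr>Obj = Obs, Mor = transporter S,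
     Comp = (\<lambda>P Q R y x. y \<otimes>\<^bsub>S\<^esub> x), Idn = (\<lambda>P. \<one>\<^bsub>S\<^esub>)\<rparr>"

text \<open>In \<open>ext_II\<close> the morphism \<open>\<psi>\<close> is the inverse of the isomorphism \<open>\<phi>\<close>. Chains of subgroups
  in \<open>ext_III\<close> are indexed from 0.\<close>

locale transporter_system = fusion_system p S F + category T +
    eps: cat_functor "transporter_cat S (Obj T)" T "\<lambda>P. P" \<epsilon> +
    rho: cat_functor T "fusion_cat S F" "\<lambda>P. P" \<rho>
  for p :: nat and S :: "('a, 'b) monoid_scheme" and F :: "'a hom_family"
    and T :: "('a set, 'm) cat"
    and \<epsilon> :: "'a set \<Rightarrow> 'a set \<Rightarrow> 'a \<Rightarrow> 'm"
    and \<rho> :: "'a set \<Rightarrow> 'a set \<Rightarrow> 'm \<Rightarrow> 'a \<Rightarrow> 'a" +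
  assumes nonempty: "Obj T \<noteq> {}"
    and objects: "Obj T \<subseteq> {P. subgroup P S}"
    and conjugacy_closed: "\<lbrakk>P \<in> Obj T; fusion_conjugate S F P Q\<rbrakk> \<Longrightarrow> Q \<in> Obj T"
    and overgroup_closed: "\<lbrakk>P \<in> Obj T; subgroup Q S; P \<subseteq> Q\<rbrakk> \<Longrightarrow> Q \<in> Obj T"
    and A1_inj: "\<lbrakk>P \<in> Obj T; Q \<in> Obj T\<rbrakk> \<Longrightarrow> inj_on (\<epsilon> P Q) (transporter S P Q)"
    and A1_surj: "\<lbrakk>P \<in> Obj T; Q \<in> Obj T\<rbrakk> \<Longrightarrow> \<rho> P Q ` Mor T P Q = F P Q"
    and A2_right: "\<lbrakk>P \<in> Obj T; Q \<in> Obj T;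
        E = kernel (aut_group T P) (aut_group (fusion_cat S F) P) (\<rho> P P)\<rbrakk>
      \<Longrightarrow> free_right T P Q E \<and> orbit_map_right T P Q E (\<rho> P Q) (F P Q)"
    and A2_left: "\<lbrakk>P \<in> Obj T; Q \<in> Obj T;
        E = kernel (aut_group T Q) (aut_group (fusion_cat S F) Q) (\<rho> Q Q)\<rbrakk>
      \<Longrightarrow> free_left T P Q E"
    and B: "\<lbrakk>P \<in> Obj T; Q \<in> Obj T; g \<in> transporter S P Q\<rbrakk>
      \<Longrightarrow> \<rho> P Q (\<epsilon> P Q g) = restrict (conj_by S g) P"
    and C: "\<lbrakk>P \<in> Obj T; Q \<in> Obj T; \<phi> \<in> Mor T P Q; g \<in> P\<rbrakk>
      \<Longrightarrow> Comp T P P Q \<phi> (\<epsilon> P P g) = Comp T P Q Q (\<epsilon> Q Q (\<rho> P Q \<phi> g)) \<phi>"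
    and sylow_I: "Q \<in> Obj T
      \<Longrightarrow> \<exists>P \<in> Obj T. fusion_conjugate S F Q P
            \<and> finite (rcosets\<^bsub>aut_group T P\<^esub> (\<epsilon> P P ` normalizer S P))
            \<and> coprime p (card (rcosets\<^bsub>aut_group T P\<^esub> (\<epsilon> P P ` normalizer S P)))"
    and ext_II: "\<lbrakk>P \<in> Obj T; Q \<in> Obj T; inverse_mors T P Q \<phi> \<psi>;
        subgroup Pt S; normal P (S\<lparr>carrier := Pt\<rparr>); subgroup Qt S; normal Q (S\<lparr>carrier := Qt\<rparr>);
        (\<lambda>x. Comp T Q P Q (Comp T P P Q \<phi> (\<epsilon> P P x)) \<psi>) ` Pt \<subseteq> \<epsilon> Q Q ` Qt\<rbrakk>
      \<Longrightarrow> \<exists>\<phi>t \<in> Mor T Pt Qt.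
            Comp T P Pt Qt \<phi>t (\<epsilon> P Pt \<one>\<^bsub>S\<^esub>) = Comp T P Q Qt (\<epsilon> Q Qt \<one>\<^bsub>S\<^esub>) \<phi>"
    and ext_III: "\<And>(Pn :: nat \<Rightarrow> 'a set) \<phi>n.
        \<lbrakk>\<And>n. Pn n \<in> Obj T; \<And>n. Pn n \<subseteq> Pn (Suc n);
         \<And>n. \<phi>n n \<in> Mor T (Pn n) (carrier S);
         \<And>n. \<phi>n n = Comp T (Pn n) (Pn (Suc n)) (carrier S) (\<phi>n (Suc n)) (\<epsilon> (Pn n) (Pn (Suc n)) \<one>\<^bsub>S\<^esub>)\<rbrakk>
      \<Longrightarrow> \<exists>\<phi> \<in> Mor T (\<Union>n. Pn n) (carrier S).
            \<forall>n. \<phi>n n = Comp T (Pn n) (\<Union>n. Pn n) (carrier S) \<phi> (\<epsilon> (Pn n) (\<Union>n. Pn n) \<one>\<^bsub>S\<^esub>)"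

section \<open>Extensions\<close>

definition ext_kernel ::
    "('o, 'm) cat \<Rightarrow> ('o, 'n) cat \<Rightarrow> ('o \<Rightarrow> 'o \<Rightarrow> 'n \<Rightarrow> 'm) \<Rightarrow> 'o \<Rightarrow> 'n set" where
  "ext_kernel T Th \<tau> P = kernel (aut_group Th P) (aut_group T P) (\<tau> P P)"

locale category_extension =
  tau: cat_functor Th T "\<lambda>P. P" \<tau>
  for p :: nat and T :: "('o, 'm) cat" and Th :: "('o, 'n) cat"
    and \<tau> :: "'o \<Rightarrow> 'o \<Rightarrow> 'n \<Rightarrow> 'm" +
  assumes same_objects: "Obj Th = Obj T"
    and kernel_toral: "P \<in> Obj Th
      \<Longrightarrow> discrete_p_toral p ((aut_group Th P)\<lparr>carrier := ext_kernel T Th \<tau> P\<rparr>)"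
    and right_action: "\<lbrakk>P \<in> Obj Th; Q \<in> Obj Th\<rbrakk>
      \<Longrightarrow> free_right Th P Q (ext_kernel T Th \<tau> P)
        \<and> orbit_map_right Th P Q (ext_kernel T Th \<tau> P) (\<tau> P Q) (Mor T P Q)"
    and left_action: "\<lbrakk>P \<in> Obj Th; Q \<in> Obj Th\<rbrakk>
      \<Longrightarrow> free_left Th P Q (ext_kernel T Th \<tau> Q)
        \<and> orbit_map_left Th P Q (ext_kernel T Th \<tau> Q) (\<tau> P Q) (Mor T P Q)"

definition pullback_group :: "('a, 'b) monoid_scheme \<Rightarrow> ('c, 'd) monoid_scheme
    \<Rightarrow> ('a \<Rightarrow> 'e) \<Rightarrow> ('c \<Rightarrow> 'e) \<Rightarrow> ('a \<times> 'c) monoid" where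
  "pullback_group G H f g = (G \<times>\<times> H)\<lparr>carrier := {(x, y) \<in> carrier G \<times> carrier H. f x = g y}\<rparr>"

text \<open>The projections of this pull-back onto \<open>S\<close> and onto the automorphism group are \<open>fst\<close> and \<open>snd\<close>.\<close>

definition ext_group :: "('a, 'b) monoid_scheme \<Rightarrow> ('a set \<Rightarrow> 'a set \<Rightarrow> 'a \<Rightarrow> 'm)
    \<Rightarrow> ('a set, 'n) cat \<Rightarrow> ('a set \<Rightarrow> 'a set \<Rightarrow> 'n \<Rightarrow> 'm) \<Rightarrow> ('a \<times> 'n) monoid" where
  "ext_group S \<epsilon> Th \<tau> = pullback_group S (aut_group Th (carrier S))
     (\<epsilon> (carrier S) (carrier S)) (\<tau> (carrier S) (carrier S))"

text \<open>\<open>Th\<close> with each object \<open>P\<close> renamed to its preimage under \<open>fst\<close> in the pull-back group \<open>St\<close>.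
  Since \<open>fst\<close> maps \<open>St\<close> onto \<open>S\<close>, the object of \<open>Th\<close> renamed to \<open>X\<close> is \<open>fst ` X\<close>.\<close>

definition ext_cat :: "('a \<times> 'n) monoid \<Rightarrow> ('a set, 'n) cat \<Rightarrow> (('a \<times> 'n) set, 'n) cat" where
  "ext_cat St Th = \<lparr>Obj = (\<lambda>P. {x \<in> carrier St. fst x \<in> P}) ` Obj Th,
     Mor = (\<lambda>X Y. Mor Th (fst ` X) (fst ` Y)),
     Comp = (\<lambda>X Y Z. Comp Th (fst ` X) (fst ` Y) (fst ` Z)),
     Idn = (\<lambda>X. Idn Th (fst ` X))\<rparr>"

definition inclusion_lifts :: "('a, 'b) monoid_scheme \<Rightarrow> ('a set \<Rightarrow> 'a set \<Rightarrow> 'a \<Rightarrow> 'm)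
    \<Rightarrow> ('a set \<Rightarrow> 'a set \<Rightarrow> 'n \<Rightarrow> 'm) \<Rightarrow> ('a \<times> 'n) monoid \<Rightarrow> (('a \<times> 'n) set, 'n) cat
    \<Rightarrow> (('a \<times> 'n) set \<Rightarrow> 'n) \<Rightarrow> bool" where
  "inclusion_lifts S \<epsilon> \<tau> St Tt \<iota> \<longleftrightarrow>
     (\<forall>X \<in> Obj Tt. \<iota> X \<in> Mor Tt X (carrier St)
        \<and> \<tau> (fst ` X) (carrier S) (\<iota> X) = \<epsilon> (fst ` X) (carrier S) \<one>\<^bsub>S\<^esub>)
     \<and> \<iota> (carrier St) = Idn Tt (carrier St)"

definition ext_eps :: "('a \<times> 'n) monoid \<Rightarrow> (('a \<times> 'n) set, 'n) cat \<Rightarrow> (('a \<times> 'n) set \<Rightarrow> 'n)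
    \<Rightarrow> ('a \<times> 'n) set \<Rightarrow> ('a \<times> 'n) set \<Rightarrow> 'a \<times> 'n \<Rightarrow> 'n" where
  "ext_eps St Tt \<iota> X Y x = (THE \<mu>. \<mu> \<in> Mor Tt X Y \<and>
     Comp Tt X Y (carrier St) (\<iota> Y) \<mu> = Comp Tt X (carrier St) (carrier St) (snd x) (\<iota> X))"

definition ext_rho :: "('a \<times> 'n) monoid \<Rightarrow> (('a \<times> 'n) set, 'n) cat
    \<Rightarrow> (('a \<times> 'n) set \<Rightarrow> ('a \<times> 'n) set \<Rightarrow> 'a \<times> 'n \<Rightarrow> 'n)
    \<Rightarrow> ('a \<times> 'n) set \<Rightarrow> ('a \<times> 'n) set \<Rightarrow> 'n \<Rightarrow> 'a \<times> 'n \<Rightarrow> 'a \<times> 'n" where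
  "ext_rho St Tt \<epsilon>t X Y \<phi> = (THE f. f \<in> hom (St\<lparr>carrier := X\<rparr>) (St\<lparr>carrier := Y\<rparr>)
     \<and> f \<in> extensional X
     \<and> (\<forall>x \<in> X. Comp Tt X X Y \<phi> (\<epsilon>t X X x) = Comp Tt X Y Y (\<epsilon>t Y Y (f x)) \<phi>))"

section \<open>Quotients\<close>

definition quot_set :: "('a, 'b) monoid_scheme \<Rightarrow> 'a set \<Rightarrow> 'a set \<Rightarrow> 'a set set" where
  "quot_set S A P = (\<lambda>x. A #>\<^bsub>S\<^esub> x) ` P"

definition quot_fusion ::
    "('a, 'b) monoid_scheme \<Rightarrow> 'a hom_family \<Rightarrow> 'a set \<Rightarrow> 'a set hom_family" where
  "quot_fusion S F A X Y = {h \<in> extensional X. \<exists>P Q f.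
     subgroup P S \<and> subgroup Q S \<and> A \<subseteq> P \<and> A \<subseteq> Q \<and> X = quot_set S A P \<and> Y = quot_set S A Q
     \<and> f \<in> F P Q \<and> (\<forall>x \<in> P. h (A #>\<^bsub>S\<^esub> x) = A #>\<^bsub>S\<^esub> f x)}"

text \<open>A subgroup \<open>P\<close> containing \<open>A\<close> is recovered from the set of cosets \<open>X = P/A\<close> as \<open>\<Union>X\<close>.
  Morphisms are orbits under right composition with \<open>\<epsilon>(A)\<close>; they are composed by composing
  representatives.\<close>

definition quot_cat :: "('a, 'b) monoid_scheme \<Rightarrow> ('a set, 'm) cat
    \<Rightarrow> ('a set \<Rightarrow> 'a set \<Rightarrow> 'a \<Rightarrow> 'm) \<Rightarrow> 'a set \<Rightarrow> ('a set set, 'm set) cat" where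
  "quot_cat S T \<epsilon> A = \<lparr>Obj = {quot_set S A P | P. P \<in> Obj T \<and> A \<subseteq> P},
     Mor = (\<lambda>X Y. {(\<lambda>a. Comp T (\<Union>X) (\<Union>X) (\<Union>Y) \<phi> (\<epsilon> (\<Union>X) (\<Union>X) a)) ` A | \<phi>. \<phi> \<in> Mor T (\<Union>X) (\<Union>Y)}),
     Comp = (\<lambda>X Y Z \<Psi> \<Phi>. {Comp T (\<Union>X) (\<Union>Y) (\<Union>Z) \<psi> \<phi> | \<psi> \<phi>. \<psi> \<in> \<Psi> \<and> \<phi> \<in> \<Phi>}),
     Idn = (\<lambda>X. \<epsilon> (\<Union>X) (\<Union>X) ` A)\<rparr>"

text \<open>The structure functors induced on the quotient: the coset \<open>A x\<close> is sent to the orbit of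
  \<open>\<epsilon>(x)\<close>, which is the image \<open>\<epsilon>(A x)\<close>, and the orbit \<open>\<Phi>\<close> of \<open>\<phi>\<close> is sent to the map \<open>A x \<mapsto> A \<rho>(\<phi>)(x)\<close>;
  the union below is over all representatives.\<close>

definition quot_eps :: "('a set \<Rightarrow> 'a set \<Rightarrow> 'a \<Rightarrow> 'm)
    \<Rightarrow> 'a set set \<Rightarrow> 'a set set \<Rightarrow> 'a set \<Rightarrow> 'm set" where
  "quot_eps \<epsilon> X Y c = \<epsilon> (\<Union>X) (\<Union>Y) ` c"

definition quot_rho :: "('a, 'b) monoid_scheme \<Rightarrow> ('a set \<Rightarrow> 'a set \<Rightarrow> 'm \<Rightarrow> 'a \<Rightarrow> 'a) \<Rightarrow> 'a set
    \<Rightarrow> 'a set set \<Rightarrow> 'a set set \<Rightarrow> 'm set \<Rightarrow> 'a set \<Rightarrow> 'a set" where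
  "quot_rho S \<rho> A X Y \<Phi> = (\<lambda>c\<in>X. \<Union>\<phi>\<in>\<Phi>. \<Union>x\<in>c. A #>\<^bsub>S\<^esub> \<rho> (\<Union>X) (\<Union>Y) \<phi> x)"

section \<open>Isomorphisms of transporter systems\<close>

definition cat_iso :: "('o, 'm) cat \<Rightarrow> ('o2, 'm2) cat \<Rightarrow> ('o \<Rightarrow> 'o2) \<Rightarrow> ('o \<Rightarrow> 'o \<Rightarrow> 'm \<Rightarrow> 'm2) \<Rightarrow> bool" where
  "cat_iso C D FO FM \<longleftrightarrow> cat_functor C D FO FM \<and> bij_betw FO (Obj C) (Obj D)
     \<and> (\<forall>P \<in> Obj C. \<forall>Q \<in> Obj C. bij_betw (FM P Q) (Mor C P Q) (Mor D (FO P) (FO Q)))"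

definition transport_map :: "('a, 'b) monoid_scheme \<Rightarrow> ('a \<Rightarrow> 'c) \<Rightarrow> 'a set \<Rightarrow> ('a \<Rightarrow> 'a) \<Rightarrow> 'c \<Rightarrow> 'c" where
  "transport_map S \<theta> P f = (\<lambda>y \<in> \<theta> ` P. \<theta> (f (inv_into (carrier S) \<theta> y)))"

definition fusion_iso :: "('a, 'b) monoid_scheme \<Rightarrow> 'a hom_family
    \<Rightarrow> ('c, 'd) monoid_scheme \<Rightarrow> 'c hom_family \<Rightarrow> ('a \<Rightarrow> 'c) \<Rightarrow> bool" where
  "fusion_iso S F S' F' \<theta> \<longleftrightarrow> \<theta> \<in> iso S S' \<and>
     cat_iso (fusion_cat S F) (fusion_cat S' F') (\<lambda>P. \<theta> ` P) (\<lambda>P Q. transport_map S \<theta> P)"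

text \<open>An isomorphism of transporter systems is a group isomorphism \<open>\<theta>\<close> together with an isomorphism
  \<open>\<Theta>\<close> of categories from \<open>T\<close> to \<open>T'\<close>, given by \<open>\<theta>\<close> on objects, that commutes with both structure
  functors, where \<open>\<theta>\<close> carries the morphisms of \<open>F\<close> between objects of \<open>T\<close> to those of \<open>F'\<close>.
  A transporter system imposes no condition on the morphisms of \<open>F\<close> that are not composites of
  restrictions of morphisms between objects of \<open>T\<close>; the fusion systems themselves are compared by
  \<open>fusion_iso\<close>.\<close>

definition transporter_iso ::
    "('a, 'b) monoid_scheme \<Rightarrow> 'a hom_family \<Rightarrow> ('a set, 'm) cat
      \<Rightarrow> ('a set \<Rightarrow> 'a set \<Rightarrow> 'a \<Rightarrow> 'm) \<Rightarrow> ('a set \<Rightarrow> 'a set \<Rightarrow> 'm \<Rightarrow> 'a \<Rightarrow> 'a)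
      \<Rightarrow> ('c, 'd) monoid_scheme \<Rightarrow> 'c hom_family \<Rightarrow> ('c set, 'n) cat
      \<Rightarrow> ('c set \<Rightarrow> 'c set \<Rightarrow> 'c \<Rightarrow> 'n) \<Rightarrow> ('c set \<Rightarrow> 'c set \<Rightarrow> 'n \<Rightarrow> 'c \<Rightarrow> 'c)
      \<Rightarrow> ('a \<Rightarrow> 'c) \<Rightarrow> ('a set \<Rightarrow> 'a set \<Rightarrow> 'm \<Rightarrow> 'n) \<Rightarrow> bool" where
  "transporter_iso S F T \<epsilon> \<rho> S' F' T' \<epsilon>' \<rho>' \<theta> \<Theta> \<longleftrightarrow>
     \<theta> \<in> iso S S'
     \<and> (\<forall>P \<in> Obj T. \<forall>Q \<in> Obj T. bij_betw (transport_map S \<theta> P) (F P Q) (F' (\<theta> ` P) (\<theta> ` Q)))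
     \<and> cat_iso T T' (\<lambda>P. \<theta> ` P) \<Theta>
     \<and> (\<forall>P \<in> Obj T. \<forall>Q \<in> Obj T. \<forall>g \<in> transporter S P Q.
          \<Theta> P Q (\<epsilon> P Q g) = \<epsilon>' (\<theta> ` P) (\<theta> ` Q) (\<theta> g))
     \<and> (\<forall>P \<in> Obj T. \<forall>Q \<in> Obj T. \<forall>\<phi> \<in> Mor T P Q.
          \<rho>' (\<theta> ` P) (\<theta> ` Q) (\<Theta> P Q \<phi>) = transport_map S \<theta> P (\<rho> P Q \<phi>))"

end

theory Submission
  imports Defs "HOL-Algebra.Multiplicative_Group" "HOL-Algebra.Zassenhaus"
begin

text \<open>The proof has a group-theoretic and a categorical half.

  Group theory: \<open>St\<close> is an extension of \<open>S\<close> by the kernel of \<open>\<tau>\<close> at \<open>S\<close>, so it has to be shown that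
  discrete p-toral groups are closed under extensions (\<open>discrete_p_toral_extension\<close>). Powers of
  \<open>Z/p^\<infinity>\<close> are replaced by the intrinsic notion \<open>p_torus\<close>: commutative, p-torsion, p-divisible, with
  finitely many elements of order \<open>p\<close>; the two notions agree by \<open>p_torus_structure\<close>. Two facts drive
  everything. A p-torus has no proper subgroup of finite index, so whatever acts on a finite set
  through a torus acts trivially; and a bilinear pairing of a torsion group with a divisible group
  vanishes, so commutators in central extensions of tori are trivial. This settles extensions of a
  torus by a torus (\<open>p_torus_extension\<close>) and by a finite p-group
  (\<open>virtual_p_torus_finite_kernel_torus\<close>). The general case follows by first dividing by the torus of the
  kernel, which is normal in the whole group because it is the set of \<open>p^k\<close>-th powers in the kernel
  (\<open>torus_eq_powers\<close>).

  Categories: the functor \<open>tt\<close> from \<open>Tt\<close> to \<open>T\<close> identifies each morphism set of \<open>T\<close> with the set of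
  orbits of the free action of the groups \<open>K X\<close> (on either side), and \<open>K X\<close> is the image of \<open>A\<close> under
  \<open>\<epsilon>t\<close> (\<open>K_eq\<close>). Hence each axiom for \<open>Tt\<close> comes from the one for \<open>T\<close>: map to \<open>T\<close>, apply the axiom,
  lift the result, and repair the lift by an element of \<open>A\<close>. The repair is unique since morphisms of
  \<open>T\<close> can be cancelled on the left (\<open>left_cancel\<close>) and \<open>\<epsilon>\<close> of an element of \<open>Q\<close> is determined by its
  composite with any morphism into \<open>Q\<close> (\<open>eps_cancel\<close>). In this way \<open>\<epsilon>t\<close> and \<open>\<rho>t\<close> are well defined,
  extension axiom (II) holds, and in axiom (III) the repairs along the chain all coincide; the index in
  axiom (I) does not change since both groups involved contain \<open>K X\<close>.

  The generated fusion system has no unwanted morphisms between objects: every \<open>\<rho>t \<phi>\<close> factors as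
  an isomorphism followed by an inclusion, so that composites of restrictions starting at an object
  are again values of \<open>\<rho>t\<close> (\<open>gSt_obj\<close>). As \<open>\<rho>t \<phi>\<close> is defined on a subgroup containing \<open>A\<close> and
  preserves \<open>A\<close>, each restriction extends to \<open>P A\<close>, which gives normality. The isomorphism with the
  quotient sends \<open>s\<close> in \<open>S\<close> to its fibre under \<open>fst\<close>, which is a coset of \<open>A\<close>, and a morphism of \<open>T\<close> to
  its fibre under \<open>\<tau>\<close>, which is an orbit of \<open>A\<close>.\<close>

section \<open>Indices of subgroups\<close>

lemma r_coset_eq: "H #>\<^bsub>G\<^esub> a = (\<lambda>h. h \<otimes>\<^bsub>G\<^esub> a) ` H"
  by (auto simp: r_coset_def)

lemma rcosetsE:
  assumes "c \<in> rcosets\<^bsub>G\<^esub> H"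
  obtains x where "x \<in> carrier G" "c = H #>\<^bsub>G\<^esub> x"
  using assms unfolding RCOSETS_def by blast

lemma (in group_hom) rcosets_vimage:
  assumes surj: "h ` carrier G = carrier H" and K: "subgroup K H"
    and L: "L = {x \<in> carrier G. h x \<in> K}"
  shows "subgroup L G" "bij_betw ((`) h) (rcosets\<^bsub>G\<^esub> L) (rcosets\<^bsub>H\<^esub> K)"
proof -
  interpret K: subgroup K H by (rule K)
  have L_iff: "x \<in> L \<longleftrightarrow> h x \<in> K" if "x \<in> carrier G" for x using that by (simp add: L)
  show sub: "subgroup L G"
  proof (rule G.subgroupI)
    show "L \<subseteq> carrier G" by (auto simp: L)
    show "L \<noteq> {}" using K.one_closed G.one_closed hom_one by (force simp: L)
  qed (simp_all add: L)
  have hL: "h ` L = K"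
  proof
    show "K \<subseteq> h ` L"
    proof
      fix k assume "k \<in> K"
      then obtain x where "x \<in> carrier G" "k = h x" using K.subset surj by (metis imageE subsetD)
      then show "k \<in> h ` L" using \<open>k \<in> K\<close> by (auto simp: L)
    qed
  qed (auto simp: L)
  have im: "h ` (L #>\<^bsub>G\<^esub> x) = K #>\<^bsub>H\<^esub> h x" if "x \<in> carrier G" for x
  proof -
    have "h (a \<otimes> x) = h a \<otimes>\<^bsub>H\<^esub> h x" if "a \<in> L" for a using that \<open>x \<in> carrier G\<close> subgroup.mem_carrier[OF sub] by simp
    then have "h ` (\<lambda>a. a \<otimes> x) ` L = (\<lambda>k. k \<otimes>\<^bsub>H\<^esub> h x) ` h ` L" by (auto simp: image_image)
    then show ?thesis by (simp add: r_coset_eq hL)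
  qed
  interpret L: subgroup L G by (rule sub)
  have inj: "L #>\<^bsub>G\<^esub> x = L #>\<^bsub>G\<^esub> y"
    if x: "x \<in> carrier G" and y: "y \<in> carrier G" and e: "K #>\<^bsub>H\<^esub> h x = K #>\<^bsub>H\<^esub> h y" for x y
  proof -
    have "h x \<in> K #>\<^bsub>H\<^esub> h y" using e H.rcos_self[OF _ K, of "h x"] x by simp
    then obtain k where k: "k \<in> K" "h x = k \<otimes>\<^bsub>H\<^esub> h y" by (auto simp: r_coset_def)
    then have "h (x \<otimes> inv y) = k" using x y K.subset
      by (simp add: H.inv_solve_right' subsetD)
    then have "x \<otimes> inv y \<in> L" using k x y by (simp add: L_iff)
    then have "x \<in> L #> y" using x y
      by (auto simp: r_coset_def G.m_assoc intro!: bexI[of _ "x \<otimes> inv y"])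
    then show ?thesis using G.repr_independence[OF _ y sub] by simp
  qed
  show "bij_betw ((`) h) (rcosets\<^bsub>G\<^esub> L) (rcosets\<^bsub>H\<^esub> K)"
  proof (rule bij_betw_imageI)
    show "inj_on ((`) h) (rcosets\<^bsub>G\<^esub> L)"
    proof (rule inj_onI)
      fix c d assume "c \<in> rcosets\<^bsub>G\<^esub> L" "d \<in> rcosets\<^bsub>G\<^esub> L" and e: "h ` c = h ` d"
      then obtain x y where xy: "x \<in> carrier G" "y \<in> carrier G" "c = L #> x" "d = L #> y"
        unfolding RCOSETS_def by blast
      then show "c = d" using inj[OF xy(1,2)] im[OF xy(1)] im[OF xy(2)] e by metis
    qed
    have "rcosets\<^bsub>H\<^esub> K = (\<lambda>y. K #>\<^bsub>H\<^esub> y) ` h ` carrier G" unfolding surj RCOSETS_def by blast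
    also have "\<dots> = (\<lambda>x. h ` (L #>\<^bsub>G\<^esub> x)) ` carrier G" by (simp add: image_image im)
    also have "\<dots> = (`) h ` (rcosets\<^bsub>G\<^esub> L)" unfolding RCOSETS_def by blast
    finally show "(`) h ` (rcosets\<^bsub>G\<^esub> L) = rcosets\<^bsub>H\<^esub> K" ..
  qed
qed

lemma (in group_hom) finite_rcosets_image:
  assumes surj: "h ` carrier G = carrier H" and L: "subgroup L G" and fin: "finite (rcosets\<^bsub>G\<^esub> L)"
  shows "finite (rcosets\<^bsub>H\<^esub> (h ` L))"
proof -
  interpret L: subgroup L G by (rule L)
  have im: "h ` (L #>\<^bsub>G\<^esub> x) = (h ` L) #>\<^bsub>H\<^esub> h x" if "x \<in> carrier G" for x
  proof -
    have "h (a \<otimes> x) = h a \<otimes>\<^bsub>H\<^esub> h x" if "a \<in> L" for a using that \<open>x \<in> carrier G\<close> L.subset by auto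
    then have "h ` (\<lambda>a. a \<otimes> x) ` L = (\<lambda>k. k \<otimes>\<^bsub>H\<^esub> h x) ` h ` L" by (auto simp: image_image)
    then show ?thesis by (simp add: r_coset_eq)
  qed
  have "rcosets\<^bsub>H\<^esub> (h ` L) \<subseteq> (`) h ` (rcosets\<^bsub>G\<^esub> L)"
    unfolding RCOSETS_def surj[symmetric] using im by auto
  then show ?thesis using fin finite_surj by blast
qed

text \<open>A coset of \<open>N\<close> lies in a unique coset of \<open>M\<close>; translating by a chosen representative of the latter
  moves it into \<open>M\<close>.\<close>

lemma (in group) rcosets_trans:
  assumes N: "subgroup N G" and M: "subgroup M G" and NM: "N \<subseteq> M"
  shows "\<exists>f. bij_betw f ((rcosets\<^bsub>G\<lparr>carrier := M\<rparr>\<^esub> N) \<times> (rcosets M)) (rcosets N)"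
proof -
  note sN = subgroup.subset[OF N] and sM = subgroup.subset[OF M]
  have RI: "H #> x \<in> rcosets H" if "x \<in> carrier G" for H x using that unfolding RCOSETS_def by blast
  define r where "r d = (SOME x. x \<in> d)" for d :: "'a set"
  have r: "r d \<in> d" "r d \<in> carrier G" "M #> r d = d" if dM: "d \<in> rcosets M" for d
  proof -
    obtain x where x: "x \<in> carrier G" "d = M #> x" using rcosetsE[OF dM] .
    then have "x \<in> d" using rcos_self M by blast
    then show 1: "r d \<in> d" unfolding r_def by (rule someI)
    then show "r d \<in> carrier G" using rcosets_part_G[OF M] dM by blast
    show "M #> r d = d" using 1 x repr_independence[OF _ _ M] by blast
  qed
  let ?f = "\<lambda>(c, d). c #> r d"
  have sub: "c #> r d \<subseteq> d" if "c \<in> rcosets\<^bsub>G\<lparr>carrier := M\<rparr>\<^esub> N" "d \<in> rcosets M" for c d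
  proof -
    have "c \<subseteq> M" using that(1) NM subgroup.m_closed[OF M] by (auto simp: RCOSETS_def r_coset_def subsetD)
    then have "c #> r d \<subseteq> M #> r d" by (auto simp: r_coset_def)
    then show ?thesis using r that by simp
  qed
  have ne: "c #> x \<noteq> {}" if "c \<in> rcosets\<^bsub>G\<lparr>carrier := M\<rparr>\<^esub> N" for c x
    using that subgroup.one_closed[OF N] by (auto simp: RCOSETS_def r_coset_def)
  have carr: "c \<subseteq> carrier G" if "c \<in> rcosets\<^bsub>G\<lparr>carrier := M\<rparr>\<^esub> N" for c
    using that sM sN by (auto simp: RCOSETS_def r_coset_def)
  have inj: "inj_on ?f ((rcosets\<^bsub>G\<lparr>carrier := M\<rparr>\<^esub> N) \<times> (rcosets M))"
  proof (rule inj_onI, clarify)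
    fix c d c' d'
    assume a: "c \<in> rcosets\<^bsub>G\<lparr>carrier := M\<rparr>\<^esub> N" "d \<in> rcosets M"
      "c' \<in> rcosets\<^bsub>G\<lparr>carrier := M\<rparr>\<^esub> N" "d' \<in> rcosets M" and e: "c #> r d = c' #> r d'"
    have "d \<inter> d' \<noteq> {}" using sub[OF a(1,2)] sub[OF a(3,4)] e ne[OF a(1)] by blast
    then have d: "d = d'" using rcos_disjoint[OF M] a(2,4) by (auto simp: pairwise_def disjnt_def)
    then have "c #> r d #> inv (r d) = c' #> r d #> inv (r d)" using e by simp
    then have "c = c'" using carr[OF a(1)] carr[OF a(3)] r(2)[OF a(2)] by (simp add: coset_mult_assoc)
    with d show "c = c' \<and> d = d'" by simp
  qed
  have im: "?f ` ((rcosets\<^bsub>G\<lparr>carrier := M\<rparr>\<^esub> N) \<times> (rcosets M)) = rcosets N"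
  proof (intro equalityI subsetI)
    fix e assume "e \<in> ?f ` ((rcosets\<^bsub>G\<lparr>carrier := M\<rparr>\<^esub> N) \<times> (rcosets M))"
    then obtain c d where c: "c \<in> rcosets\<^bsub>G\<lparr>carrier := M\<rparr>\<^esub> N" "d \<in> rcosets M" "e = c #> r d" by blast
    from c(1) obtain b where b: "b \<in> M" "c = N #> b" by (auto elim: rcosetsE)
    have "r d \<in> carrier G" using r(2)[OF c(2)] .
    then have "e = N #> (b \<otimes> r d)" using b c sN sM by (simp add: coset_mult_assoc subsetD)
    then show "e \<in> rcosets N" using b \<open>r d \<in> carrier G\<close> sM by (simp add: RI subsetD)
  next
    fix e assume e: "e \<in> rcosets N"
    obtain x where x: "x \<in> carrier G" "e = N #> x" by (rule rcosetsE[OF e])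
    have d: "M #> x \<in> rcosets M" using x by (simp add: RI)
    have "x \<in> M #> r (M #> x)" using r(3)[OF d] rcos_self[OF x(1) M] by simp
    then obtain b where b: "b \<in> M" "x = b \<otimes> r (M #> x)" by (auto simp: r_coset_def)
    have "e = (N #> b) #> r (M #> x)"
      using b x r(2)[OF d] sN sM by (simp add: coset_mult_assoc subsetD)
    moreover have "N #> b \<in> rcosets\<^bsub>G\<lparr>carrier := M\<rparr>\<^esub> N" using b(1) by (auto simp: RCOSETS_def)
    ultimately show "e \<in> ?f ` ((rcosets\<^bsub>G\<lparr>carrier := M\<rparr>\<^esub> N) \<times> (rcosets M))" using d by force
  qed
  show ?thesis using inj im by (auto simp: bij_betw_def)
qed

lemma (in group_hom) order_dvd_surj:
  assumes "h ` carrier G = carrier H"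
  shows "order H dvd order G"
proof -
  have "order (G Mod kernel G H h) = order H"
    using FactGroup_iso_set[OF assms] by (intro iso_same_order)
  moreover have "order (G Mod kernel G H h) = card (rcosets (kernel G H h))"
    by (simp add: order_def FactGroup_def)
  ultimately show ?thesis using G.lagrange[OF subgroup_kernel] by (metis dvd_triv_left)
qed

section \<open>Tori\<close>

text \<open>The groups isomorphic to a finite power of \<open>Z/p^\<infinity>\<close>, described without reference to an isomorphism
  so that extensions can be treated elementwise. The last clause bounds the rank.\<close>

definition p_torus :: "nat \<Rightarrow> ('a, 'b) monoid_scheme \<Rightarrow> bool" where
  "p_torus p G \<longleftrightarrow> comm_group G
     \<and> (\<forall>x \<in> carrier G. \<exists>n. x [^]\<^bsub>G\<^esub> (p ^ n) = \<one>\<^bsub>G\<^esub>)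
     \<and> (\<forall>x \<in> carrier G. \<exists>y \<in> carrier G. y [^]\<^bsub>G\<^esub> p = x)
     \<and> finite {x \<in> carrier G. x [^]\<^bsub>G\<^esub> p = \<one>\<^bsub>G\<^esub>}"

lemma p_torusD:
  assumes "p_torus p G"
  shows "comm_group G" "group G"
    "x \<in> carrier G \<Longrightarrow> \<exists>n. x [^]\<^bsub>G\<^esub> (p ^ n) = \<one>\<^bsub>G\<^esub>"
    "x \<in> carrier G \<Longrightarrow> \<exists>y \<in> carrier G. y [^]\<^bsub>G\<^esub> p = x"
    "finite {x \<in> carrier G. x [^]\<^bsub>G\<^esub> p = \<one>\<^bsub>G\<^esub>}"
  using assms comm_group.axioms by (auto simp: p_torus_def)

lemma p_torus_divisible:
  assumes "p_torus p G" "x \<in> carrier G"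
  shows "\<exists>y \<in> carrier G. y [^]\<^bsub>G\<^esub> (p ^ n) = x"
proof (induction n)
  case 0
  interpret group G using p_torusD(2)[OF assms(1)] .
  show ?case using assms(2) by auto
next
  case (Suc n)
  interpret group G using p_torusD(2)[OF assms(1)] .
  from Suc obtain y where y: "y \<in> carrier G" "y [^]\<^bsub>G\<^esub> (p ^ n) = x" by blast
  obtain z where z: "z \<in> carrier G" "z [^]\<^bsub>G\<^esub> p = y" using p_torusD(4)[OF assms(1) y(1)] by blast
  then have "z [^]\<^bsub>G\<^esub> (p ^ Suc n) = x" using y by (metis nat_pow_pow power_Suc)
  then show ?case using z by blast
qed

lemma p_torus_finite_torsion:
  assumes "p_torus p G"
  shows "finite {x \<in> carrier G. x [^]\<^bsub>G\<^esub> (p ^ n) = \<one>\<^bsub>G\<^esub>}"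
proof (induction n)
  case 0
  interpret group G using p_torusD(2)[OF assms(1)] .
  have "{x \<in> carrier G. x [^]\<^bsub>G\<^esub> (p ^ 0) = \<one>\<^bsub>G\<^esub>} \<subseteq> {\<one>\<^bsub>G\<^esub>}" by auto
  then show ?case by (rule finite_subset) simp
next
  case (Suc n)
  interpret comm_group G using p_torusD(1)[OF assms(1)] .
  let ?U = "\<lambda>n. {x \<in> carrier G. x [^]\<^bsub>G\<^esub> (p ^ n) = \<one>\<^bsub>G\<^esub>}"
  have fib: "finite {x \<in> carrier G. x [^]\<^bsub>G\<^esub> p = y}" for y
  proof (cases "\<exists>x0 \<in> carrier G. x0 [^]\<^bsub>G\<^esub> p = y")
    case True
    then obtain x0 where x0: "x0 \<in> carrier G" "x0 [^]\<^bsub>G\<^esub> p = y" by blast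
    have "{x \<in> carrier G. x [^]\<^bsub>G\<^esub> p = y} \<subseteq> (\<lambda>z. z \<otimes>\<^bsub>G\<^esub> x0) ` {x \<in> carrier G. x [^]\<^bsub>G\<^esub> p = \<one>\<^bsub>G\<^esub>}"
    proof
      fix x assume "x \<in> {x \<in> carrier G. x [^]\<^bsub>G\<^esub> p = y}"
      then have x: "x \<in> carrier G" "x [^]\<^bsub>G\<^esub> p = y" by auto
      have "(x \<otimes>\<^bsub>G\<^esub> inv\<^bsub>G\<^esub> x0) [^]\<^bsub>G\<^esub> p = \<one>\<^bsub>G\<^esub>" using x x0
        by (metis inv_closed nat_pow_distrib nat_pow_inv nat_pow_closed r_inv)
      moreover have "x = (x \<otimes>\<^bsub>G\<^esub> inv\<^bsub>G\<^esub> x0) \<otimes>\<^bsub>G\<^esub> x0" using x x0 by (simp add: m_assoc)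
      ultimately show "x \<in> (\<lambda>z. z \<otimes>\<^bsub>G\<^esub> x0) ` {x \<in> carrier G. x [^]\<^bsub>G\<^esub> p = \<one>\<^bsub>G\<^esub>}"
        using x x0 by blast
    qed
    then show ?thesis using p_torusD(5)[OF assms] finite_surj by blast
  next
    case False
    then have "{x \<in> carrier G. x [^]\<^bsub>G\<^esub> p = y} = {}" by blast
    then show ?thesis by (metis finite.emptyI)
  qed
  have "?U (Suc n) \<subseteq> (\<Union>y\<in>?U n. {x \<in> carrier G. x [^]\<^bsub>G\<^esub> p = y})"
    by (auto simp: nat_pow_pow)
  then show ?case using Suc fib by (meson finite_UN_I finite_subset)
qed

text \<open>If the index is \<open>p^j m\<close> with \<open>m\<close> prime to \<open>p\<close>, then every element is a \<open>p^j m\<close>-th power, by divisibility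
  for \<open>p^j\<close> and by torsion for \<open>m\<close>, and such powers lie in \<open>M\<close>.\<close>

lemma p_torus_no_finite_index:
  assumes p: "prime p" and Q: "p_torus p Q" and M: "subgroup M Q" and fin: "finite (rcosets\<^bsub>Q\<^esub> M)"
  shows "M = carrier Q"
proof
  interpret Q: comm_group Q using p_torusD(1)[OF Q] .
  interpret M: subgroup M Q by (rule M)
  show "M \<subseteq> carrier Q" by (rule M.subset)
  have nM: "M \<lhd> Q" using Q.subgroup_imp_normal M by blast
  interpret N: normal M Q by (rule nM)
  interpret F: group "Q Mod M" by (rule N.factorgroup_is_group)
  define n where "n = order (Q Mod M)"
  have "n > 0" unfolding n_def using fin F.order_gt_0_iff_finite by (simp add: FactGroup_def)
  then obtain j m where m: "n = p ^ j * m" "\<not> p dvd m"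
    using p by (metis multiplicity_decompose' not_prime_unit neq0_conv)
  show "carrier Q \<subseteq> M"
  proof
    fix x assume x: "x \<in> carrier Q"
    obtain z where z: "z \<in> carrier Q" "z [^]\<^bsub>Q\<^esub> (p ^ j) = x" using p_torus_divisible[OF Q x] by blast
    obtain f where f: "z [^]\<^bsub>Q\<^esub> (p ^ f) = \<one>\<^bsub>Q\<^esub>" using p_torusD(3)[OF Q z(1)] by blast
    have "coprime m (p ^ f)" using m(2) p by (metis coprime_commute coprime_power_right_iff prime_imp_coprime)
    moreover have "m \<noteq> 0" using m(2) by (metis dvd_0_right)
    ultimately obtain u v where u: "m * u = p ^ f * v + 1"
      using bezout_nat[of m "p ^ f"] by (auto simp: coprime_iff_gcd_eq_1)
    have one: "z [^]\<^bsub>Q\<^esub> (m * u) = z"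
      using z(1) f by (simp add: u Q.nat_pow_pow[symmetric])
    define y where "y = z [^]\<^bsub>Q\<^esub> u"
    have y: "y \<in> carrier Q" using z by (simp add: y_def)
    have "y [^]\<^bsub>Q\<^esub> n = z [^]\<^bsub>Q\<^esub> (m * u * p ^ j)"
      using z by (simp add: y_def m Q.nat_pow_pow ac_simps)
    also have "\<dots> = x" using z one by (simp add: Q.nat_pow_pow[symmetric])
    finally have yn: "y [^]\<^bsub>Q\<^esub> n = x" .
    have "M #>\<^bsub>Q\<^esub> y \<in> carrier (Q Mod M)" using y by (auto simp: carrier_FactGroup)
    then have "(M #>\<^bsub>Q\<^esub> y) [^]\<^bsub>Q Mod M\<^esub> n = M" unfolding n_def using F.pow_order_eq_1 by simp
    then have "M #>\<^bsub>Q\<^esub> x = M" using N.FactGroup_pow[of y n] y yn by simp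
    then show "x \<in> M" using Q.rcos_self[OF x M] by simp
  qed
qed

section \<open>Extensions of tori\<close>

lemma (in group) conj_nat_pow:
  assumes g: "g \<in> carrier G" and x: "x \<in> carrier G"
  shows "(g \<otimes> x \<otimes> inv g) [^] (k :: nat) = g \<otimes> x [^] k \<otimes> inv g"
proof (induction k)
  case (Suc k)
  have "(g \<otimes> x \<otimes> inv g) [^] Suc k = (g \<otimes> x [^] k \<otimes> inv g) \<otimes> (g \<otimes> x \<otimes> inv g)"
    by (simp only: nat_pow_Suc Suc.IH)
  also have "\<dots> = g \<otimes> x [^] Suc k \<otimes> inv g"
  proof -
    have "inv g \<otimes> (g \<otimes> y) = y" if "y \<in> carrier G" for y using g that by (simp add: m_assoc[symmetric])
    then show ?thesis using g x by (simp add: m_assoc)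
  qed
  finally show ?case .
qed (use g in simp)

lemma (in group_hom) fibre_kernel:
  assumes "x \<in> carrier G" "y \<in> carrier G" "h x = h y"
  obtains b where "b \<in> kernel G H h" "x = y \<otimes> b"
proof
  show "inv y \<otimes> x \<in> kernel G H h" using assms by (simp add: kernel_def)
  show "x = y \<otimes> (inv y \<otimes> x)" using assms by (simp add: G.m_assoc[symmetric])
qed

text \<open>The conjugation action on the finite set \<open>B\<close> shows that the centralizer has finite index; hence so
  has its image in the torus \<open>H\<close>.\<close>

lemma (in group_hom) centralizer_surj:
  assumes p: "prime p" and H: "p_torus p H" and surj: "h ` carrier G = carrier H"
    and B: "B \<subseteq> carrier G" "finite B"
    and conj: "\<And>g b. g \<in> carrier G \<Longrightarrow> b \<in> B \<Longrightarrow> g \<otimes> b \<otimes> inv g \<in> B"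
    and C: "C = {g \<in> carrier G. \<forall>b \<in> B. g \<otimes> b = b \<otimes> g}"
  shows "subgroup C G" "h ` C = carrier H"
proof -
  note Bc = subsetD[OF B(1)]
  show sub: "subgroup C G"
  proof (rule G.subgroupI)
    show "C \<subseteq> carrier G" by (auto simp: C)
    have "\<one> \<in> C" using Bc by (simp add: C)
    then show "C \<noteq> {}" by blast
  next
    fix a assume "a \<in> C"
    then have a: "a \<in> carrier G" "\<And>b. b \<in> B \<Longrightarrow> a \<otimes> b = b \<otimes> a" by (auto simp: C)
    have "inv a \<otimes> b = b \<otimes> inv a" if "b \<in> B" for b
      using a(1) a(2)[OF that] Bc[OF that] by (metis G.inv_closed G.inv_solve_left G.inv_solve_right G.m_assoc G.m_closed)
    then show "inv a \<in> C" using a by (simp add: C)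
  next
    fix a b assume "a \<in> C" "b \<in> C"
    then have a: "a \<in> carrier G" "b \<in> carrier G" "\<And>x. x \<in> B \<Longrightarrow> a \<otimes> x = x \<otimes> a" "\<And>x. x \<in> B \<Longrightarrow> b \<otimes> x = x \<otimes> b"
      by (auto simp: C)
    have "a \<otimes> b \<otimes> x = x \<otimes> (a \<otimes> b)" if "x \<in> B" for x
      using a(1,2) a(3,4)[OF that] Bc[OF that] by (metis G.m_assoc)
    then show "a \<otimes> b \<in> C" using a by (simp add: C)
  qed
  \<comment> \<open>Two elements with the same conjugation action on \<open>B\<close> lie in the same coset of \<open>C\<close>.\<close>
  define \<phi> where "\<phi> x = (\<lambda>b\<in>B. inv x \<otimes> b \<otimes> x)" for x
  have \<phi>: "\<phi> x \<in> B \<rightarrow>\<^sub>E B" if "x \<in> carrier G" for x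
    using conj[of "inv x"] that by (auto simp: \<phi>_def)
  have \<phi>_inj: "C #> x = C #> y" if x: "x \<in> carrier G" and y: "y \<in> carrier G" and e: "\<phi> x = \<phi> y" for x y
  proof -
    have "(x \<otimes> inv y) \<otimes> b = b \<otimes> (x \<otimes> inv y)" if b: "b \<in> B" for b
    proof -
      have bc: "b \<in> carrier G" by (rule Bc[OF b])
      have "inv x \<otimes> b \<otimes> x = inv y \<otimes> b \<otimes> y" using fun_cong[OF e, of b] b by (simp add: \<phi>_def)
      then have "x \<otimes> (inv x \<otimes> b \<otimes> x) \<otimes> inv y = x \<otimes> (inv y \<otimes> b \<otimes> y) \<otimes> inv y" by simp
      moreover have "x \<otimes> (inv x \<otimes> b \<otimes> x) = b \<otimes> x" using x bc by (simp add: G.m_assoc[symmetric])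
      moreover have "x \<otimes> (inv y \<otimes> b \<otimes> y) \<otimes> inv y = x \<otimes> inv y \<otimes> b" using x y bc by (simp add: G.m_assoc)
      ultimately have "b \<otimes> x \<otimes> inv y = x \<otimes> inv y \<otimes> b" by simp
      then show ?thesis using x y bc by (simp add: G.m_assoc)
    qed
    then have "x \<otimes> inv y \<in> C" using x y by (simp add: C)
    moreover have "x = (x \<otimes> inv y) \<otimes> y" using x y by (simp add: G.m_assoc)
    ultimately have "x \<in> C #> y" unfolding r_coset_eq by (rule rev_image_eqI)
    then show ?thesis using G.repr_independence[OF _ y sub] by simp
  qed
  have "finite (\<phi> ` carrier G)"
    using \<phi> B(2) by (intro finite_subset[OF _ finite_PiE[of B "\<lambda>_. B"]]) auto
  moreover have "rcosets C \<subseteq> (\<lambda>f. C #> (SOME x. x \<in> carrier G \<and> \<phi> x = f)) ` \<phi> ` carrier G"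
  proof
    fix c assume "c \<in> rcosets C"
    then obtain x where x: "x \<in> carrier G" "c = C #> x" by (rule rcosetsE)
    let ?y = "SOME y. y \<in> carrier G \<and> \<phi> y = \<phi> x"
    have "?y \<in> carrier G \<and> \<phi> ?y = \<phi> x" by (rule someI[of _ x]) (use x in simp)
    then have "C #> ?y = c" using x \<phi>_inj by metis
    then show "c \<in> (\<lambda>f. C #> (SOME x. x \<in> carrier G \<and> \<phi> x = f)) ` \<phi> ` carrier G" using x(1) by blast
  qed
  ultimately have "finite (rcosets C)" using finite_subset by blast
  then have "finite (rcosets\<^bsub>H\<^esub> (h ` C))" by (rule finite_rcosets_image[OF surj sub])
  then show "h ` C = carrier H"
    by (intro p_torus_no_finite_index[OF p H]) (simp_all add: subgroup_img_is_subgroup[OF sub])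
qed

text \<open>The commutator of \<open>x\<close> and \<open>z\<close> is central, so it is multiplicative in both arguments. If
  \<open>h x\<close> is killed by \<open>p^n\<close> and \<open>y\<close> is, up to the kernel, the \<open>p^n\<close>-th power of \<open>z\<close>, then
  \<open>[x, y] = [x, z]^(p^n) = [x^(p^n), z] = 1\<close>.\<close>

lemma (in group_hom) commutative_of_central_kernel:
  assumes H: "p_torus p H" and C: "subgroup C G" and hC: "h ` C = carrier H"
    and cen: "\<And>c b. c \<in> C \<Longrightarrow> b \<in> kernel G H h \<Longrightarrow> c \<otimes> b = b \<otimes> c"
    and x: "x \<in> C" and y: "y \<in> C"
  shows "x \<otimes> y = y \<otimes> x"
proof -
  interpret H: comm_group H using p_torusD(1)[OF H] .
  note Cc = subgroup.mem_carrier[OF C]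
  have xc[simp]: "x \<in> carrier G" and yc[simp]: "y \<in> carrier G" using x y Cc by auto
  obtain n where n: "h x [^]\<^bsub>H\<^esub> (p ^ n) = \<one>\<^bsub>H\<^esub>" using p_torusD(3)[OF H, of "h x"] by auto
  define N where "N = p ^ n"
  obtain u where "u \<in> carrier H" "u [^]\<^bsub>H\<^esub> N = h y" using p_torus_divisible[OF H, of "h y"] by (auto simp: N_def)
  then obtain z where z: "z \<in> C" "h z [^]\<^bsub>H\<^esub> N = h y" using hC by force
  have zc[simp]: "z \<in> carrier G" using z Cc by auto
  obtain b where b: "b \<in> kernel G H h" "y = z [^] N \<otimes> b"
    using fibre_kernel[of y "z [^] N"] z by (auto simp: hom_nat_pow)
  have bc[simp]: "b \<in> carrier G" using b by (simp add: kernel_def)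
  define w where "w = x \<otimes> z \<otimes> inv x \<otimes> inv z"
  have wc[simp]: "w \<in> carrier G" by (simp add: w_def)
  have "h w = h x \<otimes>\<^bsub>H\<^esub> h z \<otimes>\<^bsub>H\<^esub> (inv\<^bsub>H\<^esub> h x \<otimes>\<^bsub>H\<^esub> inv\<^bsub>H\<^esub> h z)"
    by (simp add: w_def H.m_assoc)
  also have "\<dots> = \<one>\<^bsub>H\<^esub>" by (simp add: H.inv_mult[symmetric])
  finally have wk: "w \<in> kernel G H h" by (simp add: kernel_def)
  have xz: "x \<otimes> z = w \<otimes> (z \<otimes> x)" by (simp add: w_def G.m_assoc G.inv_solve_left')
  have xw: "x \<otimes> w = w \<otimes> x" and zw: "z \<otimes> w = w \<otimes> z" using cen wk x z by auto
  have 1: "x [^] k \<otimes> z = w [^] k \<otimes> (z \<otimes> x [^] k)" for k :: nat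
  proof (induction k)
    case (Suc k)
    have "x [^] Suc k \<otimes> z = x [^] k \<otimes> (w \<otimes> (z \<otimes> x))" by (simp add: G.m_assoc xz)
    also have "\<dots> = (x [^] k \<otimes> w) \<otimes> (z \<otimes> x)" by (simp add: G.m_assoc)
    also have "\<dots> = (w \<otimes> x [^] k) \<otimes> (z \<otimes> x)" using G.group_commutes_pow[OF xw] by simp
    also have "\<dots> = w \<otimes> (x [^] k \<otimes> z) \<otimes> x" by (simp add: G.m_assoc)
    also have "\<dots> = (w \<otimes> w [^] k) \<otimes> (z \<otimes> x [^] Suc k)" by (simp add: Suc.IH G.m_assoc)
    also have "w \<otimes> w [^] k = w [^] Suc k" using G.nat_pow_Suc2 by simp
    finally show ?case .
  qed simp
  have 2: "x \<otimes> z [^] k = w [^] k \<otimes> (z [^] k \<otimes> x)" for k :: nat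
  proof (induction k)
    case (Suc k)
    have "x \<otimes> z [^] Suc k = (x \<otimes> z [^] k) \<otimes> z" by (simp add: G.m_assoc)
    also have "\<dots> = w [^] k \<otimes> (z [^] k \<otimes> (x \<otimes> z))" by (simp add: Suc.IH G.m_assoc)
    also have "\<dots> = w [^] k \<otimes> ((z [^] k \<otimes> w) \<otimes> (z \<otimes> x))" by (simp add: xz G.m_assoc)
    also have "z [^] k \<otimes> w = w \<otimes> z [^] k" using G.group_commutes_pow[OF zw] by simp
    also have "w [^] k \<otimes> ((w \<otimes> z [^] k) \<otimes> (z \<otimes> x)) = w [^] Suc k \<otimes> (z [^] Suc k \<otimes> x)" by (simp add: G.m_assoc)
    finally show ?case .
  qed simp
  have "x [^] N \<in> kernel G H h" using n by (simp add: kernel_def hom_nat_pow N_def)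
  then have "x [^] N \<otimes> z = z \<otimes> x [^] N" using cen[OF z(1)] by simp
  then have "w [^] N \<otimes> (z \<otimes> x [^] N) = \<one> \<otimes> (z \<otimes> x [^] N)" using 1[of N] by simp
  then have wN: "w [^] N = \<one>" using G.right_cancel[of "z \<otimes> x [^] N" "w [^] N" \<one>] by simp
  have "x \<otimes> y = (x \<otimes> z [^] N) \<otimes> b" by (simp add: b(2) G.m_assoc)
  also have "\<dots> = z [^] N \<otimes> (x \<otimes> b)" using 2[of N] by (simp add: wN G.m_assoc)
  also have "\<dots> = y \<otimes> x" using cen[OF x b(1)] by (simp add: b(2) G.m_assoc)
  finally show ?thesis .
qed

text \<open>For each \<open>n\<close> the \<open>p^n\<close>-torsion of the kernel is a finite set normalized by \<open>G\<close>, so it is centralized by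
  a subgroup that maps onto \<open>H\<close> and contains the kernel, that is, by \<open>G\<close>. Thus the kernel is central
  and \<open>G\<close> is commutative.\<close>

lemma (in group_hom) p_torus_extension:
  assumes p: "prime p" and H: "p_torus p H" and surj: "h ` carrier G = carrier H"
    and K: "p_torus p (G\<lparr>carrier := kernel G H h\<rparr>)"
  shows "p_torus p G"
proof -
  interpret H: comm_group H using p_torusD(1)[OF H] .
  let ?K = "kernel G H h"
  have pow: "x [^]\<^bsub>G\<lparr>carrier := ?K\<rparr>\<^esub> n = x [^] n" for x and n :: nat by (metis G.nat_pow_consistent)
  interpret K: comm_group "G\<lparr>carrier := ?K\<rparr>" using p_torusD(1)[OF K] .
  have Kc: "x \<in> ?K \<Longrightarrow> x \<in> carrier G" for x by (simp add: kernel_def)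
  have Kcomm: "x \<in> ?K \<Longrightarrow> y \<in> ?K \<Longrightarrow> x \<otimes> y = y \<otimes> x" for x y using K.m_comm[of x y] by simp
  have Ktors: "\<exists>n. x [^] (p ^ n) = \<one>" if "x \<in> ?K" for x using p_torusD(3)[OF K, of x] that by (simp add: pow)
  have Kdiv: "\<exists>y \<in> ?K. y [^] p = x" if "x \<in> ?K" for x using p_torusD(4)[OF K, of x] that by (simp add: pow)
  have cen: "c \<otimes> a = a \<otimes> c" if c: "c \<in> carrier G" and a: "a \<in> ?K" for c a
  proof -
    obtain n where n: "a [^] (p ^ n) = \<one>" using Ktors[OF a] by blast
    define B where "B = {a \<in> ?K. a [^] (p ^ n) = \<one>}"
    have fin: "finite B" using p_torus_finite_torsion[OF K, of n] by (simp add: B_def pow)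
    define C where "C = {g \<in> carrier G. \<forall>b \<in> B. g \<otimes> b = b \<otimes> g}"
    have conj: "g \<otimes> b \<otimes> inv g \<in> B" if g: "g \<in> carrier G" and b: "b \<in> B" for g b
    proof -
      have bc: "b \<in> carrier G" "b \<in> ?K" "b [^] (p ^ n) = \<one>" using b Kc by (auto simp: B_def)
      have "g \<otimes> b \<otimes> inv g \<in> ?K" using g bc by (simp add: kernel_def)
      moreover have "(g \<otimes> b \<otimes> inv g) [^] (p ^ n) = \<one>" using g bc by (simp add: G.conj_nat_pow)
      ultimately show ?thesis using g bc by (simp add: B_def)
    qed
    have Bc: "B \<subseteq> carrier G" using Kc by (auto simp: B_def)
    note CC = centralizer_surj[OF p H surj Bc fin conj C_def]
    have "c \<in> C"
    proof -
      obtain c' where c': "c' \<in> C" "h c' = h c" using CC(2) c by (metis hom_closed imageE)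
      have cc: "c' \<in> carrier G" using c' by (simp add: C_def)
      obtain b where b: "b \<in> ?K" "c = c' \<otimes> b" using fibre_kernel[OF c cc] c' by metis
      have "b \<in> C" using b(1) Kcomm Kc by (auto simp: C_def B_def)
      then show ?thesis using CC(1) c'(1) b(2) subgroup.m_closed by metis
    qed
    moreover have "a \<in> B" using a n by (simp add: B_def)
    ultimately show ?thesis by (simp add: C_def)
  qed
  have comm: "x \<otimes> y = y \<otimes> x" if "x \<in> carrier G" "y \<in> carrier G" for x y
    using commutative_of_central_kernel[OF H G.subgroup_self surj] cen that by blast
  interpret CG: comm_group G by (rule G.group_comm_groupI) (use comm in auto)
  show ?thesis
    unfolding p_torus_def
  proof (intro conjI ballI)
    show "comm_group G" by (rule CG.comm_group_axioms)
  next
    fix x assume x: "x \<in> carrier G"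
    obtain n where "h x [^]\<^bsub>H\<^esub> (p ^ n) = \<one>\<^bsub>H\<^esub>" using p_torusD(3)[OF H hom_closed[OF x]] ..
    then have xK: "x [^] (p ^ n) \<in> ?K" using x by (simp add: kernel_def hom_nat_pow)
    obtain m where m: "(x [^] (p ^ n)) [^] (p ^ m) = \<one>" using Ktors[OF xK] ..
    have "x [^] (p ^ (n + m)) = (x [^] (p ^ n)) [^] (p ^ m)"
      by (simp only: G.nat_pow_pow[OF x] power_add)
    also note m
    finally have "x [^] (p ^ (n + m)) = \<one>" .
    then show "\<exists>n. x [^] (p ^ n) = \<one>" ..
  next
    fix x assume x: "x \<in> carrier G"
    obtain u where "u \<in> carrier H" "u [^]\<^bsub>H\<^esub> p = h x" using p_torusD(4)[OF H hom_closed[OF x]] by blast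
    then obtain y where y: "y \<in> carrier G" "h y [^]\<^bsub>H\<^esub> p = h x" using surj by (metis imageE)
    obtain b where b: "b \<in> ?K" "x = y [^] p \<otimes> b"
      using fibre_kernel[of x "y [^] p"] x y by (auto simp: hom_nat_pow)
    obtain c where c: "c \<in> ?K" "c [^] p = b" using Kdiv[OF b(1)] by metis
    have "(y \<otimes> c) [^] p = x" using y b c Kc by (simp add: CG.nat_pow_distrib)
    then show "\<exists>y\<in>carrier G. y [^] p = x" using y c Kc G.m_closed by metis
  next
    let ?T = "{x \<in> carrier G. x [^] p = \<one>}"
    let ?TK = "{x \<in> ?K. x [^] p = \<one>}"
    have fK: "finite ?TK" using p_torusD(5)[OF K] by (simp add: pow)
    have "finite (h ` ?T)"
      by (rule finite_subset[OF _ p_torusD(5)[OF H]]) (auto simp: hom_nat_pow[symmetric])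
    moreover have "finite {x \<in> ?T. h x = u}" for u
    proof (cases "\<exists>x0 \<in> ?T. h x0 = u")
      case True
      then obtain x0 where x0: "x0 \<in> carrier G" "x0 [^] p = \<one>" "h x0 = u" by auto
      have "{x \<in> ?T. h x = u} \<subseteq> (\<lambda>b. x0 \<otimes> b) ` ?TK"
      proof
        fix x assume "x \<in> {x \<in> ?T. h x = u}"
        then have x: "x \<in> carrier G" "x [^] p = \<one>" "h x = u" by auto
        obtain b where b: "b \<in> ?K" "x = x0 \<otimes> b" using fibre_kernel[OF x(1) x0(1)] x x0 by metis
        have "b [^] p = \<one>" using x x0 b Kc[OF b(1)] by (simp add: CG.nat_pow_distrib)
        then show "x \<in> (\<lambda>b. x0 \<otimes> b) ` ?TK" using b by blast
      qed
      then show ?thesis using fK finite_surj by blast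
    next
      case False
      then have "{x \<in> ?T. h x = u} = {}" by blast
      then show ?thesis by (metis finite.emptyI)
    qed
    moreover have "?T = (\<Union>u \<in> h ` ?T. {x \<in> ?T. h x = u})" by blast
    ultimately show "finite ?T" by (metis (no_types, lifting) finite_UN_I)
  qed
qed

text \<open>The intrinsic form of \<open>discrete_p_toral\<close>; see \<open>virtual_p_torus_iff_discrete_p_toral\<close>.\<close>

definition virtual_p_torus :: "nat \<Rightarrow> ('a, 'b) monoid_scheme \<Rightarrow> bool" where
  "virtual_p_torus p G \<longleftrightarrow> group G \<and> (\<exists>N k. N \<lhd> G \<and> p_torus p (G\<lparr>carrier := N\<rparr>)
     \<and> finite (rcosets\<^bsub>G\<^esub> N) \<and> card (rcosets\<^bsub>G\<^esub> N) = p ^ k)"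

lemma (in group) torus_eq_powers:
  assumes N: "N \<lhd> G" and torus: "p_torus p (G\<lparr>carrier := N\<rparr>)" and k: "card (rcosets N) = p ^ k"
  shows "N = (\<lambda>x. x [^] (p ^ k)) ` carrier G"
proof
  have sN: "N \<subseteq> carrier G" using normal_imp_subgroup[OF N] subgroup.subset by blast
  interpret F: group "G Mod N" using normal.factorgroup_is_group[OF N] .
  have "order (G Mod N) = p ^ k" using k by (simp add: order_def FactGroup_def)
  show "N \<subseteq> (\<lambda>x. x [^] (p ^ k)) ` carrier G"
  proof
    fix x assume "x \<in> N"
    then obtain y where "y \<in> N" "y [^] (p ^ k) = x"
      using p_torus_divisible[OF torus, of x k] by (auto simp: nat_pow_consistent[symmetric])
    then show "x \<in> (\<lambda>x. x [^] (p ^ k)) ` carrier G" using sN by auto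
  qed
  show "(\<lambda>x. x [^] (p ^ k)) ` carrier G \<subseteq> N"
  proof clarify
    fix x assume x: "x \<in> carrier G"
    then have "N #> x \<in> carrier (G Mod N)" by (simp add: carrier_FactGroup)
    then have "(N #> x) [^]\<^bsub>G Mod N\<^esub> order (G Mod N) = N" using F.pow_order_eq_1 by simp
    then have "N #> (x [^] (p ^ k)) = N"
      using normal.FactGroup_pow[OF N x] \<open>order (G Mod N) = p ^ k\<close> by simp
    then show "x [^] (p ^ k) \<in> N"
      using rcos_self[OF _ normal_imp_subgroup[OF N]] x by (metis nat_pow_closed)
  qed
qed

text \<open>A set of powers is invariant under all automorphisms of \<open>M\<close>, in particular under conjugation by
  elements of \<open>G\<close>.\<close>

lemma (in group) torus_characteristic:
  assumes M: "M \<lhd> G" and N: "N \<lhd> (G\<lparr>carrier := M\<rparr>)" and torus: "p_torus p (G\<lparr>carrier := N\<rparr>)"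
    and k: "card (rcosets\<^bsub>G\<lparr>carrier := M\<rparr>\<^esub> N) = p ^ k"
  shows "N \<lhd> G"
proof -
  have sM: "subgroup M G" using M by (rule normal_imp_subgroup)
  interpret M: group "G\<lparr>carrier := M\<rparr>" using sM by (rule subgroup_imp_group)
  have N_eq: "N = (\<lambda>x. x [^] (p ^ k)) ` M"
    using M.torus_eq_powers[OF N _ k] torus by (simp add: nat_pow_consistent[symmetric])
  have sN: "subgroup N G"
    using incl_subgroup[OF sM] normal_imp_subgroup[OF N] by simp
  have "g \<otimes> x \<otimes> inv g \<in> N" if g: "g \<in> carrier G" and x: "x \<in> N" for g x
  proof -
    obtain y where y: "y \<in> M" "x = y [^] (p ^ k)" using x N_eq by blast
    have "y \<in> carrier G" using y sM subgroup.mem_carrier by metis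
    then have "g \<otimes> x \<otimes> inv g = (g \<otimes> y \<otimes> inv g) [^] (p ^ k)" using g y by (simp add: conj_nat_pow)
    moreover have "g \<otimes> y \<otimes> inv g \<in> M" using M y g normal_inv_iff by blast
    ultimately show ?thesis using N_eq by blast
  qed
  then show ?thesis using sN normal_inv_iff by blast
qed

lemma (in group) virtual_p_torus_of_normal:
  assumes M: "M \<lhd> G" and fin: "finite (rcosets M)" "card (rcosets M) = p ^ l"
    and v: "virtual_p_torus p (G\<lparr>carrier := M\<rparr>)"
  shows "virtual_p_torus p G"
proof -
  have sM: "subgroup M G" using M by (rule normal_imp_subgroup)
  obtain N k where N: "N \<lhd> (G\<lparr>carrier := M\<rparr>)" and torus: "p_torus p (G\<lparr>carrier := N\<rparr>)"
    and k: "finite (rcosets\<^bsub>G\<lparr>carrier := M\<rparr>\<^esub> N)" "card (rcosets\<^bsub>G\<lparr>carrier := M\<rparr>\<^esub> N) = p ^ k"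
    using v unfolding virtual_p_torus_def by auto
  have nN: "N \<lhd> G" by (rule torus_characteristic[OF M N torus k(2)])
  have NM: "N \<subseteq> M" using normal_imp_subgroup[OF N] subgroup.subset by fastforce
  obtain f where f: "bij_betw f ((rcosets\<^bsub>G\<lparr>carrier := M\<rparr>\<^esub> N) \<times> (rcosets M)) (rcosets N)"
    using rcosets_trans[OF normal_imp_subgroup[OF nN] sM NM] by blast
  have "finite (rcosets N)" using bij_betw_finite[OF f] k(1) fin(1) by simp
  moreover have "card (rcosets N) = p ^ (k + l)"
    using bij_betw_same_card[OF f] k fin by (simp add: card_cartesian_product power_add)
  ultimately show ?thesis unfolding virtual_p_torus_def using nN torus is_group by blast
qed

lemma (in group_hom) vimage_normal:
  assumes N: "N \<lhd> H"
  shows "{x \<in> carrier G. h x \<in> N} \<lhd> G"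
proof -
  have sN: "subgroup N H" using N by (rule normal_imp_subgroup)
  have sub: "subgroup {x \<in> carrier G. h x \<in> N} G"
  proof (rule G.subgroupI)
    show "{x \<in> carrier G. h x \<in> N} \<noteq> {}" using subgroup.one_closed[OF sN] G.one_closed hom_one by force
  qed (auto simp: subgroup.m_closed[OF sN] subgroup.m_inv_closed[OF sN])
  have "h (g \<otimes> x \<otimes> inv g) \<in> N" if "g \<in> carrier G" "x \<in> carrier G" "h x \<in> N" for g x
    using that N H.normal_inv_iff by auto
  then show ?thesis using sub by (simp add: G.normal_inv_iff)
qed

lemma (in group_hom) restrict_vimage:
  assumes surj: "h ` carrier G = carrier H" and N: "subgroup N H" and L: "L = {x \<in> carrier G. h x \<in> N}"
  shows "group_hom (G\<lparr>carrier := L\<rparr>) (H\<lparr>carrier := N\<rparr>) h" "h ` L = N"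
    "kernel (G\<lparr>carrier := L\<rparr>) (H\<lparr>carrier := N\<rparr>) h = kernel G H h"
proof -
  have sL: "subgroup L G" by (rule rcosets_vimage(1)[OF surj N L])
  show "group_hom (G\<lparr>carrier := L\<rparr>) (H\<lparr>carrier := N\<rparr>) h"
    using G.subgroup_imp_group[OF sL] H.subgroup_imp_group[OF N]
    by (auto simp: group_hom_def group_hom_axioms_def hom_def L)
  show "h ` L = N"
  proof
    show "N \<subseteq> h ` L"
    proof
      fix k assume "k \<in> N"
      then obtain x where "x \<in> carrier G" "k = h x" using subgroup.subset[OF N] surj by (metis imageE subsetD)
      then show "k \<in> h ` L" using \<open>k \<in> N\<close> by (auto simp: L)
    qed
  qed (auto simp: L)
  show "kernel (G\<lparr>carrier := L\<rparr>) (H\<lparr>carrier := N\<rparr>) h = kernel G H h"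
    using subgroup.one_closed[OF N] by (auto simp: kernel_def L)
qed

text \<open>The centralizer \<open>C\<close> of the kernel maps onto the torus \<open>H\<close> and is commutative. It need not be
  divisible, but a \<open>p\<close>-th root in \<open>H\<close> lifts to one in \<open>C\<close> up to an element of the kernel, and this
  error disappears after raising to the power \<open>p^m\<close>. So the \<open>p^m\<close>-th powers of elements of \<open>C\<close> form a
  torus, and together with the kernel they generate \<open>G\<close>.\<close>

lemma (in group_hom) virtual_p_torus_finite_kernel_torus:
  assumes p: "prime p" and H: "p_torus p H" and surj: "h ` carrier G = carrier H"
    and K: "finite (kernel G H h)" "card (kernel G H h) = p ^ m"
  shows "virtual_p_torus p G"
proof -
  let ?K = "kernel G H h"
  have Kc: "x \<in> ?K \<Longrightarrow> x \<in> carrier G" for x by (simp add: kernel_def)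
  have sK: "subgroup ?K G" by (rule subgroup_kernel)
  interpret K: group "G\<lparr>carrier := ?K\<rparr>" using G.subgroup_imp_group[OF sK] .
  have Kpow: "b [^] (p ^ m) = \<one>" if "b \<in> ?K" for b
    using K.pow_order_eq_1[of b] that K(2) by (simp add: order_def G.nat_pow_consistent[symmetric])
  define C where "C = {g \<in> carrier G. \<forall>b \<in> ?K. g \<otimes> b = b \<otimes> g}"
  have conj: "g \<otimes> b \<otimes> inv g \<in> ?K" if "g \<in> carrier G" "b \<in> ?K" for g b
    using that by (simp add: kernel_def)
  have Ksub: "?K \<subseteq> carrier G" using Kc by blast
  note CC = centralizer_surj[OF p H surj Ksub K(1) conj C_def]
  have Cc: "x \<in> carrier G" if "x \<in> C" for x using that by (simp add: C_def)
  have Ccomm: "x \<otimes> y = y \<otimes> x" if "x \<in> C" "y \<in> C" for x y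
    using commutative_of_central_kernel[OF H CC _ that] by (simp add: C_def)
  have Cnorm: "g \<otimes> c \<otimes> inv g \<in> C" if g: "g \<in> carrier G" and c: "c \<in> C" for g c
  proof -
    have "(g \<otimes> c \<otimes> inv g) \<otimes> b = b \<otimes> (g \<otimes> c \<otimes> inv g)" if b: "b \<in> ?K" for b
    proof -
      define d where "d = inv g \<otimes> b \<otimes> g"
      have d: "d \<in> ?K" using conj[of "inv g" b] g b by (simp add: d_def)
      have bd: "b = g \<otimes> d \<otimes> inv g" unfolding d_def using g Kc[OF b]
        by (simp add: G.m_assoc[symmetric]) (simp add: G.m_assoc)
      have cd: "c \<otimes> d = d \<otimes> c" using c d by (simp add: C_def)
      have e: "inv g \<otimes> (g \<otimes> y) = y" if "y \<in> carrier G" for y using g that by (simp add: G.m_assoc[symmetric])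
      have cd': "c \<otimes> (d \<otimes> y) = d \<otimes> (c \<otimes> y)" if "y \<in> carrier G" for y
        using cd that Cc[OF c] Kc[OF d] by (simp add: G.m_assoc[symmetric])
      show ?thesis unfolding bd using g Cc[OF c] Kc[OF d] by (simp add: G.m_assoc e cd')
    qed
    then show ?thesis using g Cc[OF c] by (simp add: C_def)
  qed
  define P where "P = (\<lambda>c. c [^] (p ^ m)) ` C"
  have Cpow: "c [^] n \<in> C" if "c \<in> C" for c and n :: nat
  proof (induction n)
    case 0 show ?case using subgroup.one_closed[OF CC(1)] by simp
  next
    case (Suc n) then show ?case using subgroup.m_closed[OF CC(1)] that by simp
  qed
  have PC: "P \<subseteq> C" using Cpow by (auto simp: P_def)
  have sP: "subgroup P G"
  proof (rule G.subgroupI)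
    show "P \<subseteq> carrier G" using PC Cc by blast
    show "P \<noteq> {}" using subgroup.one_closed[OF CC(1)] by (auto simp: P_def)
  next
    fix a assume "a \<in> P"
    then obtain c where c: "c \<in> C" "a = c [^] (p ^ m)" by (auto simp: P_def)
    then have "inv a = (inv c) [^] (p ^ m)" using Cc by (simp add: G.nat_pow_inv)
    then show "inv a \<in> P" using c subgroup.m_inv_closed[OF CC(1)] by (auto simp: P_def)
  next
    fix a b assume "a \<in> P" "b \<in> P"
    then obtain c d where c: "c \<in> C" "a = c [^] (p ^ m)" "d \<in> C" "b = d [^] (p ^ m)" by (auto simp: P_def)
    then have "a \<otimes> b = (c \<otimes> d) [^] (p ^ m)" using Cc Ccomm by (simp add: G.pow_mult_distrib)
    then show "a \<otimes> b \<in> P" using c subgroup.m_closed[OF CC(1)] by (auto simp: P_def)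
  qed
  have nP: "P \<lhd> G"
  proof -
    have "g \<otimes> x \<otimes> inv g \<in> P" if g: "g \<in> carrier G" and x: "x \<in> P" for g x
    proof -
      obtain c where c: "c \<in> C" "x = c [^] (p ^ m)" using x by (auto simp: P_def)
      have "g \<otimes> x \<otimes> inv g = (g \<otimes> c \<otimes> inv g) [^] (p ^ m)" using G.conj_nat_pow[OF g Cc[OF c(1)]] c by simp
      then show ?thesis using Cnorm[OF g c(1)] by (auto simp: P_def)
    qed
    then show ?thesis using sP G.normal_inv_iff by blast
  qed
  have fst_lift: "\<exists>c \<in> C. h c [^]\<^bsub>H\<^esub> (p ^ n) = h x" if x: "x \<in> carrier G" for x n
  proof -
    obtain u where u: "u \<in> carrier H" "u [^]\<^bsub>H\<^esub> (p ^ n) = h x"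
      using p_torus_divisible[OF H hom_closed[OF x]] by blast
    then obtain c where "c \<in> C" "u = h c" using CC(2) by (metis imageE)
    then show ?thesis using u by blast
  qed
  \<comment> \<open>Since \<open>H\<close> is divisible, already the \<open>p^m\<close>-th powers of elements of \<open>C\<close> map onto \<open>H\<close>.\<close>
  have decomp: "\<exists>c \<in> P. \<exists>b \<in> ?K. x = c \<otimes> b" if x: "x \<in> carrier G" for x
  proof -
    obtain c where c: "c \<in> C" "h c [^]\<^bsub>H\<^esub> (p ^ m) = h x" using fst_lift[OF x] by blast
    have "h x = h (c [^] (p ^ m))" using c Cc[OF c(1)] by (simp add: hom_nat_pow)
    then obtain b where "b \<in> ?K" "x = c [^] (p ^ m) \<otimes> b"
      using fibre_kernel[of x "c [^] (p ^ m)"] x Cc[OF c(1)] by auto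
    then show ?thesis using c by (auto simp: P_def)
  qed
  have torus: "p_torus p (G\<lparr>carrier := P\<rparr>)"
  proof -
    have pow: "x [^]\<^bsub>G\<lparr>carrier := P\<rparr>\<^esub> n = x [^] n" for x and n :: nat by (metis G.nat_pow_consistent)
    interpret P: group "G\<lparr>carrier := P\<rparr>" using G.subgroup_imp_group[OF sP] .
    have 1: "comm_group (G\<lparr>carrier := P\<rparr>)"
      by (rule P.group_comm_groupI) (use PC Ccomm in auto)
    have 2: "\<exists>n. x [^] (p ^ n) = \<one>" if "x \<in> P" for x
    proof -
      have xc: "x \<in> carrier G" using that PC Cc by blast
      obtain n where "h x [^]\<^bsub>H\<^esub> (p ^ n) = \<one>\<^bsub>H\<^esub>" using p_torusD(3)[OF H hom_closed[OF xc]] ..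
      then have "x [^] (p ^ n) \<in> ?K" using xc by (simp add: kernel_def hom_nat_pow)
      then have "(x [^] (p ^ n)) [^] (p ^ m) = \<one>" by (rule Kpow)
      then have "x [^] (p ^ (n + m)) = \<one>" by (simp only: G.nat_pow_pow[OF xc] power_add)
      then show ?thesis ..
    qed
    have 3: "\<exists>y \<in> P. y [^] p = x" if xP: "x \<in> P" for x
    proof -
      obtain c where c: "c \<in> C" "x = c [^] (p ^ m)" using xP by (auto simp: P_def)
      obtain d where d: "d \<in> C" "h d [^]\<^bsub>H\<^esub> p = h c" using fst_lift[OF Cc[OF c(1)], of 1] by auto
      have dc: "d \<in> carrier G" and cc: "c \<in> carrier G" using Cc c d by auto
      obtain b where b: "b \<in> ?K" "c = d [^] p \<otimes> b"
        using fibre_kernel[of c "d [^] p"] c d dc cc by (auto simp: hom_nat_pow)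
      have "d [^] p \<otimes> b = b \<otimes> d [^] p" using Cpow[OF d(1)] b by (simp add: C_def)
      then have "x = (d [^] p) [^] (p ^ m) \<otimes> b [^] (p ^ m)"
        unfolding c(2) b(2) using dc Kc[OF b(1)] by (intro G.pow_mult_distrib) simp_all
      also have "\<dots> = (d [^] (p ^ m)) [^] p"
        using Kpow[OF b(1)] dc by (simp add: G.nat_pow_pow mult.commute)
      finally show ?thesis using d by (auto simp: P_def)
    qed
    have 4: "finite {x \<in> P. x [^] p = \<one>}"
    proof -
      let ?T = "{x \<in> P. x [^] p = \<one>}"
      have Tc: "x \<in> carrier G" if "x \<in> ?T" for x using that PC Cc by blast
      have "h ` ?T \<subseteq> {y \<in> carrier H. y [^]\<^bsub>H\<^esub> p = \<one>\<^bsub>H\<^esub>}"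
      proof clarify
        fix x assume "x \<in> P" "x [^] p = \<one>"
        moreover then have "x \<in> carrier G" using Tc by blast
        ultimately show "h x \<in> carrier H \<and> h x [^]\<^bsub>H\<^esub> p = \<one>\<^bsub>H\<^esub>" by (simp add: hom_nat_pow[symmetric])
      qed
      then have "finite (h ` ?T)" using p_torusD(5)[OF H] finite_subset by blast
      moreover have "finite {x \<in> ?T. h x = u}" for u
      proof (cases "\<exists>x0 \<in> ?T. h x0 = u")
        case True
        then obtain x0 where x0: "x0 \<in> ?T" "h x0 = u" by blast
        have "{x \<in> ?T. h x = u} \<subseteq> (\<lambda>b. x0 \<otimes> b) ` ?K"
        proof
          fix x assume x: "x \<in> {x \<in> ?T. h x = u}"
          then have "x \<in> ?T" by blast
          obtain b where "b \<in> ?K" "x = x0 \<otimes> b"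
            using fibre_kernel[OF Tc[OF \<open>x \<in> ?T\<close>] Tc[OF x0(1)]] x x0 by auto
          then show "x \<in> (\<lambda>b. x0 \<otimes> b) ` ?K" by blast
        qed
        then show ?thesis using K(1) finite_surj by blast
      next
        case False
        then have "{x \<in> ?T. h x = u} = {}" by blast
        then show ?thesis by (metis finite.emptyI)
      qed
      moreover have "?T = (\<Union>u \<in> h ` ?T. {x \<in> ?T. h x = u})" by blast
      ultimately show ?thesis by (metis (no_types, lifting) finite_UN_I)
    qed
    show ?thesis unfolding p_torus_def using 1 2 3 4 by (simp add: pow)
  qed
  let ?q = "\<lambda>b. P #> b"
  interpret F: group "G Mod P" using normal.factorgroup_is_group[OF nP] .
  have "?q \<in> hom (G\<lparr>carrier := ?K\<rparr>) (G Mod P)"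
    using normal.rcos_sum[OF nP] Kc by (auto simp: hom_def carrier_FactGroup)
  then interpret q: group_hom "G\<lparr>carrier := ?K\<rparr>" "G Mod P" ?q
    by unfold_locales
  have "?q ` ?K = rcosets P"
  proof (intro equalityI subsetI)
    fix c assume "c \<in> ?q ` ?K"
    then show "c \<in> rcosets P" using Kc by (auto simp: RCOSETS_def)
  next
    fix e assume "e \<in> rcosets P"
    then obtain x where x: "x \<in> carrier G" "e = P #> x" by (rule rcosetsE)
    obtain c b where cb: "c \<in> P" "b \<in> ?K" "x = c \<otimes> b" using decomp[OF x(1)] by blast
    have cc: "c \<in> carrier G" using cb PC Cc by blast
    have "P #> x = P #> c #> b"
      using cb cc Kc[OF cb(2)] subgroup.subset[OF sP] by (simp add: G.coset_mult_assoc)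
    then have "P #> x = P #> b" using G.coset_join2[OF cc sP cb(1)] by simp
    then show "e \<in> ?q ` ?K" using x cb by blast
  qed
  then have "order (G Mod P) dvd order (G\<lparr>carrier := ?K\<rparr>)"
    by (intro q.order_dvd_surj) (simp add: FactGroup_def)
  then have dvd: "card (rcosets P) dvd p ^ m" using K(2) by (simp add: order_def FactGroup_def)
  have "finite (rcosets P)"
  proof (rule ccontr)
    assume "infinite (rcosets P)"
    then have "card (rcosets P) = 0" by simp
    then have "p ^ m = 0" using dvd by simp
    then show False using p by (simp add: prime_gt_0_nat)
  qed
  moreover obtain j where "card (rcosets P) = p ^ j" using dvd p divides_primepow_nat by blast
  ultimately show ?thesis unfolding virtual_p_torus_def using nP torus G.is_group by blast
qed

lemma (in group_hom) virtual_p_torus_finite_kernel: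
  assumes p: "prime p" and H: "virtual_p_torus p H" and surj: "h ` carrier G = carrier H"
    and K: "finite (kernel G H h)" "card (kernel G H h) = p ^ m"
  shows "virtual_p_torus p G"
proof -
  obtain N k where N: "N \<lhd> H" and torus: "p_torus p (H\<lparr>carrier := N\<rparr>)"
    and k: "finite (rcosets\<^bsub>H\<^esub> N)" "card (rcosets\<^bsub>H\<^esub> N) = p ^ k"
    using H unfolding virtual_p_torus_def by auto
  define L where "L = {x \<in> carrier G. h x \<in> N}"
  have sN: "subgroup N H" using N by (rule normal_imp_subgroup)
  note r = restrict_vimage[OF surj sN L_def]
  have bij: "bij_betw ((`) h) (rcosets L) (rcosets\<^bsub>H\<^esub> N)" by (rule rcosets_vimage(2)[OF surj sN L_def])
  have "virtual_p_torus p (G\<lparr>carrier := L\<rparr>)"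
    by (rule group_hom.virtual_p_torus_finite_kernel_torus[OF r(1) p torus]) (use r(2,3) K in simp_all)
  moreover have "L \<lhd> G" unfolding L_def by (rule vimage_normal[OF N])
  ultimately show ?thesis
    using G.virtual_p_torus_of_normal bij_betw_finite[OF bij] bij_betw_same_card[OF bij] k by simp
qed

lemma (in group_hom) virtual_p_torus_torus_kernel:
  assumes p: "prime p" and H: "virtual_p_torus p H" and surj: "h ` carrier G = carrier H"
    and K: "p_torus p (G\<lparr>carrier := kernel G H h\<rparr>)"
  shows "virtual_p_torus p G"
proof -
  obtain N k where N: "N \<lhd> H" and torus: "p_torus p (H\<lparr>carrier := N\<rparr>)"
    and k: "finite (rcosets\<^bsub>H\<^esub> N)" "card (rcosets\<^bsub>H\<^esub> N) = p ^ k"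
    using H unfolding virtual_p_torus_def by auto
  define L where "L = {x \<in> carrier G. h x \<in> N}"
  have sN: "subgroup N H" using N by (rule normal_imp_subgroup)
  note r = restrict_vimage[OF surj sN L_def]
  have bij: "bij_betw ((`) h) (rcosets L) (rcosets\<^bsub>H\<^esub> N)" by (rule rcosets_vimage(2)[OF surj sN L_def])
  have "p_torus p (G\<lparr>carrier := L\<rparr>)"
    by (rule group_hom.p_torus_extension[OF r(1) p torus]) (use r(2,3) K in simp_all)
  moreover have "L \<lhd> G" unfolding L_def by (rule vimage_normal[OF N])
  ultimately show ?thesis unfolding virtual_p_torus_def
    using bij_betw_finite[OF bij] bij_betw_same_card[OF bij] k G.is_group by auto
qed

text \<open>Modulo the torus \<open>N\<close> of the kernel, \<open>G\<close> is an extension with finite kernel; and \<open>G\<close> itself is an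
  extension of that quotient by the torus \<open>N\<close>.\<close>

theorem (in group_hom) virtual_p_torus_extension:
  assumes p: "prime p" and H: "virtual_p_torus p H" and surj: "h ` carrier G = carrier H"
    and K: "virtual_p_torus p (G\<lparr>carrier := kernel G H h\<rparr>)"
  shows "virtual_p_torus p G"
proof -
  let ?K = "kernel G H h"
  obtain N k where N: "N \<lhd> (G\<lparr>carrier := ?K\<rparr>)" and torus: "p_torus p (G\<lparr>carrier := N\<rparr>)"
    and k: "finite (rcosets\<^bsub>G\<lparr>carrier := ?K\<rparr>\<^esub> N)" "card (rcosets\<^bsub>G\<lparr>carrier := ?K\<rparr>\<^esub> N) = p ^ k"
    using K unfolding virtual_p_torus_def by auto
  have nN: "N \<lhd> G" by (rule G.torus_characteristic[OF normal_kernel N torus k(2)])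
  have sN: "subgroup N G" using nN by (rule normal_imp_subgroup)
  have NK: "N \<subseteq> ?K" using normal_imp_subgroup[OF N] subgroup.subset by fastforce
  interpret F: group "G Mod N" using normal.factorgroup_is_group[OF nN] .
  have resp: "h x = h y" if x: "x \<in> carrier G" and y: "y \<in> carrier G" and e: "N #> x = N #> y" for x y
  proof -
    have "x \<in> N #> y" using G.rcos_self[OF x sN] e by simp
    then obtain n where "n \<in> N" "x = n \<otimes> y" by (auto simp: r_coset_eq)
    moreover then have "h n = \<one>\<^bsub>H\<^esub>" "n \<in> carrier G" using NK by (auto simp: kernel_def)
    ultimately show ?thesis using y by simp
  qed
  obtain g where g: "g \<in> hom (G Mod N) H" "\<And>x. x \<in> carrier G \<Longrightarrow> g (N #> x) = h x"
    using FactGroup_universal[OF homh nN resp] by blast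
  interpret g: group_hom "G Mod N" H g by unfold_locales (rule g(1))
  have "kernel (G Mod N) H g = rcosets\<^bsub>G\<lparr>carrier := ?K\<rparr>\<^esub> N"
    using g(2) by (auto simp: kernel_def carrier_FactGroup RCOSETS_def)
  moreover have "g ` carrier (G Mod N) = carrier H"
    using g(2) surj by (simp add: carrier_FactGroup image_image)
  ultimately have F: "virtual_p_torus p (G Mod N)"
    using g.virtual_p_torus_finite_kernel[OF p H] k by simp
  have "(\<lambda>x. N #> x) \<in> hom G (G Mod N)" by (rule normal.r_coset_hom_Mod[OF nN])
  then interpret q: group_hom G "G Mod N" "\<lambda>x. N #> x" by unfold_locales
  have "kernel G (G Mod N) (\<lambda>x. N #> x) = N"
    using G.coset_join1[OF _ _ sN] G.coset_join2[OF _ sN] subgroup.subset[OF sN] by (auto simp: kernel_def)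
  then show ?thesis using q.virtual_p_torus_torus_kernel[OF p F] torus by (simp add: carrier_FactGroup)
qed

section \<open>The structure of tori\<close>

lemma p_torus_iso:
  assumes f: "f \<in> iso G H" and H: "group H" and G: "p_torus p G"
  shows "p_torus p H"
proof -
  interpret G: comm_group G using p_torusD(1)[OF G] .
  interpret H: group H by (rule H)
  interpret f: group_hom G H f using f by unfold_locales (simp add: iso_def)
  have inj: "inj_on f (carrier G)" and surj: "f ` carrier G = carrier H"
    using f by (auto simp: iso_def bij_betw_def)
  have cH: "comm_group H" using G.iso_imp_comm_group is_isoI[OF f] H.is_monoid by blast
  have ex: "\<exists>x \<in> carrier G. y = f x" if "y \<in> carrier H" for y using that surj by blast
  show ?thesis unfolding p_torus_def
  proof (intro conjI ballI)
    show "comm_group H" by (rule cH)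
  next
    fix y assume "y \<in> carrier H"
    then obtain x where x: "x \<in> carrier G" "y = f x" using ex by blast
    obtain n where "x [^]\<^bsub>G\<^esub> (p ^ n) = \<one>\<^bsub>G\<^esub>" using p_torusD(3)[OF G x(1)] ..
    then have "y [^]\<^bsub>H\<^esub> (p ^ n) = \<one>\<^bsub>H\<^esub>" using x by (simp add: f.hom_nat_pow[symmetric])
    then show "\<exists>n. y [^]\<^bsub>H\<^esub> (p ^ n) = \<one>\<^bsub>H\<^esub>" ..
  next
    fix y assume "y \<in> carrier H"
    then obtain x where x: "x \<in> carrier G" "y = f x" using ex by blast
    obtain u where "u \<in> carrier G" "u [^]\<^bsub>G\<^esub> p = x" using p_torusD(4)[OF G x(1)] by blast
    then have "f u \<in> carrier H" "f u [^]\<^bsub>H\<^esub> p = y" using x by (auto simp: f.hom_nat_pow)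
    then show "\<exists>u\<in>carrier H. u [^]\<^bsub>H\<^esub> p = y" ..
  next
    have "{y \<in> carrier H. y [^]\<^bsub>H\<^esub> p = \<one>\<^bsub>H\<^esub>} \<subseteq> f ` {x \<in> carrier G. x [^]\<^bsub>G\<^esub> p = \<one>\<^bsub>G\<^esub>}"
    proof
      fix y assume y: "y \<in> {y \<in> carrier H. y [^]\<^bsub>H\<^esub> p = \<one>\<^bsub>H\<^esub>}"
      then obtain x where x: "x \<in> carrier G" "y = f x" using ex by blast
      then have "f (x [^]\<^bsub>G\<^esub> p) = f \<one>\<^bsub>G\<^esub>" using y by (simp add: f.hom_nat_pow)
      then have "x [^]\<^bsub>G\<^esub> p = \<one>\<^bsub>G\<^esub>" using inj_onD[OF inj] x(1) by blast
      then show "y \<in> f ` {x \<in> carrier G. x [^]\<^bsub>G\<^esub> p = \<one>\<^bsub>G\<^esub>}" using x by blast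
    qed
    then show "finite {y \<in> carrier H. y [^]\<^bsub>H\<^esub> p = \<one>\<^bsub>H\<^esub>}"
      using p_torusD(5)[OF G] finite_surj by blast
  qed
qed

lemma prufer_carrier: "z \<in> carrier (prufer_group p) \<longleftrightarrow> (\<exists>n. z ^ (p ^ n) = 1)"
  and prufer_mult [simp]: "x \<otimes>\<^bsub>prufer_group p\<^esub> y = x * y"
  and prufer_one [simp]: "\<one>\<^bsub>prufer_group p\<^esub> = 1"
  by (auto simp: prufer_group_def)

lemma prufer_pow [simp]: "z [^]\<^bsub>prufer_group p\<^esub> (n :: nat) = z ^ n"
  by (induction n) auto

lemma comm_group_prufer:
  assumes "p > 0"
  shows "comm_group (prufer_group p)"
proof (rule comm_groupI)
  show "\<exists>y\<in>carrier (prufer_group p). y \<otimes>\<^bsub>prufer_group p\<^esub> z = \<one>\<^bsub>prufer_group p\<^esub>"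
    if z: "z \<in> carrier (prufer_group p)" for z
  proof -
    obtain n where n: "z ^ (p ^ n) = 1" using z by (auto simp: prufer_carrier)
    then have "inverse z ^ (p ^ n) = 1" by (simp add: power_inverse)
    then have "inverse z \<in> carrier (prufer_group p)" by (auto simp: prufer_carrier)
    moreover have "z \<noteq> 0" using n assms by (metis power_eq_0_iff zero_neq_one zero_power neq0_conv)
    ultimately show ?thesis by (intro bexI[of _ "inverse z"]) auto
  qed
  show "x \<otimes>\<^bsub>prufer_group p\<^esub> y \<in> carrier (prufer_group p)"
    if xy: "x \<in> carrier (prufer_group p)" "y \<in> carrier (prufer_group p)" for x y
  proof -
    obtain n m where n: "x ^ (p ^ n) = 1" "y ^ (p ^ m) = 1" using xy by (auto simp: prufer_carrier)
    have "(x * y) ^ (p ^ (n + m)) = (x ^ (p ^ n)) ^ (p ^ m) * (y ^ (p ^ m)) ^ (p ^ n)"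
      by (simp add: power_mult_distrib power_mult[symmetric] power_add mult.commute)
    then show ?thesis using n by (auto simp: prufer_carrier)
  qed
  show "\<one>\<^bsub>prufer_group p\<^esub> \<in> carrier (prufer_group p)" by (auto simp: prufer_carrier)
qed auto

lemma p_torus_prufer:
  assumes p: "p > 0"
  shows "p_torus p (prufer_group p)"
  unfolding p_torus_def
proof (intro conjI ballI)
  show "comm_group (prufer_group p)" using p by (rule comm_group_prufer)
  show "\<exists>n. z [^]\<^bsub>prufer_group p\<^esub> (p ^ n) = \<one>\<^bsub>prufer_group p\<^esub>" if "z \<in> carrier (prufer_group p)" for z
    using that by (simp add: prufer_carrier)
  show "\<exists>w\<in>carrier (prufer_group p). w [^]\<^bsub>prufer_group p\<^esub> p = z" if z: "z \<in> carrier (prufer_group p)" for z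
  proof -
    define w where "w = rcis (root p (cmod z)) (Arg z / p)"
    have w: "w ^ p = z" using p by (simp add: w_def DeMoivre2 rcis_cmod_Arg)
    obtain n where "z ^ (p ^ n) = 1" using z by (auto simp: prufer_carrier)
    then have "w ^ (p ^ Suc n) = 1" using w by (simp add: power_mult)
    then have "w \<in> carrier (prufer_group p)" unfolding prufer_carrier by blast
    then show ?thesis using w by auto
  qed
  have "finite {z::complex. z ^ p = 1}" using p by (intro finite_roots_unity) simp
  then show "finite {z \<in> carrier (prufer_group p). z [^]\<^bsub>prufer_group p\<^esub> p = \<one>\<^bsub>prufer_group p\<^esub>}"
    by (rule rev_finite_subset) auto
qed

lemma product_group_pow:
  "x \<in> carrier (product_group I G) \<Longrightarrow> x [^]\<^bsub>product_group I G\<^esub> (n :: nat) = (\<lambda>i\<in>I. x i [^]\<^bsub>G i\<^esub> n)"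
  by (induction n) (auto simp: restrict_def fun_eq_iff)

lemma p_torus_product:
  assumes p: "p > 0" and I: "finite I" and G: "\<And>i. i \<in> I \<Longrightarrow> p_torus p (G i)"
  shows "p_torus p (product_group I G)"
proof -
  have grp: "group (product_group I G)" using p_torusD(2)[OF G] by simp
  interpret P: group "product_group I G" by (rule grp)
  show ?thesis
    unfolding p_torus_def
  proof (intro conjI ballI)
    show "comm_group (product_group I G)"
      by (rule P.group_comm_groupI)
        (use comm_groupE(4)[OF p_torusD(1)[OF G]] in \<open>auto simp: restrict_def fun_eq_iff PiE_iff\<close>)
  next
    fix x assume x: "x \<in> carrier (product_group I G)"
    then have "\<forall>i\<in>I. \<exists>n. x i [^]\<^bsub>G i\<^esub> (p ^ n) = \<one>\<^bsub>G i\<^esub>"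
      using p_torusD(3)[OF G] by (auto simp: PiE_iff)
    then obtain n where n: "\<And>i. i \<in> I \<Longrightarrow> x i [^]\<^bsub>G i\<^esub> (p ^ n i) = \<one>\<^bsub>G i\<^esub>" by metis
    define N where "N = (\<Sum>i\<in>I. n i)"
    have "x i [^]\<^bsub>G i\<^esub> (p ^ N) = \<one>\<^bsub>G i\<^esub>" if i: "i \<in> I" for i
    proof -
      interpret Gi: group "G i" using p_torusD(2)[OF G[OF i]] .
      have xi: "x i \<in> carrier (G i)" using x i by (auto simp: PiE_iff)
      have "n i \<le> N" unfolding N_def using I i by (intro member_le_sum) auto
      then have "p ^ N = p ^ n i * p ^ (N - n i)" by (simp add: power_add[symmetric])
      then show ?thesis using n[OF i] xi by (simp add: Gi.nat_pow_pow[symmetric])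
    qed
    then have "x [^]\<^bsub>product_group I G\<^esub> (p ^ N) = \<one>\<^bsub>product_group I G\<^esub>"
      using x by (simp only: product_group_pow one_product_group) (auto simp: restrict_def)
    then show "\<exists>n. x [^]\<^bsub>product_group I G\<^esub> (p ^ n) = \<one>\<^bsub>product_group I G\<^esub>" ..
  next
    fix x assume x: "x \<in> carrier (product_group I G)"
    then have "\<forall>i\<in>I. \<exists>y. y \<in> carrier (G i) \<and> y [^]\<^bsub>G i\<^esub> p = x i"
      using p_torusD(4)[OF G] by (fastforce simp: PiE_iff)
    then obtain y where y: "\<And>i. i \<in> I \<Longrightarrow> y i \<in> carrier (G i) \<and> y i [^]\<^bsub>G i\<^esub> p = x i" by metis
    have yc: "restrict y I \<in> carrier (product_group I G)" using y by auto
    have "restrict y I [^]\<^bsub>product_group I G\<^esub> p = x"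
      unfolding product_group_pow[OF yc] using y x by (auto simp: PiE_iff extensional_def fun_eq_iff)
    then show "\<exists>y\<in>carrier (product_group I G). y [^]\<^bsub>product_group I G\<^esub> p = x" using yc by blast
  next
    have "{x \<in> carrier (product_group I G). x [^]\<^bsub>product_group I G\<^esub> p = \<one>\<^bsub>product_group I G\<^esub>}
      \<subseteq> (\<Pi>\<^sub>E i\<in>I. {z \<in> carrier (G i). z [^]\<^bsub>G i\<^esub> p = \<one>\<^bsub>G i\<^esub>})"
    proof
      fix x assume x: "x \<in> {x \<in> carrier (product_group I G). x [^]\<^bsub>product_group I G\<^esub> p = \<one>\<^bsub>product_group I G\<^esub>}"
      then have e: "(\<lambda>i\<in>I. x i [^]\<^bsub>G i\<^esub> p) = (\<lambda>i\<in>I. \<one>\<^bsub>G i\<^esub>)" using product_group_pow[of x I G p] by simp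
      have "x i [^]\<^bsub>G i\<^esub> p = \<one>\<^bsub>G i\<^esub>" if "i \<in> I" for i using fun_cong[OF e, of i] that by simp
      then show "x \<in> (\<Pi>\<^sub>E i\<in>I. {z \<in> carrier (G i). z [^]\<^bsub>G i\<^esub> p = \<one>\<^bsub>G i\<^esub>})" using x by (auto simp: PiE_iff)
    qed
    moreover have "finite (\<Pi>\<^sub>E i\<in>I. {z \<in> carrier (G i). z [^]\<^bsub>G i\<^esub> p = \<one>\<^bsub>G i\<^esub>})"
      using I p_torusD(5)[OF G] by (intro finite_PiE) auto
    ultimately show "finite {x \<in> carrier (product_group I G). x [^]\<^bsub>product_group I G\<^esub> p = \<one>\<^bsub>product_group I G\<^esub>}"
      by (rule finite_subset)
  qed
qed

text \<open>Successive \<open>p\<close>-th roots starting from an element of order \<open>p\<close>, so that \<open>d n\<close> has order \<open>p^n\<close>. The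
  roots of unity \<open>exp(2 \<pi> i / p^n)\<close> are such a chain generating \<open>Z/p^\<infinity>\<close>.\<close>

definition root_chain :: "nat \<Rightarrow> ('a, 'b) monoid_scheme \<Rightarrow> (nat \<Rightarrow> 'a) \<Rightarrow> bool" where
  "root_chain p G d \<longleftrightarrow> (\<forall>n. d n \<in> carrier G) \<and> d 0 = \<one>\<^bsub>G\<^esub> \<and> d 1 \<noteq> \<one>\<^bsub>G\<^esub>
     \<and> (\<forall>n. d (Suc n) [^]\<^bsub>G\<^esub> p = d n)"

context group begin

lemma root_chain_pow:
  assumes d: "root_chain p G d"
  shows "d (n + m) [^] (p ^ m) = d n"
proof (induction m)
  case 0 then show ?case using d by (simp add: root_chain_def)
next
  case (Suc m)
  have "d (n + Suc m) [^] (p ^ Suc m) = (d (Suc (n + m)) [^] p) [^] (p ^ m)"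
  proof -
    have "d (Suc (n + m)) \<in> carrier G" using d unfolding root_chain_def by blast
    then show ?thesis by (simp add: nat_pow_pow)
  qed
  also have "d (Suc (n + m)) [^] p = d (n + m)" using d by (simp add: root_chain_def)
  finally show ?case using Suc by simp
qed

lemma root_chain_pow_eq_one_iff:
  assumes p: "prime p" and d: "root_chain p G d"
  shows "d N [^] (j :: nat) = \<one> \<longleftrightarrow> p ^ N dvd j"
proof -
  have dc: "d N \<in> carrier G" using d by (simp add: root_chain_def)
  have "d N [^] (p ^ N) = \<one>" using root_chain_pow[OF d, of 0 N] d by (simp add: root_chain_def)
  then have "ord (d N) dvd p ^ N" using pow_eq_id[OF dc] by simp
  then obtain i where i: "i \<le> N" "ord (d N) = p ^ i" using divides_primepow_nat[OF p] by blast
  have "i = N"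
  proof (rule ccontr)
    assume "i \<noteq> N"
    then obtain M where M: "N = 1 + M" "i \<le> M" using i(1) by (cases N) auto
    have "p ^ i dvd p ^ M" using M(2) by (rule le_imp_power_dvd)
    then have "d N [^] (p ^ M) = \<one>" using pow_eq_id[OF dc] i by simp
    then have "d 1 = \<one>" using root_chain_pow[OF d, of 1 M] M by simp
    then show False using d by (simp add: root_chain_def)
  qed
  then show ?thesis using pow_eq_id[OF dc] i by simp
qed

lemma root_chain_pow_eq_iff:
  assumes p: "prime p" and d: "root_chain p G d"
  shows "d N [^] (a :: nat) = d N [^] (b :: nat) \<longleftrightarrow> a mod p ^ N = b mod p ^ N"
proof -
  have dc: "d N \<in> carrier G" using d by (simp add: root_chain_def)
  have le: "d N [^] a = d N [^] b \<longleftrightarrow> b mod p ^ N = a mod p ^ N" if ab: "a \<le> b" for a b :: nat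
  proof -
    have "d N [^] b = d N [^] a \<otimes> d N [^] (b - a)" using dc ab by (simp add: nat_pow_mult)
    then have "d N [^] a = d N [^] b \<longleftrightarrow> d N [^] (b - a) = \<one>"
      using dc by simp
    then show ?thesis
      using root_chain_pow_eq_one_iff[OF p d] mod_eq_dvd_iff_nat[OF ab, of "p ^ N"] by simp
  qed
  show ?thesis using le[of a b] le[of b a] by (metis nat_le_linear)
qed

text \<open>The criterion on the right does not mention the group. So the same relations hold between the
  powers in any two chains, and matching generators defines an injective homomorphism.\<close>

lemma root_chain_pow_eq_iff':
  assumes p: "prime p" and d: "root_chain p G d"
  shows "d n [^] (k :: nat) = d m [^] (l :: nat) \<longleftrightarrow> (p ^ m * k) mod p ^ (n + m) = (p ^ n * l) mod p ^ (n + m)"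
proof -
  have dc: "d N \<in> carrier G" for N using d by (simp add: root_chain_def)
  have "d n [^] k = d (n + m) [^] (p ^ m * k)" using dc root_chain_pow[OF d, of n m] by (metis nat_pow_pow)
  moreover have "d m [^] l = d (n + m) [^] (p ^ n * l)"
    using dc root_chain_pow[OF d, of m n] by (metis nat_pow_pow add.commute)
  ultimately show ?thesis using root_chain_pow_eq_iff[OF p d] by simp
qed

lemma root_chain_mult:
  assumes d: "root_chain p G d"
  shows "d n [^] (k :: nat) \<otimes> d m [^] (l :: nat) = d (n + m) [^] (p ^ m * k + p ^ n * l)"
proof -
  have dc: "d N \<in> carrier G" for N using d by (simp add: root_chain_def)
  have "d n [^] k = d (n + m) [^] (p ^ m * k)" using dc root_chain_pow[OF d, of n m] by (metis nat_pow_pow)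
  moreover have "d m [^] l = d (n + m) [^] (p ^ n * l)"
    using dc root_chain_pow[OF d, of m n] by (metis nat_pow_pow add.commute)
  ultimately show ?thesis using dc by (simp add: nat_pow_mult)
qed

end

lemma prufer_root_chain:
  assumes p: "prime p"
  defines "\<zeta> \<equiv> \<lambda>n. cis (2 * pi / real (p ^ n))"
  shows "root_chain p (prufer_group p) \<zeta>"
    "z \<in> carrier (prufer_group p) \<Longrightarrow> \<exists>n k. z = \<zeta> n ^ k"
proof -
  have p0: "p > 0" "p > 1" using prime_gt_0_nat[OF p] prime_gt_1_nat[OF p] by auto
  have pw: "\<zeta> n ^ (p ^ n) = 1" for n using p0 by (simp add: \<zeta>_def DeMoivre)
  have "\<zeta> 1 \<noteq> 1"
  proof
    assume "\<zeta> 1 = 1"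
    moreover have "inj_on (\<lambda>k. cis (2 * pi * real k / real p)) {..<p}"
      using bij_betw_roots_unity[OF p0(1)] by (rule bij_betw_imp_inj_on)
    ultimately have "(1::nat) = 0" using p0 by (auto simp: \<zeta>_def dest: inj_onD[of _ _ 1 0])
    then show False by simp
  qed
  moreover have "\<zeta> (Suc n) ^ p = \<zeta> n" for n using p0 by (simp add: \<zeta>_def DeMoivre)
  ultimately show "root_chain p (prufer_group p) \<zeta>"
    using pw by (auto simp: root_chain_def prufer_carrier \<zeta>_def)
  assume "z \<in> carrier (prufer_group p)"
  then obtain n where "z ^ (p ^ n) = 1" by (auto simp: prufer_carrier)
  then have "z \<in> (\<lambda>k. cis (2 * pi * real k / real (p ^ n))) ` {..<p ^ n}"
    using bij_betw_roots_unity[of "p ^ n"] p0 by (auto simp: bij_betw_def)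
  then obtain k where "z = cis (2 * pi * real k / real (p ^ n))" by blast
  then have "z = \<zeta> n ^ k" by (simp add: \<zeta>_def DeMoivre mult.commute)
  then show "\<exists>n k. z = \<zeta> n ^ k" by blast
qed

text \<open>Extracting \<open>p\<close>-th roots repeatedly extends \<open>g\<close> to a chain, onto which the chain of roots of unity is
  mapped. A nontrivial value of \<open>\<chi>\<close> has a power of order \<open>p\<close>, of which \<open>g\<close> is a further power.\<close>

lemma prufer_embedding:
  assumes p: "prime p" and G: "p_torus p G" and g: "g \<in> carrier G" "g [^]\<^bsub>G\<^esub> p = \<one>\<^bsub>G\<^esub>" "g \<noteq> \<one>\<^bsub>G\<^esub>"
  obtains \<chi> where "\<chi> \<in> hom (prufer_group p) G"
    "\<And>z. z \<in> carrier (prufer_group p) \<Longrightarrow> z \<noteq> 1 \<Longrightarrow> \<exists>j::nat. \<chi> z [^]\<^bsub>G\<^esub> j = g"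
proof -
  interpret G: comm_group G using p_torusD(1)[OF G] .
  have p0: "p > 0" using p by (simp add: prime_gt_0_nat)
  interpret P: comm_group "prufer_group p" using comm_group_prufer[OF p0] .
  define e where "e = rec_nat g (\<lambda>_ x. SOME y. y \<in> carrier G \<and> y [^]\<^bsub>G\<^esub> p = x)"
  have e0: "e 0 = g" by (simp add: e_def)
  have eS: "e (Suc n) = (SOME y. y \<in> carrier G \<and> y [^]\<^bsub>G\<^esub> p = e n)" for n by (simp add: e_def)
  have step: "e (Suc n) \<in> carrier G \<and> e (Suc n) [^]\<^bsub>G\<^esub> p = e n" if en: "e n \<in> carrier G" for n
  proof -
    obtain y where "y \<in> carrier G \<and> y [^]\<^bsub>G\<^esub> p = e n" using p_torusD(4)[OF G en] by blast
    then show ?thesis unfolding eS by (rule someI)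
  qed
  have ec: "e n \<in> carrier G" for n by (induction n) (use g e0 step in auto)
  define d where "d n = (case n of 0 \<Rightarrow> \<one>\<^bsub>G\<^esub> | Suc m \<Rightarrow> e m)" for n
  have d: "root_chain p G d"
    using ec g e0 step by (auto simp: root_chain_def d_def split: nat.split)
  define \<zeta> where "\<zeta> n = cis (2 * pi / real (p ^ n))" for n
  have \<zeta>: "root_chain p (prufer_group p) \<zeta>" and \<zeta>_gen: "\<And>z. z \<in> carrier (prufer_group p) \<Longrightarrow> \<exists>n k. z = \<zeta> n ^ k"
    using prufer_root_chain[OF p] by (simp_all add: \<zeta>_def[abs_def])
  have iff: "\<zeta> n ^ k = \<zeta> m ^ l \<longleftrightarrow> d n [^]\<^bsub>G\<^esub> k = d m [^]\<^bsub>G\<^esub> l" for n m k l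
    using P.root_chain_pow_eq_iff'[OF p \<zeta>, of n k m l] G.root_chain_pow_eq_iff'[OF p d, of n k m l] by simp
  define \<chi> where "\<chi> z = (SOME y. \<exists>n k. z = \<zeta> n ^ k \<and> y = d n [^]\<^bsub>G\<^esub> k)" for z
  have \<chi>: "\<chi> (\<zeta> n ^ k) = d n [^]\<^bsub>G\<^esub> k" for n k
  proof -
    have "\<exists>m l. \<zeta> n ^ k = \<zeta> m ^ l \<and> \<chi> (\<zeta> n ^ k) = d m [^]\<^bsub>G\<^esub> l" unfolding \<chi>_def by (rule someI) blast
    then show ?thesis using iff by metis
  qed
  have dc: "d n \<in> carrier G" for n using d by (simp add: root_chain_def)
  have "\<chi> \<in> hom (prufer_group p) G"
  proof (rule homI)
    fix x y assume "x \<in> carrier (prufer_group p)" "y \<in> carrier (prufer_group p)"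
    then obtain n k m l where xy: "x = \<zeta> n ^ k" "y = \<zeta> m ^ l" using \<zeta>_gen by metis
    have "x * y = \<zeta> (n + m) ^ (p ^ m * k + p ^ n * l)" using P.root_chain_mult[OF \<zeta>, of n k m l] xy by simp
    then have "\<chi> (x * y) = \<chi> x \<otimes>\<^bsub>G\<^esub> \<chi> y" using G.root_chain_mult[OF d, of n k m l] xy \<chi> by simp
    then show "\<chi> (x \<otimes>\<^bsub>prufer_group p\<^esub> y) = \<chi> x \<otimes>\<^bsub>G\<^esub> \<chi> y" by simp
  next
    fix x assume "x \<in> carrier (prufer_group p)"
    then obtain n k where "x = \<zeta> n ^ k" using \<zeta>_gen by metis
    then show "\<chi> x \<in> carrier G" using \<chi> dc by simp
  qed
  moreover have "\<exists>j::nat. \<chi> z [^]\<^bsub>G\<^esub> j = g" if z: "z \<in> carrier (prufer_group p)" "z \<noteq> 1" for z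
  proof -
    obtain n k where nk: "z = \<zeta> n ^ k" using z(1) \<zeta>_gen by metis
    have nd: "\<not> p ^ n dvd k" using P.root_chain_pow_eq_one_iff[OF p \<zeta>, of n k] z(2) nk by simp
    then have "k \<noteq> 0" by (metis dvd_0_right)
    then obtain i u where iu: "k = p ^ i * u" "\<not> p dvd u"
      using p by (metis multiplicity_decompose' not_prime_unit)
    have "i < n" using nd iu by (metis dvd_mult2 le_imp_power_dvd not_le_imp_less)
    then obtain c where c: "n = Suc (i + c)" by (metis less_iff_Suc_add)
    have "coprime u p" using p iu(2) by (metis coprime_commute prime_imp_coprime)
    moreover have "u \<noteq> 0" using iu(2) by (metis dvd_0_right)
    ultimately obtain v w where vw: "u * v = p * w + 1"
      using bezout_nat[of u p] by (auto simp: coprime_iff_gcd_eq_1)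
    have "\<chi> z [^]\<^bsub>G\<^esub> (p ^ c * v) = d n [^]\<^bsub>G\<^esub> (p ^ (i + c) * (u * v))"
      using dc by (simp add: nk \<chi> G.nat_pow_pow iu(1) power_add ac_simps)
    also have "\<dots> = (d n [^]\<^bsub>G\<^esub> (p ^ (i + c))) [^]\<^bsub>G\<^esub> (u * v)" using dc by (simp add: G.nat_pow_pow)
    also have "d n [^]\<^bsub>G\<^esub> (p ^ (i + c)) = d 1" using G.root_chain_pow[OF d, of 1 "i + c"] c by simp
    also have "d 1 = g" by (simp add: d_def e0)
    also have "g [^]\<^bsub>G\<^esub> (u * v) = g" using g by (simp add: vw G.nat_pow_pow[symmetric])
    finally show ?thesis by blast
  qed
  ultimately show ?thesis using that by blast
qed

text \<open>The new factor is embedded by a \<open>\<chi>\<close> that hits \<open>g\<close>. The sum with \<open>f\<close> stays injective: if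
  \<open>\<chi> z\<close> were a nontrivial element of the image of \<open>f\<close>, then so would be \<open>g\<close>, as a power of it.\<close>

lemma prufer_power_extend:
  fixes p r :: nat
  defines "T \<equiv> \<lambda>r::nat. product_group {..<r} (\<lambda>_. prufer_group p)"
  assumes p: "prime p" and G: "p_torus p G"
    and f: "f \<in> hom (T r) G" "inj_on f (carrier (T r))"
    and g: "g \<in> carrier G" "g [^]\<^bsub>G\<^esub> p = \<one>\<^bsub>G\<^esub>" "g \<notin> f ` carrier (T r)"
  obtains f' where "f' \<in> hom (T (Suc r)) G" "inj_on f' (carrier (T (Suc r)))"
    "f ` carrier (T r) \<subseteq> f' ` carrier (T (Suc r))" "g \<in> f' ` carrier (T (Suc r))"
proof -
  interpret G: comm_group G using p_torusD(1)[OF G] .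
  have p0: "p > 0" using prime_gt_0_nat[OF p] .
  interpret P: comm_group "prufer_group p" using comm_group_prufer[OF p0] .
  have gT: "group (T n)" for n unfolding T_def by (rule product_group) (rule P.is_group)
  interpret f: group_hom "T r" G f
    using f(1) gT by (simp add: group_hom_def group_hom_axioms_def G.is_group)
  have D: "subgroup (f ` carrier (T r)) G" by (rule f.img_is_subgroup)
  have g1: "g \<noteq> \<one>\<^bsub>G\<^esub>" using g(3) subgroup.one_closed[OF D] by metis
  obtain \<chi> where \<chi>: "\<chi> \<in> hom (prufer_group p) G"
    and \<chi>g: "\<And>z. z \<in> carrier (prufer_group p) \<Longrightarrow> z \<noteq> 1 \<Longrightarrow> \<exists>j::nat. \<chi> z [^]\<^bsub>G\<^esub> j = g"
    using prufer_embedding[OF p G g(1,2) g1] by blast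
  interpret \<chi>: group_hom "prufer_group p" G \<chi>
    using \<chi> by (simp add: group_hom_def group_hom_axioms_def G.is_group P.is_group)
  have \<chi>_meets: "z = 1" if z: "z \<in> carrier (prufer_group p)" "\<chi> z \<in> f ` carrier (T r)" for z
  proof (rule ccontr)
    assume "z \<noteq> 1"
    then obtain j :: nat where "\<chi> z [^]\<^bsub>G\<^esub> j = g" using \<chi>g z(1) by blast
    moreover have "\<chi> z [^]\<^bsub>G\<^esub> j \<in> f ` carrier (T r)"
    proof (induction j)
      case 0 show ?case using subgroup.one_closed[OF D] by simp
    next
      case (Suc j) then show ?case using subgroup.m_closed[OF D _ z(2)] by simp
    qed
    ultimately show False using g(3) by simp
  qed
  define f' where "f' x = f (restrict x {..<r}) \<otimes>\<^bsub>G\<^esub> \<chi> (x r)" for x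
  have res: "restrict x {..<r} \<in> carrier (T r)" "x r \<in> carrier (prufer_group p)"
    if "x \<in> carrier (T (Suc r))" for x
    using that by (auto simp: T_def PiE_iff)
  have hom: "f' \<in> hom (T (Suc r)) G"
  proof (rule homI)
    fix x assume "x \<in> carrier (T (Suc r))"
    then show "f' x \<in> carrier G" using res by (simp add: f'_def)
  next
    fix x y assume xy: "x \<in> carrier (T (Suc r))" "y \<in> carrier (T (Suc r))"
    have "restrict (x \<otimes>\<^bsub>T (Suc r)\<^esub> y) {..<r} = restrict x {..<r} \<otimes>\<^bsub>T r\<^esub> restrict y {..<r}"
      by (auto simp: T_def restrict_def fun_eq_iff)
    moreover have "(x \<otimes>\<^bsub>T (Suc r)\<^esub> y) r = x r \<otimes>\<^bsub>prufer_group p\<^esub> y r" by (simp add: T_def)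
    ultimately have "f' (x \<otimes>\<^bsub>T (Suc r)\<^esub> y) = (f (restrict x {..<r}) \<otimes>\<^bsub>G\<^esub> f (restrict y {..<r})) \<otimes>\<^bsub>G\<^esub> (\<chi> (x r) \<otimes>\<^bsub>G\<^esub> \<chi> (y r))"
      using res[OF xy(1)] res[OF xy(2)] f.hom_mult \<chi>.hom_mult unfolding f'_def by presburger
    also have "\<dots> = f' x \<otimes>\<^bsub>G\<^esub> f' y"
      using res[OF xy(1)] res[OF xy(2)] unfolding f'_def by (simp add: G.m_ac)
    finally show "f' (x \<otimes>\<^bsub>T (Suc r)\<^esub> y) = f' x \<otimes>\<^bsub>G\<^esub> f' y" .
  qed
  interpret f': group_hom "T (Suc r)" G f'
    using hom gT by (simp add: group_hom_def group_hom_axioms_def G.is_group)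
  have inj: "inj_on f' (carrier (T (Suc r)))"
  proof -
    have "x = \<one>\<^bsub>T (Suc r)\<^esub>" if x: "x \<in> carrier (T (Suc r))" "f' x = \<one>\<^bsub>G\<^esub>" for x
    proof -
    have xc: "restrict x {..<r} \<in> carrier (T r)" "x r \<in> carrier (prufer_group p)" using res[OF x(1)] by auto
    have "\<chi> (x r) = inv\<^bsub>G\<^esub> f (restrict x {..<r})"
      using x xc unfolding f'_def by (metis G.inv_equality G.m_comm f.hom_closed \<chi>.hom_closed)
    then have "\<chi> (x r) \<in> f ` carrier (T r)" using subgroup.m_inv_closed[OF D] xc by auto
    then have xr: "x r = 1" using \<chi>_meets xc by blast
    then have "f (restrict x {..<r}) = \<one>\<^bsub>G\<^esub>" using x xc \<chi>.hom_one unfolding f'_def by simp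
    then have "restrict x {..<r} = \<one>\<^bsub>T r\<^esub>" using inj_onD[OF f(2), of _ "\<one>\<^bsub>T r\<^esub>"] xc by simp
    then have "x i = 1" if "i < r" for i using that by (auto simp: T_def restrict_def fun_eq_iff split: if_splits)
    then show ?thesis using xr x
      by (auto simp: T_def PiE_iff extensional_def fun_eq_iff less_Suc_eq)
    qed
    then show ?thesis using f'.inj_on_one_iff by blast
  qed
  have ext: "f y \<otimes>\<^bsub>G\<^esub> \<chi> z \<in> f' ` carrier (T (Suc r))" if y: "y \<in> carrier (T r)" and z: "z \<in> carrier (prufer_group p)" for y z
  proof -
    have "restrict (y(r := z)) {..<r} = y" using y by (auto simp: T_def PiE_iff extensional_def fun_eq_iff)
    moreover have "y(r := z) \<in> carrier (T (Suc r))" using y z by (auto simp: T_def PiE_iff extensional_def less_Suc_eq)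
    ultimately show ?thesis by (auto simp: f'_def intro!: rev_image_eqI[of "y(r := z)"])
  qed
  have "f ` carrier (T r) \<subseteq> f' ` carrier (T (Suc r))"
  proof clarify
    fix y assume "y \<in> carrier (T r)"
    then show "f y \<in> f' ` carrier (T (Suc r))" using ext[of y 1] \<chi>.hom_one P.one_closed by simp
  qed
  moreover have "g \<in> f' ` carrier (T (Suc r))"
  proof -
    obtain z where z: "z \<in> carrier (prufer_group p)" "z \<noteq> 1"
    proof -
      have "root_chain p (prufer_group p) (\<lambda>n. cis (2 * pi / real (p ^ n)))" by (rule prufer_root_chain[OF p])
      then show ?thesis using that[of "cis (2 * pi / real (p ^ 1))"] unfolding root_chain_def prufer_one by blast
    qed
    then obtain j :: nat where "\<chi> z [^]\<^bsub>G\<^esub> j = g" using \<chi>g by blast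
    then have "\<chi> (z ^ j) = g" using \<chi>.hom_nat_pow[OF z(1), of j] by simp
    moreover have "z ^ j \<in> carrier (prufer_group p)" using P.nat_pow_closed[OF z(1), of j] by simp
    ultimately show ?thesis using ext[of "\<one>\<^bsub>T r\<^esub>" "z ^ j"] f.hom_one g(1) f.G.one_closed by simp
  qed
  ultimately show ?thesis using that hom inj by blast
qed

text \<open>Among the embeddings of powers of \<open>Z/p^\<infinity>\<close>, choose one whose image contains as many elements of order
  \<open>p\<close> as possible. By \<open>prufer_power_extend\<close> it contains all of them. Since the image is divisible,
  induction on \<open>n\<close> shows that it contains the \<open>p^n\<close>-torsion.\<close>

theorem p_torus_structure:
  assumes p: "prime p" and G: "p_torus p G"
  obtains r :: nat where "G \<cong> product_group {..<r} (\<lambda>_. prufer_group p)"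
proof -
  interpret G: comm_group G using p_torusD(1)[OF G] .
  have p0: "p > 0" using prime_gt_0_nat[OF p] .
  define T where "T r = product_group {..<r::nat} (\<lambda>_. prufer_group p)" for r
  have tT: "p_torus p (T r)" for r unfolding T_def by (intro p_torus_product p_torus_prufer) (use p0 in auto)
  have gT: "group (T r)" for r using p_torusD(2)[OF tT] .
  let ?\<Omega> = "{x \<in> carrier G. x [^]\<^bsub>G\<^esub> p = \<one>\<^bsub>G\<^esub>}"
  define E where "E = (\<lambda>(r, f). f \<in> hom (T r) G \<and> inj_on f (carrier (T r)))"
  define \<mu> where "\<mu> = (\<lambda>(r, f). card (?\<Omega> \<inter> f ` carrier (T r)))"
  have E0: "E (0, \<lambda>_. \<one>\<^bsub>G\<^esub>)" by (auto simp: E_def T_def hom_def)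
  have bound: "\<mu> rf \<le> card ?\<Omega>" for rf
    unfolding \<mu>_def using p_torusD(5)[OF G] by (auto split: prod.split intro: card_mono)
  have "\<exists>rf. E rf \<and> (\<forall>y. E y \<longrightarrow> \<mu> y \<le> \<mu> rf)"
    by (rule ex_has_greatest_nat[where P = E and f = \<mu> and b = "Suc (card ?\<Omega>)", OF E0])
      (use bound in \<open>auto simp: less_Suc_eq_le\<close>)
  then obtain rf where rf: "E rf" "\<And>y. E y \<Longrightarrow> \<mu> y \<le> \<mu> rf" by metis
  obtain r f where "rf = (r, f)" by (cases rf)
  then have f: "f \<in> hom (T r) G" "inj_on f (carrier (T r))" using rf(1) by (auto simp: E_def)
  let ?D = "f ` carrier (T r)"
  have sub: "?\<Omega> \<subseteq> ?D"
  proof (rule ccontr)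
    assume "\<not> ?\<Omega> \<subseteq> ?D"
    then obtain g where g: "g \<in> carrier G" "g [^]\<^bsub>G\<^esub> p = \<one>\<^bsub>G\<^esub>" "g \<notin> ?D" by blast
    obtain f' where f': "f' \<in> hom (T (Suc r)) G" "inj_on f' (carrier (T (Suc r)))"
      "?D \<subseteq> f' ` carrier (T (Suc r))" "g \<in> f' ` carrier (T (Suc r))"
      using prufer_power_extend[OF p G, of f r g, folded T_def, OF f g] by blast
    have "?\<Omega> \<inter> ?D \<subset> ?\<Omega> \<inter> f' ` carrier (T (Suc r))" using f' g by blast
    then have "card (?\<Omega> \<inter> ?D) < card (?\<Omega> \<inter> f' ` carrier (T (Suc r)))"
      using p_torusD(5)[OF G] by (intro psubset_card_mono) auto
    moreover have "E (Suc r, f')" using f' by (simp add: E_def)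
    ultimately show False using rf(2)[of "(Suc r, f')"] \<open>rf = (r, f)\<close> by (simp add: \<mu>_def)
  qed
  interpret f: group_hom "T r" G f
    using f(1) gT by (simp add: group_hom_def group_hom_axioms_def G.is_group)
  have D: "subgroup ?D G" by (rule f.img_is_subgroup)
  have tors: "x \<in> ?D" if "x \<in> carrier G" "x [^]\<^bsub>G\<^esub> (p ^ n) = \<one>\<^bsub>G\<^esub>" for x n
    using that
  proof (induction n arbitrary: x)
    case 0
    then show ?case using subgroup.one_closed[OF D] by simp
  next
    case (Suc n)
    have "x [^]\<^bsub>G\<^esub> p \<in> ?D"
      using Suc.prems Suc.IH[of "x [^]\<^bsub>G\<^esub> p"] by (simp add: G.nat_pow_pow)
    then obtain u where u: "u \<in> carrier (T r)" "x [^]\<^bsub>G\<^esub> p = f u" by blast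
    obtain v where v: "v \<in> carrier (T r)" "v [^]\<^bsub>T r\<^esub> p = u" using p_torusD(4)[OF tT u(1)] by blast
    have fv: "f v \<in> carrier G" "f v \<in> ?D" using v by auto
    have "f v [^]\<^bsub>G\<^esub> p = x [^]\<^bsub>G\<^esub> p" using u v f.hom_nat_pow[OF v(1), of p] by simp
    then have "(x \<otimes>\<^bsub>G\<^esub> inv\<^bsub>G\<^esub> f v) [^]\<^bsub>G\<^esub> p = \<one>\<^bsub>G\<^esub>"
      using Suc.prems(1) fv by (simp add: G.nat_pow_distrib G.nat_pow_inv)
    then have "x \<otimes>\<^bsub>G\<^esub> inv\<^bsub>G\<^esub> f v \<in> ?D" using sub Suc.prems(1) fv by auto
    then have "x \<otimes>\<^bsub>G\<^esub> inv\<^bsub>G\<^esub> f v \<otimes>\<^bsub>G\<^esub> f v \<in> ?D" using subgroup.m_closed[OF D] fv by blast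
    then show ?case using Suc.prems(1) fv by (simp add: G.m_assoc)
  qed
  have "carrier G \<subseteq> ?D"
  proof
    fix x assume x: "x \<in> carrier G"
    then obtain n where "x [^]\<^bsub>G\<^esub> (p ^ n) = \<one>\<^bsub>G\<^esub>" using p_torusD(3)[OF G x] by blast
    then show "x \<in> ?D" using tors x by blast
  qed
  then have "f \<in> iso (T r) G" using f f.hom_closed by (auto simp: iso_def bij_betw_def)
  then have "T r \<cong> G" by (rule is_isoI)
  then have "G \<cong> T r" by (rule group.iso_sym[OF gT])
  then show ?thesis using that by (simp add: T_def)
qed

lemma virtual_p_torus_iff_discrete_p_toral:
  assumes p: "prime p"
  shows "virtual_p_torus p G \<longleftrightarrow> discrete_p_toral p G"
proof -
  have p0: "p > 0" using prime_gt_0_nat[OF p] .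
  have T: "p_torus p (product_group {..<r::nat} (\<lambda>_. prufer_group p))" for r
    by (intro p_torus_product p_torus_prufer) (use p0 in auto)
  have "p_torus p (G\<lparr>carrier := N\<rparr>) \<longleftrightarrow> (\<exists>r. G\<lparr>carrier := N\<rparr> \<cong> product_group {..<r::nat} (\<lambda>_. prufer_group p))"
    if G: "group G" and N: "N \<lhd> G" for N
  proof
    assume "p_torus p (G\<lparr>carrier := N\<rparr>)"
    then show "\<exists>r. G\<lparr>carrier := N\<rparr> \<cong> product_group {..<r::nat} (\<lambda>_. prufer_group p)"
      using p_torus_structure[OF p] by metis
  next
    assume "\<exists>r. G\<lparr>carrier := N\<rparr> \<cong> product_group {..<r::nat} (\<lambda>_. prufer_group p)"
    then obtain r where r: "G\<lparr>carrier := N\<rparr> \<cong> product_group {..<r::nat} (\<lambda>_. prufer_group p)" by blast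
    have GN: "group (G\<lparr>carrier := N\<rparr>)"
      using group.subgroup_imp_group[OF G normal_imp_subgroup[OF N]] .
    obtain f where "f \<in> iso (product_group {..<r::nat} (\<lambda>_. prufer_group p)) (G\<lparr>carrier := N\<rparr>)"
      using group.iso_sym[OF GN r] by (auto simp: is_iso_def)
    then show "p_torus p (G\<lparr>carrier := N\<rparr>)" using p_torus_iso[OF _ GN T] by blast
  qed
  then show ?thesis unfolding virtual_p_torus_def discrete_p_toral_def by blast
qed

theorem discrete_p_toral_extension:
  assumes p: "prime p" and h: "group_hom G H h" "h ` carrier G = carrier H"
    and H: "discrete_p_toral p H"
    and K: "discrete_p_toral p K" and f: "f \<in> iso K (G\<lparr>carrier := kernel G H h\<rparr>)"
  shows "discrete_p_toral p G"
proof -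
  interpret h: group_hom G H h by (rule h(1))
  let ?K = "G\<lparr>carrier := kernel G H h\<rparr>"
  interpret K: group K using K by (simp add: discrete_p_toral_def)
  interpret GK: group ?K using h.G.subgroup_imp_group[OF h.subgroup_kernel] .
  define f' where "f' = inv_into (carrier K) f"
  have f': "f' \<in> iso ?K K" unfolding f'_def using K.iso_set_sym[OF f] .
  interpret f': group_hom ?K K f' using f' by unfold_locales (simp add: iso_def)
  have bij: "bij_betw f' (carrier ?K) (carrier K)" using f' by (simp add: iso_def)
  have "kernel ?K K f' = {\<one>\<^bsub>?K\<^esub>}"
  proof (rule f'.inj_iff_trivial_ker[THEN iffD1])
    show "inj_on f' (carrier ?K)" using bij by (rule bij_betw_imp_inj_on)
  qed
  moreover have "virtual_p_torus p K" using K by (simp add: virtual_p_torus_iff_discrete_p_toral[OF p])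
  ultimately have vK: "virtual_p_torus p ?K"
    using f'.virtual_p_torus_finite_kernel[OF p, of 0] bij by (simp add: bij_betw_def)
  have "virtual_p_torus p H" using H by (simp add: virtual_p_torus_iff_discrete_p_toral[OF p])
  then have "virtual_p_torus p G" using h.virtual_p_torus_extension[OF p _ h(2) vK] by blast
  then show ?thesis by (simp add: virtual_p_torus_iff_discrete_p_toral[OF p])
qed

section \<open>Isomorphisms in categories\<close>

lemma isos_iff: "f \<in> isos C P Q \<longleftrightarrow> (\<exists>g. inverse_mors C P Q f g)"
  by (simp add: isos_def)

lemma isos_mor: "f \<in> isos C P Q \<Longrightarrow> f \<in> Mor C P Q"
  by (auto simp: isos_def inverse_mors_def)

context category begin

lemma inverse_mors_comp:
  assumes obj: "P \<in> Obj C" "Q \<in> Obj C" "R \<in> Obj C"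
    and f: "inverse_mors C P Q f f'" and g: "inverse_mors C Q R g g'"
  shows "inverse_mors C P R (Comp C P Q R g f) (Comp C R Q P f' g')"
proof -
  have m: "f \<in> Mor C P Q" "f' \<in> Mor C Q P" "g \<in> Mor C Q R" "g' \<in> Mor C R Q"
    and e: "Comp C P Q P f' f = Idn C P" "Comp C Q P Q f f' = Idn C Q"
      "Comp C Q R Q g' g = Idn C Q" "Comp C R Q R g g' = Idn C R"
    using f g by (auto simp: inverse_mors_def)
  have gf: "Comp C P Q R g f \<in> Mor C P R" and fg: "Comp C R Q P f' g' \<in> Mor C R P"
    using obj m comp_closed by auto
  have "Comp C P R P (Comp C R Q P f' g') (Comp C P Q R g f)
      = Comp C P Q P f' (Comp C P R Q g' (Comp C P Q R g f))"
    using comp_assoc[of P R Q P] obj m gf by simp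
  also have "\<dots> = Idn C P" using comp_assoc[of P Q R Q f g g'] obj m e id_left by simp
  finally have 1: "Comp C P R P (Comp C R Q P f' g') (Comp C P Q R g f) = Idn C P" .
  have "Comp C R P R (Comp C P Q R g f) (Comp C R Q P f' g')
      = Comp C R Q R g (Comp C R P Q f (Comp C R Q P f' g'))"
    using comp_assoc[of R P Q R] obj m fg by simp
  also have "\<dots> = Idn C R" using comp_assoc[of R Q P Q g' f' f] obj m e id_left by simp
  finally show ?thesis using 1 gf fg by (simp add: inverse_mors_def)
qed

lemma inverse_mors_sym: "inverse_mors C P Q f g \<Longrightarrow> inverse_mors C Q P g f"
  by (auto simp: inverse_mors_def)

lemma isos_comp:
  "\<lbrakk>P \<in> Obj C; Q \<in> Obj C; R \<in> Obj C; f \<in> isos C P Q; g \<in> isos C Q R\<rbrakk> \<Longrightarrow> Comp C P Q R g f \<in> isos C P R"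
  unfolding isos_iff using inverse_mors_comp by blast

lemma id_inverse_mors: "P \<in> Obj C \<Longrightarrow> inverse_mors C P P (Idn C P) (Idn C P)"
  using id_closed id_left by (auto simp: inverse_mors_def)

lemma inverse_mors_left_right:
  assumes obj: "P \<in> Obj C" "Q \<in> Obj C" and m: "f \<in> Mor C P Q" "a \<in> Mor C Q P" "b \<in> Mor C Q P"
    and a: "Comp C P Q P a f = Idn C P" and b: "Comp C Q P Q f b = Idn C Q"
  shows "inverse_mors C P Q f a"
proof -
  have "a = Comp C Q Q P a (Comp C Q P Q f b)" using b m obj id_right by simp
  also have "\<dots> = Comp C Q P P (Comp C P Q P a f) b" using comp_assoc[of Q P Q P b f a] obj m by simp
  also have "\<dots> = b" using a m obj id_left by simp
  finally show ?thesis using m a b by (simp add: inverse_mors_def)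
qed

lemma isos_if_comps_isos:
  assumes obj: "P \<in> Obj C" "Q \<in> Obj C" and m: "f \<in> Mor C P Q" "g \<in> Mor C Q P"
    and gf: "Comp C P Q P g f \<in> isos C P P" and fg: "Comp C Q P Q f g \<in> isos C Q Q"
  shows "f \<in> isos C P Q"
proof -
  obtain u where u: "inverse_mors C P P (Comp C P Q P g f) u" using gf by (auto simp: isos_iff)
  obtain v where v: "inverse_mors C Q Q (Comp C Q P Q f g) v" using fg by (auto simp: isos_iff)
  have um: "u \<in> Mor C P P" and vm: "v \<in> Mor C Q Q" using u v by (auto simp: inverse_mors_def)
  have "Comp C P Q P (Comp C Q P P u g) f = Idn C P"
    using comp_assoc[of P Q P P f g u] obj m um u by (simp add: inverse_mors_def)
  moreover have "Comp C Q P Q f (Comp C Q Q P g v) = Idn C Q"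
    using comp_assoc[of Q Q P Q v g f] obj m vm v by (simp add: inverse_mors_def)
  ultimately have "inverse_mors C P Q f (Comp C Q P P u g)"
    using obj m um vm comp_closed by (intro inverse_mors_left_right) auto
  then show ?thesis by (auto simp: isos_iff)
qed

lemma group_aut:
  assumes P: "P \<in> Obj C"
  shows "group (aut_group C P)"
proof (rule groupI)
  fix x y assume "x \<in> carrier (aut_group C P)" "y \<in> carrier (aut_group C P)"
  then show "x \<otimes>\<^bsub>aut_group C P\<^esub> y \<in> carrier (aut_group C P)"
    using isos_comp[OF P P P] by (simp add: aut_group_def)
next
  show "\<one>\<^bsub>aut_group C P\<^esub> \<in> carrier (aut_group C P)"
    using id_inverse_mors[OF P] by (auto simp: aut_group_def isos_iff)
next
  fix x y z
  assume "x \<in> carrier (aut_group C P)" "y \<in> carrier (aut_group C P)" "z \<in> carrier (aut_group C P)"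
  then have "x \<in> Mor C P P" "y \<in> Mor C P P" "z \<in> Mor C P P" by (auto simp: aut_group_def isos_mor)
  then show "x \<otimes>\<^bsub>aut_group C P\<^esub> y \<otimes>\<^bsub>aut_group C P\<^esub> z = x \<otimes>\<^bsub>aut_group C P\<^esub> (y \<otimes>\<^bsub>aut_group C P\<^esub> z)"
    using comp_assoc[OF P P P P] by (simp add: aut_group_def)
next
  fix x assume x: "x \<in> carrier (aut_group C P)"
  then have "x \<in> Mor C P P" by (auto simp: aut_group_def isos_mor)
  then show "\<one>\<^bsub>aut_group C P\<^esub> \<otimes>\<^bsub>aut_group C P\<^esub> x = x" using id_left P by (simp add: aut_group_def)
  from x obtain y where "inverse_mors C P P x y" by (auto simp: aut_group_def isos_iff)
  then show "\<exists>y\<in>carrier (aut_group C P). y \<otimes>\<^bsub>aut_group C P\<^esub> x = \<one>\<^bsub>aut_group C P\<^esub>"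
    using inverse_mors_sym by (intro bexI[of _ y]) (auto simp: aut_group_def isos_iff inverse_mors_def)
qed

lemma iso_cancel_right:
  assumes obj: "P \<in> Obj C" "Q \<in> Obj C" "R \<in> Obj C" and f: "f \<in> isos C P Q"
    and gh: "g \<in> Mor C Q R" "h \<in> Mor C Q R" and e: "Comp C P Q R g f = Comp C P Q R h f"
  shows "g = h"
proof -
  obtain f' where f': "inverse_mors C P Q f f'" using f by (auto simp: isos_iff)
  have "k = Comp C Q P R (Comp C P Q R k f) f'" if "k \<in> Mor C Q R" for k
    using comp_assoc[of Q P Q R f' f k] f' obj that id_right by (simp add: inverse_mors_def)
  then show ?thesis using gh e by metis
qed

end

context cat_functor begin

lemma preserves_inverse_mors:
  assumes "P \<in> Obj C" "Q \<in> Obj C" "inverse_mors C P Q f g"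
  shows "inverse_mors D (FO P) (FO Q) (FM P Q f) (FM Q P g)"
  using assms preserves_id preserves_comp[of P Q P f g] preserves_comp[of Q P Q g f] mor_closed
  by (simp add: inverse_mors_def)

lemma preserves_isos:
  "\<lbrakk>P \<in> Obj C; Q \<in> Obj C; f \<in> isos C P Q\<rbrakk> \<Longrightarrow> FM P Q f \<in> isos D (FO P) (FO Q)"
  unfolding isos_iff using preserves_inverse_mors by blast

lemma group_hom_aut:
  assumes P: "P \<in> Obj C"
  shows "group_hom (aut_group C P) (aut_group D (FO P)) (FM P P)"
proof -
  have "FM P P \<in> hom (aut_group C P) (aut_group D (FO P))"
    using preserves_isos[OF P P] preserves_comp[OF P P P] by (auto simp: hom_def aut_group_def isos_mor)
  then show ?thesis
    using C.group_aut[OF P] D.group_aut[OF obj_closed[OF P]] by (simp add: group_hom_def group_hom_axioms_def)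
qed

text \<open>A lift \<open>g\<close> of the inverse of \<open>FM f\<close> is an inverse of \<open>f\<close> up to the automorphisms \<open>g f\<close> and \<open>f g\<close>.\<close>

lemma reflects_isos:
  assumes obj: "P \<in> Obj C" "Q \<in> Obj C" and f: "f \<in> Mor C P Q" and iso: "FM P Q f \<in> isos D (FO P) (FO Q)"
    and full: "Mor D (FO Q) (FO P) \<subseteq> FM Q P ` Mor C Q P"
    and fib: "\<And>X h. X \<in> Obj C \<Longrightarrow> h \<in> Mor C X X \<Longrightarrow> FM X X h = Idn D (FO X) \<Longrightarrow> h \<in> isos C X X"
  shows "f \<in> isos C P Q"
proof -
  obtain g' where g': "inverse_mors D (FO P) (FO Q) (FM P Q f) g'" using iso by (auto simp: isos_iff)
  then obtain g where g: "g \<in> Mor C Q P" "FM Q P g = g'" using full by (auto simp: inverse_mors_def)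
  show ?thesis
    using obj f g g' C.comp_closed preserves_comp
    by (intro C.isos_if_comps_isos[OF obj f g(1)] fib) (auto simp: inverse_mors_def)
qed

end

section \<open>Transporter systems\<close>

lemma fusion_cat_simps [simp]:
  "Obj (fusion_cat S F) = {P. subgroup P S}" "Mor (fusion_cat S F) = F"
  "Comp (fusion_cat S F) P Q R g f = compose P g f" "Idn (fusion_cat S F) P = (\<lambda>x\<in>P. x)"
  by (simp_all add: fusion_cat_def)

lemma transporter_cat_simps [simp]:
  "Obj (transporter_cat S X) = X" "Mor (transporter_cat S X) = transporter S"
  "Comp (transporter_cat S X) P Q R y x = y \<otimes>\<^bsub>S\<^esub> x" "Idn (transporter_cat S X) P = \<one>\<^bsub>S\<^esub>"
  by (simp_all add: transporter_cat_def)

lemma aut_group_simps [simp]: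
  "carrier (aut_group C P) = isos C P P" "x \<otimes>\<^bsub>aut_group C P\<^esub> y = Comp C P P P x y"
  "\<one>\<^bsub>aut_group C P\<^esub> = Idn C P"
  by (simp_all add: aut_group_def)

lemma inj_homsD:
  assumes "f \<in> inj_homs S P Q"
  shows "f \<in> extensional P" "inj_on f P" "x \<in> P \<Longrightarrow> f x \<in> Q"
    "x \<in> P \<Longrightarrow> y \<in> P \<Longrightarrow> f (x \<otimes>\<^bsub>S\<^esub> y) = f x \<otimes>\<^bsub>S\<^esub> f y" "f ` P \<subseteq> Q"
  using assms by (auto simp: inj_homs_def hom_def)

lemma category_fusion_cat:
  assumes inj: "\<And>P Q f. f \<in> F P Q \<Longrightarrow> f \<in> inj_homs S P Q"
    and comp: "\<And>P Q R f g. f \<in> F P Q \<Longrightarrow> g \<in> F Q R \<Longrightarrow> compose P g f \<in> F P R"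
    and id: "\<And>P. subgroup P S \<Longrightarrow> (\<lambda>x\<in>P. x) \<in> F P P"
  shows "category (fusion_cat S F)"
proof
  show "Comp (fusion_cat S F) P Q R g f \<in> Mor (fusion_cat S F) P R"
    if "f \<in> Mor (fusion_cat S F) P Q" "g \<in> Mor (fusion_cat S F) Q R" for P Q R f g
    using comp that by simp
  show "Idn (fusion_cat S F) P \<in> Mor (fusion_cat S F) P P" if "P \<in> Obj (fusion_cat S F)" for P
    using id that by simp
  fix P Q f assume "f \<in> Mor (fusion_cat S F) P Q"
  then have f: "f \<in> inj_homs S P Q" using inj by simp
  note fQ = inj_homsD(3)[OF f] and fe = inj_homsD(1)[OF f]
  show "Comp (fusion_cat S F) P Q W (Comp (fusion_cat S F) Q R W h g) f
      = Comp (fusion_cat S F) P R W h (Comp (fusion_cat S F) P Q R g f)" for R W g h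
    using fQ by (simp add: compose_def restrict_def fun_eq_iff)
  show "Comp (fusion_cat S F) P Q Q (Idn (fusion_cat S F) Q) f = f"
    using fQ fe by (auto simp: compose_def restrict_def fun_eq_iff extensional_def)
  show "Comp (fusion_cat S F) P P Q f (Idn (fusion_cat S F) P) = f"
    using fe by (auto simp: compose_def restrict_def fun_eq_iff extensional_def)
qed

context group begin

lemma conj_by_closed: "g \<in> carrier G \<Longrightarrow> x \<in> carrier G \<Longrightarrow> conj_by G g x \<in> carrier G"
  by (simp add: conj_by_def)

lemma conj_by_one [simp]: "x \<in> carrier G \<Longrightarrow> conj_by G \<one> x = x"
  by (simp add: conj_by_def)

lemma conj_by_conj_by:
  "\<lbrakk>g \<in> carrier G; h \<in> carrier G; x \<in> carrier G\<rbrakk> \<Longrightarrow> conj_by G (g \<otimes> h) x = conj_by G g (conj_by G h x)"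
  by (simp add: conj_by_def m_assoc inv_mult_group)

lemma one_transporter:
  "subgroup P G \<Longrightarrow> P \<subseteq> Q \<Longrightarrow> \<one> \<in> transporter G P Q"
  using subgroup.mem_carrier by (fastforce simp: transporter_def)

lemma mem_transporter:
  "\<lbrakk>subgroup Q G; P \<subseteq> Q; y \<in> Q\<rbrakk> \<Longrightarrow> y \<in> transporter G P Q"
  by (auto simp: transporter_def conj_by_def subgroup.mem_carrier
      intro!: subgroup.m_closed subgroup.m_inv_closed)

lemma transporter_mult:
  assumes "P \<subseteq> carrier G" "x \<in> transporter G P Q" "y \<in> transporter G Q R"
  shows "y \<otimes> x \<in> transporter G P R"
  using assms by (auto simp: transporter_def conj_by_conj_by subset_eq)

lemma group_hom_of_hom:
  assumes "subgroup P G" "subgroup Q G" "f \<in> hom (G\<lparr>carrier := P\<rparr>) (G\<lparr>carrier := Q\<rparr>)"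
  shows "group_hom (G\<lparr>carrier := P\<rparr>) (G\<lparr>carrier := Q\<rparr>) f"
  using assms subgroup_imp_group by (simp add: group_hom_def group_hom_axioms_def)

lemma hom_image_subgroup:
  assumes P: "subgroup P G" and Q: "subgroup Q G" and f: "f \<in> hom (G\<lparr>carrier := P\<rparr>) (G\<lparr>carrier := Q\<rparr>)"
    and P': "subgroup P' G" "P' \<subseteq> P"
  shows "subgroup (f ` P') G"
proof -
  interpret f: group_hom "G\<lparr>carrier := P\<rparr>" "G\<lparr>carrier := Q\<rparr>" f by (rule group_hom_of_hom[OF P Q f])
  have "subgroup (f ` P') (G\<lparr>carrier := Q\<rparr>)"
    by (rule f.subgroup_img_is_subgroup) (rule subgroup_incl[OF P'(1) P P'(2)])
  then show ?thesis by (rule incl_subgroup[OF Q])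
qed

end

context transporter_system begin

lemma group_S: "group S"
  using discrete_p_toral by (simp add: discrete_p_toral_def)

sublocale S: group S by (rule group_S)

lemma obj_subgroup: "P \<in> Obj T \<Longrightarrow> subgroup P S"
  using objects by blast

lemma carrier_obj: "carrier S \<in> Obj T"
  using nonempty overgroup_closed S.subgroup_self obj_subgroup subgroup.subset by blast

lemma obj_sub: "P \<in> Obj T \<Longrightarrow> P \<subseteq> carrier S"
  using obj_subgroup subgroup.subset by blast

lemma rho_F: "\<lbrakk>P \<in> Obj T; Q \<in> Obj T; f \<in> Mor T P Q\<rbrakk> \<Longrightarrow> \<rho> P Q f \<in> F P Q"
  using rho.mor_closed by simp

lemma F_inj_homs: "\<lbrakk>P \<in> Obj T; Q \<in> Obj T; f \<in> F P Q\<rbrakk> \<Longrightarrow> f \<in> inj_homs S P Q"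
  using subset_inj_homs obj_subgroup by blast

lemma rho_inj_homs: "\<lbrakk>P \<in> Obj T; Q \<in> Obj T; f \<in> Mor T P Q\<rbrakk> \<Longrightarrow> \<rho> P Q f \<in> inj_homs S P Q"
  using F_inj_homs rho_F by blast

lemma rho_comp:
  "\<lbrakk>P \<in> Obj T; Q \<in> Obj T; R \<in> Obj T; f \<in> Mor T P Q; g \<in> Mor T Q R\<rbrakk>
    \<Longrightarrow> \<rho> P R (Comp T P Q R g f) = compose P (\<rho> Q R g) (\<rho> P Q f)"
  using rho.preserves_comp by simp

abbreviation E where "E P \<equiv> kernel (aut_group T P) (aut_group (fusion_cat S F) P) (\<rho> P P)"

lemma rho_fibre:
  assumes "P \<in> Obj T" "Q \<in> Obj T" "f \<in> Mor T P Q" "f' \<in> Mor T P Q" "\<rho> P Q f = \<rho> P Q f'"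
  obtains e where "e \<in> E P" "f' = Comp T P P Q f e"
  using A2_right[OF assms(1,2) refl] assms(3-5) by (auto simp: orbit_map_right_def)

lemma rho_id_kernel:
  assumes P: "P \<in> Obj T" and f: "f \<in> Mor T P P" "\<rho> P P f = (\<lambda>x\<in>P. x)"
  shows "f \<in> E P"
proof -
  have "\<rho> P P (Idn T P) = \<rho> P P f" using f rho.preserves_id[OF P] by simp
  then obtain e where e: "e \<in> E P" "f = Comp T P P P (Idn T P) e"
    using rho_fibre[OF P P id_closed[OF P] f(1)] by blast
  then have "e \<in> Mor T P P" using isos_mor[of e T P P] by (simp add: kernel_def)
  then show ?thesis using e id_left[OF P P] by simp
qed

text \<open>Morphisms of the fusion system are injective, so \<open>a\<close> and \<open>b\<close> have the same image in it and differ by an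
  element of \<open>E P\<close>; this element fixes \<open>f a\<close>, and the action is free.\<close>

lemma left_cancel:
  assumes obj: "P \<in> Obj T" "Q \<in> Obj T" "R \<in> Obj T" and m: "a \<in> Mor T P Q" "b \<in> Mor T P Q" "f \<in> Mor T Q R"
    and e: "Comp T P Q R f a = Comp T P Q R f b"
  shows "a = b"
proof -
  note ih = rho_inj_homs[OF obj(2,3) m(3)] rho_inj_homs[OF obj(1,2) m(1)] rho_inj_homs[OF obj(1,2) m(2)]
  have "compose P (\<rho> Q R f) (\<rho> P Q a) = compose P (\<rho> Q R f) (\<rho> P Q b)"
    using rho_comp obj m e by metis
  then have c: "\<rho> Q R f (\<rho> P Q a x) = \<rho> Q R f (\<rho> P Q b x)" if "x \<in> P" for x
    using that by (metis compose_eq)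
  have "\<rho> P Q a x = \<rho> P Q b x" if "x \<in> P" for x
    using inj_onD[OF inj_homsD(2)[OF ih(1)] c[OF that]] inj_homsD(3)[OF ih(2)] inj_homsD(3)[OF ih(3)] that by blast
  then have "\<rho> P Q a = \<rho> P Q b"
    using extensionalityI[OF inj_homsD(1)[OF ih(2)] inj_homsD(1)[OF ih(3)]] by blast
  then obtain k where k: "k \<in> E P" "b = Comp T P P Q a k" using rho_fibre[OF obj(1,2) m(1,2)] by blast
  have km: "k \<in> Mor T P P" using k(1) isos_mor[of k T P P] by (simp add: kernel_def)
  have "Comp T P P R (Comp T P Q R f a) k = Comp T P Q R f a"
    using comp_assoc[of P P Q R k a f] obj m km k e by simp
  then have "k = Idn T P"
    using A2_right[OF obj(1,3) refl] k(1) comp_closed[of P Q R a f] obj m by (auto simp: free_right_def)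
  then show ?thesis using k(2) id_right obj m by simp
qed

lemma rho_reflects_isos:
  assumes P: "P \<in> Obj T" and Q: "Q \<in> Obj T" and f: "f \<in> Mor T P Q"
    and iso: "\<rho> P Q f \<in> isos (fusion_cat S F) P Q"
  shows "f \<in> isos T P Q"
proof (rule rho.reflects_isos[OF P Q f iso])
  show "Mor (fusion_cat S F) Q P \<subseteq> \<rho> Q P ` Mor T Q P" using A1_surj[OF Q P] by simp
  show "h \<in> isos T X X" if "X \<in> Obj T" "h \<in> Mor T X X" "\<rho> X X h = Idn (fusion_cat S F) X" for X h
    using rho_id_kernel[of X h] that by (simp add: kernel_def)
qed

lemma rho_incl: "\<lbrakk>P \<in> Obj T; Q \<in> Obj T; P \<subseteq> Q\<rbrakk> \<Longrightarrow> \<rho> P Q (\<epsilon> P Q \<one>\<^bsub>S\<^esub>) = (\<lambda>x\<in>P. x)"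
  using B[of P Q "\<one>\<^bsub>S\<^esub>"] S.one_transporter obj_subgroup obj_sub by (fastforce simp: restrict_def fun_eq_iff)

lemma incl_mor: "\<lbrakk>P \<in> Obj T; Q \<in> Obj T; P \<subseteq> Q\<rbrakk> \<Longrightarrow> \<epsilon> P Q \<one>\<^bsub>S\<^esub> \<in> Mor T P Q"
  using eps.mor_closed S.one_transporter obj_subgroup by simp

text \<open>The factorization of \<open>\<rho> f\<close> in the fusion system lifts to \<open>T\<close> up to an element of \<open>E P\<close>, which is
  absorbed into the isomorphism.\<close>

lemma factorization:
  assumes P: "P \<in> Obj T" and Q: "Q \<in> Obj T" and f: "f \<in> Mor T P Q"
  shows "\<rho> P Q f ` P \<in> Obj T" "\<rho> P Q f ` P \<subseteq> Q"
    "\<exists>g \<in> isos T P (\<rho> P Q f ` P). f = Comp T P (\<rho> P Q f ` P) Q (\<epsilon> (\<rho> P Q f ` P) Q \<one>\<^bsub>S\<^esub>) g"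
proof -
  obtain R u where R: "subgroup R S" "R \<subseteq> Q" and u: "u \<in> isos (fusion_cat S F) P R"
    and fu: "\<rho> P Q f = compose P (\<lambda>x\<in>R. x) u"
    using factors[OF obj_subgroup[OF P] obj_subgroup[OF Q] rho_F[OF P Q f]] by blast
  have RO: "R \<in> Obj T"
    using conjugacy_closed[OF P] u R obj_subgroup[OF P] by (auto simp: fusion_conjugate_def)
  obtain v where v: "inverse_mors (fusion_cat S F) P R u v" using u by (auto simp: isos_iff)
  then have uv: "u \<in> F P R" "v \<in> F R P" "compose R u v = (\<lambda>x\<in>R. x)" by (auto simp: inverse_mors_def)
  note ih = F_inj_homs[OF P RO uv(1)] F_inj_homs[OF RO P uv(2)]
  have fu': "\<rho> P Q f x = u x" if "x \<in> P" for x
    using fu that inj_homsD(3)[OF ih(1)] by (simp add: compose_def)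
  have "u ` P = R"
  proof
    show "u ` P \<subseteq> R" using inj_homsD(5)[OF ih(1)] .
    show "R \<subseteq> u ` P"
    proof
      fix y assume y: "y \<in> R"
      have "u (v y) = y" using fun_cong[OF uv(3), of y] y by (simp add: compose_def)
      then show "y \<in> u ` P" using inj_homsD(3)[OF ih(2) y] by force
    qed
  qed
  then have im: "\<rho> P Q f ` P = R" using fu' by (simp cong: image_cong)
  show "\<rho> P Q f ` P \<in> Obj T" "\<rho> P Q f ` P \<subseteq> Q" unfolding im by (rule RO, rule R(2))
  obtain g where g: "g \<in> Mor T P R" "\<rho> P R g = u" using uv(1) unfolding A1_surj[OF P RO, symmetric] by blast
  have giso: "g \<in> isos T P R" using rho_reflects_isos[OF P RO g(1)] g(2) u by simp
  have inc: "\<epsilon> R Q \<one>\<^bsub>S\<^esub> \<in> Mor T R Q" by (rule incl_mor[OF RO Q R(2)])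
  have m: "Comp T P R Q (\<epsilon> R Q \<one>\<^bsub>S\<^esub>) g \<in> Mor T P Q" using comp_closed[OF P RO Q g(1) inc] .
  have "\<rho> P Q (Comp T P R Q (\<epsilon> R Q \<one>\<^bsub>S\<^esub>) g) = \<rho> P Q f"
    using rho_comp[OF P RO Q g(1) inc] rho_incl[OF RO Q R(2)] g(2) fu by simp
  then obtain e where e: "e \<in> E P" "f = Comp T P P Q (Comp T P R Q (\<epsilon> R Q \<one>\<^bsub>S\<^esub>) g) e"
    using rho_fibre[OF P Q m f] by blast
  have eiso: "e \<in> isos T P P" using e(1) by (simp add: kernel_def)
  have "f = Comp T P R Q (\<epsilon> R Q \<one>\<^bsub>S\<^esub>) (Comp T P P R g e)"
    using e(2) comp_assoc[OF P P RO Q isos_mor[OF eiso] g(1) inc] by simp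
  moreover have "Comp T P P R g e \<in> isos T P R" using isos_comp[OF P P RO eiso giso] .
  ultimately show "\<exists>g \<in> isos T P (\<rho> P Q f ` P). f = Comp T P (\<rho> P Q f ` P) Q (\<epsilon> (\<rho> P Q f ` P) Q \<one>\<^bsub>S\<^esub>) g"
    unfolding im by blast
qed

lemma eps_comp:
  "\<lbrakk>P \<in> Obj T; Q \<in> Obj T; R \<in> Obj T; x \<in> transporter S P Q; y \<in> transporter S Q R\<rbrakk>
    \<Longrightarrow> Comp T P Q R (\<epsilon> Q R y) (\<epsilon> P Q x) = \<epsilon> P R (y \<otimes>\<^bsub>S\<^esub> x)"
  using eps.preserves_comp[of P Q R x y] by simp

lemma eps_mor: "\<lbrakk>P \<in> Obj T; Q \<in> Obj T; x \<in> transporter S P Q\<rbrakk> \<Longrightarrow> \<epsilon> P Q x \<in> Mor T P Q"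
  using eps.mor_closed by simp

text \<open>By \<open>factorization\<close> it suffices to consider an inclusion \<open>f\<close>, where the claim is the injectivity of
  \<open>\<epsilon>\<close>.\<close>

lemma eps_cancel:
  assumes P: "P \<in> Obj T" and Q: "Q \<in> Obj T" and f: "f \<in> Mor T P Q" and y: "y \<in> Q" and z: "z \<in> Q"
    and e: "Comp T P Q Q (\<epsilon> Q Q y) f = Comp T P Q Q (\<epsilon> Q Q z) f"
  shows "y = z"
proof -
  let ?R = "\<rho> P Q f ` P"
  obtain g where g: "g \<in> isos T P ?R" "f = Comp T P ?R Q (\<epsilon> ?R Q \<one>\<^bsub>S\<^esub>) g"
    using factorization(3)[OF P Q f] by blast
  have R: "?R \<in> Obj T" "?R \<subseteq> Q" using factorization[OF P Q f] by auto
  have sQ: "subgroup Q S" and sR: "subgroup ?R S" using obj_subgroup Q R by auto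
  have inc: "\<epsilon> ?R Q \<one>\<^bsub>S\<^esub> \<in> Mor T ?R Q" by (rule incl_mor[OF R(1) Q R(2)])
  have t1: "\<one>\<^bsub>S\<^esub> \<in> transporter S ?R Q" using S.one_transporter[OF sR R(2)] .
  have w: "Comp T P Q Q (\<epsilon> Q Q w) f = Comp T P ?R Q (\<epsilon> ?R Q w) g" "w \<in> transporter S ?R Q" if "w \<in> Q" for w
  proof -
    have tw: "w \<in> transporter S Q Q" using S.mem_transporter[OF sQ _ that] by simp
    have "w \<otimes>\<^bsub>S\<^esub> \<one>\<^bsub>S\<^esub> = w" using subgroup.mem_carrier[OF sQ that] by simp
    then have "Comp T ?R Q Q (\<epsilon> Q Q w) (\<epsilon> ?R Q \<one>\<^bsub>S\<^esub>) = \<epsilon> ?R Q w"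
      using eps_comp[OF R(1) Q Q t1 tw] by simp
    then show "Comp T P Q Q (\<epsilon> Q Q w) f = Comp T P ?R Q (\<epsilon> ?R Q w) g"
      using comp_assoc[OF P R(1) Q Q isos_mor[OF g(1)] inc eps_mor[OF Q Q tw]] g(2) by simp
    show "w \<in> transporter S ?R Q" using S.mem_transporter[OF sQ R(2) that] .
  qed
  have "\<epsilon> ?R Q y = \<epsilon> ?R Q z"
    using iso_cancel_right[OF P R(1) Q g(1) eps_mor[OF R(1) Q w(2)[OF y]] eps_mor[OF R(1) Q w(2)[OF z]]]
      w(1)[OF y] w(1)[OF z] e by simp
  then show ?thesis using inj_onD[OF A1_inj[OF R(1) Q]] w(2) y z by blast
qed

end

section \<open>The functors of the extension\<close>

locale transporter_extension =
  transporter_system p S F T \<epsilon> \<rho> + category_extension p T Th \<tau>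
  for p :: nat
    and S :: "('a, 'b) monoid_scheme"
    and F :: "'a hom_family"
    and T :: "('a set, 'm) cat"
    and \<epsilon> :: "'a set \<Rightarrow> 'a set \<Rightarrow> 'a \<Rightarrow> 'm"
    and \<rho> :: "'a set \<Rightarrow> 'a set \<Rightarrow> 'm \<Rightarrow> 'a \<Rightarrow> 'a"
    and Th :: "('a set, 'n) cat"
    and \<tau> :: "'a set \<Rightarrow> 'a set \<Rightarrow> 'n \<Rightarrow> 'm" +
  fixes St :: "('a \<times> 'n) monoid"
    and A :: "('a \<times> 'n) set"
    and Tt :: "(('a \<times> 'n) set, 'n) cat"
    and \<iota> :: "('a \<times> 'n) set \<Rightarrow> 'n"
    and \<epsilon>t :: "('a \<times> 'n) set \<Rightarrow> ('a \<times> 'n) set \<Rightarrow> 'a \<times> 'n \<Rightarrow> 'n"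
    and \<rho>t :: "('a \<times> 'n) set \<Rightarrow> ('a \<times> 'n) set \<Rightarrow> 'n \<Rightarrow> 'a \<times> 'n \<Rightarrow> 'a \<times> 'n"
    and Ft :: "('a \<times> 'n) hom_family"
  assumes prime_p: "prime p"
    and St_def: "St = ext_group S \<epsilon> Th \<tau>"
    and A_def: "A = kernel St S fst"
    and Tt_def: "Tt = ext_cat St Th"
    and \<iota>_lifts: "inclusion_lifts S \<epsilon> \<tau> St Tt \<iota>"
    and \<epsilon>t_def: "\<epsilon>t = ext_eps St Tt \<iota>"
    and \<rho>t_def: "\<rho>t = ext_rho St Tt \<epsilon>t"
    and Ft_def: "Ft = generated_fusion St (Obj Tt) (\<lambda>X Y. \<rho>t X Y ` Mor Tt X Y)"
begin

lemma kernel_memI: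
  assumes P: "P \<in> Obj T" and h: "h \<in> Mor Th P P" "\<tau> P P h = Idn T P"
  shows "h \<in> ext_kernel T Th \<tau> P"
proof -
  have P': "P \<in> Obj Th" using P same_objects by simp
  have i: "Idn Th P \<in> Mor Th P P" using tau.C.id_closed P' by simp
  have "\<tau> P P (Idn Th P) = \<tau> P P h" using h tau.preserves_id P' by simp
  then obtain k where k: "k \<in> ext_kernel T Th \<tau> P" "h = Comp Th P P P (Idn Th P) k"
    using right_action[OF P' P'] i h(1) unfolding orbit_map_right_def by blast
  have "k \<in> Mor Th P P" using k(1) isos_mor[of k Th P P] by (simp add: ext_kernel_def kernel_def)
  then show ?thesis using k tau.C.id_left[OF P' P'] by simp
qed

lemma tau_reflects_isos:
  assumes P: "P \<in> Obj T" and Q: "Q \<in> Obj T" and f: "f \<in> Mor Th P Q" and iso: "\<tau> P Q f \<in> isos T P Q"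
  shows "f \<in> isos Th P Q"
proof (rule tau.reflects_isos[OF _ _ f iso])
  show "P \<in> Obj Th" "Q \<in> Obj Th" using P Q same_objects by auto
  then show "Mor T Q P \<subseteq> \<tau> Q P ` Mor Th Q P"
    using right_action[of Q P] by (simp add: orbit_map_right_def)
  show "h \<in> isos Th X X" if "X \<in> Obj Th" "h \<in> Mor Th X X" "\<tau> X X h = Idn T X" for X h
    using kernel_memI[of X h] that same_objects by (simp add: ext_kernel_def kernel_def)
qed

abbreviation S0 where "S0 \<equiv> carrier S"

lemma S0_Th: "S0 \<in> Obj Th"
  using carrier_obj same_objects by simp

lemma St_carrier: "x \<in> carrier St \<longleftrightarrow> fst x \<in> S0 \<and> snd x \<in> isos Th S0 S0 \<and> \<epsilon> S0 S0 (fst x) = \<tau> S0 S0 (snd x)"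
  by (cases x) (auto simp: St_def ext_group_def pullback_group_def)

lemma St_mult: "x \<otimes>\<^bsub>St\<^esub> y = (fst x \<otimes>\<^bsub>S\<^esub> fst y, Comp Th S0 S0 S0 (snd x) (snd y))"
  by (cases x; cases y) (simp add: St_def ext_group_def pullback_group_def DirProd_def)

lemma St_one: "\<one>\<^bsub>St\<^esub> = (\<one>\<^bsub>S\<^esub>, Idn Th S0)"
  by (simp add: St_def ext_group_def pullback_group_def DirProd_def)

lemma S0_transporter: "x \<in> S0 \<Longrightarrow> x \<in> transporter S S0 S0"
  using S.mem_transporter[OF S.subgroup_self] by simp

lemma eps_S0_hom: "\<epsilon> S0 S0 \<in> hom S (aut_group T S0)"
proof (rule homI)
  fix x y assume "x \<in> S0" "y \<in> S0"
  then show "\<epsilon> S0 S0 (x \<otimes>\<^bsub>S\<^esub> y) = \<epsilon> S0 S0 x \<otimes>\<^bsub>aut_group T S0\<^esub> \<epsilon> S0 S0 y"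
    using eps_comp[OF carrier_obj carrier_obj carrier_obj S0_transporter S0_transporter] by simp
next
  fix x assume x: "x \<in> S0"
  have "inverse_mors (transporter_cat S (Obj T)) S0 S0 x (inv\<^bsub>S\<^esub> x)"
    using S0_transporter x by (simp add: inverse_mors_def)
  then show "\<epsilon> S0 S0 x \<in> carrier (aut_group T S0)"
    using eps.preserves_isos[of S0 S0 x] carrier_obj by (auto simp: isos_iff)
qed

sublocale St: group St
proof -
  interpret H: group "aut_group Th S0" by (rule tau.C.group_aut[OF S0_Th])
  interpret SH: group "S \<times>\<times> aut_group Th S0" by (rule DirProd_group[OF group_S H.is_group])
  interpret e: group_hom S "aut_group T S0" "\<epsilon> S0 S0"
    using eps_S0_hom group_aut[OF carrier_obj] by (simp add: group_hom_def group_hom_axioms_def group_S)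
  interpret t: group_hom "aut_group Th S0" "aut_group T S0" "\<tau> S0 S0" by (rule tau.group_hom_aut[OF S0_Th])
  let ?K = "{(x, y) \<in> carrier S \<times> carrier (aut_group Th S0). \<epsilon> S0 S0 x = \<tau> S0 S0 y}"
  have "subgroup ?K (S \<times>\<times> aut_group Th S0)"
  proof (rule SH.subgroupI)
    show "?K \<subseteq> carrier (S \<times>\<times> aut_group Th S0)" by auto
    show "?K \<noteq> {}" using e.hom_one t.hom_one H.one_closed by fastforce
  next
    fix a assume "a \<in> ?K"
    then obtain x y where a: "a = (x, y)" "x \<in> carrier S" "y \<in> carrier (aut_group Th S0)" "\<epsilon> S0 S0 x = \<tau> S0 S0 y"
      by auto
    have "\<epsilon> S0 S0 (inv\<^bsub>S\<^esub> x) = \<tau> S0 S0 (inv\<^bsub>aut_group Th S0\<^esub> y)"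
      using a e.hom_inv[OF a(2)] t.hom_inv[OF a(3)] by simp
    then show "inv\<^bsub>S \<times>\<times> aut_group Th S0\<^esub> a \<in> ?K"
      using inv_DirProd[OF group_S H.is_group a(2,3)] a S.inv_closed[OF a(2)] H.inv_closed[OF a(3)] by simp
  next
    fix a b assume "a \<in> ?K" "b \<in> ?K"
    then obtain x y x' y' where a: "a = (x, y)" "x \<in> carrier S" "y \<in> carrier (aut_group Th S0)" "\<epsilon> S0 S0 x = \<tau> S0 S0 y"
      and b: "b = (x', y')" "x' \<in> carrier S" "y' \<in> carrier (aut_group Th S0)" "\<epsilon> S0 S0 x' = \<tau> S0 S0 y'" by auto
    have "\<epsilon> S0 S0 (x \<otimes>\<^bsub>S\<^esub> x') = \<tau> S0 S0 (y \<otimes>\<^bsub>aut_group Th S0\<^esub> y')"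
      using e.hom_mult[OF a(2) b(2)] t.hom_mult[OF a(3) b(3)] a b by simp
    then show "a \<otimes>\<^bsub>S \<times>\<times> aut_group Th S0\<^esub> b \<in> ?K"
      using a b S.m_closed[OF a(2) b(2)] H.m_closed[OF a(3) b(3)] by (simp add: DirProd_def)
  qed
  then show "group St" unfolding St_def ext_group_def pullback_group_def by (rule SH.subgroup_imp_group)
qed

lemma fst_surj: "fst ` carrier St = S0"
proof
  show "S0 \<subseteq> fst ` carrier St"
  proof
    fix x assume x: "x \<in> S0"
    have e: "\<epsilon> S0 S0 x \<in> isos T S0 S0" using eps_S0_hom x by (auto simp: hom_def)
    have "\<tau> S0 S0 ` Mor Th S0 S0 = Mor T S0 S0"
      using right_action[OF S0_Th S0_Th] by (simp add: orbit_map_right_def)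
    then obtain m where m: "m \<in> Mor Th S0 S0" "\<tau> S0 S0 m = \<epsilon> S0 S0 x" using isos_mor[OF e] by (metis imageE)
    then have "m \<in> isos Th S0 S0" using tau_reflects_isos[OF carrier_obj carrier_obj m(1)] e by simp
    then have "(x, m) \<in> carrier St" using x m by (simp add: St_carrier)
    then show "x \<in> fst ` carrier St" by force
  qed
qed (auto simp: St_carrier)

sublocale fst: group_hom St S fst
proof -
  have "fst \<in> hom St S" by (auto simp: hom_def St_mult St_carrier)
  then show "group_hom St S fst"
    by (simp add: group_hom_def group_hom_axioms_def group_S St.is_group)
qed

lemma A_iff: "x \<in> A \<longleftrightarrow> x \<in> carrier St \<and> fst x = \<one>\<^bsub>S\<^esub>"
  by (simp add: A_def kernel_def)

lemma A_normal: "A \<lhd> St"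
  unfolding A_def by (rule fst.normal_kernel)

lemma A_subgroup: "subgroup A St"
  using A_normal by (rule normal_imp_subgroup)

subsection \<open>The category\<close>

definition pre where "pre P = {x \<in> carrier St. fst x \<in> P}"

lemma fst_pre: "P \<subseteq> S0 \<Longrightarrow> fst ` pre P = P"
proof
  assume P: "P \<subseteq> S0"
  show "P \<subseteq> fst ` pre P"
  proof
    fix x assume x: "x \<in> P"
    then obtain y where "y \<in> carrier St" "x = fst y" using fst_surj P by (metis imageE subsetD)
    then show "x \<in> fst ` pre P" using x by (auto simp: pre_def)
  qed
qed (auto simp: pre_def)

lemma Obj_Tt: "Obj Tt = pre ` Obj T"
  by (simp add: Tt_def ext_cat_def same_objects pre_def[abs_def])

lemma Tt_simps:
  "Mor Tt X Y = Mor Th (fst ` X) (fst ` Y)"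
  "Comp Tt X Y Z = Comp Th (fst ` X) (fst ` Y) (fst ` Z)"
  "Idn Tt X = Idn Th (fst ` X)"
  by (simp_all add: Tt_def ext_cat_def)

lemma obj_fst: "X \<in> Obj Tt \<Longrightarrow> fst ` X \<in> Obj T"
  using fst_pre obj_sub by (auto simp: Obj_Tt)

lemma obj_pre: "X \<in> Obj Tt \<Longrightarrow> X = pre (fst ` X)"
  using fst_pre obj_sub by (auto simp: Obj_Tt)

lemma pre_subgroup: "subgroup P S \<Longrightarrow> subgroup (pre P) St"
  unfolding pre_def using fst.rcosets_vimage(1)[OF fst_surj _ refl] .

lemma pre_obj: "P \<in> Obj T \<Longrightarrow> pre P \<in> Obj Tt"
  by (simp add: Obj_Tt)

lemma Tt_obj_subgroup: "X \<in> Obj Tt \<Longrightarrow> subgroup X St"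
  using pre_subgroup obj_subgroup by (auto simp: Obj_Tt)

lemma A_sub_pre: "subgroup P S \<Longrightarrow> A \<subseteq> pre P"
  using subgroup.one_closed by (auto simp: pre_def A_iff)

lemma A_sub: "X \<in> Obj Tt \<Longrightarrow> A \<subseteq> X"
  using A_sub_pre obj_subgroup by (auto simp: Obj_Tt)

lemma Tt_obj_memI: "X \<in> Obj Tt \<Longrightarrow> x \<in> carrier St \<Longrightarrow> fst x \<in> fst ` X \<Longrightarrow> x \<in> X"
  using obj_pre[of X] by (auto simp: pre_def)

lemma pre_carrier: "pre S0 = carrier St"
  by (auto simp: pre_def St_carrier)

lemma Tt_carrier_obj: "carrier St \<in> Obj Tt"
  using pre_obj[OF carrier_obj] by (simp add: pre_carrier)

lemma fibre_A:
  assumes "x \<in> carrier St" "y \<in> carrier St" "fst x = fst y"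
  obtains a where "a \<in> A" "x = a \<otimes>\<^bsub>St\<^esub> y"
proof
  show "x \<otimes>\<^bsub>St\<^esub> inv\<^bsub>St\<^esub> y \<in> A" using assms by (simp add: A_iff)
  show "x = x \<otimes>\<^bsub>St\<^esub> inv\<^bsub>St\<^esub> y \<otimes>\<^bsub>St\<^esub> y" using assms by (simp add: St.m_assoc)
qed

text \<open>Such a subgroup is a union of cosets of \<open>A\<close>, which are the fibres of \<open>fst\<close>.\<close>

lemma pre_fst: "subgroup X St \<Longrightarrow> A \<subseteq> X \<Longrightarrow> pre (fst ` X) = X"
proof
  assume X: "subgroup X St" and AX: "A \<subseteq> X"
  show "pre (fst ` X) \<subseteq> X"
  proof
    fix y assume "y \<in> pre (fst ` X)"
    then obtain x where x: "y \<in> carrier St" "x \<in> X" "fst y = fst x" by (auto simp: pre_def)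
    obtain a where "a \<in> A" "y = a \<otimes>\<^bsub>St\<^esub> x" using fibre_A[OF x(1) subgroup.mem_carrier[OF X x(2)] x(3)] .
    then show "y \<in> X" using AX x(2) subgroup.m_closed[OF X] by blast
  qed
  show "X \<subseteq> pre (fst ` X)" using subgroup.mem_carrier[OF X] by (auto simp: pre_def)
qed

lemma fst_subgroup: "subgroup X St \<Longrightarrow> subgroup (fst ` X) S"
  by (rule fst.subgroup_img_is_subgroup)

lemma Tt_overgroup_closed:
  assumes X: "X \<in> Obj Tt" and Y: "subgroup Y St" and XY: "X \<subseteq> Y"
  shows "Y \<in> Obj Tt"
proof -
  have "fst ` Y \<in> Obj T" using overgroup_closed[OF obj_fst[OF X] fst_subgroup[OF Y]] XY by blast
  moreover have "pre (fst ` Y) = Y" using pre_fst[OF Y] A_sub[OF X] XY by blast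
  ultimately show ?thesis using pre_obj by metis
qed

sublocale Tt: category Tt
proof
  note o = obj_fst[folded same_objects]
  show "Comp Tt P Q R g f \<in> Mor Tt P R"
    if "P \<in> Obj Tt" "Q \<in> Obj Tt" "R \<in> Obj Tt" "f \<in> Mor Tt P Q" "g \<in> Mor Tt Q R" for P Q R f g
    using tau.C.comp_closed[OF o o o] that by (simp add: Tt_simps)
  show "Idn Tt P \<in> Mor Tt P P" if "P \<in> Obj Tt" for P
    using tau.C.id_closed[OF o] that by (simp add: Tt_simps)
  show "Comp Tt P Q W (Comp Tt Q R W h g) f = Comp Tt P R W h (Comp Tt P Q R g f)"
    if "P \<in> Obj Tt" "Q \<in> Obj Tt" "R \<in> Obj Tt" "W \<in> Obj Tt" "f \<in> Mor Tt P Q" "g \<in> Mor Tt Q R" "h \<in> Mor Tt R W"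
    for P Q R W f g h
    using tau.C.comp_assoc[OF o o o o] that by (simp add: Tt_simps)
  show "Comp Tt P Q Q (Idn Tt Q) f = f" if "P \<in> Obj Tt" "Q \<in> Obj Tt" "f \<in> Mor Tt P Q" for P Q f
    using tau.C.id_left[OF o o] that by (simp add: Tt_simps)
  show "Comp Tt P P Q f (Idn Tt P) = f" if "P \<in> Obj Tt" "Q \<in> Obj Tt" "f \<in> Mor Tt P Q" for P Q f
    using tau.C.id_right[OF o o] that by (simp add: Tt_simps)
qed

abbreviation tt where "tt X Y \<equiv> \<tau> (fst ` X) (fst ` Y)"

sublocale tt: cat_functor Tt T "\<lambda>X. fst ` X" tt
proof
  note o = obj_fst[folded same_objects]
  show "fst ` P \<in> Obj T" if "P \<in> Obj Tt" for P using obj_fst that .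
  show "tt P Q f \<in> Mor T (fst ` P) (fst ` Q)" if "P \<in> Obj Tt" "Q \<in> Obj Tt" "f \<in> Mor Tt P Q" for P Q f
    using tau.mor_closed[OF o o] that by (simp add: Tt_simps)
  show "tt P P (Idn Tt P) = Idn T (fst ` P)" if "P \<in> Obj Tt" for P
    using tau.preserves_id[OF o] that by (simp add: Tt_simps)
  show "tt P R (Comp Tt P Q R g f) = Comp T (fst ` P) (fst ` Q) (fst ` R) (tt Q R g) (tt P Q f)"
    if "P \<in> Obj Tt" "Q \<in> Obj Tt" "R \<in> Obj Tt" "f \<in> Mor Tt P Q" "g \<in> Mor Tt Q R" for P Q R f g
    using tau.preserves_comp[OF o o o] that by (simp add: Tt_simps)
qed

lemma isos_Tt: "isos Tt X Y = isos Th (fst ` X) (fst ` Y)"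
  by (simp add: isos_def inverse_mors_def Tt_simps)

definition K where "K X = ext_kernel T Th \<tau> (fst ` X)"

lemma K_iff: "k \<in> K X \<longleftrightarrow> k \<in> isos Tt X X \<and> tt X X k = Idn T (fst ` X)"
  by (simp add: K_def ext_kernel_def kernel_def isos_Tt)

lemma K_mor: "k \<in> K X \<Longrightarrow> k \<in> Mor Tt X X"
  using isos_mor[of k Tt X X] by (simp add: K_iff)

lemma K_I: "\<lbrakk>X \<in> Obj Tt; k \<in> Mor Tt X X; tt X X k = Idn T (fst ` X)\<rbrakk> \<Longrightarrow> k \<in> K X"
  unfolding K_def using kernel_memI obj_fst by (simp add: Tt_simps)

lemma tt_right:
  assumes "X \<in> Obj Tt" "Y \<in> Obj Tt" "f \<in> Mor Tt X Y" "f' \<in> Mor Tt X Y" "tt X Y f = tt X Y f'"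
  obtains k where "k \<in> K X" "f' = Comp Tt X X Y f k"
proof -
  have "fst ` X \<in> Obj Th" "fst ` Y \<in> Obj Th" using assms obj_fst same_objects by auto
  then have "\<exists>k\<in>ext_kernel T Th \<tau> (fst ` X). f' = Comp Th (fst ` X) (fst ` X) (fst ` Y) f k"
    using right_action[of "fst ` X" "fst ` Y"] assms(3-5) by (simp add: orbit_map_right_def Tt_simps)
  then show ?thesis using that by (auto simp: K_def Tt_simps)
qed

lemma tt_left:
  assumes "X \<in> Obj Tt" "Y \<in> Obj Tt" "f \<in> Mor Tt X Y" "f' \<in> Mor Tt X Y" "tt X Y f = tt X Y f'"
  obtains k where "k \<in> K Y" "f' = Comp Tt X Y Y k f"
proof -
  have "fst ` X \<in> Obj Th" "fst ` Y \<in> Obj Th" using assms obj_fst same_objects by auto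
  then have "\<exists>k\<in>ext_kernel T Th \<tau> (fst ` Y). f' = Comp Th (fst ` X) (fst ` Y) (fst ` Y) k f"
    using left_action[of "fst ` X" "fst ` Y"] assms(3-5) by (simp add: orbit_map_left_def Tt_simps)
  then show ?thesis using that by (auto simp: K_def Tt_simps)
qed

lemma K_free_right:
  assumes "X \<in> Obj Tt" "Y \<in> Obj Tt" "f \<in> Mor Tt X Y" "k \<in> K X" "Comp Tt X X Y f k = f"
  shows "k = Idn Tt X"
proof -
  have "fst ` X \<in> Obj Th" "fst ` Y \<in> Obj Th" using assms obj_fst same_objects by auto
  then show ?thesis
    using right_action[of "fst ` X" "fst ` Y"] assms(3-5) by (simp add: free_right_def Tt_simps K_def)
qed

lemma K_free_left:
  assumes "X \<in> Obj Tt" "Y \<in> Obj Tt" "f \<in> Mor Tt X Y" "k \<in> K Y" "Comp Tt X Y Y k f = f"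
  shows "k = Idn Tt Y"
proof -
  have "fst ` X \<in> Obj Th" "fst ` Y \<in> Obj Th" using assms obj_fst same_objects by auto
  then show ?thesis
    using left_action[of "fst ` X" "fst ` Y"] assms(3-5) by (simp add: free_left_def Tt_simps K_def)
qed

lemma tt_surj:
  assumes "X \<in> Obj Tt" "Y \<in> Obj Tt" "g \<in> Mor T (fst ` X) (fst ` Y)"
  obtains f where "f \<in> Mor Tt X Y" "tt X Y f = g"
proof -
  have "fst ` X \<in> Obj Th" "fst ` Y \<in> Obj Th" using assms obj_fst same_objects by auto
  then have "tt X Y ` Mor Tt X Y = Mor T (fst ` X) (fst ` Y)"
    using right_action[of "fst ` X" "fst ` Y"] by (simp add: orbit_map_right_def Tt_simps)
  then show ?thesis using assms(3) that by (metis imageE)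
qed

lemma tt_reflects_isos:
  assumes "X \<in> Obj Tt" "Y \<in> Obj Tt" "f \<in> Mor Tt X Y" "tt X Y f \<in> isos T (fst ` X) (fst ` Y)"
  shows "f \<in> isos Tt X Y"
  unfolding isos_Tt
  by (rule tau_reflects_isos[OF obj_fst[OF assms(1)] obj_fst[OF assms(2)]]) (use assms(3,4) in \<open>simp_all add: Tt_simps\<close>)

text \<open>Cancelling in \<open>T\<close> shows that \<open>a\<close> and \<open>b\<close> lie over the same morphism; the element of \<open>K X\<close> by which
  they differ is trivial because it fixes \<open>f a\<close>.\<close>

lemma Tt_left_cancel:
  assumes obj: "X \<in> Obj Tt" "Y \<in> Obj Tt" "Z \<in> Obj Tt" and m: "a \<in> Mor Tt X Y" "b \<in> Mor Tt X Y" "f \<in> Mor Tt Y Z"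
    and e: "Comp Tt X Y Z f a = Comp Tt X Y Z f b"
  shows "a = b"
proof -
  have "Comp T (fst ` X) (fst ` Y) (fst ` Z) (tt Y Z f) (tt X Y a) = Comp T (fst ` X) (fst ` Y) (fst ` Z) (tt Y Z f) (tt X Y b)"
    using tt.preserves_comp[OF obj m(1,3)] tt.preserves_comp[OF obj m(2,3)] e by metis
  then have "tt X Y a = tt X Y b"
    by (rule left_cancel[OF obj_fst[OF obj(1)] obj_fst[OF obj(2)] obj_fst[OF obj(3)] tt.mor_closed[OF obj(1,2) m(1)]
          tt.mor_closed[OF obj(1,2) m(2)] tt.mor_closed[OF obj(2,3) m(3)]])
  then obtain k where k: "k \<in> K X" "b = Comp Tt X X Y a k" using tt_right[OF obj(1,2) m(1,2)] by blast
  have "Comp Tt X X Z (Comp Tt X Y Z f a) k = Comp Tt X Y Z f a"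
    using Tt.comp_assoc[OF obj(1,1,2,3) K_mor[OF k(1)] m(1,3)] k(2) e by simp
  then have "k = Idn Tt X"
    using K_free_right[OF obj(1,3) Tt.comp_closed[OF obj m(1,3)] k(1)] by simp
  then show ?thesis using k(2) Tt.id_right[OF obj(1,2) m(1)] by simp
qed

subsection \<open>The functor \<open>\<epsilon>t\<close>\<close>

lemma \<iota>_mor: "X \<in> Obj Tt \<Longrightarrow> \<iota> X \<in> Mor Tt X (carrier St)"
  and \<iota>_tt: "X \<in> Obj Tt \<Longrightarrow> \<tau> (fst ` X) S0 (\<iota> X) = \<epsilon> (fst ` X) S0 \<one>\<^bsub>S\<^esub>"
  using \<iota>_lifts by (auto simp: inclusion_lifts_def fst_surj)

lemma snd_mor: "x \<in> carrier St \<Longrightarrow> snd x \<in> Mor Tt (carrier St) (carrier St)"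
  and snd_tt: "x \<in> carrier St \<Longrightarrow> \<tau> S0 S0 (snd x) = \<epsilon> S0 S0 (fst x)"
  using isos_mor[of "snd x" Th S0 S0] by (auto simp: St_carrier Tt_simps fst_surj)

lemma fst_transporter:
  assumes x: "x \<in> transporter St X Y" and X: "X \<subseteq> carrier St"
  shows "fst x \<in> transporter S (fst ` X) (fst ` Y)"
proof -
  have xc: "x \<in> carrier St" and xX: "\<And>u. u \<in> X \<Longrightarrow> conj_by St x u \<in> Y" using x by (auto simp: transporter_def)
  have "conj_by S (fst x) (fst u) \<in> fst ` Y" if u: "u \<in> X" for u
  proof -
    have "conj_by S (fst x) (fst u) = fst (conj_by St x u)" using xc u X by (auto simp: conj_by_def subset_eq)
    then show ?thesis using xX[OF u] by simp
  qed
  then show ?thesis using xc by (auto simp: transporter_def)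
qed

lemma Tt_transporter_iff:
  assumes X: "X \<in> Obj Tt" and Y: "Y \<in> Obj Tt"
  shows "x \<in> transporter St X Y \<longleftrightarrow> x \<in> carrier St \<and> fst x \<in> transporter S (fst ` X) (fst ` Y)"
proof
  have Xc: "X \<subseteq> carrier St" using Tt_obj_subgroup[OF X] by (rule subgroup.subset)
  show "x \<in> carrier St \<and> fst x \<in> transporter S (fst ` X) (fst ` Y)" if "x \<in> transporter St X Y"
    using fst_transporter[OF that Xc] that by (simp add: transporter_def)
  show "x \<in> transporter St X Y" if a: "x \<in> carrier St \<and> fst x \<in> transporter S (fst ` X) (fst ` Y)"
  proof -
    have "conj_by St x u \<in> Y" if u: "u \<in> X" for u
    proof (rule Tt_obj_memI[OF Y])
      have uc: "u \<in> carrier St" using u Xc by blast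
      show "conj_by St x u \<in> carrier St" using uc a St.conj_by_closed by blast
      have "fst (conj_by St x u) = conj_by S (fst x) (fst u)" using uc a by (simp add: conj_by_def)
      then show "fst (conj_by St x u) \<in> fst ` Y" using a u by (auto simp: transporter_def)
    qed
    then show ?thesis using a by (auto simp: transporter_def)
  qed
qed

lemma St_transporter_carrier: "x \<in> transporter St X Y \<Longrightarrow> x \<in> carrier St"
  by (simp add: transporter_def)

lemma St_transporter_self: "x \<in> transporter St X Y \<Longrightarrow> x \<in> transporter St (carrier St) (carrier St)"
  using St.mem_transporter[OF St.subgroup_self] by (simp add: transporter_def)

text \<open>Any lift of \<open>\<epsilon> (fst x)\<close> satisfies the equation up to an element of \<open>K X\<close>.\<close>

lemma \<epsilon>t_ex1:
  assumes X: "X \<in> Obj Tt" and Y: "Y \<in> Obj Tt" and x: "x \<in> transporter St X Y"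
  shows "\<exists>!\<mu>. \<mu> \<in> Mor Tt X Y \<and>
     Comp Tt X Y (carrier St) (\<iota> Y) \<mu> = Comp Tt X (carrier St) (carrier St) (snd x) (\<iota> X)"
proof -
  note Z = Tt_carrier_obj
  note oX = obj_fst[OF X] and oY = obj_fst[OF Y]
  have xc: "x \<in> carrier St" using x by (rule St_transporter_carrier)
  have fx: "fst x \<in> transporter S (fst ` X) (fst ` Y)" using x Tt_transporter_iff[OF X Y] by simp
  obtain m where m: "m \<in> Mor Tt X Y" "tt X Y m = \<epsilon> (fst ` X) (fst ` Y) (fst x)"
    using tt_surj[OF X Y eps_mor[OF oX oY fx]] by blast
  have l: "Comp Tt X Y (carrier St) (\<iota> Y) m \<in> Mor Tt X (carrier St)"
    by (rule Tt.comp_closed[OF X Y Z m(1) \<iota>_mor[OF Y]])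
  have r: "Comp Tt X (carrier St) (carrier St) (snd x) (\<iota> X) \<in> Mor Tt X (carrier St)"
    by (rule Tt.comp_closed[OF X Z Z \<iota>_mor[OF X] snd_mor[OF xc]])
  have 1: "\<one>\<^bsub>S\<^esub> \<in> transporter S (fst ` X) S0" "\<one>\<^bsub>S\<^esub> \<in> transporter S (fst ` Y) S0"
    using S.one_transporter obj_subgroup obj_sub oX oY by auto
  have fxS: "fst x \<in> S0" using xc by (simp add: St_carrier)
  have "tt X (carrier St) (Comp Tt X Y (carrier St) (\<iota> Y) m) = \<epsilon> (fst ` X) S0 (fst x)"
    using tt.preserves_comp[OF X Y Z m(1) \<iota>_mor[OF Y]] eps_comp[OF oX oY carrier_obj fx 1(2)] fxS
    by (simp add: m(2) \<iota>_tt[OF Y] fst_surj)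
  moreover have "tt X (carrier St) (Comp Tt X (carrier St) (carrier St) (snd x) (\<iota> X)) = \<epsilon> (fst ` X) S0 (fst x)"
    using tt.preserves_comp[OF X Z Z \<iota>_mor[OF X] snd_mor[OF xc]]
      eps_comp[OF oX carrier_obj carrier_obj 1(1) S0_transporter[OF fxS]] fxS
    by (simp add: snd_tt[OF xc] \<iota>_tt[OF X] fst_surj)
  ultimately obtain k where k: "k \<in> K X"
    "Comp Tt X (carrier St) (carrier St) (snd x) (\<iota> X) = Comp Tt X X (carrier St) (Comp Tt X Y (carrier St) (\<iota> Y) m) k"
    using tt_right[OF X Z l r] by metis
  have "Comp Tt X Y (carrier St) (\<iota> Y) (Comp Tt X X Y m k) = Comp Tt X (carrier St) (carrier St) (snd x) (\<iota> X)"
    using Tt.comp_assoc[OF X X Y Z K_mor[OF k(1)] m(1) \<iota>_mor[OF Y]] k(2) by simp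
  moreover have "Comp Tt X X Y m k \<in> Mor Tt X Y" by (rule Tt.comp_closed[OF X X Y K_mor[OF k(1)] m(1)])
  moreover have "a = b" if "a \<in> Mor Tt X Y" "b \<in> Mor Tt X Y"
    "Comp Tt X Y (carrier St) (\<iota> Y) a = Comp Tt X Y (carrier St) (\<iota> Y) b" for a b
    using Tt_left_cancel[OF X Y Z that(1,2) \<iota>_mor[OF Y] that(3)] .
  ultimately show ?thesis by metis
qed

lemma \<epsilon>t_mor: "\<lbrakk>X \<in> Obj Tt; Y \<in> Obj Tt; x \<in> transporter St X Y\<rbrakk> \<Longrightarrow> \<epsilon>t X Y x \<in> Mor Tt X Y"
  and \<epsilon>t_\<iota>: "\<lbrakk>X \<in> Obj Tt; Y \<in> Obj Tt; x \<in> transporter St X Y\<rbrakk>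
    \<Longrightarrow> Comp Tt X Y (carrier St) (\<iota> Y) (\<epsilon>t X Y x) = Comp Tt X (carrier St) (carrier St) (snd x) (\<iota> X)"
  using theI'[OF \<epsilon>t_ex1[of X Y x]] by (simp_all add: \<epsilon>t_def ext_eps_def)

lemma \<epsilon>t_unique:
  assumes X: "X \<in> Obj Tt" and Y: "Y \<in> Obj Tt" and x: "x \<in> transporter St X Y" and m: "m \<in> Mor Tt X Y"
    and e: "Comp Tt X Y (carrier St) (\<iota> Y) m = Comp Tt X (carrier St) (carrier St) (snd x) (\<iota> X)"
  shows "\<epsilon>t X Y x = m"
  using Tt_left_cancel[OF X Y Tt_carrier_obj \<epsilon>t_mor[OF X Y x] m \<iota>_mor[OF Y]] \<epsilon>t_\<iota>[OF X Y x] e by simp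

lemma \<epsilon>t_tt:
  assumes X: "X \<in> Obj Tt" and Y: "Y \<in> Obj Tt" and x: "x \<in> transporter St X Y"
  shows "tt X Y (\<epsilon>t X Y x) = \<epsilon> (fst ` X) (fst ` Y) (fst x)"
proof -
  note oX = obj_fst[OF X] and oY = obj_fst[OF Y] and Z = Tt_carrier_obj
  have xc: "x \<in> carrier St" using x by (rule St_transporter_carrier)
  have fx: "fst x \<in> transporter S (fst ` X) (fst ` Y)" using x Tt_transporter_iff[OF X Y] by simp
  have 1: "\<one>\<^bsub>S\<^esub> \<in> transporter S (fst ` X) S0" "\<one>\<^bsub>S\<^esub> \<in> transporter S (fst ` Y) S0"
    using S.one_transporter obj_subgroup obj_sub oX oY by auto
  have fxS: "fst x \<in> S0" using xc by (simp add: St_carrier)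
  have "tt X (carrier St) (Comp Tt X (carrier St) (carrier St) (snd x) (\<iota> X)) = \<epsilon> (fst ` X) S0 (fst x)"
    using tt.preserves_comp[OF X Z Z \<iota>_mor[OF X] snd_mor[OF xc]]
      eps_comp[OF oX carrier_obj carrier_obj 1(1) S0_transporter[OF fxS]] fxS
    by (simp add: snd_tt[OF xc] \<iota>_tt[OF X] fst_surj)
  moreover have "tt X (carrier St) (Comp Tt X Y (carrier St) (\<iota> Y) (\<epsilon>t X Y x))
      = Comp T (fst ` X) (fst ` Y) S0 (\<epsilon> (fst ` Y) S0 \<one>\<^bsub>S\<^esub>) (tt X Y (\<epsilon>t X Y x))"
    using tt.preserves_comp[OF X Y Z \<epsilon>t_mor[OF X Y x] \<iota>_mor[OF Y]] by (simp add: \<iota>_tt[OF Y] fst_surj)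
  moreover have "\<epsilon> (fst ` X) S0 (fst x) = Comp T (fst ` X) (fst ` Y) S0 (\<epsilon> (fst ` Y) S0 \<one>\<^bsub>S\<^esub>) (\<epsilon> (fst ` X) (fst ` Y) (fst x))"
    using eps_comp[OF oX oY carrier_obj fx 1(2)] fxS by simp
  ultimately have "Comp T (fst ` X) (fst ` Y) S0 (\<epsilon> (fst ` Y) S0 \<one>\<^bsub>S\<^esub>) (tt X Y (\<epsilon>t X Y x))
      = Comp T (fst ` X) (fst ` Y) S0 (\<epsilon> (fst ` Y) S0 \<one>\<^bsub>S\<^esub>) (\<epsilon> (fst ` X) (fst ` Y) (fst x))"
    using \<epsilon>t_\<iota>[OF X Y x] by simp
  then show ?thesis
    using left_cancel[OF oX oY carrier_obj tt.mor_closed[OF X Y \<epsilon>t_mor[OF X Y x]] eps_mor[OF oX oY fx]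
        eps_mor[OF oY carrier_obj 1(2)]] by simp
qed

lemma \<epsilon>t_comp:
  assumes X: "X \<in> Obj Tt" and Y: "Y \<in> Obj Tt" and Z: "Z \<in> Obj Tt"
    and x: "x \<in> transporter St X Y" and y: "y \<in> transporter St Y Z"
  shows "Comp Tt X Y Z (\<epsilon>t Y Z y) (\<epsilon>t X Y x) = \<epsilon>t X Z (y \<otimes>\<^bsub>St\<^esub> x)"
proof (rule \<epsilon>t_unique[symmetric])
  note W = Tt_carrier_obj
  have xc: "x \<in> carrier St" and yc: "y \<in> carrier St" using x y by (auto intro: St_transporter_carrier)
  note ex = \<epsilon>t_mor[OF X Y x] and ey = \<epsilon>t_mor[OF Y Z y]
  show "y \<otimes>\<^bsub>St\<^esub> x \<in> transporter St X Z"
    using St.transporter_mult[OF _ x y] subgroup.subset[OF Tt_obj_subgroup[OF X]] by blast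
  show "Comp Tt X Y Z (\<epsilon>t Y Z y) (\<epsilon>t X Y x) \<in> Mor Tt X Z" by (rule Tt.comp_closed[OF X Y Z ex ey])
  have "Comp Tt X Z (carrier St) (\<iota> Z) (Comp Tt X Y Z (\<epsilon>t Y Z y) (\<epsilon>t X Y x))
      = Comp Tt X Y (carrier St) (Comp Tt Y (carrier St) (carrier St) (snd y) (\<iota> Y)) (\<epsilon>t X Y x)"
    using Tt.comp_assoc[OF X Y Z W ex ey \<iota>_mor[OF Z]] \<epsilon>t_\<iota>[OF Y Z y] by simp
  also have "\<dots> = Comp Tt X (carrier St) (carrier St) (snd y) (Comp Tt X (carrier St) (carrier St) (snd x) (\<iota> X))"
    using Tt.comp_assoc[OF X Y W W ex \<iota>_mor[OF Y] snd_mor[OF yc]] \<epsilon>t_\<iota>[OF X Y x] by simp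
  also have "\<dots> = Comp Tt X (carrier St) (carrier St) (Comp Tt (carrier St) (carrier St) (carrier St) (snd y) (snd x)) (\<iota> X)"
    using Tt.comp_assoc[OF X W W W \<iota>_mor[OF X] snd_mor[OF xc] snd_mor[OF yc]] by simp
  also have "Comp Tt (carrier St) (carrier St) (carrier St) (snd y) (snd x) = snd (y \<otimes>\<^bsub>St\<^esub> x)"
    by (simp add: St_mult Tt_simps fst_surj)
  finally show "Comp Tt X Z (carrier St) (\<iota> Z) (Comp Tt X Y Z (\<epsilon>t Y Z y) (\<epsilon>t X Y x))
      = Comp Tt X (carrier St) (carrier St) (snd (y \<otimes>\<^bsub>St\<^esub> x)) (\<iota> X)" .
qed (use X Z in auto)

lemma \<epsilon>t_id:
  assumes X: "X \<in> Obj Tt"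
  shows "\<epsilon>t X X \<one>\<^bsub>St\<^esub> = Idn Tt X"
proof (rule \<epsilon>t_unique[OF X X])
  show "\<one>\<^bsub>St\<^esub> \<in> transporter St X X" using St.one_transporter[OF Tt_obj_subgroup[OF X]] by simp
  show "Idn Tt X \<in> Mor Tt X X" using Tt.id_closed[OF X] .
  have "snd \<one>\<^bsub>St\<^esub> = Idn Tt (carrier St)" by (simp add: St_one Tt_simps fst_surj)
  then show "Comp Tt X X (carrier St) (\<iota> X) (Idn Tt X) = Comp Tt X (carrier St) (carrier St) (snd \<one>\<^bsub>St\<^esub>) (\<iota> X)"
    using Tt.id_right[OF X Tt_carrier_obj \<iota>_mor[OF X]] Tt.id_left[OF X Tt_carrier_obj \<iota>_mor[OF X]] by simp
qed

lemma K_carrier: "k \<in> K (carrier St) \<longleftrightarrow> (\<one>\<^bsub>S\<^esub>, k) \<in> A"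
proof -
  have "\<epsilon> S0 S0 \<one>\<^bsub>S\<^esub> = Idn T S0" using eps.preserves_id[of S0] carrier_obj by simp
  then show ?thesis by (auto simp: K_iff A_iff St_carrier isos_Tt fst_surj)
qed

lemma \<epsilon>t_inj:
  assumes X: "X \<in> Obj Tt" and Y: "Y \<in> Obj Tt" and x: "x \<in> transporter St X Y" and y: "y \<in> transporter St X Y"
    and e: "\<epsilon>t X Y x = \<epsilon>t X Y y"
  shows "x = y"
proof -
  note oX = obj_fst[OF X] and oY = obj_fst[OF Y] and W = Tt_carrier_obj
  have xc: "x \<in> carrier St" and yc: "y \<in> carrier St" using x y by (auto intro: St_transporter_carrier)
  have "fst x = fst y"
    using inj_onD[OF A1_inj[OF oX oY]] \<epsilon>t_tt[OF X Y x] \<epsilon>t_tt[OF X Y y] e x y Tt_transporter_iff[OF X Y] by simp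
  then obtain a where a: "a \<in> A" "x = a \<otimes>\<^bsub>St\<^esub> y" using fibre_A[OF xc yc] by blast
  have ac: "a \<in> carrier St" "fst a = \<one>\<^bsub>S\<^esub>" using a(1) by (auto simp: A_iff)
  have ak: "snd a \<in> K (carrier St)" using a(1) ac K_carrier by (metis prod.collapse)
  let ?m = "Comp Tt X (carrier St) (carrier St) (snd y) (\<iota> X)"
  have m: "?m \<in> Mor Tt X (carrier St)" by (rule Tt.comp_closed[OF X W W \<iota>_mor[OF X] snd_mor[OF yc]])
  have "snd x = Comp Tt (carrier St) (carrier St) (carrier St) (snd a) (snd y)"
    by (simp add: a(2) St_mult Tt_simps fst_surj)
  then have "Comp Tt X (carrier St) (carrier St) (snd a) ?m = Comp Tt X (carrier St) (carrier St) (snd x) (\<iota> X)"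
    using Tt.comp_assoc[OF X W W W \<iota>_mor[OF X] snd_mor[OF yc] snd_mor[OF ac(1)]] by simp
  also have "\<dots> = ?m" using \<epsilon>t_\<iota>[OF X Y x] \<epsilon>t_\<iota>[OF X Y y] e by simp
  finally have "snd a = Idn Tt (carrier St)" using K_free_left[OF X W m ak] by simp
  then have "a = \<one>\<^bsub>St\<^esub>" using ac(2) by (simp add: St_one Tt_simps fst_surj prod_eq_iff)
  then show ?thesis using a(2) yc by simp
qed

lemma Tt_mem_transporter: "X \<in> Obj Tt \<Longrightarrow> x \<in> X \<Longrightarrow> x \<in> transporter St X X"
  using St.mem_transporter[OF Tt_obj_subgroup] by simp

text \<open>The right and left orbit of \<open>\<iota> X\<close> are the same fibre of \<open>\<tau>\<close>. So \<open>\<iota> X\<close> transfers \<open>k\<close> in \<open>K X\<close> to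
  an element of \<open>K\<close> at \<open>St\<close>, which is the second component of an element of \<open>A\<close>.\<close>

lemma K_eq:
  assumes X: "X \<in> Obj Tt"
  shows "K X = \<epsilon>t X X ` A"
proof
  note oX = obj_fst[OF X] and W = Tt_carrier_obj
  show "\<epsilon>t X X ` A \<subseteq> K X"
  proof clarify
    fix a m assume am: "(a, m) \<in> A"
    then have "(a, m) \<in> X" using A_sub[OF X] by blast
    then have a: "(a, m) \<in> transporter St X X" "a = \<one>\<^bsub>S\<^esub>"
      using Tt_mem_transporter[OF X] am by (auto simp: A_iff)
    have "\<epsilon> (fst ` X) (fst ` X) \<one>\<^bsub>S\<^esub> = Idn T (fst ` X)" using eps.preserves_id oX by simp
    then show "\<epsilon>t X X (a, m) \<in> K X" using K_I[OF X \<epsilon>t_mor[OF X X a(1)]] \<epsilon>t_tt[OF X X a(1)] a(2) by simp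
  qed
  show "K X \<subseteq> \<epsilon>t X X ` A"
  proof
    fix k assume k: "k \<in> K X"
    note km = K_mor[OF k]
    have c: "Comp Tt X X (carrier St) (\<iota> X) k \<in> Mor Tt X (carrier St)"
      by (rule Tt.comp_closed[OF X X W km \<iota>_mor[OF X]])
    have "tt X (carrier St) (Comp Tt X X (carrier St) (\<iota> X) k) = tt X (carrier St) (\<iota> X)"
      using tt.preserves_comp[OF X X W km \<iota>_mor[OF X]] k
        id_right[OF oX obj_fst[OF W] tt.mor_closed[OF X W \<iota>_mor[OF X]]] by (simp add: K_iff)
    then obtain k' where k': "k' \<in> K (carrier St)"
      "Comp Tt X X (carrier St) (\<iota> X) k = Comp Tt X (carrier St) (carrier St) k' (\<iota> X)"
      using tt_left[OF X W \<iota>_mor[OF X] c] by metis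
    have a: "(\<one>\<^bsub>S\<^esub>, k') \<in> A" using k'(1) K_carrier by simp
    then have "(\<one>\<^bsub>S\<^esub>, k') \<in> transporter St X X" using Tt_mem_transporter[OF X] A_sub[OF X] by blast
    then have "\<epsilon>t X X (\<one>\<^bsub>S\<^esub>, k') = k" using \<epsilon>t_unique[OF X X _ km] k'(2) by simp
    then show "k \<in> \<epsilon>t X X ` A" using a by force
  qed
qed

text \<open>By \<open>eps_cancel\<close>, \<open>y\<close> and \<open>z\<close> agree up to an element of \<open>A\<close>, which acts trivially on a morphism and is
  therefore trivial.\<close>

lemma \<epsilon>t_cancel:
  assumes X: "X \<in> Obj Tt" and Y: "Y \<in> Obj Tt" and f: "f \<in> Mor Tt X Y" and y: "y \<in> Y" and z: "z \<in> Y"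
    and e: "Comp Tt X Y Y (\<epsilon>t Y Y y) f = Comp Tt X Y Y (\<epsilon>t Y Y z) f"
  shows "y = z"
proof -
  note oX = obj_fst[OF X] and oY = obj_fst[OF Y]
  note sY = Tt_obj_subgroup[OF Y]
  have yc: "y \<in> carrier St" and zc: "z \<in> carrier St" using y z subgroup.mem_carrier[OF sY] by auto
  note ty = Tt_mem_transporter[OF Y y] and tz = Tt_mem_transporter[OF Y z]
  have "Comp T (fst ` X) (fst ` Y) (fst ` Y) (\<epsilon> (fst ` Y) (fst ` Y) (fst y)) (tt X Y f)
      = Comp T (fst ` X) (fst ` Y) (fst ` Y) (\<epsilon> (fst ` Y) (fst ` Y) (fst z)) (tt X Y f)"
    using tt.preserves_comp[OF X Y Y f \<epsilon>t_mor[OF Y Y ty]] tt.preserves_comp[OF X Y Y f \<epsilon>t_mor[OF Y Y tz]] e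
    by (simp add: \<epsilon>t_tt[OF Y Y ty] \<epsilon>t_tt[OF Y Y tz])
  then have "fst y = fst z" using eps_cancel[OF oX oY tt.mor_closed[OF X Y f]] y z by blast
  then obtain a where a: "a \<in> A" "y = a \<otimes>\<^bsub>St\<^esub> z" using fibre_A[OF yc zc] by blast
  have aY: "a \<in> Y" using a(1) A_sub[OF Y] by blast
  note ta = Tt_mem_transporter[OF Y aY]
  let ?m = "Comp Tt X Y Y (\<epsilon>t Y Y z) f"
  have m: "?m \<in> Mor Tt X Y" by (rule Tt.comp_closed[OF X Y Y f \<epsilon>t_mor[OF Y Y tz]])
  have "Comp Tt X Y Y (\<epsilon>t Y Y a) ?m = Comp Tt X Y Y (\<epsilon>t Y Y y) f"
    using Tt.comp_assoc[OF X Y Y Y f \<epsilon>t_mor[OF Y Y tz] \<epsilon>t_mor[OF Y Y ta]] \<epsilon>t_comp[OF Y Y Y tz ta] a(2) by simp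
  then have "\<epsilon>t Y Y a = Idn Tt Y" using K_free_left[OF X Y m] a(1) K_eq[OF Y] e by simp
  then have "a = \<one>\<^bsub>St\<^esub>"
    using \<epsilon>t_inj[OF Y Y ta, of "\<one>\<^bsub>St\<^esub>"] \<epsilon>t_id[OF Y] Tt_mem_transporter[OF Y subgroup.one_closed[OF sY]] by simp
  then show ?thesis using a(2) zc by simp
qed


subsection \<open>The functor \<open>\<rho>t\<close>\<close>

text \<open>Axiom (C) for \<open>T\<close> provides what has to be the image of \<open>y\<close> in \<open>S\<close>; a lift of it satisfies the equation up to an element
  of \<open>K Y\<close>, that is, of \<open>A\<close>.\<close>

lemma \<rho>t_pointwise:
  assumes X: "X \<in> Obj Tt" and Y: "Y \<in> Obj Tt" and f: "f \<in> Mor Tt X Y" and x: "x \<in> X"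
  shows "\<exists>y \<in> Y. Comp Tt X X Y f (\<epsilon>t X X x) = Comp Tt X Y Y (\<epsilon>t Y Y y) f"
proof -
  note oX = obj_fst[OF X] and oY = obj_fst[OF Y]
  note sY = Tt_obj_subgroup[OF Y]
  note tf = tt.mor_closed[OF X Y f]
  have fx: "fst x \<in> fst ` X" using x by blast
  have "\<rho> (fst ` X) (fst ` Y) (tt X Y f) (fst x) \<in> fst ` Y"
    using inj_homsD(3)[OF rho_inj_homs[OF oX oY tf] fx] .
  then obtain y1 where y1: "y1 \<in> Y" "fst y1 = \<rho> (fst ` X) (fst ` Y) (tt X Y f) (fst x)" by auto
  note tx = Tt_mem_transporter[OF X x] and ty = Tt_mem_transporter[OF Y y1(1)]
  have a: "Comp Tt X X Y f (\<epsilon>t X X x) \<in> Mor Tt X Y" by (rule Tt.comp_closed[OF X X Y \<epsilon>t_mor[OF X X tx] f])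
  have b: "Comp Tt X Y Y (\<epsilon>t Y Y y1) f \<in> Mor Tt X Y" by (rule Tt.comp_closed[OF X Y Y f \<epsilon>t_mor[OF Y Y ty]])
  have "tt X Y (Comp Tt X Y Y (\<epsilon>t Y Y y1) f) = tt X Y (Comp Tt X X Y f (\<epsilon>t X X x))"
    using tt.preserves_comp[OF X X Y \<epsilon>t_mor[OF X X tx] f] tt.preserves_comp[OF X Y Y f \<epsilon>t_mor[OF Y Y ty]]
      C[OF oX oY tf fx] by (simp add: \<epsilon>t_tt[OF X X tx] \<epsilon>t_tt[OF Y Y ty] y1(2))
  then obtain k where k: "k \<in> K Y" "Comp Tt X X Y f (\<epsilon>t X X x) = Comp Tt X Y Y k (Comp Tt X Y Y (\<epsilon>t Y Y y1) f)"
    using tt_left[OF X Y b a] by blast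
  obtain c where c: "c \<in> A" "k = \<epsilon>t Y Y c" using k(1) K_eq[OF Y] by blast
  have cY: "c \<in> Y" using c(1) A_sub[OF Y] by blast
  note tc = Tt_mem_transporter[OF Y cY]
  have "Comp Tt X X Y f (\<epsilon>t X X x) = Comp Tt X Y Y (\<epsilon>t Y Y (c \<otimes>\<^bsub>St\<^esub> y1)) f"
    using Tt.comp_assoc[OF X Y Y Y f \<epsilon>t_mor[OF Y Y ty] \<epsilon>t_mor[OF Y Y tc]] \<epsilon>t_comp[OF Y Y Y ty tc] k(2) c(2) by simp
  then show ?thesis using subgroup.m_closed[OF sY cY y1(1)] by blast
qed

lemma \<rho>t_ex1:
  assumes X: "X \<in> Obj Tt" and Y: "Y \<in> Obj Tt" and f: "f \<in> Mor Tt X Y"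
  shows "\<exists>!h. h \<in> hom (St\<lparr>carrier := X\<rparr>) (St\<lparr>carrier := Y\<rparr>) \<and> h \<in> extensional X
     \<and> (\<forall>x \<in> X. Comp Tt X X Y f (\<epsilon>t X X x) = Comp Tt X Y Y (\<epsilon>t Y Y (h x)) f)"
proof -
  note sX = Tt_obj_subgroup[OF X] and sY = Tt_obj_subgroup[OF Y]
  have "\<forall>x\<in>X. \<exists>y. y \<in> Y \<and> Comp Tt X X Y f (\<epsilon>t X X x) = Comp Tt X Y Y (\<epsilon>t Y Y y) f"
    using \<rho>t_pointwise[OF X Y f] by blast
  then obtain h0 where h0: "\<forall>x\<in>X. h0 x \<in> Y \<and> Comp Tt X X Y f (\<epsilon>t X X x) = Comp Tt X Y Y (\<epsilon>t Y Y (h0 x)) f"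
    using bchoice[of X "\<lambda>x y. y \<in> Y \<and> Comp Tt X X Y f (\<epsilon>t X X x) = Comp Tt X Y Y (\<epsilon>t Y Y y) f"] by blast
  define h where "h = restrict h0 X"
  have h: "h x \<in> Y" "Comp Tt X X Y f (\<epsilon>t X X x) = Comp Tt X Y Y (\<epsilon>t Y Y (h x)) f" if "x \<in> X" for x
    using h0 that by (auto simp: h_def)
  have "h (x \<otimes>\<^bsub>St\<^esub> y) = h x \<otimes>\<^bsub>St\<^esub> h y" if x: "x \<in> X" and y: "y \<in> X" for x y
  proof -
    note tx = Tt_mem_transporter[OF X x] and ty = Tt_mem_transporter[OF X y]
    note thx = Tt_mem_transporter[OF Y h(1)[OF x]] and thy = Tt_mem_transporter[OF Y h(1)[OF y]]
    note xy = subgroup.m_closed[OF sX x y] and hxy = subgroup.m_closed[OF sY h(1)[OF x] h(1)[OF y]]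
    note ex = \<epsilon>t_mor[OF X X tx] and ey = \<epsilon>t_mor[OF X X ty]
    note ehx = \<epsilon>t_mor[OF Y Y thx] and ehy = \<epsilon>t_mor[OF Y Y thy]
    have "Comp Tt X Y Y (\<epsilon>t Y Y (h (x \<otimes>\<^bsub>St\<^esub> y))) f = Comp Tt X X Y f (Comp Tt X X X (\<epsilon>t X X x) (\<epsilon>t X X y))"
      using h(2)[OF xy] \<epsilon>t_comp[OF X X X ty tx] by simp
    also have "\<dots> = Comp Tt X X Y (Comp Tt X Y Y (\<epsilon>t Y Y (h x)) f) (\<epsilon>t X X y)"
      using Tt.comp_assoc[OF X X X Y ey ex f] h(2)[OF x] by simp
    also have "\<dots> = Comp Tt X Y Y (\<epsilon>t Y Y (h x)) (Comp Tt X Y Y (\<epsilon>t Y Y (h y)) f)"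
      using Tt.comp_assoc[OF X X Y Y ey f ehx] h(2)[OF y] by simp
    also have "\<dots> = Comp Tt X Y Y (\<epsilon>t Y Y (h x \<otimes>\<^bsub>St\<^esub> h y)) f"
      using Tt.comp_assoc[OF X Y Y Y f ehy ehx] \<epsilon>t_comp[OF Y Y Y thy thx] by simp
    finally show ?thesis using \<epsilon>t_cancel[OF X Y f h(1)[OF xy] hxy] by blast
  qed
  then have hom: "h \<in> hom (St\<lparr>carrier := X\<rparr>) (St\<lparr>carrier := Y\<rparr>)" using h(1) by (simp add: hom_def)
  show ?thesis
  proof (rule ex1I[of _ h])
    show "h \<in> hom (St\<lparr>carrier := X\<rparr>) (St\<lparr>carrier := Y\<rparr>) \<and> h \<in> extensional X
     \<and> (\<forall>x \<in> X. Comp Tt X X Y f (\<epsilon>t X X x) = Comp Tt X Y Y (\<epsilon>t Y Y (h x)) f)"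
      using hom h(2) by (simp add: h_def)
  next
    fix g assume g: "g \<in> hom (St\<lparr>carrier := X\<rparr>) (St\<lparr>carrier := Y\<rparr>) \<and> g \<in> extensional X
     \<and> (\<forall>x \<in> X. Comp Tt X X Y f (\<epsilon>t X X x) = Comp Tt X Y Y (\<epsilon>t Y Y (g x)) f)"
    then have ge: "g \<in> extensional X" by blast
    have "h \<in> extensional X" by (simp add: h_def)
    moreover have "g x = h x" if x: "x \<in> X" for x
    proof -
      have "g x \<in> Y" using g x by (auto simp: hom_def)
      then show ?thesis using \<epsilon>t_cancel[OF X Y f _ h(1)[OF x]] g h(2)[OF x] x by metis
    qed
    ultimately show "g = h" using extensionalityI[OF ge] by blast
  qed
qed

lemma \<rho>t_spec:
  assumes "X \<in> Obj Tt" "Y \<in> Obj Tt" "f \<in> Mor Tt X Y"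
  shows "\<rho>t X Y f \<in> hom (St\<lparr>carrier := X\<rparr>) (St\<lparr>carrier := Y\<rparr>) \<and> \<rho>t X Y f \<in> extensional X
     \<and> (\<forall>x \<in> X. Comp Tt X X Y f (\<epsilon>t X X x) = Comp Tt X Y Y (\<epsilon>t Y Y (\<rho>t X Y f x)) f)"
  unfolding \<rho>t_def ext_rho_def by (rule theI'[OF \<rho>t_ex1[OF assms]])

lemma \<rho>t_hom: "\<lbrakk>X \<in> Obj Tt; Y \<in> Obj Tt; f \<in> Mor Tt X Y\<rbrakk>
    \<Longrightarrow> \<rho>t X Y f \<in> hom (St\<lparr>carrier := X\<rparr>) (St\<lparr>carrier := Y\<rparr>)"
  and \<rho>t_ext: "\<lbrakk>X \<in> Obj Tt; Y \<in> Obj Tt; f \<in> Mor Tt X Y\<rbrakk> \<Longrightarrow> \<rho>t X Y f \<in> extensional X"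
  and \<rho>t_eq: "\<lbrakk>X \<in> Obj Tt; Y \<in> Obj Tt; f \<in> Mor Tt X Y; x \<in> X\<rbrakk>
    \<Longrightarrow> Comp Tt X X Y f (\<epsilon>t X X x) = Comp Tt X Y Y (\<epsilon>t Y Y (\<rho>t X Y f x)) f"
  using \<rho>t_spec[of X Y f] by blast+

lemma \<rho>t_closed: "\<lbrakk>X \<in> Obj Tt; Y \<in> Obj Tt; f \<in> Mor Tt X Y; x \<in> X\<rbrakk> \<Longrightarrow> \<rho>t X Y f x \<in> Y"
  using \<rho>t_hom[of X Y f] by (auto simp: hom_def)

lemma \<rho>t_eqI:
  assumes X: "X \<in> Obj Tt" and Y: "Y \<in> Obj Tt" and f: "f \<in> Mor Tt X Y" and x: "x \<in> X" and y: "y \<in> Y"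
    and e: "Comp Tt X X Y f (\<epsilon>t X X x) = Comp Tt X Y Y (\<epsilon>t Y Y y) f"
  shows "\<rho>t X Y f x = y"
  using \<epsilon>t_cancel[OF X Y f \<rho>t_closed[OF X Y f x] y] \<rho>t_eq[OF X Y f x] e by simp

lemma \<rho>t_fst:
  assumes X: "X \<in> Obj Tt" and Y: "Y \<in> Obj Tt" and f: "f \<in> Mor Tt X Y" and x: "x \<in> X"
  shows "fst (\<rho>t X Y f x) = \<rho> (fst ` X) (fst ` Y) (tt X Y f) (fst x)"
proof -
  note oX = obj_fst[OF X] and oY = obj_fst[OF Y] and tf = tt.mor_closed[OF X Y f]
  have fx: "fst x \<in> fst ` X" using x by blast
  note rc = \<rho>t_closed[OF X Y f x]
  note tx = Tt_mem_transporter[OF X x] and ty = Tt_mem_transporter[OF Y rc]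
  have "Comp T (fst ` X) (fst ` Y) (fst ` Y) (\<epsilon> (fst ` Y) (fst ` Y) (fst (\<rho>t X Y f x))) (tt X Y f)
      = tt X Y (Comp Tt X X Y f (\<epsilon>t X X x))"
    using tt.preserves_comp[OF X Y Y f \<epsilon>t_mor[OF Y Y ty]] \<rho>t_eq[OF X Y f x] by (simp add: \<epsilon>t_tt[OF Y Y ty])
  also have "\<dots> = Comp T (fst ` X) (fst ` Y) (fst ` Y)
      (\<epsilon> (fst ` Y) (fst ` Y) (\<rho> (fst ` X) (fst ` Y) (tt X Y f) (fst x))) (tt X Y f)"
    using tt.preserves_comp[OF X X Y \<epsilon>t_mor[OF X X tx] f] C[OF oX oY tf fx] by (simp add: \<epsilon>t_tt[OF X X tx])
  finally show ?thesis
    using eps_cancel[OF oX oY tf _ inj_homsD(3)[OF rho_inj_homs[OF oX oY tf] fx]] rc by blast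
qed

lemma \<rho>t_inj:
  assumes X: "X \<in> Obj Tt" and Y: "Y \<in> Obj Tt" and f: "f \<in> Mor Tt X Y"
  shows "inj_on (\<rho>t X Y f) X"
proof (rule inj_onI)
  fix x y assume x: "x \<in> X" and y: "y \<in> X" and e: "\<rho>t X Y f x = \<rho>t X Y f y"
  note tx = Tt_mem_transporter[OF X x] and ty = Tt_mem_transporter[OF X y]
  have "\<epsilon>t X X x = \<epsilon>t X X y"
    using Tt_left_cancel[OF X X Y \<epsilon>t_mor[OF X X tx] \<epsilon>t_mor[OF X X ty] f] \<rho>t_eq[OF X Y f x] \<rho>t_eq[OF X Y f y] e by simp
  then show "x = y" using \<epsilon>t_inj[OF X X tx ty] by simp
qed

lemma \<rho>t_inj_homs: "\<lbrakk>X \<in> Obj Tt; Y \<in> Obj Tt; f \<in> Mor Tt X Y\<rbrakk> \<Longrightarrow> \<rho>t X Y f \<in> inj_homs St X Y"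
  using \<rho>t_hom \<rho>t_ext \<rho>t_inj by (simp add: inj_homs_def)

lemma \<rho>t_comp:
  assumes X: "X \<in> Obj Tt" and Y: "Y \<in> Obj Tt" and Z: "Z \<in> Obj Tt" and f: "f \<in> Mor Tt X Y" and g: "g \<in> Mor Tt Y Z"
  shows "\<rho>t X Z (Comp Tt X Y Z g f) = compose X (\<rho>t Y Z g) (\<rho>t X Y f)"
proof (rule extensionalityI)
  note gf = Tt.comp_closed[OF X Y Z f g]
  show "\<rho>t X Z (Comp Tt X Y Z g f) \<in> extensional X" by (rule \<rho>t_ext[OF X Z gf])
  show "compose X (\<rho>t Y Z g) (\<rho>t X Y f) \<in> extensional X" by (rule compose_extensional)
  fix x assume x: "x \<in> X"
  note y = \<rho>t_closed[OF X Y f x]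
  note z = \<rho>t_closed[OF Y Z g y]
  note ex = \<epsilon>t_mor[OF X X Tt_mem_transporter[OF X x]] and ey = \<epsilon>t_mor[OF Y Y Tt_mem_transporter[OF Y y]]
    and ez = \<epsilon>t_mor[OF Z Z Tt_mem_transporter[OF Z z]]
  have "Comp Tt X X Z (Comp Tt X Y Z g f) (\<epsilon>t X X x) = Comp Tt X Y Z g (Comp Tt X Y Y (\<epsilon>t Y Y (\<rho>t X Y f x)) f)"
    using Tt.comp_assoc[OF X X Y Z ex f g] \<rho>t_eq[OF X Y f x] by simp
  also have "\<dots> = Comp Tt X Y Z (Comp Tt Y Z Z (\<epsilon>t Z Z (\<rho>t Y Z g (\<rho>t X Y f x))) g) f"
    using Tt.comp_assoc[OF X Y Y Z f ey g] \<rho>t_eq[OF Y Z g y] by simp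
  also have "\<dots> = Comp Tt X Z Z (\<epsilon>t Z Z (\<rho>t Y Z g (\<rho>t X Y f x))) (Comp Tt X Y Z g f)"
    using Tt.comp_assoc[OF X Y Z Z f g ez] by simp
  finally show "\<rho>t X Z (Comp Tt X Y Z g f) x = compose X (\<rho>t Y Z g) (\<rho>t X Y f) x"
    using \<rho>t_eqI[OF X Z gf x z] x by (simp add: compose_def)
qed

lemma \<rho>t_\<epsilon>t:
  assumes X: "X \<in> Obj Tt" and Y: "Y \<in> Obj Tt" and g: "g \<in> transporter St X Y"
  shows "\<rho>t X Y (\<epsilon>t X Y g) = restrict (conj_by St g) X"
proof (rule extensionalityI)
  note eg = \<epsilon>t_mor[OF X Y g]
  show "\<rho>t X Y (\<epsilon>t X Y g) \<in> extensional X" by (rule \<rho>t_ext[OF X Y eg])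
  show "restrict (conj_by St g) X \<in> extensional X" by simp
  fix x assume x: "x \<in> X"
  have xc: "x \<in> carrier St" using subgroup.mem_carrier[OF Tt_obj_subgroup[OF X] x] .
  have gc: "g \<in> carrier St" and y: "conj_by St g x \<in> Y" using g x by (auto simp: transporter_def)
  note tx = Tt_mem_transporter[OF X x] and ty = Tt_mem_transporter[OF Y y]
  have "conj_by St g x \<otimes>\<^bsub>St\<^esub> g = g \<otimes>\<^bsub>St\<^esub> x" using gc xc by (simp add: conj_by_def St.m_assoc)
  then have "Comp Tt X X Y (\<epsilon>t X Y g) (\<epsilon>t X X x) = Comp Tt X Y Y (\<epsilon>t Y Y (conj_by St g x)) (\<epsilon>t X Y g)"
    using \<epsilon>t_comp[OF X X Y tx g] \<epsilon>t_comp[OF X Y Y g ty] by simp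
  then show "\<rho>t X Y (\<epsilon>t X Y g) x = restrict (conj_by St g) X x" using \<rho>t_eqI[OF X Y eg x y] x by simp
qed

lemma \<rho>t_incl:
  assumes X: "X \<in> Obj Tt" and Y: "Y \<in> Obj Tt" and XY: "X \<subseteq> Y"
  shows "\<rho>t X Y (\<epsilon>t X Y \<one>\<^bsub>St\<^esub>) = (\<lambda>x\<in>X. x)"
  using \<rho>t_\<epsilon>t[OF X Y St.one_transporter[OF Tt_obj_subgroup[OF X] XY]] subgroup.mem_carrier[OF Tt_obj_subgroup[OF X]]
  by (auto simp: restrict_def fun_eq_iff)

lemma Tt_incl_mor: "\<lbrakk>X \<in> Obj Tt; Y \<in> Obj Tt; X \<subseteq> Y\<rbrakk> \<Longrightarrow> \<epsilon>t X Y \<one>\<^bsub>St\<^esub> \<in> Mor Tt X Y"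
  using \<epsilon>t_mor[OF _ _ St.one_transporter] Tt_obj_subgroup by blast

lemma tt_incl: "\<lbrakk>X \<in> Obj Tt; Y \<in> Obj Tt; X \<subseteq> Y\<rbrakk> \<Longrightarrow> tt X Y (\<epsilon>t X Y \<one>\<^bsub>St\<^esub>) = \<epsilon> (fst ` X) (fst ` Y) \<one>\<^bsub>S\<^esub>"
  using \<epsilon>t_tt[OF _ _ St.one_transporter] Tt_obj_subgroup by (simp add: St_one)

lemma \<rho>t_id: "X \<in> Obj Tt \<Longrightarrow> \<rho>t X X (Idn Tt X) = (\<lambda>x\<in>X. x)"
  using \<rho>t_incl[of X X] \<epsilon>t_id by simp

lemma \<rho>t_inverse:
  assumes X: "X \<in> Obj Tt" and Y: "Y \<in> Obj Tt" and fg: "inverse_mors Tt X Y f g" and x: "x \<in> X"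
  shows "\<rho>t Y X g (\<rho>t X Y f x) = x"
proof -
  have m: "f \<in> Mor Tt X Y" "g \<in> Mor Tt Y X" "Comp Tt X Y X g f = Idn Tt X" using fg by (auto simp: inverse_mors_def)
  show ?thesis using fun_cong[OF \<rho>t_comp[OF X Y X m(1,2)], of x] \<rho>t_id[OF X] m(3) x by (simp add: compose_def)
qed

lemma \<rho>t_iso_image:
  assumes X: "X \<in> Obj Tt" and Y: "Y \<in> Obj Tt" and f: "f \<in> isos Tt X Y"
  shows "\<rho>t X Y f ` X = Y"
proof
  obtain g where fg: "inverse_mors Tt X Y f g" using f by (auto simp: isos_iff)
  then have m: "f \<in> Mor Tt X Y" "g \<in> Mor Tt Y X" by (auto simp: inverse_mors_def)
  show "\<rho>t X Y f ` X \<subseteq> Y" using \<rho>t_closed[OF X Y m(1)] by blast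
  show "Y \<subseteq> \<rho>t X Y f ` X"
  proof
    fix y assume y: "y \<in> Y"
    show "y \<in> \<rho>t X Y f ` X"
      using \<rho>t_inverse[OF Y X Tt.inverse_mors_sym[OF fg] y] \<rho>t_closed[OF Y X m(2) y] by force
  qed
qed

text \<open>For surjectivity onto \<open>A\<close>: composing \<open>f\<close> with \<open>b\<close> from the left stays in the fibre of \<open>tt\<close>, hence equals
  composing with some element of \<open>A\<close> from the right.\<close>

lemma \<rho>t_A:
  assumes X: "X \<in> Obj Tt" and Y: "Y \<in> Obj Tt" and f: "f \<in> Mor Tt X Y"
  shows "\<rho>t X Y f ` A = A"
proof
  note oX = obj_fst[OF X] and oY = obj_fst[OF Y] and sX = Tt_obj_subgroup[OF X] and sY = Tt_obj_subgroup[OF Y]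
  note tf = tt.mor_closed[OF X Y f]
  show "\<rho>t X Y f ` A \<subseteq> A"
  proof
    fix b assume "b \<in> \<rho>t X Y f ` A"
    then obtain a where a: "a \<in> A" "b = \<rho>t X Y f a" by blast
    have aX: "a \<in> X" using a(1) A_sub[OF X] by blast
    interpret h: group_hom "S\<lparr>carrier := fst ` X\<rparr>" "S\<lparr>carrier := fst ` Y\<rparr>" "\<rho> (fst ` X) (fst ` Y) (tt X Y f)"
      using S.group_hom_of_hom[OF obj_subgroup[OF oX] obj_subgroup[OF oY]] rho_inj_homs[OF oX oY tf]
      by (simp add: inj_homs_def)
    have "fst b = \<one>\<^bsub>S\<^esub>" using \<rho>t_fst[OF X Y f aX] a h.hom_one by (simp add: A_iff)
    moreover have "b \<in> carrier St" using \<rho>t_closed[OF X Y f aX] a(2) subgroup.mem_carrier[OF sY] by simp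
    ultimately show "b \<in> A" by (simp add: A_iff)
  qed
  show "A \<subseteq> \<rho>t X Y f ` A"
  proof
    fix b assume b: "b \<in> A"
    have bY: "b \<in> Y" using b A_sub[OF Y] by blast
    note tb = Tt_mem_transporter[OF Y bY]
    have fb: "fst b = \<one>\<^bsub>S\<^esub>" using b by (simp add: A_iff)
    have eq: "tt X Y f = tt X Y (Comp Tt X Y Y (\<epsilon>t Y Y b) f)"
      using tt.preserves_comp[OF X Y Y f \<epsilon>t_mor[OF Y Y tb]] \<epsilon>t_tt[OF Y Y tb] fb
        eps.preserves_id[of "fst ` Y"] oY id_left[OF oX oY tf] by simp
    obtain k where k: "k \<in> K X" "Comp Tt X Y Y (\<epsilon>t Y Y b) f = Comp Tt X X Y f k"
      using tt_right[OF X Y f Tt.comp_closed[OF X Y Y f \<epsilon>t_mor[OF Y Y tb]] eq] by blast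
    obtain a where a: "a \<in> A" "k = \<epsilon>t X X a" using k(1) K_eq[OF X] by blast
    have "a \<in> X" using a(1) A_sub[OF X] by blast
    then have "\<rho>t X Y f a = b" using \<rho>t_eqI[OF X Y f _ bY] k(2) a(2) by simp
    then show "b \<in> \<rho>t X Y f ` A" using a(1) by blast
  qed
qed

lemma Tt_factorization:
  assumes X: "X \<in> Obj Tt" and Y: "Y \<in> Obj Tt" and f: "f \<in> Mor Tt X Y"
  obtains Z g where "Z \<in> Obj Tt" "Z \<subseteq> Y" "g \<in> isos Tt X Z" "\<rho>t X Y f = \<rho>t X Z g" "\<rho>t X Y f ` X = Z"
    "f = Comp Tt X Z Y (\<epsilon>t Z Y \<one>\<^bsub>St\<^esub>) g"
proof -
  note oX = obj_fst[OF X] and oY = obj_fst[OF Y]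
  note tf = tt.mor_closed[OF X Y f]
  define R where "R = \<rho> (fst ` X) (fst ` Y) (tt X Y f) ` fst ` X"
  note fac = factorization[OF oX oY tf, folded R_def]
  obtain g0 where g0: "g0 \<in> isos T (fst ` X) R"
    "tt X Y f = Comp T (fst ` X) R (fst ` Y) (\<epsilon> R (fst ` Y) \<one>\<^bsub>S\<^esub>) g0" using fac(3) by blast
  define Z where "Z = pre R"
  have Z: "Z \<in> Obj Tt" and fZ: "fst ` Z = R"
    using pre_obj[OF fac(1)] fst_pre[OF obj_sub[OF fac(1)]] by (auto simp: Z_def)
  have ZY: "Z \<subseteq> Y" using fac(2) Tt_obj_memI[OF Y] by (auto simp: Z_def pre_def)
  obtain g1 where g1: "g1 \<in> Mor Tt X Z" "tt X Z g1 = g0"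
    using tt_surj[OF X Z] isos_mor[OF g0(1)] fZ by metis
  have g1i: "g1 \<in> isos Tt X Z" using tt_reflects_isos[OF X Z g1(1)] g0(1) g1(2) fZ by simp
  note inc = Tt_incl_mor[OF Z Y ZY]
  have "tt X Y (Comp Tt X Z Y (\<epsilon>t Z Y \<one>\<^bsub>St\<^esub>) g1) = tt X Y f"
    using tt.preserves_comp[OF X Z Y g1(1) inc] tt_incl[OF Z Y ZY] g0(2) g1(2) fZ by simp
  then obtain k where k: "k \<in> K X" "f = Comp Tt X X Y (Comp Tt X Z Y (\<epsilon>t Z Y \<one>\<^bsub>St\<^esub>) g1) k"
    using tt_right[OF X Y Tt.comp_closed[OF X Z Y g1(1) inc] f] by blast
  define g where "g = Comp Tt X X Z g1 k"
  have ki: "k \<in> isos Tt X X" using k(1) by (simp add: K_iff)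
  have g: "g \<in> isos Tt X Z" unfolding g_def by (rule Tt.isos_comp[OF X X Z ki g1i])
  note gSt = isos_mor[OF g]
  have fg: "f = Comp Tt X Z Y (\<epsilon>t Z Y \<one>\<^bsub>St\<^esub>) g"
    using k(2) Tt.comp_assoc[OF X X Z Y K_mor[OF k(1)] g1(1) inc] by (simp add: g_def)
  have r: "\<rho>t X Y f = \<rho>t X Z g"
  proof (rule extensionalityI[OF \<rho>t_ext[OF X Y f] \<rho>t_ext[OF X Z gSt]])
    fix x assume x: "x \<in> X"
    show "\<rho>t X Y f x = \<rho>t X Z g x"
      using \<rho>t_comp[OF X Z Y gSt inc] \<rho>t_incl[OF Z Y ZY] \<rho>t_closed[OF X Z gSt x] x fg by (simp add: compose_def)
  qed
  show ?thesis using that[OF Z ZY g r _ fg] \<rho>t_iso_image[OF X Z g] r by simp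
qed

section \<open>The generated fusion system\<close>

abbreviation gSt where "gSt \<equiv> generated_mor St (Obj Tt) (\<lambda>X Y. \<rho>t X Y ` Mor Tt X Y)"

lemma Ft_iff: "f \<in> Ft P Q \<longleftrightarrow> gSt P Q f"
  by (simp add: Ft_def generated_fusion_def)

lemma gSt_restriction:
  assumes "X \<in> Obj Tt" "Y \<in> Obj Tt" "h \<in> \<rho>t X Y ` Mor Tt X Y"
    "subgroup P St" "subgroup Q St" "P \<subseteq> X" "Q \<subseteq> Y" "h ` P \<subseteq> Q"
  shows "gSt P Q (restrict h P)"
  by (rule generated_mor.restriction[where H = "\<lambda>X Y. \<rho>t X Y ` Mor Tt X Y"]) (fact assms)+

lemma gSt_inj_homs:
  "gSt P Q f \<Longrightarrow> subgroup P St \<and> subgroup Q St \<and> f \<in> inj_homs St P Q"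
proof (induction rule: generated_mor.induct)
  case (restriction X Y h P Q)
  then obtain \<phi> where \<phi>: "\<phi> \<in> Mor Tt X Y" "h = \<rho>t X Y \<phi>" by blast
  note ih = \<rho>t_inj_homs[OF restriction(1,2) \<phi>(1), folded \<phi>(2)]
  have "restrict h P \<in> inj_homs St P Q"
    unfolding inj_homs_def hom_def
    using inj_homsD(4)[OF ih] inj_on_subset[OF inj_homsD(2)[OF ih]] restriction(4-8)
    by (auto simp: subgroup.m_closed subset_eq inj_on_restrict_eq)
  then show ?case using restriction by blast
next
  case (composite P Q f R g)
  then have sub: "subgroup P St" "subgroup Q St" "subgroup R St"
    and f: "f \<in> inj_homs St P Q" and g: "g \<in> inj_homs St Q R" by auto
  have "compose P g f \<in> inj_homs St P R"
    unfolding inj_homs_def hom_def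
    using inj_homsD(3,4)[OF f] inj_homsD(3,4)[OF g] sub(1)
      comp_inj_on[OF inj_homsD(2)[OF f] inj_on_subset[OF inj_homsD(2)[OF g] inj_homsD(5)[OF f]]]
    by (auto simp: compose_def subgroup.m_closed inj_on_def)
  then show ?case using sub by blast
qed

lemma \<rho>t_gm:
  assumes X: "X \<in> Obj Tt" and Y: "Y \<in> Obj Tt" and f: "f \<in> Mor Tt X Y"
  shows "gSt X Y (\<rho>t X Y f)"
proof -
  have "restrict (\<rho>t X Y f) X = \<rho>t X Y f" using \<rho>t_ext[OF X Y f] by (rule extensional_restrict)
  moreover have "\<rho>t X Y f ` X \<subseteq> Y" using \<rho>t_closed[OF X Y f] by blast
  ultimately show ?thesis
    using gSt_restriction[OF X Y, of "\<rho>t X Y f" X Y]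
      Tt_obj_subgroup[OF X] Tt_obj_subgroup[OF Y] f by simp
qed

lemma gSt_incl:
  assumes P: "subgroup P St" and Q: "subgroup Q St" and PQ: "P \<subseteq> Q"
  shows "gSt P Q (\<lambda>x\<in>P. x)"
proof -
  note W = Tt_carrier_obj
  have "restrict (\<rho>t (carrier St) (carrier St) (Idn Tt (carrier St))) P = (\<lambda>x\<in>P. x)"
    using \<rho>t_id[OF W] subgroup.mem_carrier[OF P] by (auto simp: restrict_def fun_eq_iff)
  moreover have "\<rho>t (carrier St) (carrier St) (Idn Tt (carrier St)) ` P \<subseteq> Q"
    using \<rho>t_id[OF W] subgroup.mem_carrier[OF P] PQ by auto
  ultimately show ?thesis
    using gSt_restriction[OF W W _ P Q subgroup.subset[OF P] subgroup.subset[OF Q],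
        of "\<rho>t (carrier St) (carrier St) (Idn Tt (carrier St))"] Tt.id_closed[OF W] by auto
qed

text \<open>Stated with a smaller source and a smaller target at once, which the induction needs: in a
  composite the first map has to be corestricted to its image before the second one is restricted.\<close>

lemma gSt_restrict:
  "\<lbrakk>gSt P Q f; subgroup P' St; P' \<subseteq> P; subgroup Q' St; Q' \<subseteq> Q; f ` P' \<subseteq> Q'\<rbrakk> \<Longrightarrow> gSt P' Q' (restrict f P')"
proof (induction arbitrary: P' Q' rule: generated_mor.induct)
  case (restriction X Y h P Q)
  have e: "restrict (restrict h P) P' = restrict h P'" using restriction.prems(2) by (auto simp: restrict_def fun_eq_iff)
  have sub: "P' \<subseteq> X" "Q' \<subseteq> Y" using restriction by auto
  have im: "h ` P' \<subseteq> Q'" using restriction.prems(2,5) by (auto simp: subset_eq)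
  show ?case unfolding e
    by (rule gSt_restriction[OF restriction.hyps(1-3) restriction.prems(1,3) sub im])
next
  case (composite P Q f R g)
  have f: "subgroup P St" "subgroup Q St" "f \<in> inj_homs St P Q" using gSt_inj_homs[OF composite.hyps(1)] by auto
  have fP': "subgroup (f ` P') St"
    using St.hom_image_subgroup[OF f(1,2) _ composite.prems(1,2)] f(3) by (simp add: inj_homs_def)
  have fQ: "f ` P' \<subseteq> Q" using inj_homsD(5)[OF f(3)] composite.prems(2) by blast
  have gf: "g ` f ` P' \<subseteq> Q'" using composite.prems(2,5) by (auto simp: compose_def subset_eq)
  have 1: "gSt P' (f ` P') (restrict f P')"
    using composite.IH(1)[OF composite.prems(1,2) fP' fQ order_refl] .
  have 2: "gSt (f ` P') Q' (restrict g (f ` P'))"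
    using composite.IH(2)[OF fP' fQ composite.prems(3,4) gf] .
  have "compose P' (restrict g (f ` P')) (restrict f P') = restrict (compose P g f) P'"
    using composite.prems(2) by (auto simp: compose_def restrict_def fun_eq_iff)
  then show ?case using generated_mor.composite[OF 1 2] by (simp only:)
qed

text \<open>A generator is the restriction of some \<open>\<rho>t \<phi>\<close>, and the isomorphism through which \<open>\<phi>\<close> factors has
  an inverse in \<open>Tt\<close>.\<close>

lemma gSt_inverse:
  "gSt P Q f \<Longrightarrow> gSt (f ` P) P (restrict (inv_into P f) (f ` P))"
proof (induction rule: generated_mor.induct)
  case (restriction X Y h P Q)
  then obtain \<phi> where \<phi>: "\<phi> \<in> Mor Tt X Y" "h = \<rho>t X Y \<phi>" by blast
  note X = restriction(1) and Y = restriction(2)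
  obtain Z \<psi> where Z: "Z \<in> Obj Tt" "Z \<subseteq> Y" "\<psi> \<in> isos Tt X Z" "\<rho>t X Y \<phi> = \<rho>t X Z \<psi>" "\<rho>t X Y \<phi> ` X = Z"
    using Tt_factorization[OF X Y \<phi>(1)] by metis
  obtain \<chi> where \<chi>: "inverse_mors Tt X Z \<psi> \<chi>" using Z(3) by (auto simp: isos_iff)
  then have \<chi>m: "\<chi> \<in> Mor Tt Z X" by (simp add: inverse_mors_def)
  have inv: "\<rho>t Z X \<chi> (h x) = x" if "x \<in> X" for x
    using \<rho>t_inverse[OF X Z(1) \<chi> that] \<phi>(2) Z(4) by simp
  have gm0: "gSt P Q (restrict h P)" using gSt_restriction[OF restriction.hyps] .
  note ih = gSt_inj_homs[OF gm0]
  have sub: "subgroup (restrict h P ` P) St"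
    using St.hom_image_subgroup[of P Q "restrict h P" P] ih by (simp add: inj_homs_def)
  have im: "restrict h P ` P \<subseteq> Z" using Z(5) \<phi>(2) restriction(6) by auto
  have "gSt (restrict h P ` P) P (restrict (\<rho>t Z X \<chi>) (restrict h P ` P))"
  proof (rule gSt_restrict[OF \<rho>t_gm[OF Z(1) X \<chi>m] sub im restriction(4,6)])
    show "\<rho>t Z X \<chi> ` restrict h P ` P \<subseteq> P" using inv restriction(6) by (auto simp: subset_eq)
  qed
  moreover have "restrict (\<rho>t Z X \<chi>) (restrict h P ` P) = restrict (inv_into P (restrict h P)) (restrict h P ` P)"
  proof (rule restrict_ext)
    fix y assume "y \<in> restrict h P ` P"
    then obtain x where x: "x \<in> P" "y = restrict h P x" by blast
    have "inv_into P (restrict h P) y = x"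
      unfolding x(2) by (rule inv_into_f_f[OF inj_homsD(2) x(1)]) (use ih in blast)
    then show "\<rho>t Z X \<chi> y = inv_into P (restrict h P) y"
      using inv[OF subsetD[OF restriction(6) x(1)]] x by simp
  qed
  ultimately show ?case by (simp only:)
next
  case (composite P Q f R g)
  have f: "subgroup P St" "subgroup Q St" "f \<in> inj_homs St P Q" using gSt_inj_homs[OF composite.hyps(1)] by auto
  have g: "subgroup R St" "g \<in> inj_homs St Q R" using gSt_inj_homs[OF composite.hyps(2)] by auto
  have fP: "subgroup (f ` P) St"
    using St.hom_image_subgroup[OF f(1,2) _ f(1)] f(3) by (simp add: inj_homs_def)
  have fQ: "f ` P \<subseteq> Q" using inj_homsD(5)[OF f(3)] .
  have gfP: "subgroup (g ` f ` P) St"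
    using St.hom_image_subgroup[OF f(2) g(1) _ fP fQ] g(2) by (simp add: inj_homs_def)
  note injf = inj_homsD(2)[OF f(3)] and injg = inj_homsD(2)[OF g(2)]
  let ?g' = "restrict (inv_into Q g) (g ` Q)"
  have g': "inv_into Q g (g y) = y" if "y \<in> Q" for y using inv_into_f_f[OF injg that] .
  have f': "inv_into P f (f x) = x" if "x \<in> P" for x using inv_into_f_f[OF injf that] .
  have 1: "gSt (g ` f ` P) (f ` P) (restrict ?g' (g ` f ` P))"
  proof (rule gSt_restrict[OF composite.IH(2) gfP _ fP fQ])
    show "g ` f ` P \<subseteq> g ` Q" using fQ by blast
    show "?g' ` g ` f ` P \<subseteq> f ` P"
    proof
      fix y assume "y \<in> ?g' ` g ` f ` P"
      then obtain x where x: "x \<in> P" "y = ?g' (g (f x))" by blast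
      have "f x \<in> Q" using fQ x(1) by blast
      then show "y \<in> f ` P" using g' x by simp
    qed
  qed
  have im: "compose P g f ` P = g ` f ` P" by (auto simp: compose_def)
  have inj: "inj_on (compose P g f) P"
    using inj_homsD(2) gSt_inj_homs[OF generated_mor.composite[OF composite.hyps]] by blast
  have "compose (g ` f ` P) (restrict (inv_into P f) (f ` P)) (restrict ?g' (g ` f ` P))
      = restrict (inv_into P (compose P g f)) (g ` f ` P)"
  proof
    fix y show "compose (g ` f ` P) (restrict (inv_into P f) (f ` P)) (restrict ?g' (g ` f ` P)) y
      = restrict (inv_into P (compose P g f)) (g ` f ` P) y"
    proof (cases "y \<in> g ` f ` P")
      case True
      then obtain x where x: "x \<in> P" "y = g (f x)" by blast
      have "inv_into P (compose P g f) y = x"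
        using inv_into_f_f[OF inj x(1)] x by (simp add: compose_def)
      moreover have "f x \<in> Q" using fQ x(1) by blast
      ultimately show ?thesis using True x g' f' by (simp add: compose_def)
    qed (simp add: compose_def)
  qed
  then show ?case using generated_mor.composite[OF 1 composite.IH(1)] by (simp only: im)
qed

text \<open>The restriction of \<open>\<rho>t \<phi>\<close> to an object \<open>P\<close> comes from \<open>\<phi>\<close> composed with the inclusion of \<open>P\<close>. Its
  image is an object by \<open>Tt_factorization\<close>, and so is the overgroup \<open>Q\<close> of this image.\<close>

lemma gSt_obj:
  "gSt P Q f \<Longrightarrow> P \<in> Obj Tt \<Longrightarrow> Q \<in> Obj Tt \<and> f \<in> \<rho>t P Q ` Mor Tt P Q"
proof (induction rule: generated_mor.induct)
  case (restriction X Y h P Q)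
  then obtain \<phi> where \<phi>: "\<phi> \<in> Mor Tt X Y" "h = \<rho>t X Y \<phi>" by blast
  note X = restriction(1) and Y = restriction(2) and P = restriction.prems
  note inc = Tt_incl_mor[OF P X restriction(6)]
  let ?f = "Comp Tt P X Y \<phi> (\<epsilon>t P X \<one>\<^bsub>St\<^esub>)"
  have f: "?f \<in> Mor Tt P Y" by (rule Tt.comp_closed[OF P X Y inc \<phi>(1)])
  have rf: "\<rho>t P Y ?f = restrict h P"
    using \<rho>t_comp[OF P X Y inc \<phi>(1)] \<rho>t_incl[OF P X restriction(6)] \<phi>(2)
    by (auto simp: compose_def restrict_def fun_eq_iff)
  obtain Z \<psi> where Z: "Z \<in> Obj Tt" "Z \<subseteq> Y" "\<psi> \<in> isos Tt P Z" "\<rho>t P Y ?f = \<rho>t P Z \<psi>" "\<rho>t P Y ?f ` P = Z"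
    using Tt_factorization[OF P Y f] by metis
  have ZQ: "Z \<subseteq> Q" using Z(5) rf restriction(8) by auto
  have Q: "Q \<in> Obj Tt" by (rule Tt_overgroup_closed[OF Z(1) restriction(5) ZQ])
  note \<psi>m = isos_mor[OF Z(3)] and inc2 = Tt_incl_mor[OF Z(1) Q ZQ]
  have "\<rho>t P Q (Comp Tt P Z Q (\<epsilon>t Z Q \<one>\<^bsub>St\<^esub>) \<psi>) = compose P (\<lambda>x\<in>Z. x) (\<rho>t P Z \<psi>)"
    using \<rho>t_comp[OF P Z(1) Q \<psi>m inc2] \<rho>t_incl[OF Z(1) Q ZQ] by simp
  also have "\<dots> = \<rho>t P Z \<psi>"
    using \<rho>t_closed[OF P Z(1) \<psi>m] \<rho>t_ext[OF P Z(1) \<psi>m]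
    by (auto simp: compose_def restrict_def fun_eq_iff extensional_def)
  finally have "\<rho>t P Q (Comp Tt P Z Q (\<epsilon>t Z Q \<one>\<^bsub>St\<^esub>) \<psi>) = restrict h P" using Z(4) rf by simp
  moreover have "Comp Tt P Z Q (\<epsilon>t Z Q \<one>\<^bsub>St\<^esub>) \<psi> \<in> Mor Tt P Q" by (rule Tt.comp_closed[OF P Z(1) Q \<psi>m inc2])
  ultimately show ?case using Q by (metis imageI)
next
  case (composite P Q f R g)
  note P = composite.prems
  have Q: "Q \<in> Obj Tt" and f: "f \<in> \<rho>t P Q ` Mor Tt P Q" using composite.IH(1)[OF P] by auto
  have R: "R \<in> Obj Tt" and g: "g \<in> \<rho>t Q R ` Mor Tt Q R" using composite.IH(2)[OF Q] by auto
  obtain \<phi> where \<phi>: "\<phi> \<in> Mor Tt P Q" "f = \<rho>t P Q \<phi>" using f by blast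
  obtain \<psi> where \<psi>: "\<psi> \<in> Mor Tt Q R" "g = \<rho>t Q R \<psi>" using g by blast
  have "compose P g f = \<rho>t P R (Comp Tt P Q R \<psi> \<phi>)" using \<rho>t_comp[OF P Q R \<phi>(1) \<psi>(1)] \<phi>(2) \<psi>(2) by simp
  then show ?case using R Tt.comp_closed[OF P Q R \<phi>(1) \<psi>(1)] by (metis imageI)
qed

lemma Ft_obj: "\<lbrakk>P \<in> Obj Tt; Q \<in> Obj Tt\<rbrakk> \<Longrightarrow> Ft P Q = \<rho>t P Q ` Mor Tt P Q"
  using gSt_obj \<rho>t_gm by (auto simp: Ft_iff)

end

section \<open>The extension is a transporter system\<close>

context group begin

text \<open>In this form normalizers can be compared along \<open>fst\<close> by means of \<open>Tt_transporter_iff\<close>.\<close>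

lemma normalizer_iff:
  assumes P: "subgroup P G"
  shows "x \<in> normalizer G P \<longleftrightarrow> x \<in> transporter G P P \<and> inv x \<in> transporter G P P"
proof -
  have Pc: "P \<subseteq> carrier G" using P by (rule subgroup.subset)
  have im: "x <# P #> inv x = conj_by G x ` P" if "x \<in> carrier G"
    by (auto simp: l_coset_def r_coset_def conj_by_def)
  have iff: "x \<in> normalizer G P \<longleftrightarrow> x \<in> carrier G \<and> conj_by G x ` P = P"
    using Pc im by (auto simp: normalizer_def stabilizer_def)
  have cancel: "conj_by G x (conj_by G (inv x) u) = u" "conj_by G (inv x) (conj_by G x u) = u"
    if "x \<in> carrier G" "u \<in> P" for u
  proof -
    have uc: "u \<in> carrier G" using that(2) Pc by blast
    show "conj_by G x (conj_by G (inv x) u) = u"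
      using conj_by_conj_by[of x "inv x" u] that(1) uc by simp
    show "conj_by G (inv x) (conj_by G x u) = u"
      using conj_by_conj_by[of "inv x" x u] that(1) uc by simp
  qed
  show ?thesis
  proof
    assume "x \<in> normalizer G P"
    then have x: "x \<in> carrier G" "conj_by G x ` P = P" using iff by auto
    have "conj_by G (inv x) ` P \<subseteq> P"
    proof
      fix v assume "v \<in> conj_by G (inv x) ` P"
      then obtain u where u: "u \<in> P" "v = conj_by G (inv x) u" by blast
      obtain w where "w \<in> P" "u = conj_by G x w" using u(1) x(2) by (metis imageE)
      then show "v \<in> P" using u(2) cancel(2)[OF x(1)] by simp
    qed
    then show "x \<in> transporter G P P \<and> inv x \<in> transporter G P P" using x by (simp add: transporter_def)
  next
    assume a: "x \<in> transporter G P P \<and> inv x \<in> transporter G P P"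
    then have x: "x \<in> carrier G" "conj_by G x ` P \<subseteq> P" "conj_by G (inv x) ` P \<subseteq> P" by (auto simp: transporter_def)
    have "P \<subseteq> conj_by G x ` P"
    proof
      fix u assume u: "u \<in> P"
      then have "conj_by G (inv x) u \<in> P" using x(3) by blast
      then show "u \<in> conj_by G x ` P" using cancel(1)[OF x(1) u] by (metis imageI)
    qed
    then show "x \<in> normalizer G P" using iff x by blast
  qed
qed

lemma category_transporter:
  assumes Ob: "\<And>P. P \<in> Ob \<Longrightarrow> subgroup P G"
  shows "category (transporter_cat G Ob)"
proof
  have c: "x \<in> carrier G" if "x \<in> transporter G P Q" for x P Q using that by (simp add: transporter_def)
  show "Comp (transporter_cat G Ob) P Q R g f \<in> Mor (transporter_cat G Ob) P R"
    if "P \<in> Obj (transporter_cat G Ob)" "f \<in> Mor (transporter_cat G Ob) P Q"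
      "g \<in> Mor (transporter_cat G Ob) Q R" for P Q R f g
    using transporter_mult[OF subgroup.subset[OF Ob]] that by simp
  show "Idn (transporter_cat G Ob) P \<in> Mor (transporter_cat G Ob) P P" if "P \<in> Obj (transporter_cat G Ob)" for P
    using one_transporter[OF Ob] that by simp
qed (use m_assoc in \<open>auto simp: transporter_def\<close>)

lemma subgroup_UN_chain:
  assumes P: "\<And>n. subgroup (P n) G" and mono: "\<And>n. P n \<subseteq> P (Suc n)"
  shows "subgroup (\<Union>n::nat. P n) G"
proof (rule subgroupI)
  have le: "P m \<subseteq> P n" if "m \<le> n" for m n using lift_Suc_mono_le[of P, OF mono that] .
  show "(\<Union>n. P n) \<subseteq> carrier G" using subgroup.subset[OF P] by blast
  show "(\<Union>n. P n) \<noteq> {}" using subgroup.one_closed[OF P] by blast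
  show "inv a \<in> (\<Union>n. P n)" if "a \<in> (\<Union>n. P n)" for a using that subgroup.m_inv_closed[OF P] by blast
  show "a \<otimes> b \<in> (\<Union>n. P n)" if "a \<in> (\<Union>n. P n)" "b \<in> (\<Union>n. P n)" for a b
  proof -
    obtain m n where "a \<in> P m" "b \<in> P n" using \<open>a \<in> _\<close> \<open>b \<in> _\<close> by blast
    then have "a \<in> P (max m n)" "b \<in> P (max m n)" using le[of m "max m n"] le[of n "max m n"] by auto
    then show ?thesis using subgroup.m_closed[OF P] by blast
  qed
qed

lemma normal_restrict_iff:
  assumes Q: "subgroup Q G"
  shows "P \<lhd> (G\<lparr>carrier := Q\<rparr>) \<longleftrightarrow> subgroup P G \<and> P \<subseteq> Q \<and> (\<forall>x\<in>Q. \<forall>h\<in>P. x \<otimes> h \<otimes> inv x \<in> P)"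
proof -
  interpret Q: group "G\<lparr>carrier := Q\<rparr>" by (rule subgroup_imp_group[OF Q])
  have "subgroup P (G\<lparr>carrier := Q\<rparr>) \<longleftrightarrow> subgroup P G \<and> P \<subseteq> Q"
    using incl_subgroup[OF Q] subgroup_incl[OF _ Q] subgroup.subset by fastforce
  then show ?thesis using Q.normal_inv_iff[of P] m_inv_consistent[OF Q] by auto
qed

end

context transporter_extension begin

lemma discrete_p_toral_St: "discrete_p_toral p St"
proof -
  let ?K = "(aut_group Th S0)\<lparr>carrier := ext_kernel T Th \<tau> S0\<rparr>"
  have K: "discrete_p_toral p ?K" by (rule kernel_toral[OF S0_Th])
  have e1: "\<epsilon> S0 S0 \<one>\<^bsub>S\<^esub> = Idn T S0" using eps.preserves_id[of S0] carrier_obj by simp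
  have ker: "kernel St S fst = (\<lambda>k. (\<one>\<^bsub>S\<^esub>, k)) ` ext_kernel T Th \<tau> S0"
    using e1 by (force simp: kernel_def ext_kernel_def St_carrier)
  have "(\<lambda>k. (\<one>\<^bsub>S\<^esub>, k)) \<in> iso ?K (St\<lparr>carrier := kernel St S fst\<rparr>)"
  proof (rule isoI)
    show "(\<lambda>k. (\<one>\<^bsub>S\<^esub>, k)) \<in> hom ?K (St\<lparr>carrier := kernel St S fst\<rparr>)"
      by (rule homI) (auto simp: ker St_mult)
    show "bij_betw (\<lambda>k. (\<one>\<^bsub>S\<^esub>, k)) (carrier ?K) (carrier (St\<lparr>carrier := kernel St S fst\<rparr>))"
      by (simp add: bij_betw_def ker inj_on_def)
  qed
  then show ?thesis
    by (rule discrete_p_toral_extension[OF prime_p fst.group_hom_axioms fst_surj discrete_p_toral K])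
qed

lemma category_Ft: "category (fusion_cat St Ft)"
  by (rule category_fusion_cat)
    (simp_all add: Ft_iff gSt_inj_homs gSt_incl generated_mor.composite)

lemma fusion_system_Ft: "fusion_system p St Ft"
proof (rule fusion_system.intro)
  show "discrete_p_toral p St" by (rule discrete_p_toral_St)
  show "category (fusion_cat St Ft)" by (rule category_Ft)
  show "conj_homs St P Q \<subseteq> Ft P Q" if P: "subgroup P St" and Q: "subgroup Q St" for P Q
  proof
    fix f assume "f \<in> conj_homs St P Q"
    then obtain g where g: "g \<in> transporter St P Q" "f = restrict (conj_by St g) P" by (auto simp: conj_homs_def)
    note W = Tt_carrier_obj
    have gW: "g \<in> transporter St (carrier St) (carrier St)" using g(1) by (rule St_transporter_self)
    note eg = \<epsilon>t_mor[OF W W gW]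
    have Pc: "P \<subseteq> carrier St" using P by (rule subgroup.subset)
    have r: "\<rho>t (carrier St) (carrier St) (\<epsilon>t (carrier St) (carrier St) g) u = conj_by St g u" if "u \<in> P" for u
      using \<rho>t_\<epsilon>t[OF W W gW] that Pc by (simp add: subsetD)
    have "gSt P Q (restrict (\<rho>t (carrier St) (carrier St) (\<epsilon>t (carrier St) (carrier St) g)) P)"
      by (rule gSt_restrict[OF \<rho>t_gm[OF W W eg] P Pc Q subgroup.subset[OF Q]])
        (use r g(1) in \<open>auto simp: transporter_def\<close>)
    moreover have "restrict (\<rho>t (carrier St) (carrier St) (\<epsilon>t (carrier St) (carrier St) g)) P = f"
      unfolding g(2) using r by (rule restrict_ext)
    ultimately show "f \<in> Ft P Q" by (simp only: Ft_iff)
  qed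
  show "Ft P Q \<subseteq> inj_homs St P Q" for P Q using gSt_inj_homs by (auto simp: Ft_iff)
  show "\<exists>R g. subgroup R St \<and> R \<subseteq> Q \<and> g \<in> isos (fusion_cat St Ft) P R \<and> f = compose P (\<lambda>x\<in>R. x) g"
    if P: "subgroup P St" and Q: "subgroup Q St" and f: "f \<in> Ft P Q" for P Q f
  proof -
    have gmf: "gSt P Q f" using f by (simp add: Ft_iff)
    then have ih: "f \<in> inj_homs St P Q" using gSt_inj_homs by blast
    have R: "subgroup (f ` P) St"
      using St.hom_image_subgroup[OF P Q _ P] ih by (simp add: inj_homs_def)
    have "gSt P (f ` P) (restrict f P)"
      by (rule gSt_restrict[OF gmf P order_refl R inj_homsD(5)[OF ih] order_refl])
    moreover have "restrict f P = f" using inj_homsD(1)[OF ih] by (rule extensional_restrict)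
    ultimately have f1: "gSt P (f ` P) f" by (simp only:)
    let ?g = "restrict (inv_into P f) (f ` P)"
    have f2: "gSt (f ` P) P ?g" by (rule gSt_inverse[OF gmf])
    have inv: "inv_into P f (f x) = x" if "x \<in> P" for x using inv_into_f_f[OF inj_homsD(2)[OF ih] that] .
    have "inverse_mors (fusion_cat St Ft) P (f ` P) f ?g"
      using f1 f2 inv by (auto simp: inverse_mors_def Ft_iff compose_def restrict_def fun_eq_iff)
    then have "f \<in> isos (fusion_cat St Ft) P (f ` P)" by (auto simp: isos_iff)
    moreover have "f = compose P (\<lambda>x\<in>f ` P. x) f"
      using inj_homsD(1)[OF ih] by (auto simp: compose_def restrict_def fun_eq_iff extensional_def)
    ultimately show ?thesis using R inj_homsD(5)[OF ih] by blast
  qed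
qed

lemma \<epsilon>t_functor: "cat_functor (transporter_cat St (Obj Tt)) Tt (\<lambda>P. P) \<epsilon>t"
proof (rule cat_functor.intro)
  show "category (transporter_cat St (Obj Tt))" by (rule St.category_transporter[OF Tt_obj_subgroup])
  show "category Tt" by (rule Tt.category_axioms)
  show "cat_functor_axioms (transporter_cat St (Obj Tt)) Tt (\<lambda>P. P) \<epsilon>t"
    by (rule cat_functor_axioms.intro) (simp_all add: \<epsilon>t_mor \<epsilon>t_id \<epsilon>t_comp)
qed

lemma \<rho>t_functor: "cat_functor Tt (fusion_cat St Ft) (\<lambda>P. P) \<rho>t"
proof (rule cat_functor.intro)
  show "category Tt" by (rule Tt.category_axioms)
  show "category (fusion_cat St Ft)" by (rule category_Ft)
  show "cat_functor_axioms Tt (fusion_cat St Ft) (\<lambda>P. P) \<rho>t"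
    by (rule cat_functor_axioms.intro) (simp_all add: Tt_obj_subgroup Ft_obj \<rho>t_id \<rho>t_comp)
qed

lemma fst_normalizer:
  assumes X: "X \<in> Obj Tt" and z: "z \<in> carrier St"
  shows "z \<in> normalizer St X \<longleftrightarrow> fst z \<in> normalizer S (fst ` X)"
  using St.normalizer_iff[OF Tt_obj_subgroup[OF X]] S.normalizer_iff[OF obj_subgroup[OF obj_fst[OF X]]]
    Tt_transporter_iff[OF X X] z by simp

lemma eps_normalizer_subgroup:
  assumes P: "P \<in> Obj T"
  shows "subgroup (\<epsilon> P P ` normalizer S P) (aut_group T P)"
proof -
  note sP = obj_subgroup[OF P]
  have N: "subgroup (normalizer S P) S" by (rule S.normalizer_imp_subgroup[OF obj_sub[OF P]])
  have tr: "x \<in> transporter S P P" "inv\<^bsub>S\<^esub> x \<in> transporter S P P" "x \<in> carrier S" if "x \<in> normalizer S P" for x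
    using S.normalizer_iff[OF sP] that by (auto simp: transporter_def)
  have iso: "\<epsilon> P P x \<in> isos T P P" if x: "x \<in> normalizer S P" for x
  proof -
    have "inverse_mors (transporter_cat S (Obj T)) P P x (inv\<^bsub>S\<^esub> x)" using tr[OF x] by (simp add: inverse_mors_def)
    then show ?thesis using eps.preserves_isos[of P P x] P by (auto simp: isos_iff)
  qed
  have "group_hom (S\<lparr>carrier := normalizer S P\<rparr>) (aut_group T P) (\<epsilon> P P)"
    using S.subgroup_imp_group[OF N] group_aut[OF P] iso eps_comp[OF P P P] tr
    by (auto simp: group_hom_def group_hom_axioms_def hom_def)
  then show ?thesis using group_hom.img_is_subgroup by fastforce
qed

text \<open>The automorphism group in \<open>Tt\<close> maps onto the one in \<open>T\<close> with kernel \<open>K Y\<close>, and the image of the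
  normalizer in \<open>St\<close> is the full preimage of the image of the normalizer in \<open>S\<close>. So the indices agree.\<close>

lemma sylow_I_t:
  assumes X: "X \<in> Obj Tt"
  shows "\<exists>Y \<in> Obj Tt. fusion_conjugate St Ft X Y
            \<and> finite (rcosets\<^bsub>aut_group Tt Y\<^esub> (\<epsilon>t Y Y ` normalizer St Y))
            \<and> coprime p (card (rcosets\<^bsub>aut_group Tt Y\<^esub> (\<epsilon>t Y Y ` normalizer St Y)))"
proof -
  note oX = obj_fst[OF X]
  obtain P where P: "P \<in> Obj T" "fusion_conjugate S F (fst ` X) P"
    and fin: "finite (rcosets\<^bsub>aut_group T P\<^esub> (\<epsilon> P P ` normalizer S P))"
    and cop: "coprime p (card (rcosets\<^bsub>aut_group T P\<^esub> (\<epsilon> P P ` normalizer S P)))"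
    using sylow_I[OF oX] by blast
  define Y where "Y = pre P"
  have Y: "Y \<in> Obj Tt" and fY: "fst ` Y = P"
    using pre_obj[OF P(1)] fst_pre[OF obj_sub[OF P(1)]] by (auto simp: Y_def)
  have conj: "fusion_conjugate St Ft X Y"
  proof -
    obtain u where u: "u \<in> isos (fusion_cat S F) (fst ` X) P" using P(2) by (auto simp: fusion_conjugate_def)
    then have "u \<in> F (fst ` X) P" using isos_mor[OF u] by simp
    then obtain g where g: "g \<in> Mor T (fst ` X) P" "\<rho> (fst ` X) P g = u" using A1_surj[OF oX P(1)] by (metis imageE)
    have gi: "g \<in> isos T (fst ` X) P" using rho_reflects_isos[OF oX P(1) g(1)] u g(2) by simp
    obtain f where f: "f \<in> Mor Tt X Y" "tt X Y f = g" using tt_surj[OF X Y] g(1) fY by metis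
    have "f \<in> isos Tt X Y" using tt_reflects_isos[OF X Y f(1)] f(2) gi fY by simp
    then have "\<rho>t X Y f \<in> isos (fusion_cat St Ft) X Y" using cat_functor.preserves_isos[OF \<rho>t_functor X Y] by simp
    then show ?thesis using Tt_obj_subgroup X Y by (auto simp: fusion_conjugate_def)
  qed
  have hom: "group_hom (aut_group Tt Y) (aut_group T P) (tt Y Y)" using tt.group_hom_aut[OF Y] fY by simp
  have surj: "tt Y Y ` carrier (aut_group Tt Y) = carrier (aut_group T P)"
  proof
    show "tt Y Y ` carrier (aut_group Tt Y) \<subseteq> carrier (aut_group T P)"
      using group_hom.hom_closed[OF hom] by blast
    show "carrier (aut_group T P) \<subseteq> tt Y Y ` carrier (aut_group Tt Y)"
    proof
      fix g assume "g \<in> carrier (aut_group T P)"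
      then have g: "g \<in> isos T P P" by simp
      obtain f where f: "f \<in> Mor Tt Y Y" "tt Y Y f = g" using tt_surj[OF Y Y] isos_mor[OF g] fY by metis
      then have "f \<in> isos Tt Y Y" using tt_reflects_isos[OF Y Y f(1)] g fY by simp
      then show "g \<in> tt Y Y ` carrier (aut_group Tt Y)" using f(2) by auto
    qed
  qed
  have L: "\<epsilon>t Y Y ` normalizer St Y = {x \<in> carrier (aut_group Tt Y). tt Y Y x \<in> \<epsilon> P P ` normalizer S P}"
  proof (intro equalityI subsetI)
    fix x assume "x \<in> \<epsilon>t Y Y ` normalizer St Y"
    then obtain z where z: "z \<in> normalizer St Y" "x = \<epsilon>t Y Y z" by blast
    have zt: "z \<in> transporter St Y Y" using St.normalizer_iff[OF Tt_obj_subgroup[OF Y]] z(1) by blast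
    then have zc: "z \<in> carrier St" by (rule St_transporter_carrier)
    have fz: "fst z \<in> normalizer S P" using fst_normalizer[OF Y zc] z(1) fY by simp
    have tx: "tt Y Y x = \<epsilon> P P (fst z)" using \<epsilon>t_tt[OF Y Y zt] z(2) fY by simp
    have "\<epsilon> P P (fst z) \<in> isos T P P"
      using subgroup.subset[OF eps_normalizer_subgroup[OF P(1)]] fz by auto
    then have "x \<in> isos Tt Y Y" using tt_reflects_isos[OF Y Y \<epsilon>t_mor[OF Y Y zt]] tx z(2) fY by simp
    then show "x \<in> {x \<in> carrier (aut_group Tt Y). tt Y Y x \<in> \<epsilon> P P ` normalizer S P}" using tx fz by simp
  next
    fix x assume "x \<in> {x \<in> carrier (aut_group Tt Y). tt Y Y x \<in> \<epsilon> P P ` normalizer S P}"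
    then obtain g where x: "x \<in> isos Tt Y Y" and g: "g \<in> normalizer S P" "tt Y Y x = \<epsilon> P P g" by auto
    have "g \<in> S0" using subgroup.mem_carrier[OF S.normalizer_imp_subgroup[OF obj_sub[OF P(1)]] g(1)] .
    then obtain z where z: "z \<in> carrier St" "fst z = g" using fst_surj by (metis imageE)
    have zN: "z \<in> normalizer St Y" using fst_normalizer[OF Y z(1)] z(2) g(1) fY by simp
    then have zt: "z \<in> transporter St Y Y" using St.normalizer_iff[OF Tt_obj_subgroup[OF Y]] by blast
    have "tt Y Y (\<epsilon>t Y Y z) = tt Y Y x" using \<epsilon>t_tt[OF Y Y zt] z(2) g(2) fY by simp
    then obtain k where k: "k \<in> K Y" "x = Comp Tt Y Y Y (\<epsilon>t Y Y z) k"
      using tt_right[OF Y Y \<epsilon>t_mor[OF Y Y zt] isos_mor[OF x]] by blast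
    obtain a where a: "a \<in> A" "k = \<epsilon>t Y Y a" using k(1) K_eq[OF Y] by blast
    have aY: "a \<in> Y" using a(1) A_sub[OF Y] by blast
    have ac: "a \<in> carrier St" "fst a = \<one>\<^bsub>S\<^esub>" using a(1) by (auto simp: A_iff)
    have "x = \<epsilon>t Y Y (z \<otimes>\<^bsub>St\<^esub> a)" using k(2) a(2) \<epsilon>t_comp[OF Y Y Y Tt_mem_transporter[OF Y aY] zt] by simp
    moreover have "z \<otimes>\<^bsub>St\<^esub> a \<in> normalizer St Y"
      using fst_normalizer[OF Y, of "z \<otimes>\<^bsub>St\<^esub> a"] z ac g(1) fY \<open>g \<in> S0\<close> by simp
    ultimately show "x \<in> \<epsilon>t Y Y ` normalizer St Y" by blast
  qed
  have bij: "bij_betw ((`) (tt Y Y)) (rcosets\<^bsub>aut_group Tt Y\<^esub> (\<epsilon>t Y Y ` normalizer St Y))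
      (rcosets\<^bsub>aut_group T P\<^esub> (\<epsilon> P P ` normalizer S P))"
    by (rule group_hom.rcosets_vimage(2)[OF hom surj eps_normalizer_subgroup[OF P(1)] L])
  show ?thesis using Y conj fin cop bij_betw_finite[OF bij] bij_betw_same_card[OF bij] by auto
qed

lemma ext_II_t:
  assumes X: "X \<in> Obj Tt" and Y: "Y \<in> Obj Tt" and fg: "inverse_mors Tt X Y f g"
    and Xt: "subgroup Xt St" "X \<lhd> (St\<lparr>carrier := Xt\<rparr>)" and Yt: "subgroup Yt St" "Y \<lhd> (St\<lparr>carrier := Yt\<rparr>)"
    and im: "(\<lambda>x. Comp Tt Y X Y (Comp Tt X X Y f (\<epsilon>t X X x)) g) ` Xt \<subseteq> \<epsilon>t Y Y ` Yt"
  shows "\<exists>h \<in> Mor Tt Xt Yt. Comp Tt X Xt Yt h (\<epsilon>t X Xt \<one>\<^bsub>St\<^esub>) = Comp Tt X Y Yt (\<epsilon>t Y Yt \<one>\<^bsub>St\<^esub>) f"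
proof -
  note oX = obj_fst[OF X] and oY = obj_fst[OF Y]
  have m: "f \<in> Mor Tt X Y" "g \<in> Mor Tt Y X" using fg by (auto simp: inverse_mors_def)
  have nX: "X \<subseteq> Xt" "\<And>x h. x \<in> Xt \<Longrightarrow> h \<in> X \<Longrightarrow> x \<otimes>\<^bsub>St\<^esub> h \<otimes>\<^bsub>St\<^esub> inv\<^bsub>St\<^esub> x \<in> X"
    using St.normal_restrict_iff[OF Xt(1)] Xt(2) by auto
  have nY: "Y \<subseteq> Yt" "\<And>x h. x \<in> Yt \<Longrightarrow> h \<in> Y \<Longrightarrow> x \<otimes>\<^bsub>St\<^esub> h \<otimes>\<^bsub>St\<^esub> inv\<^bsub>St\<^esub> x \<in> Y"
    using St.normal_restrict_iff[OF Yt(1)] Yt(2) by auto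
  have XtO: "Xt \<in> Obj Tt" by (rule Tt_overgroup_closed[OF X Xt(1) nX(1)])
  have YtO: "Yt \<in> Obj Tt" by (rule Tt_overgroup_closed[OF Y Yt(1) nY(1)])
  note oXt = obj_fst[OF XtO] and oYt = obj_fst[OF YtO]
  have norm: "fst ` Z \<lhd> (S\<lparr>carrier := fst ` Zt\<rparr>)"
    if Z: "Z \<in> Obj Tt" and Zt: "subgroup Zt St" and ZZt: "Z \<subseteq> Zt"
      and n: "\<And>x h. x \<in> Zt \<Longrightarrow> h \<in> Z \<Longrightarrow> x \<otimes>\<^bsub>St\<^esub> h \<otimes>\<^bsub>St\<^esub> inv\<^bsub>St\<^esub> x \<in> Z" for Z Zt
  proof -
    have "fst x \<otimes>\<^bsub>S\<^esub> fst h \<otimes>\<^bsub>S\<^esub> inv\<^bsub>S\<^esub> fst x \<in> fst ` Z" if "x \<in> Zt" "h \<in> Z" for x h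
    proof -
      have "x \<in> carrier St" "h \<in> carrier St" using that subgroup.mem_carrier[OF Zt] ZZt by blast+
      then have "fst x \<otimes>\<^bsub>S\<^esub> fst h \<otimes>\<^bsub>S\<^esub> inv\<^bsub>S\<^esub> fst x = fst (x \<otimes>\<^bsub>St\<^esub> h \<otimes>\<^bsub>St\<^esub> inv\<^bsub>St\<^esub> x)" by simp
      then show ?thesis using n[OF that] by simp
    qed
    moreover have "fst ` Z \<subseteq> fst ` Zt" using ZZt by (rule image_mono)
    ultimately show ?thesis
      using S.normal_restrict_iff[OF fst_subgroup[OF Zt]] obj_subgroup[OF obj_fst[OF Z]] by blast
  qed
  have mem: "x \<in> transporter St X X" if "x \<in> Xt" for x
    using that nX(2)[OF that] subgroup.mem_carrier[OF Xt(1) that] by (auto simp: transporter_def conj_by_def)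
  have mem': "x \<in> transporter St Y Y" if "x \<in> Yt" for x
    using that nY(2)[OF that] subgroup.mem_carrier[OF Yt(1) that] by (auto simp: transporter_def conj_by_def)
  have "(\<lambda>x. Comp T (fst ` Y) (fst ` X) (fst ` Y) (Comp T (fst ` X) (fst ` X) (fst ` Y) (tt X Y f) (\<epsilon> (fst ` X) (fst ` X) x)) (tt Y X g)) ` (fst ` Xt)
      \<subseteq> \<epsilon> (fst ` Y) (fst ` Y) ` (fst ` Yt)"
  proof
    fix v assume "v \<in> (\<lambda>x. Comp T (fst ` Y) (fst ` X) (fst ` Y) (Comp T (fst ` X) (fst ` X) (fst ` Y) (tt X Y f) (\<epsilon> (fst ` X) (fst ` X) x)) (tt Y X g)) ` (fst ` Xt)"
    then obtain x where x: "x \<in> Xt" "v = Comp T (fst ` Y) (fst ` X) (fst ` Y) (Comp T (fst ` X) (fst ` X) (fst ` Y) (tt X Y f) (\<epsilon> (fst ` X) (fst ` X) (fst x))) (tt Y X g)"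
      by blast
    obtain y where y: "y \<in> Yt" "Comp Tt Y X Y (Comp Tt X X Y f (\<epsilon>t X X x)) g = \<epsilon>t Y Y y" using im x(1) by blast
    note ex = \<epsilon>t_mor[OF X X mem[OF x(1)]]
    have "v = tt Y Y (Comp Tt Y X Y (Comp Tt X X Y f (\<epsilon>t X X x)) g)"
      using tt.preserves_comp[OF Y X Y m(2) Tt.comp_closed[OF X X Y ex m(1)]] tt.preserves_comp[OF X X Y ex m(1)]
      by (simp add: x(2) \<epsilon>t_tt[OF X X mem[OF x(1)]])
    also have "\<dots> = \<epsilon> (fst ` Y) (fst ` Y) (fst y)" using y(2) \<epsilon>t_tt[OF Y Y mem'[OF y(1)]] by simp
    finally show "v \<in> \<epsilon> (fst ` Y) (fst ` Y) ` (fst ` Yt)" using y(1) by blast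
  qed
  then obtain h0 where h0: "h0 \<in> Mor T (fst ` Xt) (fst ` Yt)"
    "Comp T (fst ` X) (fst ` Xt) (fst ` Yt) h0 (\<epsilon> (fst ` X) (fst ` Xt) \<one>\<^bsub>S\<^esub>)
      = Comp T (fst ` X) (fst ` Y) (fst ` Yt) (\<epsilon> (fst ` Y) (fst ` Yt) \<one>\<^bsub>S\<^esub>) (tt X Y f)"
    using ext_II[OF oX oY tt.preserves_inverse_mors[OF X Y fg] fst_subgroup[OF Xt(1)] norm[OF X Xt(1) nX]
        fst_subgroup[OF Yt(1)] norm[OF Y Yt(1) nY]] by blast
  obtain h1 where h1: "h1 \<in> Mor Tt Xt Yt" "tt Xt Yt h1 = h0" using tt_surj[OF XtO YtO h0(1)] by blast
  note i1 = Tt_incl_mor[OF X XtO nX(1)] and i2 = Tt_incl_mor[OF Y YtO nY(1)]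
  have l: "Comp Tt X Xt Yt h1 (\<epsilon>t X Xt \<one>\<^bsub>St\<^esub>) \<in> Mor Tt X Yt" by (rule Tt.comp_closed[OF X XtO YtO i1 h1(1)])
  have r: "Comp Tt X Y Yt (\<epsilon>t Y Yt \<one>\<^bsub>St\<^esub>) f \<in> Mor Tt X Yt" by (rule Tt.comp_closed[OF X Y YtO m(1) i2])
  have "tt X Yt (Comp Tt X Xt Yt h1 (\<epsilon>t X Xt \<one>\<^bsub>St\<^esub>)) = tt X Yt (Comp Tt X Y Yt (\<epsilon>t Y Yt \<one>\<^bsub>St\<^esub>) f)"
    using tt.preserves_comp[OF X XtO YtO i1 h1(1)] tt.preserves_comp[OF X Y YtO m(1) i2] h0(2) h1(2)
    by (simp add: tt_incl[OF X XtO nX(1)] tt_incl[OF Y YtO nY(1)])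
  then obtain k where k: "k \<in> K Yt"
    "Comp Tt X Y Yt (\<epsilon>t Y Yt \<one>\<^bsub>St\<^esub>) f = Comp Tt X Yt Yt k (Comp Tt X Xt Yt h1 (\<epsilon>t X Xt \<one>\<^bsub>St\<^esub>))"
    using tt_left[OF X YtO l r] by blast
  note km = K_mor[OF k(1)]
  have "Comp Tt X Xt Yt (Comp Tt Xt Yt Yt k h1) (\<epsilon>t X Xt \<one>\<^bsub>St\<^esub>) = Comp Tt X Y Yt (\<epsilon>t Y Yt \<one>\<^bsub>St\<^esub>) f"
    using Tt.comp_assoc[OF X XtO YtO YtO i1 h1(1) km] k(2) by simp
  then show ?thesis using Tt.comp_closed[OF XtO YtO YtO h1(1) km] by blast
qed

lemma ext_III_t:
  fixes Xn :: "nat \<Rightarrow> ('a \<times> 'n) set"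
  assumes X: "\<And>n. Xn n \<in> Obj Tt" and mono: "\<And>n. Xn n \<subseteq> Xn (Suc n)"
    and f: "\<And>n. fn n \<in> Mor Tt (Xn n) (carrier St)"
    and comp: "\<And>n. fn n = Comp Tt (Xn n) (Xn (Suc n)) (carrier St) (fn (Suc n)) (\<epsilon>t (Xn n) (Xn (Suc n)) \<one>\<^bsub>St\<^esub>)"
  shows "\<exists>h \<in> Mor Tt (\<Union>n. Xn n) (carrier St).
            \<forall>n. fn n = Comp Tt (Xn n) (\<Union>n. Xn n) (carrier St) h (\<epsilon>t (Xn n) (\<Union>n. Xn n) \<one>\<^bsub>St\<^esub>)"
proof -
  define U where "U = (\<Union>n. Xn n)"
  note W = Tt_carrier_obj
  have XU: "Xn n \<subseteq> U" for n by (auto simp: U_def)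
  have "subgroup U St" unfolding U_def by (rule St.subgroup_UN_chain[of Xn, OF Tt_obj_subgroup[OF X] mono])
  then have U: "U \<in> Obj Tt" by (rule Tt_overgroup_closed[OF X[of 0] _ XU])
  have fU: "fst ` U = (\<Union>n. fst ` Xn n)" by (auto simp: U_def)
  have "\<exists>h\<in>Mor T (\<Union>n. fst ` Xn n) S0. \<forall>n. tt (Xn n) (carrier St) (fn n)
      = Comp T (fst ` Xn n) (\<Union>n. fst ` Xn n) S0 h (\<epsilon> (fst ` Xn n) (\<Union>n. fst ` Xn n) \<one>\<^bsub>S\<^esub>)"
  proof (rule ext_III)
    fix n
    show "fst ` Xn n \<in> Obj T" by (rule obj_fst[OF X])
    show "fst ` Xn n \<subseteq> fst ` Xn (Suc n)" using mono by (rule image_mono)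
    show "tt (Xn n) (carrier St) (fn n) \<in> Mor T (fst ` Xn n) S0"
      using tt.mor_closed[OF X W f] by (simp add: fst_surj)
    show "tt (Xn n) (carrier St) (fn n) = Comp T (fst ` Xn n) (fst ` Xn (Suc n)) S0
        (tt (Xn (Suc n)) (carrier St) (fn (Suc n))) (\<epsilon> (fst ` Xn n) (fst ` Xn (Suc n)) \<one>\<^bsub>S\<^esub>)"
      using tt.preserves_comp[OF X X W Tt_incl_mor[OF X X mono] f, of n] comp[of n]
      by (simp add: fst_surj tt_incl[OF X X mono])
  qed
  then obtain h0 where h0: "h0 \<in> Mor T (fst ` U) S0"
    "\<And>n. tt (Xn n) (carrier St) (fn n) = Comp T (fst ` Xn n) (fst ` U) S0 h0 (\<epsilon> (fst ` Xn n) (fst ` U) \<one>\<^bsub>S\<^esub>)"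
    by (auto simp: fU)
  obtain h1 where h1: "h1 \<in> Mor Tt U (carrier St)" "tt U (carrier St) h1 = h0"
    using tt_surj[OF U W] h0(1) by (metis fst_surj)
  define g where "g n = Comp Tt (Xn n) U (carrier St) h1 (\<epsilon>t (Xn n) U \<one>\<^bsub>St\<^esub>)" for n
  have g: "g n \<in> Mor Tt (Xn n) (carrier St)" for n
    unfolding g_def by (rule Tt.comp_closed[OF X U W Tt_incl_mor[OF X U XU] h1(1)])
  have "\<exists>a. a \<in> A \<and> fn n = Comp Tt (Xn n) (carrier St) (carrier St) (\<epsilon>t (carrier St) (carrier St) a) (g n)" for n
  proof -
    have "tt (Xn n) (carrier St) (g n) = tt (Xn n) (carrier St) (fn n)"
      using tt.preserves_comp[OF X U W Tt_incl_mor[OF X U XU] h1(1), of n] h0(2)[of n] h1(2)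
      by (simp add: g_def fst_surj tt_incl[OF X U XU])
    then obtain k where k: "k \<in> K (carrier St)" "fn n = Comp Tt (Xn n) (carrier St) (carrier St) k (g n)"
      using tt_left[OF X W g f] by blast
    obtain a where "a \<in> A" "k = \<epsilon>t (carrier St) (carrier St) a" using k(1) unfolding K_eq[OF W] by (rule imageE)
    then show ?thesis using k(2) by (intro exI[of _ a]) simp
  qed
  then have "\<exists>a. \<forall>n. a n \<in> A \<and> fn n = Comp Tt (Xn n) (carrier St) (carrier St) (\<epsilon>t (carrier St) (carrier St) (a n)) (g n)"
    by (intro choice allI)
  then obtain a where a': "\<forall>n. a n \<in> A \<and> fn n = Comp Tt (Xn n) (carrier St) (carrier St) (\<epsilon>t (carrier St) (carrier St) (a n)) (g n)" ..
  then have a: "a n \<in> A"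
    "fn n = Comp Tt (Xn n) (carrier St) (carrier St) (\<epsilon>t (carrier St) (carrier St) (a n)) (g n)" for n by blast+
  have ac: "a n \<in> carrier St" for n using a(1) by (simp add: A_iff)
  have ea: "\<epsilon>t (carrier St) (carrier St) (a n) \<in> Mor Tt (carrier St) (carrier St)" for n
    using \<epsilon>t_mor[OF W W Tt_mem_transporter[OF W ac]] .
  \<comment> \<open>The action on \<open>g n\<close> is free, so each \<open>fn n\<close> has only one correction, and restricting
    \<open>fn (Suc n)\<close> to \<open>Xn n\<close> shows that the next one is the same.\<close>
  have "a (Suc n) = a n" for n
  proof -
    have gs: "g n = Comp Tt (Xn n) (Xn (Suc n)) (carrier St) (g (Suc n)) (\<epsilon>t (Xn n) (Xn (Suc n)) \<one>\<^bsub>St\<^esub>)"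
      using Tt.comp_assoc[OF X X U W Tt_incl_mor[OF X X mono] Tt_incl_mor[OF X U XU] h1(1), of n]
        \<epsilon>t_comp[OF X X U St.one_transporter[OF Tt_obj_subgroup[OF X] mono] St.one_transporter[OF Tt_obj_subgroup[OF X] XU], of n]
      by (simp add: g_def)
    have fS: "fn n = Comp Tt (Xn n) (carrier St) (carrier St) (\<epsilon>t (carrier St) (carrier St) (a (Suc n))) (g n)"
      using comp[of n] a(2)[of "Suc n"] gs
        Tt.comp_assoc[OF X[of n] X[of "Suc n"] W W Tt_incl_mor[OF X[of n] X[of "Suc n"] mono] g[of "Suc n"] ea[of "Suc n"]] by simp
    show ?thesis
      by (rule \<epsilon>t_cancel[OF X[of n] W g[of n] ac[of "Suc n"] ac[of n] trans[OF fS[symmetric] a(2)[of n]]])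
  qed
  then have an: "a n = a 0" for n by (induction n) auto
  let ?h = "Comp Tt U (carrier St) (carrier St) (\<epsilon>t (carrier St) (carrier St) (a 0)) h1"
  have "fn n = Comp Tt (Xn n) U (carrier St) ?h (\<epsilon>t (Xn n) U \<one>\<^bsub>St\<^esub>)" for n
    using Tt.comp_assoc[OF X[of n] U W W Tt_incl_mor[OF X[of n] U XU] h1(1) ea[of 0]] a(2)[of n] an[of n] by (simp add: g_def)
  moreover have "?h \<in> Mor Tt U (carrier St)" by (rule Tt.comp_closed[OF U W W h1(1) ea])
  ultimately show ?thesis unfolding U_def by blast
qed

abbreviation Et where "Et X \<equiv> kernel (aut_group Tt X) (aut_group (fusion_cat St Ft) X) (\<rho>t X X)"

lemma Et_iff: "e \<in> Et X \<longleftrightarrow> e \<in> isos Tt X X \<and> \<rho>t X X e = (\<lambda>x\<in>X. x)"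
  by (simp add: kernel_def)

lemma tt_kernel_\<rho>t:
  assumes X: "X \<in> Obj Tt" and e: "e \<in> Et X"
  shows "tt X X e \<in> E (fst ` X)"
proof (rule rho_id_kernel[OF obj_fst[OF X]])
  note oX = obj_fst[OF X]
  have em: "e \<in> Mor Tt X X" using e isos_mor[of e Tt X X] by (simp add: Et_iff)
  show tm: "tt X X e \<in> Mor T (fst ` X) (fst ` X)" by (rule tt.mor_closed[OF X X em])
  show "\<rho> (fst ` X) (fst ` X) (tt X X e) = (\<lambda>x\<in>fst ` X. x)"
  proof (rule extensionalityI[OF inj_homsD(1)[OF rho_inj_homs[OF oX oX tm]]])
    show "(\<lambda>x\<in>fst ` X. x) \<in> extensional (fst ` X)" by simp
    fix u assume u: "u \<in> fst ` X"
    then obtain x where x: "x \<in> X" "u = fst x" by blast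
    show "\<rho> (fst ` X) (fst ` X) (tt X X e) u = (\<lambda>x\<in>fst ` X. x) u"
      using \<rho>t_fst[OF X X em x(1)] e x u by (simp add: Et_iff)
  qed
qed

text \<open>Both ambiguities of \<open>g\<close> relative to \<open>f\<close>, an element of \<open>E\<close> below and an element of \<open>K X\<close> above, combine to
  one automorphism, and \<open>\<rho>t\<close> sends it to the identity by injectivity of \<open>\<rho>t f\<close>.\<close>

lemma \<rho>t_fibre:
  assumes X: "X \<in> Obj Tt" and Y: "Y \<in> Obj Tt" and f: "f \<in> Mor Tt X Y" and g: "g \<in> Mor Tt X Y"
  shows "\<rho>t X Y f = \<rho>t X Y g \<longleftrightarrow> (\<exists>e \<in> Et X. g = Comp Tt X X Y f e)"
proof
  assume "\<exists>e \<in> Et X. g = Comp Tt X X Y f e"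
  then obtain e where e: "e \<in> Et X" "g = Comp Tt X X Y f e" by blast
  have em: "e \<in> Mor Tt X X" using e(1) isos_mor[of e Tt X X] by (simp add: Et_iff)
  show "\<rho>t X Y f = \<rho>t X Y g"
    using \<rho>t_comp[OF X X Y em f] e \<rho>t_ext[OF X Y f]
    by (auto simp: Et_iff compose_def restrict_def fun_eq_iff extensional_def)
next
  assume r: "\<rho>t X Y f = \<rho>t X Y g"
  note oX = obj_fst[OF X] and oY = obj_fst[OF Y]
  note tf = tt.mor_closed[OF X Y f] and tg = tt.mor_closed[OF X Y g]
  have "\<rho> (fst ` X) (fst ` Y) (tt X Y f) = \<rho> (fst ` X) (fst ` Y) (tt X Y g)"
  proof (rule extensionalityI[OF inj_homsD(1)[OF rho_inj_homs[OF oX oY tf]] inj_homsD(1)[OF rho_inj_homs[OF oX oY tg]]])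
    fix u assume "u \<in> fst ` X"
    then obtain x where x: "x \<in> X" "u = fst x" by blast
    show "\<rho> (fst ` X) (fst ` Y) (tt X Y f) u = \<rho> (fst ` X) (fst ` Y) (tt X Y g) u"
      using \<rho>t_fst[OF X Y f x(1)] \<rho>t_fst[OF X Y g x(1)] r x(2) by simp
  qed
  then obtain e0 where e0: "e0 \<in> E (fst ` X)" "tt X Y g = Comp T (fst ` X) (fst ` X) (fst ` Y) (tt X Y f) e0"
    using rho_fibre[OF oX oY tf tg] by blast
  have e0i: "e0 \<in> isos T (fst ` X) (fst ` X)" using e0(1) by (simp add: kernel_def)
  obtain e1 where e1: "e1 \<in> Mor Tt X X" "tt X X e1 = e0" using tt_surj[OF X X isos_mor[OF e0i]] by blast
  have e1i: "e1 \<in> isos Tt X X" using tt_reflects_isos[OF X X e1(1)] e0i e1(2) by simp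
  have "tt X Y (Comp Tt X X Y f e1) = tt X Y g" using tt.preserves_comp[OF X X Y e1(1) f] e0(2) e1(2) by simp
  then obtain k where k: "k \<in> K X" "g = Comp Tt X X Y (Comp Tt X X Y f e1) k"
    using tt_right[OF X Y Tt.comp_closed[OF X X Y e1(1) f] g] by blast
  have ki: "k \<in> isos Tt X X" using k(1) by (simp add: K_iff)
  define e where "e = Comp Tt X X X e1 k"
  have ei: "e \<in> isos Tt X X" unfolding e_def by (rule Tt.isos_comp[OF X X X ki e1i])
  note em = isos_mor[OF ei]
  have ge: "g = Comp Tt X X Y f e" using k(2) Tt.comp_assoc[OF X X X Y isos_mor[OF ki] e1(1) f] by (simp add: e_def)
  have "\<rho>t X X e = (\<lambda>x\<in>X. x)"
  proof (rule extensionalityI[OF \<rho>t_ext[OF X X em]])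
    show "(\<lambda>x\<in>X. x) \<in> extensional X" by simp
    fix x assume x: "x \<in> X"
    have "\<rho>t X Y f (\<rho>t X X e x) = \<rho>t X Y f x"
      using fun_cong[OF \<rho>t_comp[OF X X Y em f], of x] ge r x by (simp add: compose_def)
    then show "\<rho>t X X e x = (\<lambda>x\<in>X. x) x"
      using inj_onD[OF \<rho>t_inj[OF X Y f] _ \<rho>t_closed[OF X X em x] x] x by simp
  qed
  then show "\<exists>e \<in> Et X. g = Comp Tt X X Y f e" using ei ge by (auto simp: Et_iff)
qed

theorem transporter_system_t: "transporter_system p St Ft Tt \<epsilon>t \<rho>t"
proof (rule transporter_system.intro)
  show "fusion_system p St Ft" by (rule fusion_system_Ft)
  show "category Tt" by (rule Tt.category_axioms)
  show "cat_functor (transporter_cat St (Obj Tt)) Tt (\<lambda>P. P) \<epsilon>t" by (rule \<epsilon>t_functor)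
  show "cat_functor Tt (fusion_cat St Ft) (\<lambda>P. P) \<rho>t" by (rule \<rho>t_functor)
  show "transporter_system_axioms p St Ft Tt \<epsilon>t \<rho>t"
  proof (rule transporter_system_axioms.intro)
    show "Obj Tt \<noteq> {}" using Tt_carrier_obj by blast
    show "Obj Tt \<subseteq> {P. subgroup P St}" using Tt_obj_subgroup by blast
    show "Y \<in> Obj Tt" if X: "X \<in> Obj Tt" and c: "fusion_conjugate St Ft X Y" for X Y
    proof -
      obtain u where "u \<in> isos (fusion_cat St Ft) X Y" using c by (auto simp: fusion_conjugate_def)
      then have "gSt X Y u" using isos_mor[of u "fusion_cat St Ft" X Y] by (simp add: Ft_iff)
      then show ?thesis using gSt_obj X by blast
    qed
    show "Q \<in> Obj Tt" if "P \<in> Obj Tt" "subgroup Q St" "P \<subseteq> Q" for P Q using Tt_overgroup_closed that .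
    show "inj_on (\<epsilon>t X Y) (transporter St X Y)" if "X \<in> Obj Tt" "Y \<in> Obj Tt" for X Y
      using \<epsilon>t_inj[OF that] by (rule inj_onI)
    show "\<rho>t X Y ` Mor Tt X Y = Ft X Y" if "X \<in> Obj Tt" "Y \<in> Obj Tt" for X Y using Ft_obj[OF that] by simp
    show "free_right Tt X Y E' \<and> orbit_map_right Tt X Y E' (\<rho>t X Y) (Ft X Y)"
      if X: "X \<in> Obj Tt" and Y: "Y \<in> Obj Tt" and E': "E' = Et X" for X Y E'
    proof
      show "free_right Tt X Y E'"
        unfolding free_right_def
      proof (intro ballI impI)
        fix f e assume f: "f \<in> Mor Tt X Y" and e: "e \<in> E'" and c: "Comp Tt X X Y f e = f"
        have em: "e \<in> Mor Tt X X" using e E' isos_mor[of e Tt X X] by (simp add: Et_iff)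
        show "e = Idn Tt X"
          by (rule Tt_left_cancel[OF X X Y em Tt.id_closed[OF X] f]) (simp add: c Tt.id_right[OF X Y f])
      qed
      show "orbit_map_right Tt X Y E' (\<rho>t X Y) (Ft X Y)"
        unfolding orbit_map_right_def E' using Ft_obj[OF X Y] \<rho>t_fibre[OF X Y] by simp
    qed
    show "free_left Tt X Y E'" if X: "X \<in> Obj Tt" and Y: "Y \<in> Obj Tt" and E': "E' = Et Y" for X Y E'
      unfolding free_left_def
    proof (intro ballI impI)
      fix f e assume f: "f \<in> Mor Tt X Y" and e: "e \<in> E'" and c: "Comp Tt X Y Y e f = f"
      note oX = obj_fst[OF X] and oY = obj_fst[OF Y]
      have em: "e \<in> Mor Tt Y Y" using e E' isos_mor[of e Tt Y Y] by (simp add: Et_iff)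
      have "Comp T (fst ` X) (fst ` Y) (fst ` Y) (tt Y Y e) (tt X Y f) = tt X Y f"
        using tt.preserves_comp[OF X Y Y f em] c by simp
      then have "tt Y Y e = Idn T (fst ` Y)"
        using A2_left[OF oX oY refl] tt_kernel_\<rho>t[OF Y] e E' tt.mor_closed[OF X Y f] unfolding free_left_def by blast
      then have "e \<in> K Y" using K_I[OF Y em] by simp
      then show "e = Idn Tt Y" using K_free_left[OF X Y f] c by blast
    qed
    show "\<rho>t P Q (\<epsilon>t P Q g) = restrict (conj_by St g) P"
      if "P \<in> Obj Tt" "Q \<in> Obj Tt" "g \<in> transporter St P Q" for P Q g using \<rho>t_\<epsilon>t that .
    show "Comp Tt P P Q \<phi> (\<epsilon>t P P g) = Comp Tt P Q Q (\<epsilon>t Q Q (\<rho>t P Q \<phi> g)) \<phi>"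
      if "P \<in> Obj Tt" "Q \<in> Obj Tt" "\<phi> \<in> Mor Tt P Q" "g \<in> P" for P Q \<phi> g using \<rho>t_eq that .
  qed (fact sylow_I_t ext_II_t ext_III_t)+
qed

section \<open>Normality of the kernel\<close>

lemma setmult_A_subgroup: "subgroup P St \<Longrightarrow> subgroup (P <#>\<^bsub>St\<^esub> A) St"
  using St.mult_norm_subgroup[OF A_normal] St.commut_normal[OF _ A_normal] by metis

lemma sub_setmult_A: "subgroup P St \<Longrightarrow> P \<subseteq> P <#>\<^bsub>St\<^esub> A \<and> A \<subseteq> P <#>\<^bsub>St\<^esub> A"
proof
  assume P: "subgroup P St"
  show "P \<subseteq> P <#>\<^bsub>St\<^esub> A"
  proof
    fix x assume "x \<in> P"
    moreover then have "x = x \<otimes>\<^bsub>St\<^esub> \<one>\<^bsub>St\<^esub>" using subgroup.mem_carrier[OF P] by simp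
    ultimately show "x \<in> P <#>\<^bsub>St\<^esub> A" unfolding set_mult_def using subgroup.one_closed[OF A_subgroup] by blast
  qed
  show "A \<subseteq> P <#>\<^bsub>St\<^esub> A"
  proof
    fix x assume "x \<in> A"
    moreover then have "x = \<one>\<^bsub>St\<^esub> \<otimes>\<^bsub>St\<^esub> x" using subgroup.mem_carrier[OF A_subgroup] by simp
    ultimately show "x \<in> P <#>\<^bsub>St\<^esub> A" unfolding set_mult_def using subgroup.one_closed[OF P] by blast
  qed
qed

lemma setmult_A_le: "subgroup X St \<Longrightarrow> P \<subseteq> X \<Longrightarrow> A \<subseteq> X \<Longrightarrow> P <#>\<^bsub>St\<^esub> A \<subseteq> X"
  using subgroup.m_closed[of X St] by (auto simp: set_mult_def subset_eq)

text \<open>The generators are restrictions of maps \<open>\<rho>t \<phi>\<close> whose source contains \<open>A\<close>, so they extend to \<open>P A\<close>;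
  the extensions compose because they map \<open>A\<close> onto \<open>A\<close>.\<close>

lemma gSt_extend_A:
  "gSt P Q f \<Longrightarrow> \<exists>g. gSt (P <#>\<^bsub>St\<^esub> A) (Q <#>\<^bsub>St\<^esub> A) g \<and> restrict g P = f \<and> g ` A = A"
proof (induction rule: generated_mor.induct)
  case (restriction X Y h P Q)
  then obtain \<phi> where \<phi>: "\<phi> \<in> Mor Tt X Y" "h = \<rho>t X Y \<phi>" by blast
  note X = restriction(1) and Y = restriction(2) and P = restriction(4) and Q = restriction(5)
  have PX: "P <#>\<^bsub>St\<^esub> A \<subseteq> X" by (rule setmult_A_le[OF Tt_obj_subgroup[OF X] restriction(6) A_sub[OF X]])
  have QY: "Q <#>\<^bsub>St\<^esub> A \<subseteq> Y" by (rule setmult_A_le[OF Tt_obj_subgroup[OF Y] restriction(7) A_sub[OF Y]])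
  have hA: "h ` A = A" using \<rho>t_A[OF X Y \<phi>(1)] \<phi>(2) by simp
  note ih = \<rho>t_inj_homs[OF X Y \<phi>(1), folded \<phi>(2)]
  have im: "h ` (P <#>\<^bsub>St\<^esub> A) \<subseteq> Q <#>\<^bsub>St\<^esub> A"
  proof
    fix v assume "v \<in> h ` (P <#>\<^bsub>St\<^esub> A)"
    then obtain u a where u: "u \<in> P" "a \<in> A" "v = h (u \<otimes>\<^bsub>St\<^esub> a)" by (auto simp: set_mult_def)
    have "v = h u \<otimes>\<^bsub>St\<^esub> h a"
      using inj_homsD(4)[OF ih] u restriction(6) A_sub[OF X] by blast
    moreover have "h u \<in> Q" "h a \<in> A" using restriction(8) hA u by blast+
    ultimately show "v \<in> Q <#>\<^bsub>St\<^esub> A" unfolding set_mult_def by blast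
  qed
  let ?g = "restrict h (P <#>\<^bsub>St\<^esub> A)"
  have "gSt (P <#>\<^bsub>St\<^esub> A) (Q <#>\<^bsub>St\<^esub> A) ?g"
    by (rule gSt_restriction[OF X Y restriction(3) setmult_A_subgroup[OF P] setmult_A_subgroup[OF Q] PX QY im])
  moreover have "restrict ?g P = restrict h P" using sub_setmult_A[OF P] by (auto simp: restrict_def fun_eq_iff)
  moreover have "?g ` A = A"
  proof -
    have "?g ` A = h ` A" using sub_setmult_A[OF P] by (intro image_cong) auto
    then show ?thesis using hA by simp
  qed
  ultimately show ?case by blast
next
  case (composite P Q f R g)
  obtain f' where f': "gSt (P <#>\<^bsub>St\<^esub> A) (Q <#>\<^bsub>St\<^esub> A) f'" "restrict f' P = f" "f' ` A = A" using composite.IH(1) by blast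
  obtain g' where g': "gSt (Q <#>\<^bsub>St\<^esub> A) (R <#>\<^bsub>St\<^esub> A) g'" "restrict g' Q = g" "g' ` A = A" using composite.IH(2) by blast
  have P: "subgroup P St" and fPQ: "f ` P \<subseteq> Q" using gSt_inj_homs[OF composite.hyps(1)] inj_homsD(5) by blast+
  note sP = sub_setmult_A[OF P]
  let ?h = "compose (P <#>\<^bsub>St\<^esub> A) g' f'"
  have "restrict ?h P = compose P g f"
  proof
    fix x show "restrict ?h P x = compose P g f x"
    proof (cases "x \<in> P")
      case True
      have "f x = f' x" using f'(2) True by (metis restrict_apply')
      moreover have "g (f x) = g' (f x)" using g'(2) fPQ True by (metis image_subset_iff restrict_apply')
      moreover have "x \<in> P <#>\<^bsub>St\<^esub> A" using True sP by blast
      ultimately show ?thesis using True by (simp add: compose_def)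
    qed (simp add: compose_def)
  qed
  moreover have "?h ` A = A"
  proof -
    have "?h ` A = g' ` f' ` A" using sP by (auto simp: compose_def image_image subset_eq)
    then show ?thesis using f'(3) g'(3) by simp
  qed
  ultimately show ?case using generated_mor.composite[OF f'(1) g'(1)] by blast
qed

theorem fusion_normal_A: "fusion_normal St Ft A"
  unfolding fusion_normal_def
proof (intro conjI allI impI)
  show "subgroup A St" by (rule A_subgroup)
next
  fix P assume "subgroup P St"
  then show "subgroup (P <#>\<^bsub>St\<^esub> A) St" by (rule setmult_A_subgroup)
next
  fix P f assume P: "subgroup P St" and "f \<in> Ft P (carrier St)"
  then have "gSt P (carrier St) f" by (simp add: Ft_iff)
  then obtain g where g: "gSt (P <#>\<^bsub>St\<^esub> A) (carrier St <#>\<^bsub>St\<^esub> A) g" "restrict g P = f" "g ` A = A"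
    using gSt_extend_A by blast
  note sP = sub_setmult_A[OF P]
  have "carrier St <#>\<^bsub>St\<^esub> A = carrier St"
    using sub_setmult_A[OF St.subgroup_self] setmult_A_le[OF St.subgroup_self order_refl subgroup.subset[OF A_subgroup]] by blast
  then have g1: "gSt (P <#>\<^bsub>St\<^esub> A) (carrier St) g" using g(1) by simp
  have gA: "gSt A A (restrict g A)"
    by (rule gSt_restrict[OF g1 A_subgroup _ A_subgroup subgroup.subset[OF A_subgroup]]) (use sP g(3) in auto)
  let ?i = "restrict g A"
  have inj: "inj_on ?i A" using gSt_inj_homs[OF gA] inj_homsD(2) by blast
  have im: "?i ` A = A" using g(3) by simp
  let ?j = "restrict (inv_into A ?i) A"
  have j: "gSt A A ?j" using gSt_inverse[OF gA] by (simp only: im)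
  have "inverse_mors (fusion_cat St Ft) A A ?i ?j"
    unfolding inverse_mors_def fusion_cat_simps Ft_iff
  proof (intro conjI gA j)
    show "compose A ?j ?i = (\<lambda>x\<in>A. x)"
    proof (rule restrict_ext[of A "\<lambda>x. ?j (?i x)" "\<lambda>x. x", folded compose_def])
      fix x assume x: "x \<in> A"
      then have "?i x \<in> A" using im by blast
      then show "?j (?i x) = x" using inv_into_f_f[OF inj x] by simp
    qed
    show "compose A ?i ?j = (\<lambda>x\<in>A. x)"
    proof (rule restrict_ext[of A "\<lambda>x. ?i (?j x)" "\<lambda>x. x", folded compose_def])
      fix x assume x: "x \<in> A"
      then have "x \<in> ?i ` A" using im by simp
      then show "?i (?j x) = x" using f_inv_into_f[of x ?i A] x by simp
    qed
  qed
  then have "restrict g A \<in> carrier (aut_group (fusion_cat St Ft) A)" by (auto simp: isos_iff)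
  then show "\<exists>\<gamma>\<in>Ft (P <#>\<^bsub>St\<^esub> A) (carrier St). restrict \<gamma> P = f \<and> restrict \<gamma> A \<in> carrier (aut_group (fusion_cat St Ft) A)"
    using g1 g(2) by (intro bexI[of _ g]) (simp_all only: Ft_iff simp_thms)
qed

end

section \<open>The quotient by the kernel\<close>

text \<open>The category laws of the target need not be assumed, since they are transported from the source.\<close>

lemma cat_isoI:
  assumes C: "category C" and obj: "bij_betw FO (Obj C) (Obj D)"
    and mor: "\<And>P Q. P \<in> Obj C \<Longrightarrow> Q \<in> Obj C \<Longrightarrow> bij_betw (FM P Q) (Mor C P Q) (Mor D (FO P) (FO Q))"
    and id: "\<And>P. P \<in> Obj C \<Longrightarrow> FM P P (Idn C P) = Idn D (FO P)"
    and comp: "\<And>P Q R f g. \<lbrakk>P \<in> Obj C; Q \<in> Obj C; R \<in> Obj C; f \<in> Mor C P Q; g \<in> Mor C Q R\<rbrakk>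
      \<Longrightarrow> FM P R (Comp C P Q R g f) = Comp D (FO P) (FO Q) (FO R) (FM Q R g) (FM P Q f)"
  shows "cat_iso C D FO FM"
proof -
  interpret C: category C by (rule C)
  have o: "\<exists>P. P \<in> Obj C \<and> X = FO P" if "X \<in> Obj D" for X
    using bij_betw_imp_surj_on[OF obj] that by blast
  have m: "\<exists>f. f \<in> Mor C P Q \<and> x = FM P Q f" if "P \<in> Obj C" "Q \<in> Obj C" "x \<in> Mor D (FO P) (FO Q)" for P Q x
    using bij_betw_imp_surj_on[OF mor[OF that(1,2)]] that(3) by blast
  have m': "FM P Q f \<in> Mor D (FO P) (FO Q)" if "P \<in> Obj C" "Q \<in> Obj C" "f \<in> Mor C P Q" for P Q f
    using bij_betw_apply[OF mor] that by blast
  have D: "category D"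
  proof
    fix P' Q' R' f' g' assume a: "P' \<in> Obj D" "Q' \<in> Obj D" "R' \<in> Obj D" and f': "f' \<in> Mor D P' Q'" and g': "g' \<in> Mor D Q' R'"
    obtain P Q R where P: "P \<in> Obj C" "P' = FO P" and Q: "Q \<in> Obj C" "Q' = FO Q" and R: "R \<in> Obj C" "R' = FO R"
      using o a by metis
    obtain f where f: "f \<in> Mor C P Q" "f' = FM P Q f" using m P Q f' by blast
    obtain g where g: "g \<in> Mor C Q R" "g' = FM Q R g" using m Q R g' by blast
    show "Comp D P' Q' R' g' f' \<in> Mor D P' R'"
      using m'[OF P(1) R(1) C.comp_closed[OF P(1) Q(1) R(1) f(1) g(1)]] comp[OF P(1) Q(1) R(1) f(1) g(1)] P Q R f g by simp
  next
    fix P' assume "P' \<in> Obj D"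
    then obtain P where P: "P \<in> Obj C" "P' = FO P" using o by blast
    show "Idn D P' \<in> Mor D P' P'" using m'[OF P(1) P(1) C.id_closed[OF P(1)]] id[OF P(1)] P by simp
  next
    fix P' Q' R' W' f' g' h' assume a: "P' \<in> Obj D" "Q' \<in> Obj D" "R' \<in> Obj D" "W' \<in> Obj D"
      and f': "f' \<in> Mor D P' Q'" and g': "g' \<in> Mor D Q' R'" and h': "h' \<in> Mor D R' W'"
    obtain P Q R W where P: "P \<in> Obj C" "P' = FO P" and Q: "Q \<in> Obj C" "Q' = FO Q"
      and R: "R \<in> Obj C" "R' = FO R" and W: "W \<in> Obj C" "W' = FO W" using o a by metis
    obtain f where f: "f \<in> Mor C P Q" "f' = FM P Q f" using m P Q f' by blast
    obtain g where g: "g \<in> Mor C Q R" "g' = FM Q R g" using m Q R g' by blast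
    obtain h where h: "h \<in> Mor C R W" "h' = FM R W h" using m R W h' by blast
    have "Comp D P' Q' W' (Comp D Q' R' W' h' g') f' = FM P W (Comp C P Q W (Comp C Q R W h g) f)"
      using comp[OF Q(1) R(1) W(1) g(1) h(1)] comp[OF P(1) Q(1) W(1) f(1) C.comp_closed[OF Q(1) R(1) W(1) g(1) h(1)]]
        P Q R W f g h by simp
    also have "\<dots> = FM P W (Comp C P R W h (Comp C P Q R g f))"
      using C.comp_assoc[OF P(1) Q(1) R(1) W(1) f(1) g(1) h(1)] by simp
    also have "\<dots> = Comp D P' R' W' h' (Comp D P' Q' R' g' f')"
      using comp[OF P(1) Q(1) R(1) f(1) g(1)] comp[OF P(1) R(1) W(1) C.comp_closed[OF P(1) Q(1) R(1) f(1) g(1)] h(1)]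
        P Q R W f g h by simp
    finally show "Comp D P' Q' W' (Comp D Q' R' W' h' g') f' = Comp D P' R' W' h' (Comp D P' Q' R' g' f')" .
  next
    fix P' Q' f' assume a: "P' \<in> Obj D" "Q' \<in> Obj D" and f': "f' \<in> Mor D P' Q'"
    obtain P Q where P: "P \<in> Obj C" "P' = FO P" and Q: "Q \<in> Obj C" "Q' = FO Q" using o a by metis
    obtain f where f: "f \<in> Mor C P Q" "f' = FM P Q f" using m P Q f' by blast
    show "Comp D P' Q' Q' (Idn D Q') f' = f'"
      using comp[OF P(1) Q(1) Q(1) f(1) C.id_closed[OF Q(1)]] id[OF Q(1)] C.id_left[OF P(1) Q(1) f(1)] P Q f by simp
    show "Comp D P' P' Q' f' (Idn D P') = f'"
      using comp[OF P(1) P(1) Q(1) C.id_closed[OF P(1)] f(1)] id[OF P(1)] C.id_right[OF P(1) Q(1) f(1)] P Q f by simp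
  qed
  have "cat_functor C D FO FM"
  proof (rule cat_functor.intro[OF C D], rule cat_functor_axioms.intro)
    show "FO P \<in> Obj D" if "P \<in> Obj C" for P using bij_betw_apply[OF obj that] .
  qed (fact m' id comp)+
  then show ?thesis unfolding cat_iso_def using obj mor by blast
qed

context transporter_extension begin

text \<open>The coset of \<open>A\<close> lying over \<open>s\<close>, written as a fibre so that no representative is chosen.\<close>

definition \<theta> where "\<theta> s = {x \<in> carrier St. fst x = s}"

lemma coset_eq_\<theta>:
  assumes x: "x \<in> carrier St"
  shows "A #>\<^bsub>St\<^esub> x = \<theta> (fst x)"
proof
  show "A #>\<^bsub>St\<^esub> x \<subseteq> \<theta> (fst x)"
  proof
    fix y assume "y \<in> A #>\<^bsub>St\<^esub> x"
    then obtain a where a: "a \<in> A" "y = a \<otimes>\<^bsub>St\<^esub> x" by (auto simp: r_coset_eq)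
    then have "a \<in> carrier St" "fst a = \<one>\<^bsub>S\<^esub>" by (simp_all add: A_iff)
    then show "y \<in> \<theta> (fst x)" using a(2) x by (simp add: \<theta>_def)
  qed
  show "\<theta> (fst x) \<subseteq> A #>\<^bsub>St\<^esub> x"
  proof
    fix y assume "y \<in> \<theta> (fst x)"
    then have y: "y \<in> carrier St" "fst y = fst x" by (simp_all add: \<theta>_def)
    obtain a where "a \<in> A" "y = a \<otimes>\<^bsub>St\<^esub> x" using fibre_A[OF y(1) x y(2)] .
    then show "y \<in> A #>\<^bsub>St\<^esub> x" unfolding r_coset_eq by blast
  qed
qed

lemma fst_lift: "s \<in> S0 \<Longrightarrow> \<exists>x. x \<in> carrier St \<and> fst x = s"
  using fst_surj by (metis imageE)

lemma \<theta>_inj: "inj_on \<theta> S0"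
proof (rule inj_onI)
  fix s t assume s: "s \<in> S0" and e: "\<theta> s = \<theta> t"
  obtain x where x: "x \<in> carrier St" "fst x = s" using fst_lift[OF s] by blast
  then have "x \<in> \<theta> t" using e unfolding \<theta>_def by blast
  then show "s = t" using x(2) by (simp add: \<theta>_def)
qed

lemma \<theta>_iso: "\<theta> \<in> iso S (St Mod A)"
proof (rule isoI)
  show hom: "\<theta> \<in> hom S (St Mod A)"
  proof (rule homI)
    fix s assume "s \<in> S0"
    then obtain x where "x \<in> carrier St" "fst x = s" using fst_lift by blast
    then have "x \<in> carrier St" "\<theta> s = A #>\<^bsub>St\<^esub> x" using coset_eq_\<theta> by auto
    then show "\<theta> s \<in> carrier (St Mod A)" unfolding carrier_FactGroup by (rule rev_image_eqI)
  next
    fix s t assume s: "s \<in> S0" and t: "t \<in> S0"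
    obtain x where x: "x \<in> carrier St" "fst x = s" using fst_lift[OF s] by blast
    obtain y where y: "y \<in> carrier St" "fst y = t" using fst_lift[OF t] by blast
    have "\<theta> s <#>\<^bsub>St\<^esub> \<theta> t = A #>\<^bsub>St\<^esub> (x \<otimes>\<^bsub>St\<^esub> y)"
      using normal.rcos_sum[OF A_normal x(1) y(1)] coset_eq_\<theta>[OF x(1)] coset_eq_\<theta>[OF y(1)] x y by simp
    also have "\<dots> = \<theta> (s \<otimes>\<^bsub>S\<^esub> t)" using coset_eq_\<theta>[of "x \<otimes>\<^bsub>St\<^esub> y"] x y by simp
    finally show "\<theta> (s \<otimes>\<^bsub>S\<^esub> t) = \<theta> s \<otimes>\<^bsub>St Mod A\<^esub> \<theta> t" by simp
  qed
  have "carrier (St Mod A) \<subseteq> \<theta> ` S0"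
  proof
    fix c assume "c \<in> carrier (St Mod A)"
    then obtain x where x: "x \<in> carrier St" "c = A #>\<^bsub>St\<^esub> x" unfolding carrier_FactGroup by blast
    then show "c \<in> \<theta> ` S0" using coset_eq_\<theta>[OF x(1)] fst.hom_closed[OF x(1)] by simp
  qed
  then have "\<theta> ` S0 = carrier (St Mod A)" using hom by (auto simp: hom_def)
  then show "bij_betw \<theta> S0 (carrier (St Mod A))" using \<theta>_inj by (simp add: bij_betw_def)
qed

lemma \<theta>_image: "X \<subseteq> carrier St \<Longrightarrow> \<theta> ` fst ` X = quot_set St A X"
  unfolding quot_set_def image_image by (rule image_cong) (auto simp: coset_eq_\<theta>)

lemma \<theta>_pre: "P \<subseteq> S0 \<Longrightarrow> \<theta> ` P = quot_set St A (pre P)"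
  using \<theta>_image[of "pre P"] fst_pre by (auto simp: pre_def)

lemma Union_\<theta>: "P \<subseteq> S0 \<Longrightarrow> \<Union> (\<theta> ` P) = pre P"
  by (auto simp: \<theta>_def pre_def)

lemma \<theta>_image_eq: "P \<subseteq> S0 \<Longrightarrow> Q \<subseteq> S0 \<Longrightarrow> \<theta> ` P = \<theta> ` Q \<Longrightarrow> P = Q"
  using inj_on_image_eq_iff[OF \<theta>_inj] by blast

lemma transport_apply: "P \<subseteq> S0 \<Longrightarrow> s \<in> P \<Longrightarrow> transport_map S \<theta> P f (\<theta> s) = \<theta> (f s)"
  using inv_into_f_f[OF \<theta>_inj] by (auto simp: transport_map_def)

lemma transport_ext: "transport_map S \<theta> P f \<in> extensional (\<theta> ` P)"
  by (simp add: transport_map_def)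

text \<open>The map induced on cosets by \<open>f'\<close> depends only on the map \<open>f\<close> of \<open>S\<close> below \<open>f'\<close>. The lemma is used
  for the morphisms of \<open>F\<close> between objects and for the fusion system that they generate.\<close>

lemma transport_bij:
  assumes P: "subgroup P S" and Q: "subgroup Q S"
    and G: "\<And>f. f \<in> G \<Longrightarrow> f \<in> inj_homs S P Q"
    and up: "\<And>f. f \<in> G \<Longrightarrow> \<exists>f' \<in> Ft (pre P) (pre Q). \<forall>x \<in> pre P. fst (f' x) = f (fst x)"
    and down: "\<And>f'. f' \<in> Ft (pre P) (pre Q) \<Longrightarrow> \<exists>f \<in> G. \<forall>x \<in> pre P. fst (f' x) = f (fst x)"
  shows "bij_betw (transport_map S \<theta> P) G (quot_fusion St Ft A (\<theta> ` P) (\<theta> ` Q))"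
proof (rule bij_betw_imageI)
  have Pc: "P \<subseteq> S0" and Qc: "Q \<subseteq> S0" using P Q by (auto dest: subgroup.subset)
  note sP = pre_subgroup[OF P] and sQ = pre_subgroup[OF Q]
  have ind: "transport_map S \<theta> P f (A #>\<^bsub>St\<^esub> x) = A #>\<^bsub>St\<^esub> f' x"
    if f': "f' \<in> Ft (pre P) (pre Q)" and e: "\<forall>x \<in> pre P. fst (f' x) = f (fst x)" and x: "x \<in> pre P" for f f' x
  proof -
    have xc: "x \<in> carrier St" "fst x \<in> P" using x by (auto simp: pre_def)
    have "f' \<in> inj_homs St (pre P) (pre Q)" using gSt_inj_homs f' by (simp add: Ft_iff)
    then have "f' x \<in> carrier St" using inj_homsD(3)[of f' St "pre P" "pre Q" x] x by (simp add: pre_def)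
    then show ?thesis
      using coset_eq_\<theta>[OF xc(1)] coset_eq_\<theta>[of "f' x"] transport_apply[OF Pc xc(2)] e x by simp
  qed
  show "inj_on (transport_map S \<theta> P) G"
  proof (rule inj_onI)
    fix f g assume f: "f \<in> G" and g: "g \<in> G" and e: "transport_map S \<theta> P f = transport_map S \<theta> P g"
    note ihf = G[OF f] and ihg = G[OF g]
    show "f = g"
    proof (rule extensionalityI[OF inj_homsD(1)[OF ihf] inj_homsD(1)[OF ihg]])
      fix s assume s: "s \<in> P"
      have "\<theta> (f s) = \<theta> (g s)" using transport_apply[OF Pc s] e by metis
      then show "f s = g s" using inj_onD[OF \<theta>_inj] inj_homsD(3)[OF ihf s] inj_homsD(3)[OF ihg s] Qc by blast
    qed
  qed
  show "transport_map S \<theta> P ` G = quot_fusion St Ft A (\<theta> ` P) (\<theta> ` Q)"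
  proof (intro equalityI subsetI)
    fix h assume "h \<in> transport_map S \<theta> P ` G"
    then obtain f where f: "f \<in> G" "h = transport_map S \<theta> P f" by blast
    obtain f' where f': "f' \<in> Ft (pre P) (pre Q)" "\<forall>x \<in> pre P. fst (f' x) = f (fst x)" using up[OF f(1)] by blast
    have "\<forall>x\<in>pre P. h (A #>\<^bsub>St\<^esub> x) = A #>\<^bsub>St\<^esub> f' x" using ind[OF f'] f(2) by simp
    then show "h \<in> quot_fusion St Ft A (\<theta> ` P) (\<theta> ` Q)"
      unfolding quot_fusion_def
      using sP sQ A_sub_pre[OF P] A_sub_pre[OF Q] \<theta>_pre[OF Pc] \<theta>_pre[OF Qc] f'(1) transport_ext f(2) by blast
  next
    fix h assume "h \<in> quot_fusion St Ft A (\<theta> ` P) (\<theta> ` Q)"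
    then obtain P' Q' f' where h: "h \<in> extensional (\<theta> ` P)" and P': "subgroup P' St" "A \<subseteq> P'" "\<theta> ` P = quot_set St A P'"
      and Q': "subgroup Q' St" "A \<subseteq> Q'" "\<theta> ` Q = quot_set St A Q'"
      and f': "f' \<in> Ft P' Q'" "\<forall>x\<in>P'. h (A #>\<^bsub>St\<^esub> x) = A #>\<^bsub>St\<^esub> f' x"
      unfolding quot_fusion_def by (elim CollectE conjE exE) (rule that)
    have recover: "Z' = pre Z" if "Z \<subseteq> S0" "subgroup Z' St" "A \<subseteq> Z'" "\<theta> ` Z = quot_set St A Z'" for Z Z'
    proof -
      have "\<theta> ` Z = \<theta> ` fst ` Z'" using that(4) \<theta>_image[OF subgroup.subset[OF that(2)]] by simp
      then have "Z = fst ` Z'" by (rule \<theta>_image_eq[OF that(1) subgroup.subset[OF fst_subgroup[OF that(2)]]])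
      then show ?thesis using pre_fst[OF that(2,3)] by simp
    qed
    have PP: "P' = pre P" by (rule recover[OF Pc P'])
    have QQ: "Q' = pre Q" by (rule recover[OF Qc Q'])
    have f'': "f' \<in> Ft (pre P) (pre Q)" using f'(1) PP QQ by simp
    obtain f where f: "f \<in> G" "\<forall>x \<in> pre P. fst (f' x) = f (fst x)" using down[OF f''] by blast
    have "h = transport_map S \<theta> P f"
    proof (rule extensionalityI[OF h transport_ext])
      fix c assume "c \<in> \<theta> ` P"
      then obtain s where s: "s \<in> P" "c = \<theta> s" by blast
      obtain x where x: "x \<in> carrier St" "fst x = s" using fst_lift s(1) Pc by blast
      have xP: "x \<in> pre P" using x s(1) by (simp add: pre_def)
      have c: "c = A #>\<^bsub>St\<^esub> x" using coset_eq_\<theta>[OF x(1)] x(2) s(2) by simp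
      show "h c = transport_map S \<theta> P f c" using ind[OF f'' f(2) xP] f'(2) xP PP c by simp
    qed
    then show "h \<in> transport_map S \<theta> P ` G" using f(1) by blast
  qed
qed

lemma tt_pre:
  assumes P: "P \<in> Obj T" and Q: "Q \<in> Obj T"
  shows "fst ` pre P = P" "fst ` pre Q = Q"
  using fst_pre obj_sub P Q by auto

lemma transport_bij_obj:
  assumes P: "P \<in> Obj T" and Q: "Q \<in> Obj T"
  shows "bij_betw (transport_map S \<theta> P) (F P Q) (quot_fusion St Ft A (\<theta> ` P) (\<theta> ` Q))"
proof (rule transport_bij[OF obj_subgroup[OF P] obj_subgroup[OF Q] F_inj_homs[OF P Q]])
  note X = pre_obj[OF P] and Y = pre_obj[OF Q]
  note fP = tt_pre[OF P Q]
  show "\<exists>f' \<in> Ft (pre P) (pre Q). \<forall>x \<in> pre P. fst (f' x) = f (fst x)" if f: "f \<in> F P Q" for f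
  proof -
    obtain g where g: "g \<in> Mor T P Q" "\<rho> P Q g = f" using A1_surj[OF P Q] f by (metis imageE)
    obtain m where m: "m \<in> Mor Tt (pre P) (pre Q)" "\<tau> P Q m = g" using tt_surj[OF X Y] g(1) fP by metis
    have "\<rho>t (pre P) (pre Q) m \<in> Ft (pre P) (pre Q)" using Ft_obj[OF X Y] m(1) by blast
    moreover have "\<forall>x \<in> pre P. fst (\<rho>t (pre P) (pre Q) m x) = f (fst x)"
      using \<rho>t_fst[OF X Y m(1)] fP m(2) g(2) by simp
    ultimately show ?thesis by blast
  qed
  show "\<exists>f \<in> F P Q. \<forall>x \<in> pre P. fst (f' x) = f (fst x)" if f': "f' \<in> Ft (pre P) (pre Q)" for f'
  proof -
    obtain m where m: "m \<in> Mor Tt (pre P) (pre Q)" "f' = \<rho>t (pre P) (pre Q) m" using f' Ft_obj[OF X Y] by blast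
    have "\<tau> P Q m \<in> Mor T P Q" using tt.mor_closed[OF X Y m(1)] fP by simp
    then have "\<rho> P Q (\<tau> P Q m) \<in> F P Q" by (rule rho_F[OF P Q])
    moreover have "\<forall>x \<in> pre P. fst (f' x) = \<rho> P Q (\<tau> P Q m) (fst x)"
      using \<rho>t_fst[OF X Y m(1)] fP m(2) by simp
    ultimately show ?thesis by blast
  qed
qed

subsection \<open>The generated fusion systems\<close>

abbreviation gS where "gS \<equiv> generated_mor S (Obj T) F"

lemma gS_restriction:
  assumes "X \<in> Obj T" "Y \<in> Obj T" "h \<in> F X Y"
    "subgroup P S" "subgroup Q S" "P \<subseteq> X" "Q \<subseteq> Y" "h ` P \<subseteq> Q"
  shows "gS P Q (restrict h P)"
  by (rule generated_mor.restriction[where H = F]) (fact assms)+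

lemma gS_inj_homs: "gS P Q f \<Longrightarrow> subgroup P S \<and> subgroup Q S \<and> f \<in> inj_homs S P Q"
  using generated_mor_in[OF _ objects] subset_inj_homs by blast

lemma gS_up:
  "gS P Q f \<Longrightarrow> \<exists>f' \<in> Ft (pre P) (pre Q). \<forall>x \<in> pre P. fst (f' x) = f (fst x)"
proof (induction rule: generated_mor.induct)
  case (restriction X Y h P Q)
  note oX = restriction(1) and oY = restriction(2) and P = restriction(4) and Q = restriction(5)
  note X = pre_obj[OF oX] and Y = pre_obj[OF oY] and fX = tt_pre[OF oX oY]
  obtain g where g: "g \<in> Mor T X Y" "\<rho> X Y g = h" using A1_surj[OF oX oY] restriction(3) by (metis imageE)
  obtain m where m: "m \<in> Mor Tt (pre X) (pre Y)" "\<tau> X Y m = g" using tt_surj[OF X Y] g(1) fX by metis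
  have r: "fst (\<rho>t (pre X) (pre Y) m x) = h (fst x)" if "x \<in> pre X" for x
    using \<rho>t_fst[OF X Y m(1) that] fX m(2) g(2) by simp
  have PX: "pre P \<subseteq> pre X" and QY: "pre Q \<subseteq> pre Y" using restriction(6,7) by (auto simp: pre_def)
  have im: "\<rho>t (pre X) (pre Y) m ` pre P \<subseteq> pre Q"
  proof
    fix y assume "y \<in> \<rho>t (pre X) (pre Y) m ` pre P"
    then obtain x where x: "x \<in> pre P" "y = \<rho>t (pre X) (pre Y) m x" by blast
    have xX: "x \<in> pre X" using x(1) PX by blast
    have "fst y = h (fst x)" using r[OF xX] x(2) by simp
    moreover have "fst x \<in> P" using x(1) by (simp add: pre_def)
    ultimately have "fst y \<in> Q" using restriction(8) by auto
    moreover have "y \<in> carrier St" using \<rho>t_closed[OF X Y m(1) xX] x(2) by (simp add: pre_def)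
    ultimately show "y \<in> pre Q" by (simp add: pre_def)
  qed
  let ?f = "restrict (\<rho>t (pre X) (pre Y) m) (pre P)"
  have "gSt (pre P) (pre Q) ?f"
    by (rule gSt_restriction[OF X Y imageI[OF m(1)] pre_subgroup[OF P] pre_subgroup[OF Q] PX QY im])
  then have "?f \<in> Ft (pre P) (pre Q)" by (simp only: Ft_iff)
  moreover have "\<forall>x \<in> pre P. fst (?f x) = restrict h P (fst x)"
  proof
    fix x assume x: "x \<in> pre P"
    then have "fst x \<in> P" by (simp add: pre_def)
    then show "fst (?f x) = restrict h P (fst x)" using r[OF subsetD[OF PX x]] x by simp
  qed
  ultimately show ?case by blast
next
  case (composite P Q f R g)
  obtain f' where f': "f' \<in> Ft (pre P) (pre Q)" "\<forall>x \<in> pre P. fst (f' x) = f (fst x)" using composite.IH(1) by blast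
  obtain g' where g': "g' \<in> Ft (pre Q) (pre R)" "\<forall>x \<in> pre Q. fst (g' x) = g (fst x)" using composite.IH(2) by blast
  have ih: "f' \<in> inj_homs St (pre P) (pre Q)" using gSt_inj_homs f'(1) by (simp add: Ft_iff)
  have "compose (pre P) g' f' \<in> Ft (pre P) (pre R)"
    using generated_mor.composite f'(1) g'(1) by (simp add: Ft_iff) blast
  moreover have "\<forall>x \<in> pre P. fst (compose (pre P) g' f' x) = compose P g f (fst x)"
  proof
    fix x assume x: "x \<in> pre P"
    then have "fst x \<in> P" by (simp add: pre_def)
    then show "fst (compose (pre P) g' f' x) = compose P g f (fst x)"
      using f'(2) g'(2) inj_homsD(3)[OF ih x] x by (simp add: compose_def)
  qed
  ultimately show ?case by blast
qed

text \<open>Here \<open>P\<close> and \<open>Q\<close> are arbitrary, since the intermediate subgroups of a composite need not contain \<open>A\<close>.\<close>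

lemma gSt_down:
  "gSt P Q f' \<Longrightarrow> \<exists>f. gS (fst ` P) (fst ` Q) f \<and> (\<forall>x \<in> P. fst (f' x) = f (fst x))"
proof (induction rule: generated_mor.induct)
  case (restriction X Y h P Q)
  then obtain m where m: "m \<in> Mor Tt X Y" "h = \<rho>t X Y m" by blast
  note X = restriction(1) and Y = restriction(2)
  note oX = obj_fst[OF X] and oY = obj_fst[OF Y]
  let ?f = "\<rho> (fst ` X) (fst ` Y) (tt X Y m)"
  have r: "fst (h x) = ?f (fst x)" if "x \<in> X" for x using \<rho>t_fst[OF X Y m(1) that] m(2) by simp
  have im: "?f ` fst ` P \<subseteq> fst ` Q"
  proof
    fix y assume "y \<in> ?f ` fst ` P"
    then obtain x where x: "x \<in> P" "y = ?f (fst x)" by blast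
    then have "y = fst (h x)" using r[OF subsetD[OF restriction(6) x(1)]] by simp
    moreover have "h x \<in> Q" using restriction(8) x(1) by blast
    ultimately show "y \<in> fst ` Q" by blast
  qed
  have "gS (fst ` P) (fst ` Q) (restrict ?f (fst ` P))"
    by (rule gS_restriction[OF oX oY rho_F[OF oX oY tt.mor_closed[OF X Y m(1)]]
          fst_subgroup[OF restriction(4)] fst_subgroup[OF restriction(5)]
          image_mono[OF restriction(6), of fst] image_mono[OF restriction(7), of fst] im])
  moreover have "\<forall>x \<in> P. fst (restrict h P x) = restrict ?f (fst ` P) (fst x)"
    using r restriction(6) by auto
  ultimately show ?case by blast
next
  case (composite P Q f R g)
  obtain f' where f': "gS (fst ` P) (fst ` Q) f'" "\<forall>x \<in> P. fst (f x) = f' (fst x)" using composite.IH(1) by blast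
  obtain g' where g': "gS (fst ` Q) (fst ` R) g'" "\<forall>x \<in> Q. fst (g x) = g' (fst x)" using composite.IH(2) by blast
  have ih: "f \<in> inj_homs St P Q" using gSt_inj_homs[OF composite.hyps(1)] by blast
  have "\<forall>x \<in> P. fst (compose P g f x) = compose (fst ` P) g' f' (fst x)"
  proof
    fix x assume x: "x \<in> P"
    show "fst (compose P g f x) = compose (fst ` P) g' f' (fst x)"
      using f'(2) g'(2) inj_homsD(3)[OF ih x] x by (simp add: compose_def)
  qed
  then show ?case using generated_mor.composite[OF f'(1) g'(1)] by blast
qed

lemma transport_bij_generated:
  assumes P: "subgroup P S" and Q: "subgroup Q S"
  shows "bij_betw (transport_map S \<theta> P) (generated_fusion S (Obj T) F P Q) (quot_fusion St Ft A (\<theta> ` P) (\<theta> ` Q))"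
proof (rule transport_bij[OF P Q])
  show "f \<in> inj_homs S P Q" if "f \<in> generated_fusion S (Obj T) F P Q" for f
    using gS_inj_homs that by (simp add: generated_fusion_def)
  show "\<exists>f' \<in> Ft (pre P) (pre Q). \<forall>x \<in> pre P. fst (f' x) = f (fst x)"
    if "f \<in> generated_fusion S (Obj T) F P Q" for f
    using gS_up that by (simp add: generated_fusion_def)
  show "\<exists>f \<in> generated_fusion S (Obj T) F P Q. \<forall>x \<in> pre P. fst (f' x) = f (fst x)"
    if "f' \<in> Ft (pre P) (pre Q)" for f'
    using gSt_down[of "pre P" "pre Q" f'] that fst_pre subgroup.subset[OF P] subgroup.subset[OF Q]
    by (simp add: Ft_iff generated_fusion_def)
qed

lemma gS_id: "subgroup P S \<Longrightarrow> gS P P (\<lambda>x\<in>P. x)"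
proof -
  assume P: "subgroup P S"
  have Pc: "P \<subseteq> S0" using P by (rule subgroup.subset)
  have "(\<lambda>x\<in>S0. x) \<in> F S0 S0"
    using rho_F[OF carrier_obj carrier_obj id_closed[OF carrier_obj]] rho.preserves_id[OF carrier_obj] by simp
  then have "gS P P (restrict (\<lambda>x\<in>S0. x) P)"
    by (rule gS_restriction[OF carrier_obj carrier_obj _ P P Pc Pc]) (use Pc in auto)
  moreover have "restrict (\<lambda>x\<in>S0. x) P = (\<lambda>x\<in>P. x)" using Pc by (auto simp: restrict_def fun_eq_iff)
  ultimately show ?thesis by (simp only:)
qed

lemma fusion_iso_quotient:
  "fusion_iso S (generated_fusion S (Obj T) F) (St Mod A) (quot_fusion St Ft A) \<theta>"
proof -
  interpret M: group "St Mod A" using normal.factorgroup_is_group[OF A_normal] .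
  interpret \<theta>: group_hom S "St Mod A" \<theta>
    using \<theta>_iso by (simp add: group_hom_def group_hom_axioms_def group_S M.is_group iso_def)
  have surj: "\<theta> ` S0 = carrier (St Mod A)" using \<theta>_iso by (simp add: iso_def bij_betw_def)
  have "cat_iso (fusion_cat S (generated_fusion S (Obj T) F)) (fusion_cat (St Mod A) (quot_fusion St Ft A))
      ((`) \<theta>) (\<lambda>P Q. transport_map S \<theta> P)"
  proof (rule cat_isoI)
    show "category (fusion_cat S (generated_fusion S (Obj T) F))"
    proof (rule category_fusion_cat)
      show "f \<in> inj_homs S P Q" if "f \<in> generated_fusion S (Obj T) F P Q" for P Q f
        using gS_inj_homs that by (simp add: generated_fusion_def)
      show "compose P g f \<in> generated_fusion S (Obj T) F P R"
        if "f \<in> generated_fusion S (Obj T) F P Q" "g \<in> generated_fusion S (Obj T) F Q R" for P Q R f g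
        using generated_mor.composite[of S "Obj T" F P Q f R g] that by (simp add: generated_fusion_def)
      show "(\<lambda>x\<in>P. x) \<in> generated_fusion S (Obj T) F P P" if "subgroup P S" for P
        using gS_id[OF that] by (simp add: generated_fusion_def)
    qed
  next
    show "bij_betw ((`) \<theta>) (Obj (fusion_cat S (generated_fusion S (Obj T) F)))
        (Obj (fusion_cat (St Mod A) (quot_fusion St Ft A)))"
    proof (rule bij_betw_imageI)
      show "inj_on ((`) \<theta>) (Obj (fusion_cat S (generated_fusion S (Obj T) F)))"
      proof (rule inj_onI)
        fix P Q assume "P \<in> Obj (fusion_cat S (generated_fusion S (Obj T) F))"
          "Q \<in> Obj (fusion_cat S (generated_fusion S (Obj T) F))" and e: "\<theta> ` P = \<theta> ` Q"
        then have "P \<subseteq> S0" "Q \<subseteq> S0" by (auto dest: subgroup.subset)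
        then show "P = Q" using e by (rule \<theta>_image_eq)
      qed
      show "(`) \<theta> ` Obj (fusion_cat S (generated_fusion S (Obj T) F)) = Obj (fusion_cat (St Mod A) (quot_fusion St Ft A))"
      proof (intro equalityI subsetI)
        fix X assume "X \<in> (`) \<theta> ` Obj (fusion_cat S (generated_fusion S (Obj T) F))"
        then show "X \<in> Obj (fusion_cat (St Mod A) (quot_fusion St Ft A))"
          using \<theta>.subgroup_img_is_subgroup by auto
      next
        fix X assume "X \<in> Obj (fusion_cat (St Mod A) (quot_fusion St Ft A))"
        then have X: "subgroup X (St Mod A)" by simp
        let ?P = "{s \<in> S0. \<theta> s \<in> X}"
        have "subgroup ?P S" by (rule \<theta>.rcosets_vimage(1)[OF surj X refl])
        moreover have "\<theta> ` ?P = X" by (rule \<theta>.restrict_vimage(2)[OF surj X refl])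
        ultimately show "X \<in> (`) \<theta> ` Obj (fusion_cat S (generated_fusion S (Obj T) F))" by auto
      qed
    qed
  next
    fix P Q assume "P \<in> Obj (fusion_cat S (generated_fusion S (Obj T) F))" "Q \<in> Obj (fusion_cat S (generated_fusion S (Obj T) F))"
    then show "bij_betw (transport_map S \<theta> P) (Mor (fusion_cat S (generated_fusion S (Obj T) F)) P Q)
        (Mor (fusion_cat (St Mod A) (quot_fusion St Ft A)) (\<theta> ` P) (\<theta> ` Q))"
      using transport_bij_generated by simp
  next
    fix P assume "P \<in> Obj (fusion_cat S (generated_fusion S (Obj T) F))"
    then have Pc: "P \<subseteq> S0" by (auto dest: subgroup.subset)
    show "transport_map S \<theta> P (Idn (fusion_cat S (generated_fusion S (Obj T) F)) P)
        = Idn (fusion_cat (St Mod A) (quot_fusion St Ft A)) (\<theta> ` P)"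
    proof (rule extensionalityI[OF transport_ext])
      fix c assume "c \<in> \<theta> ` P"
      then obtain s where "s \<in> P" "c = \<theta> s" by blast
      then show "transport_map S \<theta> P (Idn (fusion_cat S (generated_fusion S (Obj T) F)) P) c
          = Idn (fusion_cat (St Mod A) (quot_fusion St Ft A)) (\<theta> ` P) c"
        using transport_apply[OF Pc] by simp
    qed simp
  next
    fix P Q R f g
    assume P: "P \<in> Obj (fusion_cat S (generated_fusion S (Obj T) F))"
      and Q: "Q \<in> Obj (fusion_cat S (generated_fusion S (Obj T) F))"
      and f: "f \<in> Mor (fusion_cat S (generated_fusion S (Obj T) F)) P Q"
    have Pc: "P \<subseteq> S0" and Qc: "Q \<subseteq> S0" using P Q by (auto dest: subgroup.subset)
    have ih: "f \<in> inj_homs S P Q" using f gS_inj_homs by (simp add: generated_fusion_def)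
    show "transport_map S \<theta> P (Comp (fusion_cat S (generated_fusion S (Obj T) F)) P Q R g f)
      = Comp (fusion_cat (St Mod A) (quot_fusion St Ft A)) (\<theta> ` P) (\<theta> ` Q) (\<theta> ` R)
          (transport_map S \<theta> Q g) (transport_map S \<theta> P f)"
    proof (rule extensionalityI[OF transport_ext])
      fix c assume "c \<in> \<theta> ` P"
      then obtain s where s: "s \<in> P" "c = \<theta> s" by blast
      show "transport_map S \<theta> P (Comp (fusion_cat S (generated_fusion S (Obj T) F)) P Q R g f) c
        = Comp (fusion_cat (St Mod A) (quot_fusion St Ft A)) (\<theta> ` P) (\<theta> ` Q) (\<theta> ` R)
          (transport_map S \<theta> Q g) (transport_map S \<theta> P f) c"
        using transport_apply[OF Pc s(1)] transport_apply[OF Qc inj_homsD(3)[OF ih s(1)]] s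
        by (simp add: compose_def)
    qed (simp add: compose_extensional)
  qed
  then show ?thesis using \<theta>_iso by (simp add: fusion_iso_def)
qed

subsection \<open>The transporter systems\<close>

text \<open>An orbit of \<open>A\<close> on the morphisms of \<open>Tt\<close>, by \<open>\<Theta>_orbit\<close>.\<close>

definition \<Theta> where "\<Theta> P Q f = {m \<in> Mor Tt (pre P) (pre Q). \<tau> P Q m = f}"

lemma \<Theta>_lift:
  assumes P: "P \<in> Obj T" and Q: "Q \<in> Obj T" and f: "f \<in> Mor T P Q"
  shows "\<exists>m. m \<in> \<Theta> P Q f"
proof -
  obtain m where "m \<in> Mor Tt (pre P) (pre Q)" "\<tau> P Q m = f"
    using tt_surj[OF pre_obj[OF P] pre_obj[OF Q]] f tt_pre[OF P Q] by metis
  then show ?thesis by (auto simp: \<Theta>_def)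
qed

lemma \<Theta>_orbit:
  assumes P: "P \<in> Obj T" and Q: "Q \<in> Obj T" and m: "m \<in> Mor Tt (pre P) (pre Q)"
  shows "\<Theta> P Q (\<tau> P Q m) = (\<lambda>a. Comp Tt (pre P) (pre P) (pre Q) m (\<epsilon>t (pre P) (pre P) a)) ` A"
proof (intro equalityI subsetI)
  note X = pre_obj[OF P] and Y = pre_obj[OF Q] and fP = tt_pre[OF P Q]
  fix m' assume "m' \<in> \<Theta> P Q (\<tau> P Q m)"
  then have m': "m' \<in> Mor Tt (pre P) (pre Q)" "tt (pre P) (pre Q) m = tt (pre P) (pre Q) m'" using fP by (auto simp: \<Theta>_def)
  obtain k where k: "k \<in> K (pre P)" "m' = Comp Tt (pre P) (pre P) (pre Q) m k" using tt_right[OF X Y m m'] .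
  obtain a where "a \<in> A" "k = \<epsilon>t (pre P) (pre P) a" using k(1) unfolding K_eq[OF X] by (rule imageE)
  then show "m' \<in> (\<lambda>a. Comp Tt (pre P) (pre P) (pre Q) m (\<epsilon>t (pre P) (pre P) a)) ` A"
    using k(2) by (intro rev_image_eqI[of a]) simp_all
next
  note X = pre_obj[OF P] and Y = pre_obj[OF Q] and fP = tt_pre[OF P Q]
  fix m' assume "m' \<in> (\<lambda>a. Comp Tt (pre P) (pre P) (pre Q) m (\<epsilon>t (pre P) (pre P) a)) ` A"
  then obtain k where k: "k \<in> K (pre P)" "m' = Comp Tt (pre P) (pre P) (pre Q) m k" unfolding K_eq[OF X] by blast
  note km = K_mor[OF k(1)]
  have "tt (pre P) (pre Q) m' = tt (pre P) (pre Q) m"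
    using tt.preserves_comp[OF X X Y km m] k id_right[OF obj_fst[OF X] obj_fst[OF Y] tt.mor_closed[OF X Y m]]
    by (simp add: K_iff)
  then show "m' \<in> \<Theta> P Q (\<tau> P Q m)" using Tt.comp_closed[OF X X Y km m] k(2) fP by (simp add: \<Theta>_def)
qed

text \<open>Only the inclusion from left to right needs an argument: a lift of the composite differs from a
  composite of lifts by an element of \<open>A\<close>, which is moved into the first factor.\<close>

lemma \<Theta>_comp:
  assumes P: "P \<in> Obj T" and Q: "Q \<in> Obj T" and R: "R \<in> Obj T" and f: "f \<in> Mor T P Q" and g: "g \<in> Mor T Q R"
  shows "\<Theta> P R (Comp T P Q R g f) = {Comp Tt (pre P) (pre Q) (pre R) n m | n m. n \<in> \<Theta> Q R g \<and> m \<in> \<Theta> P Q f}"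
proof -
  note X = pre_obj[OF P] and Y = pre_obj[OF Q] and Z = pre_obj[OF R] and fP = tt_pre[OF P Q] and fR = tt_pre[OF Q R]
  have comp: "Comp Tt (pre P) (pre Q) (pre R) n m \<in> Mor Tt (pre P) (pre R)
      \<and> \<tau> P R (Comp Tt (pre P) (pre Q) (pre R) n m) = Comp T P Q R g f"
    if "n \<in> \<Theta> Q R g" "m \<in> \<Theta> P Q f" for n m
  proof -
    have n: "n \<in> Mor Tt (pre Q) (pre R)" "\<tau> Q R n = g" and m: "m \<in> Mor Tt (pre P) (pre Q)" "\<tau> P Q m = f"
      using that by (auto simp: \<Theta>_def)
    show ?thesis
      using Tt.comp_closed[OF X Y Z m(1) n(1)] tt.preserves_comp[OF X Y Z m(1) n(1)] n(2) m(2) fP fR by simp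
  qed
  show ?thesis
  proof (intro equalityI subsetI)
    fix u assume u: "u \<in> \<Theta> P R (Comp T P Q R g f)"
    obtain n where n: "n \<in> \<Theta> Q R g" using \<Theta>_lift[OF Q R g] by blast
    obtain m where m: "m \<in> \<Theta> P Q f" using \<Theta>_lift[OF P Q f] by blast
    have nm: "n \<in> Mor Tt (pre Q) (pre R)" "m \<in> Mor Tt (pre P) (pre Q)" using n m by (auto simp: \<Theta>_def)
    note c = comp[OF n m]
    have "u \<in> (\<lambda>a. Comp Tt (pre P) (pre P) (pre R) (Comp Tt (pre P) (pre Q) (pre R) n m) (\<epsilon>t (pre P) (pre P) a)) ` A"
      using \<Theta>_orbit[OF P R, of "Comp Tt (pre P) (pre Q) (pre R) n m"] c u by simp
    then obtain a where a: "a \<in> A"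
      "u = Comp Tt (pre P) (pre P) (pre R) (Comp Tt (pre P) (pre Q) (pre R) n m) (\<epsilon>t (pre P) (pre P) a)" by blast
    have ea: "\<epsilon>t (pre P) (pre P) a \<in> Mor Tt (pre P) (pre P)"
      using \<epsilon>t_mor[OF X X Tt_mem_transporter[OF X]] A_sub[OF X] a(1) by blast
    have "u = Comp Tt (pre P) (pre Q) (pre R) n (Comp Tt (pre P) (pre P) (pre Q) m (\<epsilon>t (pre P) (pre P) a))"
      using a(2) Tt.comp_assoc[OF X X Y Z ea nm(2) nm(1)] by simp
    moreover have "Comp Tt (pre P) (pre P) (pre Q) m (\<epsilon>t (pre P) (pre P) a) \<in> \<Theta> P Q f"
      using \<Theta>_orbit[OF P Q nm(2)] a(1) m by (auto simp: \<Theta>_def)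
    ultimately show "u \<in> {Comp Tt (pre P) (pre Q) (pre R) n m | n m. n \<in> \<Theta> Q R g \<and> m \<in> \<Theta> P Q f}" using n by blast
  next
    fix u assume "u \<in> {Comp Tt (pre P) (pre Q) (pre R) n m | n m. n \<in> \<Theta> Q R g \<and> m \<in> \<Theta> P Q f}"
    then obtain n m where "n \<in> \<Theta> Q R g" "m \<in> \<Theta> P Q f" "u = Comp Tt (pre P) (pre Q) (pre R) n m" by blast
    then show "u \<in> \<Theta> P R (Comp T P Q R g f)" using comp by (simp add: \<Theta>_def)
  qed
qed

lemma quot_cat_simps:
  assumes P: "P \<in> Obj T" and Q: "Q \<in> Obj T" and R: "R \<in> Obj T"
  shows "Mor (quot_cat St Tt \<epsilon>t A) (\<theta> ` P) (\<theta> ` Q) = \<Theta> P Q ` Mor T P Q"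
    "Comp (quot_cat St Tt \<epsilon>t A) (\<theta> ` P) (\<theta> ` Q) (\<theta> ` R) N M
      = {Comp Tt (pre P) (pre Q) (pre R) n m | n m. n \<in> N \<and> m \<in> M}"
    "Idn (quot_cat St Tt \<epsilon>t A) (\<theta> ` P) = \<epsilon>t (pre P) (pre P) ` A"
proof -
  note X = pre_obj[OF P] and Y = pre_obj[OF Q] and fP = tt_pre[OF P Q]
  have U: "\<Union> (\<theta> ` Z) = pre Z" if "Z \<in> Obj T" for Z by (rule Union_\<theta>[OF obj_sub[OF that]])
  show "Mor (quot_cat St Tt \<epsilon>t A) (\<theta> ` P) (\<theta> ` Q) = \<Theta> P Q ` Mor T P Q"
  proof (intro equalityI subsetI)
    fix M assume "M \<in> Mor (quot_cat St Tt \<epsilon>t A) (\<theta> ` P) (\<theta> ` Q)"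
    then obtain m where m: "m \<in> Mor Tt (pre P) (pre Q)"
      "M = (\<lambda>a. Comp Tt (pre P) (pre P) (pre Q) m (\<epsilon>t (pre P) (pre P) a)) ` A"
      by (auto simp: quot_cat_def U[OF P] U[OF Q])
    have "\<tau> P Q m \<in> Mor T P Q" using tt.mor_closed[OF X Y m(1)] fP by simp
    then show "M \<in> \<Theta> P Q ` Mor T P Q" using \<Theta>_orbit[OF P Q m(1)] m(2) by blast
  next
    fix M assume "M \<in> \<Theta> P Q ` Mor T P Q"
    then obtain f where f: "f \<in> Mor T P Q" "M = \<Theta> P Q f" by blast
    obtain m where "m \<in> \<Theta> P Q f" using \<Theta>_lift[OF P Q f(1)] by blast
    then have m: "m \<in> Mor Tt (pre P) (pre Q)" "\<tau> P Q m = f" by (auto simp: \<Theta>_def)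
    then show "M \<in> Mor (quot_cat St Tt \<epsilon>t A) (\<theta> ` P) (\<theta> ` Q)"
      using \<Theta>_orbit[OF P Q m(1)] f(2) by (auto simp: quot_cat_def U[OF P] U[OF Q])
  qed
  show "Comp (quot_cat St Tt \<epsilon>t A) (\<theta> ` P) (\<theta> ` Q) (\<theta> ` R) N M
      = {Comp Tt (pre P) (pre Q) (pre R) n m | n m. n \<in> N \<and> m \<in> M}"
    by (simp add: quot_cat_def U[OF P] U[OF Q] U[OF R])
  show "Idn (quot_cat St Tt \<epsilon>t A) (\<theta> ` P) = \<epsilon>t (pre P) (pre P) ` A"
    by (simp add: quot_cat_def U[OF P])
qed

lemma cat_iso_quotient: "cat_iso T (quot_cat St Tt \<epsilon>t A) ((`) \<theta>) \<Theta>"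
proof (rule cat_isoI)
  show "category T" by (rule category_axioms)
  show "bij_betw ((`) \<theta>) (Obj T) (Obj (quot_cat St Tt \<epsilon>t A))"
  proof (rule bij_betw_imageI)
    show "inj_on ((`) \<theta>) (Obj T)"
      by (rule inj_onI) (rule \<theta>_image_eq[OF obj_sub obj_sub])
    have "Obj (quot_cat St Tt \<epsilon>t A) = quot_set St A ` Obj Tt"
      using A_sub by (auto simp: quot_cat_def)
    also have "\<dots> = (\<lambda>P. quot_set St A (pre P)) ` Obj T" unfolding Obj_Tt image_image ..
    also have "\<dots> = (`) \<theta> ` Obj T" by (rule image_cong[OF refl]) (rule \<theta>_pre[OF obj_sub, symmetric])
    finally show "(`) \<theta> ` Obj T = Obj (quot_cat St Tt \<epsilon>t A)" ..
  qed
  show "bij_betw (\<Theta> P Q) (Mor T P Q) (Mor (quot_cat St Tt \<epsilon>t A) (\<theta> ` P) (\<theta> ` Q))"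
    if P: "P \<in> Obj T" and Q: "Q \<in> Obj T" for P Q
  proof (rule bij_betw_imageI)
    show "inj_on (\<Theta> P Q) (Mor T P Q)"
    proof (rule inj_onI)
      fix f g assume f: "f \<in> Mor T P Q" and e: "\<Theta> P Q f = \<Theta> P Q g"
      obtain m where "m \<in> \<Theta> P Q f" using \<Theta>_lift[OF P Q f] by blast
      moreover then have "m \<in> \<Theta> P Q g" using e by simp
      ultimately show "f = g" by (simp add: \<Theta>_def)
    qed
    show "\<Theta> P Q ` Mor T P Q = Mor (quot_cat St Tt \<epsilon>t A) (\<theta> ` P) (\<theta> ` Q)" using quot_cat_simps(1)[OF P Q Q] by simp
  qed
  show "\<Theta> P P (Idn T P) = Idn (quot_cat St Tt \<epsilon>t A) (\<theta> ` P)" if P: "P \<in> Obj T" for P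
  proof -
    note X = pre_obj[OF P] and fP = tt_pre[OF P P]
    have "\<Theta> P P (Idn T P) = K (pre P)"
      using K_I[OF X] K_mor fP by (auto simp: \<Theta>_def K_iff)
    then show ?thesis using K_eq[OF X] quot_cat_simps(3)[OF P P P] by simp
  qed
  show "\<Theta> P R (Comp T P Q R g f) = Comp (quot_cat St Tt \<epsilon>t A) (\<theta> ` P) (\<theta> ` Q) (\<theta> ` R) (\<Theta> Q R g) (\<Theta> P Q f)"
    if "P \<in> Obj T" "Q \<in> Obj T" "R \<in> Obj T" "f \<in> Mor T P Q" "g \<in> Mor T Q R" for P Q R f g
    using \<Theta>_comp[OF that] quot_cat_simps(2)[OF that(1-3)] by simp
qed

lemma \<Theta>_eps:
  assumes P: "P \<in> Obj T" and Q: "Q \<in> Obj T" and g: "g \<in> transporter S P Q"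
  shows "\<Theta> P Q (\<epsilon> P Q g) = quot_eps \<epsilon>t (\<theta> ` P) (\<theta> ` Q) (\<theta> g)"
proof -
  note X = pre_obj[OF P] and Y = pre_obj[OF Q] and fP = tt_pre[OF P Q]
  have gc: "g \<in> S0" using g by (simp add: transporter_def)
  have tr: "x \<in> transporter St (pre P) (pre Q)" if "x \<in> \<theta> g" for x
    using Tt_transporter_iff[OF X Y] that g fP by (simp add: \<theta>_def)
  have "\<Theta> P Q (\<epsilon> P Q g) = \<epsilon>t (pre P) (pre Q) ` \<theta> g"
  proof (intro equalityI subsetI)
    fix m assume m: "m \<in> \<Theta> P Q (\<epsilon> P Q g)"
    obtain x where x: "x \<in> \<theta> g" using fst_lift[OF gc] by (auto simp: \<theta>_def)
    note xt = tr[OF x]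
    have fx: "fst x = g" and xc: "x \<in> carrier St" using x by (auto simp: \<theta>_def)
    have "\<tau> P Q (\<epsilon>t (pre P) (pre Q) x) = \<epsilon> P Q g" using \<epsilon>t_tt[OF X Y xt] fx fP by simp
    then obtain a where a: "a \<in> A" "m = Comp Tt (pre P) (pre P) (pre Q) (\<epsilon>t (pre P) (pre Q) x) (\<epsilon>t (pre P) (pre P) a)"
      using \<Theta>_orbit[OF P Q \<epsilon>t_mor[OF X Y xt]] m by auto
    have aX: "a \<in> pre P" using a(1) A_sub[OF X] by blast
    have "m = \<epsilon>t (pre P) (pre Q) (x \<otimes>\<^bsub>St\<^esub> a)" using a(2) \<epsilon>t_comp[OF X X Y Tt_mem_transporter[OF X aX] xt] by simp
    moreover have "x \<otimes>\<^bsub>St\<^esub> a \<in> \<theta> g"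
    proof -
      have "a \<in> carrier St" "fst a = \<one>\<^bsub>S\<^esub>" using a(1) by (simp_all add: A_iff)
      then show ?thesis using xc fx gc by (simp add: \<theta>_def)
    qed
    ultimately show "m \<in> \<epsilon>t (pre P) (pre Q) ` \<theta> g" by blast
  next
    fix m assume "m \<in> \<epsilon>t (pre P) (pre Q) ` \<theta> g"
    then obtain x where x: "x \<in> \<theta> g" "m = \<epsilon>t (pre P) (pre Q) x" by blast
    have "fst x = g" using x(1) by (simp add: \<theta>_def)
    then show "m \<in> \<Theta> P Q (\<epsilon> P Q g)"
      using \<epsilon>t_tt[OF X Y tr[OF x(1)]] \<epsilon>t_mor[OF X Y tr[OF x(1)]] x(2) fP by (simp add: \<Theta>_def)
  qed
  then show ?thesis by (simp add: quot_eps_def Union_\<theta>[OF obj_sub[OF P]] Union_\<theta>[OF obj_sub[OF Q]])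
qed

lemma \<Theta>_rho:
  assumes P: "P \<in> Obj T" and Q: "Q \<in> Obj T" and f: "f \<in> Mor T P Q"
  shows "quot_rho St \<rho>t A (\<theta> ` P) (\<theta> ` Q) (\<Theta> P Q f) = transport_map S \<theta> P (\<rho> P Q f)"
proof (rule extensionalityI[OF _ transport_ext])
  note X = pre_obj[OF P] and Y = pre_obj[OF Q] and fP = tt_pre[OF P Q]
  show "quot_rho St \<rho>t A (\<theta> ` P) (\<theta> ` Q) (\<Theta> P Q f) \<in> extensional (\<theta> ` P)" by (simp add: quot_rho_def)
  fix c assume c: "c \<in> \<theta> ` P"
  then obtain s where s: "s \<in> P" "c = \<theta> s" by blast
  have sc: "s \<in> S0" using s(1) obj_sub[OF P] by blast
  have each: "A #>\<^bsub>St\<^esub> \<rho>t (pre P) (pre Q) m x = \<theta> (\<rho> P Q f s)" if "m \<in> \<Theta> P Q f" "x \<in> c" for m x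
  proof -
    have m: "m \<in> Mor Tt (pre P) (pre Q)" "\<tau> P Q m = f" using that(1) by (auto simp: \<Theta>_def)
    have x: "x \<in> pre P" "fst x = s" using that(2) s by (auto simp: \<theta>_def pre_def)
    have "\<rho>t (pre P) (pre Q) m x \<in> carrier St" using \<rho>t_closed[OF X Y m(1) x(1)] by (simp add: pre_def)
    then show ?thesis using coset_eq_\<theta> \<rho>t_fst[OF X Y m(1) x(1)] m(2) x(2) fP by simp
  qed
  have "\<exists>m. m \<in> \<Theta> P Q f" by (rule \<Theta>_lift[OF P Q f])
  moreover have "\<exists>x. x \<in> c" using fst_lift[OF sc] s(2) by (auto simp: \<theta>_def)
  ultimately have "(\<Union>m\<in>\<Theta> P Q f. \<Union>x\<in>c. A #>\<^bsub>St\<^esub> \<rho>t (pre P) (pre Q) m x) = \<theta> (\<rho> P Q f s)"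
    using each by auto
  then show "quot_rho St \<rho>t A (\<theta> ` P) (\<theta> ` Q) (\<Theta> P Q f) c = transport_map S \<theta> P (\<rho> P Q f) c"
    using c transport_apply[OF obj_sub[OF P] s(1)] s(2)
    by (simp add: quot_rho_def Union_\<theta>[OF obj_sub[OF P]] Union_\<theta>[OF obj_sub[OF Q]])
qed

theorem transporter_iso_quotient:
  "transporter_iso S F T \<epsilon> \<rho> (St Mod A) (quot_fusion St Ft A) (quot_cat St Tt \<epsilon>t A) (quot_eps \<epsilon>t) (quot_rho St \<rho>t A) \<theta> \<Theta>"
  unfolding transporter_iso_def using \<theta>_iso transport_bij_obj cat_iso_quotient \<Theta>_eps \<Theta>_rho by simp

end

theorem propositionA5:
  fixes p :: nat
    and S :: "('a, 'b) monoid_scheme"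
    and F :: "'a hom_family"
    and T :: "('a set, 'm) cat"
    and \<epsilon> :: "'a set \<Rightarrow> 'a set \<Rightarrow> 'a \<Rightarrow> 'm"
    and \<rho> :: "'a set \<Rightarrow> 'a set \<Rightarrow> 'm \<Rightarrow> 'a \<Rightarrow> 'a"
    and Th :: "('a set, 'n) cat"
    and \<tau> :: "'a set \<Rightarrow> 'a set \<Rightarrow> 'n \<Rightarrow> 'm"
    and St :: "('a \<times> 'n) monoid"
    and A :: "('a \<times> 'n) set"
    and Tt :: "(('a \<times> 'n) set, 'n) cat"
    and \<iota> :: "('a \<times> 'n) set \<Rightarrow> 'n"
    and \<epsilon>t :: "('a \<times> 'n) set \<Rightarrow> ('a \<times> 'n) set \<Rightarrow> 'a \<times> 'n \<Rightarrow> 'n"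
    and \<rho>t :: "('a \<times> 'n) set \<Rightarrow> ('a \<times> 'n) set \<Rightarrow> 'n \<Rightarrow> 'a \<times> 'n \<Rightarrow> 'a \<times> 'n"
    and Ft :: "('a \<times> 'n) hom_family"
  assumes "prime p"
    and "transporter_system p S F T \<epsilon> \<rho>"
    and "category_extension p T Th \<tau>"
    and "St = ext_group S \<epsilon> Th \<tau>"
    and "A = kernel St S fst"
    and "Tt = ext_cat St Th"
    and "inclusion_lifts S \<epsilon> \<tau> St Tt \<iota>"
    and "\<epsilon>t = ext_eps St Tt \<iota>"
    and "\<rho>t = ext_rho St Tt \<epsilon>t"
    and "Ft = generated_fusion St (Obj Tt) (\<lambda>X Y. \<rho>t X Y ` Mor Tt X Y)"
  shows "transporter_system p St Ft Tt \<epsilon>t \<rho>t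
    \<and> fusion_normal St Ft A
    \<and> (\<exists>\<theta> \<Theta>.
          transporter_iso S F T \<epsilon> \<rho>
            (St Mod A) (quot_fusion St Ft A) (quot_cat St Tt \<epsilon>t A) (quot_eps \<epsilon>t) (quot_rho St \<rho>t A) \<theta> \<Theta>
        \<and> fusion_iso S (generated_fusion S (Obj T) F) (St Mod A) (quot_fusion St Ft A) \<theta>)"
proof -
  interpret transporter_extension p S F T \<epsilon> \<rho> Th \<tau> St A Tt \<iota> \<epsilon>t \<rho>t Ft
    using assms by (intro transporter_extension.intro transporter_extension_axioms.intro)
  show ?thesis
    using transporter_system_t fusion_normal_A transporter_iso_quotient fusion_iso_quotient by blast
qed

end
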